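(* Let $k$ be a field of characteristic zero, let $n\ge 2$, suppose $m=n^2-1$, and let $$Y=\sum_{i,j=1}^n\Delta(X_1,\dots,X_m,e_{ji})\,e_{ij},$$ where the $e_{ij}$ are the matrix units and $X_1,\dots,X_m$ are the generic $n\times n$-matrices. Let $c_1=-\operatorname{tr}(Y),\dots,c_n=(-1)^n\det(Y)$ be the coefficients of the characteristic polynomial of $Y$, i.e. $\det(tI_n-Y)=t^n+c_1t^{n-1}+\dots+c_n$. (a) $Y\in(T_{m,n})^{\mathrm{SL}_m}$. (b) The eigenvalues of $Y$ are algebraically independent over $k$ (and, in particular, distinct). (c) $(T_{m,n})^{\mathrm{SL}_m}=k[c_1,\dots,c_{n-1},Y]$ is a polynomial ring in $n$ independent variables over $k$. (d) $\mathrm{UD}(m,n)^{\mathrm{SL}_m}=k(c_1,\dots,c_{n-1},Y)$. (e) $\mathrm{UD}(m,n)^{\mathrm{GL}_m}=k\Bigl(\frac{c_2}{(c_1)^2},\dots,\frac{c_{n-1}}{(c_1)^{n-1}},\frac{1}{c_1}Y\Bigr)$.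
   Context: $G_{m,n}$ is the $k$-subalgebra of $\mathrm{M}_n(k[x_{ij}^{(h)}])$ generated by the generic matrices $X_h=(x_{ij}^{(h)})$, $h=1,\dots,m$, where the $x_{ij}^{(h)}$ are $mn^2$ independent commuting variables. The trace ring $T_{m,n}$ is the subring of $\mathrm{M}_n(k[x_{ij}^{(h)}])$ generated by all $Z$ and $\operatorname{tr}(Z)$ with $Z\in G_{m,n}$ (scalars are identified with scalar matrices). $\mathrm{UD}(m,n)$ is the common division algebra of quotients of $G_{m,n}$ and $T_{m,n}$. The group $\mathrm{GL}_m$ acts on $G_{m,n}$ by $k$-algebra automorphisms via $g=(g_{ij})\colon X_j\mapsto\sum_{i=1}^m g_{ij}X_i$; this extends naturally to $T_{m,n}$ and $\mathrm{UD}(m,n)$. The discriminant $\Delta(A_1,\dots,A_{n^2})$ of $n^2$ matrices of size $n\times n$ is the determinant of the $n^2\times n^2$-matrix whose $i$-th row consists of the entries of $A_i$ (in the order $11,12,\dots,nn$), so that $\Delta$ is multilinear, alternating and $\Delta(e_{11},e_{12},\dots,e_{nn})=1$. *)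

theory Defs
  imports
    "Jordan_Normal_Form.Char_Poly"
    "HOL-Algebra.Generated_Fields"
    "HOL-Algebra.Algebraic_Closure_Type"
    "HOL-Computational_Algebra.Polynomial_Factorial"
    "HOL-Library.Poly_Mapping"
    "HOL-Library.Product_Lexorder"
begin

section \<open>Multivariate polynomials\<close>

type_synonym ('v, 'k) mpol = "('v \<Rightarrow>\<^sub>0 nat) \<Rightarrow>\<^sub>0 'k"

definition mconst :: "'k::zero \<Rightarrow> ('v, 'k) mpol"
  where "mconst a = Poly_Mapping.single 0 a"

definition mvar :: "'v \<Rightarrow> ('v, 'k::zero_neq_one) mpol"
  where "mvar v = Poly_Mapping.single (Poly_Mapping.single v 1) 1"

definition mpol_in :: "'v set \<Rightarrow> ('v, 'k::zero) mpol set"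
  where "mpol_in I = {p. \<forall>u \<in> Poly_Mapping.keys p. Poly_Mapping.keys u \<subseteq> I}"

text \<open>Evaluation at \<open>f\<close>, the coefficients being moved into the target ring by \<open>\<iota>\<close>.\<close>

definition mpol_eval ::
  "('k::zero \<Rightarrow> 'b::comm_ring_1) \<Rightarrow> ('v \<Rightarrow> 'b) \<Rightarrow> ('v, 'k) mpol \<Rightarrow> 'b"
  where "mpol_eval \<iota> f p =
    (\<Sum>u \<in> Poly_Mapping.keys p. \<iota> (Poly_Mapping.lookup p u) *
       (\<Prod>v \<in> Poly_Mapping.keys u. f v ^ Poly_Mapping.lookup u v))"

definition mpol_ring :: "'v set \<Rightarrow> ('v, 'k::comm_ring_1) mpol ring"
  where "mpol_ring I =
    \<lparr>carrier = mpol_in I, mult = (*), one = 1, zero = 0, add = (+)\<rparr>"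

text \<open>The elements of \<open>S\<close> themselves serve as names of the variables.\<close>

definition alg_independent :: "('k::zero \<Rightarrow> 'b::comm_ring_1) \<Rightarrow> 'b set \<Rightarrow> bool"
  where "alg_independent \<iota> S \<longleftrightarrow>
    (\<forall>p \<in> mpol_in S. mpol_eval \<iota> (\<lambda>s. s) p = 0 \<longrightarrow> p = 0)"


section \<open>Generic matrices, trace ring and generic division algebra\<close>

text \<open>All indices start at 0.  The variable \<open>(h, i, j)\<close> is the entry at position \<open>(i, j)\<close> of the
  \<open>h\<close>-th generic matrix. The type has infinitely many variables, but the algebras below only
  involve those with \<open>h < m\<close> and \<open>i, j < n\<close>.\<close>

type_synonym 'k gpol = "(nat \<times> nat \<times> nat, 'k) mpol"

abbreviation mat_alg :: "nat \<Rightarrow> 'a::comm_ring_1 mat ring"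
  where "mat_alg n \<equiv> ring_mat TYPE('a) n ()"

definition generic_mat :: "nat \<Rightarrow> nat \<Rightarrow> 'k::field_char_0 gpol mat"
  where "generic_mat n h = mat n n (\<lambda>(i, j). mvar (h, i, j))"

definition mat_unit :: "nat \<Rightarrow> nat \<Rightarrow> nat \<Rightarrow> 'a::comm_ring_1 mat"
  where "mat_unit n i j = mat n n (\<lambda>(a, b). if a = i \<and> b = j then 1 else 0)"

definition mat_tr :: "'a::comm_ring_1 mat \<Rightarrow> 'a"
  where "mat_tr A = (\<Sum>i<dim_row A. A $$ (i, i))"

definition base_scalars :: "nat \<Rightarrow> 'k::field_char_0 gpol mat set"
  where "base_scalars n = range (\<lambda>a. mconst a \<cdot>\<^sub>m 1\<^sub>m n)"

definition generic_algebra :: "nat \<Rightarrow> nat \<Rightarrow> 'k::field_char_0 gpol mat set"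
  where "generic_algebra m n =
    generate_ring (mat_alg n) (base_scalars n \<union> generic_mat n ` {..<m})"

definition trace_ring :: "nat \<Rightarrow> nat \<Rightarrow> 'k::field_char_0 gpol mat set"
  where "trace_ring m n = generate_ring (mat_alg n)
    (generic_algebra m n \<union> (\<lambda>Z. mat_tr Z \<cdot>\<^sub>m 1\<^sub>m n) ` generic_algebra m n)"

abbreviation frac_mat :: "'a::idom mat \<Rightarrow> 'a fract mat"
  where "frac_mat \<equiv> map_mat to_fract"

text \<open>The division algebra of quotients of \<open>generic_algebra m n\<close>, realised inside the matrices over
  the rational function field as the set of all \<open>A B\<inverse>\<close>.  (By a theorem of Amitsur every nonzero
  element of \<open>generic_algebra m n\<close>, where \<open>m \<ge> 2\<close>, is invertible over the rational function field;
  so the denominators are exactly the nonzero elements.)\<close>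

definition UD :: "nat \<Rightarrow> nat \<Rightarrow> 'k::field_char_0 gpol fract mat set"
  where "UD m n =
    {frac_mat A \<otimes>\<^bsub>mat_alg n\<^esub> inv\<^bsub>mat_alg n\<^esub> (frac_mat B) | A B.
       A \<in> generic_algebra m n \<and> B \<in> generic_algebra m n \<and>
       frac_mat B \<in> Units (mat_alg n)}"


section \<open>The action of the general linear group\<close>

definition GL :: "nat \<Rightarrow> 'k::field mat set"
  where "GL m = {g \<in> carrier_mat m m. det g \<noteq> 0}"

definition SL :: "nat \<Rightarrow> 'k::field mat set"
  where "SL m = {g \<in> carrier_mat m m. det g = 1}"

text \<open>The substitution \<open>X\<^sub>j \<mapsto> \<Sum>\<^sub>i g\<^sub>i\<^sub>j X\<^sub>i\<close>, as an endomorphism of the polynomial ring.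
  Applied to the entries of matrices it gives the action on the generic matrix algebra and on the
  trace ring, and its extension to fractions gives the action on \<open>UD\<close>.\<close>

definition act :: "nat \<Rightarrow> 'k::field_char_0 mat \<Rightarrow> 'k gpol \<Rightarrow> 'k gpol"
  where "act m g = mpol_eval mconst
    (\<lambda>(h, a, b). if h < m then (\<Sum>i<m. mconst (g $$ (i, h)) * mvar (i, a, b)) else mvar (h, a, b))"

definition frac_ext :: "('a::idom \<Rightarrow> 'a) \<Rightarrow> 'a fract \<Rightarrow> 'a fract"
  where "frac_ext \<phi> z =
    (THE w. \<forall>p q. q \<noteq> 0 \<and> z = Fract p q \<longrightarrow> w = Fract (\<phi> p) (\<phi> q))"

definition mat_invariants ::
  "nat \<Rightarrow> 'k::field_char_0 mat set \<Rightarrow> 'k gpol mat set \<Rightarrow> 'k gpol mat set"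
  where "mat_invariants m H S = {Z \<in> S. \<forall>g \<in> H. map_mat (act m g) Z = Z}"

definition frac_invariants ::
  "nat \<Rightarrow> 'k::field_char_0 mat set \<Rightarrow> 'k gpol fract mat set \<Rightarrow> 'k gpol fract mat set"
  where "frac_invariants m H S = {Z \<in> S. \<forall>g \<in> H. map_mat (frac_ext (act m g)) Z = Z}"

lemma act_mvar:
  assumes "h < m"
  shows "act m g (mvar (h, a, b)) = (\<Sum>i<m. mconst (g $$ (i, h)) * mvar (i, a, b))"
proof -
  have "mconst (1 :: 'a) = (1 :: 'a gpol)"
    by (simp add: mconst_def)
  then show ?thesis
    using assms by (simp add: act_def mpol_eval_def mvar_def)
qed

lemma frac_ext_Fract:
  assumes mult: "\<And>p q. \<phi> (p * q) = \<phi> p * \<phi> q" and nz: "\<And>q. q \<noteq> 0 \<Longrightarrow> \<phi> q \<noteq> 0"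
    and "q \<noteq> 0"
  shows "frac_ext \<phi> (Fract p q) = Fract (\<phi> p) (\<phi> q)"
  unfolding frac_ext_def
proof (rule the_equality)
  show "\<forall>p' q'. q' \<noteq> 0 \<and> Fract p q = Fract p' q' \<longrightarrow> Fract (\<phi> p) (\<phi> q) = Fract (\<phi> p') (\<phi> q')"
    using assms by (metis eq_fract(1))
qed (use assms in blast)


section \<open>The discriminant and the element \<open>Y\<close>\<close>

text \<open>Row \<open>r\<close> lists the entries of \<open>A r\<close> in the order 11, 12, ..., nn.\<close>

definition discriminant :: "nat \<Rightarrow> (nat \<Rightarrow> 'a::comm_ring_1 mat) \<Rightarrow> 'a"
  where "discriminant n A = det (mat (n^2) (n^2) (\<lambda>(r, s). A r $$ (s div n, s mod n)))"

text \<open>\<open>Y = \<Sum>\<^sub>i\<^sub>j \<Delta>(X\<^sub>1, ..., X\<^sub>m, e\<^sub>j\<^sub>i) e\<^sub>i\<^sub>j\<close>, that is, the matrix whose entry at \<open>(i, j)\<close> is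
  \<open>\<Delta>(X\<^sub>1, ..., X\<^sub>m, e\<^sub>j\<^sub>i)\<close>; used for \<open>m = n\<^sup>2 - 1\<close>.\<close>

definition Y_mat :: "nat \<Rightarrow> nat \<Rightarrow> 'k::field_char_0 gpol mat"
  where "Y_mat m n = mat n n
    (\<lambda>(i, j). discriminant n (\<lambda>r. if r < m then generic_mat n r else mat_unit n j i))"

end

theory Submission
  imports Defs
begin

text \<open>
  Everything follows from one description of \<open>Y\<close>: by expansion of the discriminant along its last
  row, \<open>tr (Y B) = \<Delta>(X\<^sub>1, ..., X\<^sub>m, B)\<close> for all matrices \<open>B\<close> (\<open>tr_Yt\<close>). The same formula defines a matrix
  \<open>Y(A)\<close> for each tuple \<open>A\<close> of matrices over the ground field, and polynomial identities are checked on such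
  tuples. The description shows that \<open>Y\<close> is conjugated when the tuple is conjugated, that
  \<open>g\<close> in \<open>GL\<^sub>m\<close> multiplies it by \<open>det g\<close>, and that two tuples with the same nonzero \<open>Y\<close> differ by
  an element of \<open>SL\<^sub>m\<close>, since both are bases of the hyperplane orthogonal to \<open>Y\<close>
  (\<open>Yt_transitive\<close>). An explicit slice provides a tuple for which \<open>Y\<close> is a given companion
  matrix (\<open>Yt_slice\<close>).

  For \<open>Y \<in> T\<close> it suffices that \<open>\<Delta>\<close> is a linear combination of trace monomials
  (\<open>discriminant_trace_expansion\<close>), because a trace monomial is of the form \<open>tr (Q B)\<close> as a function
  of its last argument, with \<open>Q\<close> in the trace ring (\<open>trace_monomial_representable\<close>).

  An invariant of \<open>SL\<^sub>m\<close> in the ring of fractions of \<open>T\<close> is also compatible with simultaneous conjugation.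
  A generic tuple can be moved to the slice by conjugation and the action of \<open>SL\<^sub>m\<close> (\<open>normal_form\<close>), so the
  invariant is determined by its values there. Conjugation by a matrix that commutes with the companion matrix \<open>C\<close>
  moves the point of the slice by an element of \<open>SL\<^sub>m\<close> only; so the value of the invariant
  commutes with \<open>C\<close> and is a polynomial in \<open>C\<close> (\<open>slice_values\<close>). Its coefficients are
  polynomials in \<open>c\<^sub>1, ..., c\<^sub>n\<close>, and \<open>c\<^sub>n\<close> is expressed by the other coefficients and \<open>Y\<close> by the
  Cayley--Hamilton theorem. This determines the ring of invariants, and it is one half of the description of the field of
  invariants (\<open>SL_concomitant\<close>). For the other
  half, nonzero polynomials in \<open>c\<^sub>1, ..., c\<^sub>n\<^sub>-\<^sub>1, Y\<close> are invertible (\<open>det_phi\<close>), and elements of the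
  trace ring have denominators in the generic matrix algebra, because multiplication by a trace
  maps values of the Capelli polynomial to sums of such values (\<open>TR_denominator\<close>).

  An element \<open>g\<close> of \<open>GL\<^sub>m\<close> multiplies \<open>c\<^sub>i\<close> by \<open>(det g)\<^sup>i\<close> and \<open>Y\<close> by \<open>det g\<close>. A
  fraction that is invariant under all these substitutions is invariant under the substitution with the
  factor \<open>s / c\<^sub>1\<close> instead of \<open>det g\<close>, which expresses it through the quotients \<open>c\<^sub>i / c\<^sub>1\<^sup>i\<close> and
  \<open>Y / c\<^sub>1\<close> (\<open>GL_invariant_field\<close>).

  As to the eigenvalues, the coefficients \<open>c\<^sub>1, ..., c\<^sub>n\<close> take arbitrary values on the slice, so they are algebraically
  independent, and this property passes from the coefficients of a polynomial to its roots (\<open>roots_independent\<close>).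
\<close>

section \<open>Polynomials in several variables as polynomial functions\<close>

definition mon_eval :: "('v \<Rightarrow> 'b::comm_ring_1) \<Rightarrow> ('v \<Rightarrow>\<^sub>0 nat) \<Rightarrow> 'b"
  where "mon_eval f u = (\<Prod>v \<in> Poly_Mapping.keys u. f v ^ Poly_Mapping.lookup u v)"

lemma mon_eval_superset:
  assumes "finite V" "Poly_Mapping.keys u \<subseteq> V"
  shows "mon_eval f u = (\<Prod>v \<in> V. f v ^ Poly_Mapping.lookup u v)"
  unfolding mon_eval_def
  by (rule prod.mono_neutral_left) (use assms in \<open>auto simp: in_keys_iff\<close>)

lemma mon_eval_add: "mon_eval f (u + w) = mon_eval f u * mon_eval f w"
proof -
  let ?V = "Poly_Mapping.keys u \<union> Poly_Mapping.keys w"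
  have "Poly_Mapping.keys (u + w) \<subseteq> ?V" by (rule keys_add)
  then show ?thesis
    using mon_eval_superset[of ?V "u + w" f] mon_eval_superset[of ?V u f]
      mon_eval_superset[of ?V w f]
    by (simp add: lookup_add power_add prod.distrib)
qed

lemma mon_eval_simps [simp]:
  "mon_eval f 0 = 1" "mon_eval f (Poly_Mapping.single v 1) = f v"
  "mon_eval f (Poly_Mapping.single v (Suc 0)) = f v"
  by (simp_all add: mon_eval_def)

lemma mpol_eval_superset:
  assumes "\<iota> 0 = 0" "finite U" "Poly_Mapping.keys p \<subseteq> U"
  shows "mpol_eval \<iota> f p = (\<Sum>u \<in> U. \<iota> (Poly_Mapping.lookup p u) * mon_eval f u)"
  unfolding mpol_eval_def mon_eval_def[symmetric]
  by (rule sum.mono_neutral_left) (use assms in \<open>auto simp: in_keys_iff\<close>)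

lemma mpol_sum_singles:
  "p = (\<Sum>u \<in> Poly_Mapping.keys p. Poly_Mapping.single u (Poly_Mapping.lookup p u))"
proof (rule poly_mapping_eqI)
  fix k
  show "Poly_Mapping.lookup p k = Poly_Mapping.lookup
      (\<Sum>u \<in> Poly_Mapping.keys p. Poly_Mapping.single u (Poly_Mapping.lookup p u)) k"
    by (cases "k \<in> Poly_Mapping.keys p")
      (auto simp: lookup_sum lookup_single when_def in_keys_iff sum.delta if_distrib
        cong: if_cong)
qed

lemma mpol_in_simps [simp]:
  "0 \<in> mpol_in I" "mconst a \<in> mpol_in I" "1 \<in> mpol_in I"
  "v \<in> I \<Longrightarrow> mvar v \<in> mpol_in I"
  by (auto simp: mpol_in_def mconst_def mvar_def)

lemma mpol_in_add: "p \<in> mpol_in I \<Longrightarrow> q \<in> mpol_in I \<Longrightarrow> p + q \<in> mpol_in I"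
  unfolding mpol_in_def using keys_add[of p q] by blast

lemma mpol_in_uminus: "p \<in> mpol_in I \<Longrightarrow> - p \<in> mpol_in I"
  for p :: "('v, 'k::ab_group_add) mpol"
  unfolding mpol_in_def by (simp add: in_keys_iff)

lemma mpol_in_mult: "p \<in> mpol_in I \<Longrightarrow> q \<in> mpol_in I \<Longrightarrow> p * q \<in> mpol_in I"
proof -
  assume pq: "p \<in> mpol_in I" "q \<in> mpol_in I"
  have "Poly_Mapping.keys w \<subseteq> I" if w: "w \<in> Poly_Mapping.keys (p * q)" for w
  proof -
    obtain a b where "w = a + b" "a \<in> Poly_Mapping.keys p" "b \<in> Poly_Mapping.keys q"
      using keys_mult[of p q] w by auto
    then show ?thesis using keys_add[of a b] pq by (fastforce simp: mpol_in_def)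
  qed
  then show ?thesis by (simp add: mpol_in_def)
qed

lemma mpol_in_sum: "(\<And>i. i \<in> S \<Longrightarrow> f i \<in> mpol_in I) \<Longrightarrow> (\<Sum>i\<in>S. f i) \<in> mpol_in I"
  by (induction S rule: infinite_finite_induct) (auto intro: mpol_in_add)

lemma mpol_in_prod: "(\<And>i. i \<in> S \<Longrightarrow> f i \<in> mpol_in I) \<Longrightarrow> (\<Prod>i\<in>S. f i) \<in> mpol_in I"
  by (induction S rule: infinite_finite_induct) (auto intro: mpol_in_mult)

lemma mpol_in_power: "p \<in> mpol_in I \<Longrightarrow> p ^ k \<in> mpol_in I"
  by (induction k) (auto intro: mpol_in_mult)

lemma mconst_simps [simp]:
  "mconst 0 = 0" "mconst 1 = 1"
  by (simp_all add: mconst_def)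

lemma mconst_hom: "comm_ring_hom (mconst :: 'k::comm_ring_1 \<Rightarrow> ('v, 'k) mpol)"
  by unfold_locales (simp_all add: mconst_def single_add mult_single)

lemma single_Suc_conv:
  "Poly_Mapping.single u a = mconst a * (\<Prod>v\<in>Poly_Mapping.keys u. mvar v ^ Poly_Mapping.lookup u v)"
  for a :: "'k::comm_ring_1"
proof -
  have pw: "mvar v ^ k = (Poly_Mapping.single (Poly_Mapping.single v k) 1 :: ('v, 'k) mpol)" for v :: 'v and k
    by (induction k) (simp_all add: mvar_def mult_single single_add [symmetric] flip: single_one)
  have "(\<Prod>v\<in>V. (Poly_Mapping.single (Poly_Mapping.single v (g v)) 1 :: ('v, 'k) mpol)) =
      Poly_Mapping.single (\<Sum>v\<in>V. Poly_Mapping.single v (g v)) 1" if "finite V" for V :: "'v set" and g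
    using that by (induction V) (simp_all add: mult_single flip: single_one)
  from this[OF finite_keys, of "Poly_Mapping.lookup u" u] show ?thesis
    by (simp add: pw mconst_def mult_single flip: mpol_sum_singles)
qed

text \<open>Every statement about polynomial substitutions below is proved from this induction
  principle: a polynomial is built from constants and variables.\<close>

lemma mpol_induct [consumes 1, case_names const var add mult]:
  fixes p :: "('v, 'k::comm_ring_1) mpol"
  assumes "p \<in> mpol_in I" and const: "\<And>a. P (mconst a)" and var: "\<And>v. v \<in> I \<Longrightarrow> P (mvar v)"
    and add: "\<And>p q. P p \<Longrightarrow> P q \<Longrightarrow> P (p + q)" and mult: "\<And>p q. P p \<Longrightarrow> P q \<Longrightarrow> P (p * q)"
  shows "P p"
proof -
  have P01: "P 0" "P 1" using const[of 0] const[of 1] by simp_all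
  have pw: "P (q ^ k)" if "P q" for q k
    by (induction k) (auto simp: P01 intro: mult that)
  have pr: "P (\<Prod>v\<in>V. f v)" if "finite V" "\<And>v. v \<in> V \<Longrightarrow> P (f v)" for V and f :: "'v \<Rightarrow> ('v,'k) mpol"
    using that by (induction V) (auto simp: P01 intro: mult)
  have sm: "P (\<Sum>v\<in>V. f v)" if "finite V" "\<And>v. v \<in> V \<Longrightarrow> P (f v)" for V and f :: "('v \<Rightarrow>\<^sub>0 nat) \<Rightarrow> ('v,'k) mpol"
    using that by (induction V) (auto simp: P01 intro: add)
  have "P (Poly_Mapping.single u (Poly_Mapping.lookup p u))" if "u \<in> Poly_Mapping.keys p" for u
  proof -
    have "Poly_Mapping.keys u \<subseteq> I" using assms(1) that by (auto simp: mpol_in_def)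
    then show ?thesis
      unfolding single_Suc_conv by (intro mult const pr pw var) auto
  qed
  then show ?thesis
    by (subst mpol_sum_singles) (auto intro: sm)
qed

lemma mpol_in_UNIV [simp]: "p \<in> mpol_in UNIV"
  by (simp add: mpol_in_def)

context
  fixes \<iota> :: "'k::comm_ring_1 \<Rightarrow> 'b::comm_ring_1"
  assumes hom: "comm_ring_hom \<iota>"
begin

interpretation \<iota>: comm_ring_hom \<iota> by (rule hom)

lemma mpol_eval_mconst [simp]: "mpol_eval \<iota> f (mconst a) = \<iota> a"
  by (simp add: mpol_eval_superset[of \<iota> "{0}"] mconst_def)

lemma mpol_eval_mvar [simp]: "mpol_eval \<iota> f (mvar v) = f v"
  by (simp add: mpol_eval_superset[of \<iota> "{Poly_Mapping.single v 1}"] mvar_def)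

lemma mpol_eval_add: "mpol_eval \<iota> f (p + q) = mpol_eval \<iota> f p + mpol_eval \<iota> f q"
proof -
  let ?U = "Poly_Mapping.keys p \<union> Poly_Mapping.keys q"
  have "Poly_Mapping.keys (p + q) \<subseteq> ?U" by (rule keys_add)
  then show ?thesis
    using mpol_eval_superset[of \<iota> ?U "p + q" f] mpol_eval_superset[of \<iota> ?U p f]
      mpol_eval_superset[of \<iota> ?U q f]
    by (simp add: lookup_add \<iota>.hom_add ring_distribs sum.distrib)
qed

lemma mpol_eval_0: "mpol_eval \<iota> f 0 = 0"
  by (simp add: mpol_eval_def)

lemma mpol_eval_sum: "mpol_eval \<iota> f (\<Sum>i\<in>S. p i) = (\<Sum>i\<in>S. mpol_eval \<iota> f (p i))"
  by (induction S rule: infinite_finite_induct) (auto simp: mpol_eval_add mpol_eval_0)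

lemma mpol_eval_single: "mpol_eval \<iota> f (Poly_Mapping.single u a) = \<iota> a * mon_eval f u"
  by (subst mpol_eval_superset[of \<iota> "{u}"]) (auto simp: keys_single)

lemma mpol_eval_mult: "mpol_eval \<iota> f (p * q) = mpol_eval \<iota> f p * mpol_eval \<iota> f q"
proof -
  have "p * q = (\<Sum>u\<in>Poly_Mapping.keys p. \<Sum>w\<in>Poly_Mapping.keys q.
      Poly_Mapping.single (u + w) (Poly_Mapping.lookup p u * Poly_Mapping.lookup q w))"
    by (subst mpol_sum_singles[of p], subst mpol_sum_singles[of q])
      (simp add: sum_product mult_single)
  then have "mpol_eval \<iota> f (p * q) = (\<Sum>u\<in>Poly_Mapping.keys p. \<Sum>w\<in>Poly_Mapping.keys q.
      (\<iota> (Poly_Mapping.lookup p u) * mon_eval f u) * (\<iota> (Poly_Mapping.lookup q w) * mon_eval f w))"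
    by (simp add: mpol_eval_sum mpol_eval_single mon_eval_add \<iota>.hom_mult mult_ac)
  then show ?thesis
    by (simp add: mpol_eval_def mon_eval_def sum_product)
qed

lemma mpol_eval_hom: "comm_ring_hom (mpol_eval \<iota> f)"
proof
  show "mpol_eval \<iota> f 1 = 1" using mpol_eval_mconst[of f 1] by simp
qed (simp_all add: mpol_eval_add mpol_eval_0 mpol_eval_mult)

end

lemma mpol_hom_unique:
  fixes p :: "('v, 'k::comm_ring_1) mpol"
  assumes "p \<in> mpol_in I" "comm_ring_hom h" "comm_ring_hom h'"
    and "\<And>a. h (mconst a) = h' (mconst a)" "\<And>v. v \<in> I \<Longrightarrow> h (mvar v) = h' (mvar v)"
  shows "h p = h' p"
proof -
  interpret h: comm_ring_hom h by fact
  interpret h': comm_ring_hom h' by fact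
  show ?thesis
    using assms(1) by (induction rule: mpol_induct) (simp_all add: assms h.hom_add h.hom_mult h'.hom_add h'.hom_mult)
qed

lemma comm_ring_hom_comp:
  assumes "comm_ring_hom g" "comm_ring_hom h"
  shows "comm_ring_hom (\<lambda>x. g (h x))"
proof -
  interpret g: comm_ring_hom g by fact
  interpret h: comm_ring_hom h by fact
  show ?thesis by unfold_locales (simp_all add: g.hom_add g.hom_mult h.hom_add h.hom_mult)
qed

lemma hom_mpol_eval:
  fixes h :: "'b::comm_ring_1 \<Rightarrow> 'c::comm_ring_1"
  assumes "comm_ring_hom \<iota>" "comm_ring_hom h"
  shows "h (mpol_eval \<iota> f p) = mpol_eval (\<lambda>a. h (\<iota> a)) (\<lambda>v. h (f v)) p"
proof (rule mpol_hom_unique[where I = UNIV and h = "\<lambda>p. h (mpol_eval \<iota> f p)"])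
  have hi: "comm_ring_hom (\<lambda>a. h (\<iota> a))" by (rule comm_ring_hom_comp[OF assms(2,1)])
  show "comm_ring_hom (\<lambda>p. h (mpol_eval \<iota> f p))" by (rule comm_ring_hom_comp[OF assms(2) mpol_eval_hom[OF assms(1)]])
  show "comm_ring_hom (mpol_eval (\<lambda>a. h (\<iota> a)) (\<lambda>v. h (f v)))" by (intro mpol_eval_hom hi)
qed (simp_all add: mpol_eval_mconst[OF assms(1)] mpol_eval_mvar[OF assms(1)]
    mpol_eval_mconst[OF comm_ring_hom_comp[OF assms(2,1)]]
    mpol_eval_mvar[OF comm_ring_hom_comp[OF assms(2,1)]])

lemma mpol_eval_cong:
  assumes "p \<in> mpol_in I" "comm_ring_hom \<iota>" "\<And>v. v \<in> I \<Longrightarrow> f v = g v"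
  shows "mpol_eval \<iota> f p = mpol_eval \<iota> g p"
  by (rule mpol_hom_unique[OF assms(1)]) (simp_all add: assms mpol_eval_mconst mpol_eval_mvar mpol_eval_hom)

lemma id_hom: "comm_ring_hom (\<lambda>a::'a::comm_ring_1. a)"
  by unfold_locales simp_all

abbreviation ev :: "('v \<Rightarrow> 'k) \<Rightarrow> ('v, 'k::comm_ring_1) mpol \<Rightarrow> 'k"
  where "ev \<equiv> mpol_eval (\<lambda>a. a)"

lemma ev_hom: "comm_ring_hom (ev f)"
  by (rule mpol_eval_hom[OF id_hom])

lemmas ev_mconst [simp] = mpol_eval_mconst[OF id_hom]
lemmas ev_mvar [simp] = mpol_eval_mvar[OF id_hom]

text \<open>Over an infinite ground field a polynomial is determined by its values. The induction removes
  one variable at a time: a polynomial all of whose values vanish is, in each single variable, a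
  univariate polynomial with infinitely many zeros.\<close>

lemma mpol_eq_0_if_ev_0:
  fixes p :: "('v, 'k::field_char_0) mpol"
  assumes "\<And>f. ev f p = 0"
  shows "p = 0"
proof -
  have "finite V \<Longrightarrow> p \<in> mpol_in V \<Longrightarrow> (\<forall>f. ev f p = 0) \<Longrightarrow> p = 0" for V and p :: "('v, 'k) mpol"
  proof (induction V arbitrary: p rule: finite_induct)
    case empty
    have "Poly_Mapping.keys p \<subseteq> {0}"
      using empty(1) by (auto simp: mpol_in_def)
    then have "ev undefined p = Poly_Mapping.lookup p 0"
      by (subst mpol_eval_superset[of _ "{0}"]) auto
    then have "0 \<notin> Poly_Mapping.keys p"
      using empty(2) by (simp add: in_keys_iff)
    then have "Poly_Mapping.keys p = {}"
      using \<open>Poly_Mapping.keys p \<subseteq> {0}\<close> by blast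
    then show ?case by simp
  next
    case (insert v V)
    define K where "K j = {u \<in> Poly_Mapping.keys p. Poly_Mapping.lookup u v = j}" for j
    have finK: "finite (K j)" for j by (simp add: K_def)
    define q where "q j = (\<Sum>u\<in>K j.
      Poly_Mapping.single (u - Poly_Mapping.single v j) (Poly_Mapping.lookup p u))" for j
    have dec: "u = (u - Poly_Mapping.single v j) + Poly_Mapping.single v j" if "u \<in> K j" for u j
      by (rule poly_mapping_eqI) (use that in \<open>auto simp: lookup_add lookup_minus lookup_single when_def K_def\<close>)
    have qin: "q j \<in> mpol_in V" for j
    proof -
      have "Poly_Mapping.single (u - Poly_Mapping.single v j) (Poly_Mapping.lookup p u) \<in> mpol_in V"
        if "u \<in> K j" for u
      proof -
        have "Poly_Mapping.keys u \<subseteq> insert v V" using that insert.prems(1) by (auto simp: mpol_in_def K_def)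
        then have "Poly_Mapping.keys (u - Poly_Mapping.single v j) \<subseteq> V"
          using that insert.hyps(2)
          by (auto simp: subset_iff in_keys_iff lookup_minus lookup_single when_def K_def split: if_splits)
        then show ?thesis by (auto simp: mpol_in_def)
      qed
      then show ?thesis by (auto simp: q_def intro: mpol_in_sum)
    qed
    have "ev f (q j) = 0" for f j
    proof -
      define P where "P = (\<Sum>u\<in>Poly_Mapping.keys p. Polynomial.monom (Poly_Mapping.lookup p u *
          mon_eval f (u - Poly_Mapping.single v (Poly_Mapping.lookup u v))) (Poly_Mapping.lookup u v))"
      have "poly P t = 0" for t
      proof -
        have "Poly_Mapping.lookup p u * mon_eval (f(v := t)) u =
          Poly_Mapping.lookup p u * mon_eval f (u - Poly_Mapping.single v (Poly_Mapping.lookup u v)) *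
            t ^ Poly_Mapping.lookup u v" if "u \<in> Poly_Mapping.keys p" for u
        proof -
          let ?w = "u - Poly_Mapping.single v (Poly_Mapping.lookup u v)"
          have u: "u = ?w + Poly_Mapping.single v (Poly_Mapping.lookup u v)"
            by (rule dec) (simp add: K_def that)
          have "mon_eval (f(v := t)) ?w = mon_eval f ?w"
            unfolding mon_eval_def
            by (rule prod.cong) (auto simp: in_keys_iff lookup_minus lookup_single when_def split: if_splits)
          moreover have "mon_eval (f(v := t)) (Poly_Mapping.single v (Poly_Mapping.lookup u v)) =
              t ^ Poly_Mapping.lookup u v"
            by (simp add: mon_eval_def)
          moreover have "mon_eval (f(v := t)) u = mon_eval (f(v := t)) ?w *
              mon_eval (f(v := t)) (Poly_Mapping.single v (Poly_Mapping.lookup u v))"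
            by (subst mon_eval_add [symmetric], subst u [symmetric]) (rule refl)
          ultimately show ?thesis by (simp only: mult.assoc)
        qed
        then have "poly P t = ev (f(v := t)) p"
          unfolding P_def poly_sum poly_monom mpol_eval_def mon_eval_def [symmetric]
          by (metis (no_types, lifting) sum.cong)
        then show ?thesis using insert.prems(2) by simp
      qed
      then have "P = 0" using poly_all_0_iff_0 by blast
      then have "0 = Polynomial.coeff P j" by simp
      also have "\<dots> = (\<Sum>u\<in>Poly_Mapping.keys p. if u \<in> K j then Poly_Mapping.lookup p u *
          mon_eval f (u - Poly_Mapping.single v j) else 0)"
        unfolding P_def coeff_sum by (rule sum.cong[OF refl]) (simp add: K_def)
      also have "\<dots> = (\<Sum>u\<in>K j. Poly_Mapping.lookup p u * mon_eval f (u - Poly_Mapping.single v j))"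
        by (subst sum.inter_restrict [symmetric]) (auto simp: K_def Int_def intro: sum.cong)
      also have "\<dots> = ev f (q j)"
        by (simp add: q_def mpol_eval_sum[OF id_hom] mpol_eval_single[OF id_hom])
      finally show ?thesis by simp
    qed
    then have q0: "q j = 0" for j using insert.IH[OF qin] by blast
    have False if "u \<in> Poly_Mapping.keys p" for u
    proof -
      let ?j = "Poly_Mapping.lookup u v"
      have uK: "u \<in> K ?j" using that by (simp add: K_def)
      have "Poly_Mapping.lookup (q ?j) (u - Poly_Mapping.single v ?j) =
        (\<Sum>w\<in>K ?j. Poly_Mapping.lookup p w when w - Poly_Mapping.single v ?j = u - Poly_Mapping.single v ?j)"
        by (simp add: q_def lookup_sum lookup_single)
      also have "\<dots> = (\<Sum>w\<in>K ?j. if w = u then Poly_Mapping.lookup p w else 0)"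
      proof (rule sum.cong[OF refl])
        fix w assume w: "w \<in> K ?j"
        have "w - Poly_Mapping.single v ?j = u - Poly_Mapping.single v ?j \<longleftrightarrow> w = u"
          using dec[OF uK] dec[OF w] by metis
        then show "(Poly_Mapping.lookup p w when
            w - Poly_Mapping.single v ?j = u - Poly_Mapping.single v ?j) =
          (if w = u then Poly_Mapping.lookup p w else 0)" by simp
      qed
      also have "\<dots> = Poly_Mapping.lookup p u" using uK finK by simp
      finally show False using q0 that by (simp add: in_keys_iff)
    qed
    then have "Poly_Mapping.keys p = {}" by blast
    then show ?case by simp
  qed
  moreover have "finite (\<Union>u\<in>Poly_Mapping.keys p. Poly_Mapping.keys u)" by auto
  moreover have "p \<in> mpol_in (\<Union>u\<in>Poly_Mapping.keys p. Poly_Mapping.keys u)"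
    by (auto simp: mpol_in_def)
  ultimately show ?thesis using assms by blast
qed

section \<open>Polynomials evaluated at matrices\<close>

lemma mult_entry:
  assumes "A \<in> carrier_mat n l" "B \<in> carrier_mat l r" "i < n" "j < r"
  shows "(A * B) $$ (i, j) = (\<Sum>k<l. A $$ (i, k) * B $$ (k, j))"
  using assms by (simp add: scalar_prod_def atLeast0LessThan)

lemma mult_vec_entry:
  assumes "A \<in> carrier_mat n l" "v \<in> carrier_vec l" "i < n"
  shows "(A *\<^sub>v v) $ i = (\<Sum>k<l. A $$ (i, k) * v $ k)"
  using assms by (simp add: scalar_prod_def atLeast0LessThan)

lemma mult_sq [simp]: "A \<in> carrier_mat n n \<Longrightarrow> B \<in> carrier_mat n n \<Longrightarrow> A * B \<in> carrier_mat n n"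
  by simp

lemmas mat_assoc = assoc_mult_mat[of _ n n _ n _ n for n]

lemma mat_tr_add: "A \<in> carrier_mat n n \<Longrightarrow> B \<in> carrier_mat n n \<Longrightarrow> mat_tr (A + B) = mat_tr A + mat_tr B"
  by (simp add: mat_tr_def sum.distrib)

lemma mat_tr_smult: "A \<in> carrier_mat n n \<Longrightarrow> mat_tr (a \<cdot>\<^sub>m A) = a * mat_tr A"
  by (simp add: mat_tr_def sum_distrib_left)

lemma mat_tr_one: "mat_tr (1\<^sub>m n :: 'a::comm_ring_1 mat) = of_nat n"
  by (simp add: mat_tr_def)

lemma mat_tr_mult:
  assumes "A \<in> carrier_mat n n" "B \<in> carrier_mat n n"
  shows "mat_tr (A * B) = (\<Sum>i<n. \<Sum>j<n. A $$ (i, j) * B $$ (j, i))"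
  using assms by (simp add: mat_tr_def mult_entry del: index_mult_mat(1))

lemma mat_tr_comm:
  assumes "A \<in> carrier_mat n n" "B \<in> carrier_mat n n"
  shows "mat_tr (A * B) = mat_tr (B * A)"
  unfolding mat_tr_mult[OF assms] mat_tr_mult[OF assms(2,1)]
  by (subst sum.swap) (simp add: mult.commute)

lemma hom_mat_tr:
  assumes "comm_ring_hom h" "A \<in> carrier_mat n n"
  shows "mat_tr (map_mat h A) = h (mat_tr A)"
proof -
  interpret comm_ring_hom h by fact
  show ?thesis using assms(2) by (simp add: mat_tr_def hom_sum)
qed

lemma mat_unit_carrier [simp]: "mat_unit n i j \<in> carrier_mat n n"
  by (simp add: mat_unit_def)

lemma mat_tr_mult_unit:
  assumes "A \<in> carrier_mat n n" "i < n" "j < n"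
  shows "mat_tr (A * mat_unit n j i) = A $$ (i, j)"
proof -
  have "mat_tr (A * mat_unit n j i) = (\<Sum>a<n. \<Sum>b<n. A $$ (a, b) * mat_unit n j i $$ (b, a))"
    by (rule mat_tr_mult) (use assms in auto)
  also have "\<dots> = (\<Sum>a<n. \<Sum>b<n. if b = j then (if a = i then A $$ (a, b) else 0) else 0)"
    by (intro sum.cong) (auto simp: mat_unit_def)
  also have "\<dots> = A $$ (i, j)" using assms by simp
  finally show ?thesis .
qed

text \<open>The trace form is nondegenerate.\<close>

lemma mat_eq_if_tr_eq:
  assumes "A \<in> carrier_mat n n" "B \<in> carrier_mat n n"
    and "\<And>Z. Z \<in> carrier_mat n n \<Longrightarrow> mat_tr (A * Z) = mat_tr (B * Z)"
  shows "A = B"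
proof (rule eq_matI)
  fix i j assume "i < dim_row B" "j < dim_col B"
  then have "i < n" "j < n" using assms by auto
  then show "A $$ (i, j) = B $$ (i, j)"
    using assms(3)[OF mat_unit_carrier, of j i] mat_tr_mult_unit[OF assms(1), of i j]
      mat_tr_mult_unit[OF assms(2), of i j] by simp
qed (use assms in auto)

definition pmev :: "'a::comm_ring_1 poly \<Rightarrow> 'a mat \<Rightarrow> 'a mat"
  where "pmev q A = fold_coeffs (\<lambda>a B. a \<cdot>\<^sub>m 1\<^sub>m (dim_row A) + A * B) q (0\<^sub>m (dim_row A) (dim_row A))"

context
  fixes A :: "'a::comm_ring_1 mat" and n :: nat
  assumes A [simp]: "A \<in> carrier_mat n n"
begin

lemma dim_A [simp]: "dim_row A = n" "dim_col A = n"
  using carrier_matD[OF A] by blast+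

lemma pmev_0 [simp]: "pmev 0 A = 0\<^sub>m n n"
  by (simp add: pmev_def)

lemma pmev_pCons: "pmev (pCons a q) A = a \<cdot>\<^sub>m 1\<^sub>m n + A * pmev q A"
proof (cases "pCons a q = 0")
  case True
  have "A * 0\<^sub>m n n = 0\<^sub>m n n" using right_mult_zero_mat[OF A] .
  then show ?thesis using True by (auto intro!: eq_matI simp del: index_mult_mat(1))
next
  case False
  then have "a \<noteq> 0 \<or> q \<noteq> 0" by auto
  then show ?thesis by (auto simp: pmev_def)
qed

lemma pmev_carrier [simp]: "pmev q A \<in> carrier_mat n n"
  by (induction q) (simp_all add: pmev_pCons)

lemma pmev_dim [simp]: "dim_row (pmev q A) = n" "dim_col (pmev q A) = n"
  using pmev_carrier[of q] by (simp_all only: carrier_mat_def mem_Collect_eq)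

lemma pmev_const: "pmev [:a:] A = a \<cdot>\<^sub>m 1\<^sub>m n"
  using right_mult_zero_mat[OF A, of n] by (simp add: pmev_pCons)

lemma pmev_1: "pmev 1 A = 1\<^sub>m n"
proof -
  have "pmev 1 A = 1 \<cdot>\<^sub>m 1\<^sub>m n" using pmev_const[of 1] by (simp add: one_pCons)
  then show ?thesis by (auto intro!: eq_matI)
qed

lemma pmev_X: "pmev [:0, 1:] A = A"
proof -
  have "pmev [:0, 1:] A = 0 \<cdot>\<^sub>m 1\<^sub>m n + A * (1 \<cdot>\<^sub>m 1\<^sub>m n)" by (subst pmev_pCons) (simp add: pmev_const)
  also have "1 \<cdot>\<^sub>m 1\<^sub>m n = (1\<^sub>m n :: 'a mat)" by (auto intro!: eq_matI)
  finally show ?thesis by (auto intro!: eq_matI)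
qed

lemma pmev_add: "pmev (p + q) A = pmev p A + pmev q A"
proof (induction p q rule: poly_induct2)
  case (pCons a p b q)
  have d: "A * (pmev p A + pmev q A) = A * pmev p A + A * pmev q A"
    by (rule mult_add_distrib_mat[of _ n n _ n]) simp_all
  show ?case
    unfolding add_pCons pmev_pCons pCons.IH d
    by (rule eq_matI) (simp_all add: algebra_simps del: index_mult_mat(1))
qed simp

lemma pmev_smult: "pmev (Polynomial.smult a q) A = a \<cdot>\<^sub>m pmev q A"
proof (induction q)
  case (pCons b q)
  have d: "A * (a \<cdot>\<^sub>m pmev q A) = a \<cdot>\<^sub>m (A * pmev q A)"
    by (rule mult_smult_distrib[of _ n n _ n]) simp_all
  show ?case
    unfolding smult_pCons pmev_pCons pCons.IH d
    by (rule eq_matI) (simp_all add: algebra_simps del: index_mult_mat(1))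
qed (auto intro!: eq_matI)

lemma pmev_mult: "pmev (p * q) A = pmev p A * pmev q A"
proof (induction p)
  case 0
  then show ?case using left_mult_zero_mat[of "pmev q A" n n n] by simp
next
  case (pCons a p)
  have "pmev (pCons a p * q) A = a \<cdot>\<^sub>m pmev q A + pmev (pCons 0 (p * q)) A"
    by (simp add: mult_pCons_left pmev_add pmev_smult)
  also have "\<dots> = a \<cdot>\<^sub>m pmev q A + A * (pmev p A * pmev q A)"
    unfolding pmev_pCons pCons.IH by (rule eq_matI) (simp_all del: index_mult_mat(1))
  also have "A * (pmev p A * pmev q A) = A * pmev p A * pmev q A"
    by (rule mat_assoc[of _ n, symmetric]) simp_all
  also have "a \<cdot>\<^sub>m pmev q A = (a \<cdot>\<^sub>m 1\<^sub>m n) * pmev q A"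
    by (subst mult_smult_assoc_mat[of _ n n _ n]) auto
  also have "(a \<cdot>\<^sub>m 1\<^sub>m n) * pmev q A + A * pmev p A * pmev q A = pmev (pCons a p) A * pmev q A"
    unfolding pmev_pCons by (subst add_mult_distrib_mat[of _ n n _ _ n]) auto
  finally show ?case .
qed

lemma pmev_commute:
  assumes "B \<in> carrier_mat n n" "B * A = A * B"
  shows "B * pmev q A = pmev q A * B"
proof (induction q)
  case 0
  then show ?case using assms by simp
next
  case (pCons a q)
  have "B * (a \<cdot>\<^sub>m 1\<^sub>m n + A * pmev q A) = a \<cdot>\<^sub>m B + B * (A * pmev q A)"
    by (subst mult_add_distrib_mat[of _ n n _ n]) (use assms in \<open>auto simp: mult_smult_distrib[of _ n n _ n]\<close>)
  also have "B * (A * pmev q A) = (B * A) * pmev q A"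
    by (rule mat_assoc[of _ n, symmetric]) (use assms in simp_all)
  also have "(B * A) * pmev q A = A * (B * pmev q A)"
    unfolding assms(2) by (rule mat_assoc[of _ n]) (use assms in simp_all)
  also have "A * (B * pmev q A) = A * pmev q A * B"
    unfolding pCons.IH by (rule mat_assoc[of _ n, symmetric]) (use assms in simp_all)
  also have "a \<cdot>\<^sub>m B + A * pmev q A * B = (a \<cdot>\<^sub>m 1\<^sub>m n + A * pmev q A) * B"
    by (subst add_mult_distrib_mat[of _ n n _ _ n]) (use assms in \<open>auto simp: mult_smult_assoc_mat[of _ n n _ n]\<close>)
  finally show ?case by (simp add: pmev_pCons)
qed

lemma pmev_conj:
  assumes [simp]: "P \<in> carrier_mat n n" "Q \<in> carrier_mat n n" and QP: "Q * P = 1\<^sub>m n" "P * Q = 1\<^sub>m n"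
  shows "pmev q (P * A * Q) = P * pmev q A * Q"
proof (induction q)
  case 0
  show ?case unfolding pmev_def by (simp add: carrier_matD[OF assms(1)] carrier_matD[OF assms(2)] right_mult_zero_mat[of _ n n] left_mult_zero_mat[of _ n n])
next
  case (pCons a q)
  have pc: "pmev (pCons a q) (P * A * Q) = a \<cdot>\<^sub>m 1\<^sub>m n + (P * A * Q) * pmev q (P * A * Q)"
  proof (cases "pCons a q = 0")
    case True
    have "(P * A * Q) * 0\<^sub>m n n = 0\<^sub>m n n" by (rule right_mult_zero_mat[of _ n]) simp
    then show ?thesis using True carrier_matD[OF assms(1)]
      by (auto simp: pmev_def intro!: eq_matI simp del: index_mult_mat(1))
  next
    case False
    then have "a \<noteq> 0 \<or> q \<noteq> 0" by auto
    then show ?thesis using carrier_matD[OF assms(1)] by (auto simp: pmev_def)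
  qed
  have "(P * A * Q) * (P * pmev q A * Q) = P * A * (Q * P) * (pmev q A * Q)"
    by (simp add: mat_assoc[where n = n])
  also have "\<dots> = P * (A * pmev q A) * Q" by (simp add: QP mat_assoc[where n = n])
  finally have 1: "(P * A * Q) * (P * pmev q A * Q) = P * (A * pmev q A) * Q" .
  have "P * (a \<cdot>\<^sub>m 1\<^sub>m n + A * pmev q A) * Q = (P * (a \<cdot>\<^sub>m 1\<^sub>m n) + P * (A * pmev q A)) * Q"
    by (subst mult_add_distrib_mat[of _ n n _ n]) auto
  also have "\<dots> = P * (a \<cdot>\<^sub>m 1\<^sub>m n) * Q + P * (A * pmev q A) * Q"
    by (subst add_mult_distrib_mat[of _ n n _ _ n]) auto
  also have "P * (a \<cdot>\<^sub>m 1\<^sub>m n) * Q = a \<cdot>\<^sub>m 1\<^sub>m n"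
    by (simp add: mult_smult_distrib[of _ n n _ n] mult_smult_assoc_mat[of _ n n _ n] QP
      right_mult_one_mat[OF assms(1)])
  finally show ?case unfolding pc pCons.IH 1 pmev_pCons by simp
qed

lemma pmev_eigenvector:
  assumes v: "v \<in> carrier_vec n" and Av: "A *\<^sub>v v = k \<cdot>\<^sub>v v"
  shows "pmev q A *\<^sub>v v = poly q k \<cdot>\<^sub>v v"
proof (induction q)
  case 0
  then show ?case using v by (auto intro!: eq_vecI)
next
  case (pCons a q)
  have "pmev (pCons a q) A *\<^sub>v v = (a \<cdot>\<^sub>m 1\<^sub>m n) *\<^sub>v v + A * pmev q A *\<^sub>v v"
    unfolding pmev_pCons by (rule add_mult_distrib_mat_vec[of _ n n]) (use v in auto)
  also have "A * pmev q A *\<^sub>v v = pmev q A * A *\<^sub>v v" using pmev_commute[of A q] A by simp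
  also have "\<dots> = pmev q A *\<^sub>v (k \<cdot>\<^sub>v v)" by (simp add: assoc_mult_mat_vec[of _ n n _ n] v Av)
  also have "\<dots> = k \<cdot>\<^sub>v (poly q k \<cdot>\<^sub>v v)"
  proof -
    have "pmev q A *\<^sub>v (k \<cdot>\<^sub>v v) = k \<cdot>\<^sub>v (pmev q A *\<^sub>v v)"
      by (rule eq_vecI) (use v in \<open>simp_all add: mult_vec_entry[of _ n n] sum_distrib_left
        mult.left_commute del: index_mult_mat_vec\<close>)
    then show ?thesis by (simp add: pCons.IH)
  qed
  also have "(a \<cdot>\<^sub>m 1\<^sub>m n) *\<^sub>v v = a \<cdot>\<^sub>v v" using v by (auto intro!: eq_vecI)
  finally show ?case using v by (auto intro!: eq_vecI simp: algebra_simps)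
qed

end

declare dim_A [simp del] pmev_dim [simp del]

lemma hom_pmev:
  assumes "comm_ring_hom h" and A [simp]: "A \<in> carrier_mat n n"
  shows "map_mat h (pmev q A) = pmev (map_poly h q) (map_mat h A)"
proof -
  interpret h: comm_ring_hom h by fact
  have hA [simp]: "map_mat h A \<in> carrier_mat n n" by simp
  note [simp] = dim_A[OF A] pmev_dim[OF A]
  show ?thesis
  proof (induction q)
    case 0
    then show ?case by (simp add: pmev_0[OF A] pmev_0[OF hA]) (auto intro!: eq_matI)
  next
    case (pCons a q)
    have "map_mat h (a \<cdot>\<^sub>m 1\<^sub>m n + A * pmev q A) = h a \<cdot>\<^sub>m 1\<^sub>m n + map_mat h (A * pmev q A)"
      by (intro eq_matI) (simp_all add: h.hom_add h.hom_mult del: index_mult_mat(1))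
    also have "map_mat h (A * pmev q A) = map_mat h A * map_mat h (pmev q A)"
      by (rule h.mat_hom_mult) (use pmev_carrier[OF A] in auto)
    finally show ?case
      by (simp add: pCons.IH h.map_poly_pCons_hom pmev_pCons[OF A] pmev_pCons[OF hA])
  qed
qed

section \<open>The adjugate of the characteristic matrix\<close>

text \<open>The coefficients (in the variable of the characteristic polynomial) of the adjugate of
  \<open>t - A\<close> are the Horner sections of the characteristic polynomial evaluated at \<open>A\<close>: both satisfy the
  recursion that comes from comparing coefficients in \<open>(t - A) adj (t - A) = \<chi>\<close>. The last step of the
  recursion is the Cayley--Hamilton theorem.\<close>

lemma adj_char_poly_matrix:
  fixes A :: "'a::comm_ring_1 mat"
  assumes A [simp]: "A \<in> carrier_mat n n"
  shows "map_mat (\<lambda>p. Polynomial.coeff p j) (adj_mat (char_poly_matrix A)) =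
      pmev (poly_shift (Suc j) (char_poly A)) A" (is "?B j = _")
    and cayley_hamilton: "pmev (char_poly A) A = 0\<^sub>m n n"
proof -
  let ?M = "char_poly_matrix A" and ?\<chi> = "char_poly A"
  have M [simp]: "?M \<in> carrier_mat n n" by simp
  note [simp] = adj_mat(1)[OF M] dim_A[OF A] carrier_matD[OF adj_mat(1)[OF M]]
  have Mentry: "?M $$ (i, l) = (if l = i then [:- (A $$ (i, i)), 1:] else [:- (A $$ (i, l)):])"
    if "i < n" "l < n" for i l using that by (auto simp: char_poly_matrix_def)
  define B where "B = ?B"
  have Bc [simp]: "B j \<in> carrier_mat n n" for j by (simp add: B_def)
  have entry: "(?M * adj_mat ?M) $$ (i, k) = pCons 0 (adj_mat ?M $$ (i, k))
      - (\<Sum>l<n. Polynomial.smult (A $$ (i, l)) (adj_mat ?M $$ (l, k)))" if "i < n" "k < n" for i k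
  proof -
    have "(?M * adj_mat ?M) $$ (i, k) = (\<Sum>l<n. ?M $$ (i, l) * adj_mat ?M $$ (l, k))"
      by (rule mult_entry) (use that in auto)
    also have "\<dots> = (\<Sum>l<n. (if l = i then pCons 0 (adj_mat ?M $$ (l, k)) else 0)
        - Polynomial.smult (A $$ (i, l)) (adj_mat ?M $$ (l, k)))"
      by (rule sum.cong) (use that in \<open>auto simp: Mentry\<close>)
    also have "\<dots> = pCons 0 (adj_mat ?M $$ (i, k))
      - (\<Sum>l<n. Polynomial.smult (A $$ (i, l)) (adj_mat ?M $$ (l, k)))"
      using that by (simp add: sum_subtractf)
    finally show ?thesis .
  qed
  have entry2: "(?M * adj_mat ?M) $$ (i, k) = (if i = k then ?\<chi> else 0)" if "i < n" "k < n" for i k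
    using that by (simp add: adj_mat(2)[OF M] char_poly_def)
  have AB: "(A * B j) $$ (i, k) = (\<Sum>l<n. A $$ (i, l) * Polynomial.coeff (adj_mat ?M $$ (l, k)) j)"
    if "i < n" "k < n" for i k j
  proof -
    have "(A * B j) $$ (i, k) = (\<Sum>l<n. A $$ (i, l) * B j $$ (l, k))"
      by (rule mult_entry) (use that in auto)
    then show ?thesis using that by (simp add: B_def carrier_matD[OF adj_mat(1)[OF M]])
  qed
  have rec: "B j = Polynomial.coeff ?\<chi> (Suc j) \<cdot>\<^sub>m 1\<^sub>m n + A * B (Suc j)" for j
  proof (rule eq_matI)
    fix i k assume "i < dim_row (Polynomial.coeff ?\<chi> (Suc j) \<cdot>\<^sub>m 1\<^sub>m n + A * B (Suc j))"
      "k < dim_col (Polynomial.coeff ?\<chi> (Suc j) \<cdot>\<^sub>m 1\<^sub>m n + A * B (Suc j))"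
    then have ik: "i < n" "k < n" using Bc[of "Suc j"] by (auto simp del: Bc)
    have "Polynomial.coeff ((?M * adj_mat ?M) $$ (i, k)) (Suc j) =
        Polynomial.coeff (if i = k then ?\<chi> else 0) (Suc j)" using entry2[OF ik] by simp
    then have "B j $$ (i, k) - (A * B (Suc j)) $$ (i, k) = (if i = k then Polynomial.coeff ?\<chi> (Suc j) else 0)"
      using ik by (simp add: entry[OF ik] coeff_sum AB[OF ik] del: index_mult_mat)
        (simp add: B_def carrier_matD[OF adj_mat(1)[OF M]] split: if_splits)
    then have "B j $$ (i, k) = (if i = k then Polynomial.coeff ?\<chi> (Suc j) else 0) + (A * B (Suc j)) $$ (i, k)"
      by (simp only: diff_eq_eq)
    then show "B j $$ (i, k) = (Polynomial.coeff ?\<chi> (Suc j) \<cdot>\<^sub>m 1\<^sub>m n + A * B (Suc j)) $$ (i, k)"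
      using ik carrier_matD[OF Bc[of "Suc j"]] A by (auto simp del: index_mult_mat(1))
  qed (use carrier_matD[OF Bc] A in auto)
  have rec0: "0\<^sub>m n n = Polynomial.coeff ?\<chi> 0 \<cdot>\<^sub>m 1\<^sub>m n + A * B 0"
  proof (rule eq_matI)
    fix i k assume "i < dim_row (Polynomial.coeff ?\<chi> 0 \<cdot>\<^sub>m 1\<^sub>m n + A * B 0)"
      "k < dim_col (Polynomial.coeff ?\<chi> 0 \<cdot>\<^sub>m 1\<^sub>m n + A * B 0)"
    then have ik: "i < n" "k < n" using Bc[of 0] by (auto simp del: Bc)
    have "Polynomial.coeff ((?M * adj_mat ?M) $$ (i, k)) 0 =
        Polynomial.coeff (if i = k then ?\<chi> else 0) 0" using entry2[OF ik] by simp
    then have "- (A * B 0) $$ (i, k) = (if i = k then Polynomial.coeff ?\<chi> 0 else 0)"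
      using ik by (simp add: entry[OF ik] coeff_sum AB[OF ik] del: index_mult_mat split: if_splits)
    then have "0 = (if i = k then Polynomial.coeff ?\<chi> 0 else 0) + (A * B 0) $$ (i, k)"
      by (metis add.commute add.right_inverse)
    then show "0\<^sub>m n n $$ (i, k) = (Polynomial.coeff ?\<chi> 0 \<cdot>\<^sub>m 1\<^sub>m n + A * B 0) $$ (i, k)"
      using ik carrier_matD[OF Bc[of 0]] A by (auto simp del: index_mult_mat(1))
  qed (use carrier_matD[OF Bc] A in auto)
  define D where "D = Polynomial.degree ?\<chi> + (\<Sum>i<n. \<Sum>k<n. Polynomial.degree (adj_mat ?M $$ (i, k))) + 1"
  have large: "B j = 0\<^sub>m n n \<and> poly_shift (Suc j) ?\<chi> = 0" if "j \<ge> D" for j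
  proof
    have "Polynomial.degree (adj_mat ?M $$ (i, k)) < j" if ik: "i < n" "k < n" for i k
    proof -
      have "Polynomial.degree (adj_mat ?M $$ (i, k)) \<le> (\<Sum>k<n. Polynomial.degree (adj_mat ?M $$ (i, k)))"
        by (rule member_le_sum[of k "{..<n}"]) (use ik in auto)
      also have "\<dots> \<le> (\<Sum>i<n. \<Sum>k<n. Polynomial.degree (adj_mat ?M $$ (i, k)))"
        by (rule member_le_sum[of i "{..<n}"]) (use ik in auto)
      finally show ?thesis using \<open>j \<ge> D\<close> by (simp add: D_def)
    qed
    then show "B j = 0\<^sub>m n n"
      by (intro eq_matI) (auto simp: B_def carrier_matD[OF adj_mat(1)[OF M]] coeff_eq_0)
    show "poly_shift (Suc j) ?\<chi> = 0"
      using that by (intro poly_eqI) (simp add: coeff_poly_shift coeff_eq_0 D_def)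
  qed
  have shift: "poly_shift j ?\<chi> = pCons (Polynomial.coeff ?\<chi> j) (poly_shift (Suc j) ?\<chi>)" for j
    by (rule poly_eqI) (simp add: coeff_poly_shift coeff_pCons split: nat.splits)
  have main: "B j = pmev (poly_shift (Suc j) ?\<chi>) A" if "j \<le> D" for j
    using that
  proof (induction j rule: inc_induct)
    case base
    then show ?case using large[of D] by (simp add: pmev_0[OF A])
  next
    case (step j)
    show ?case
      by (subst rec, subst shift, subst pmev_pCons[OF A]) (simp add: step.IH)
  qed
  have main': "B j = pmev (poly_shift (Suc j) ?\<chi>) A" for j
    
  proof (cases "j \<le> D")
    case False
    then have "B j = 0\<^sub>m n n" "poly_shift (Suc j) ?\<chi> = 0" using large[of j] by auto
    then show ?thesis using pmev_0[of A n] A by metis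
  qed (rule main)
  then show "?B j = pmev (poly_shift (Suc j) ?\<chi>) A" by (simp add: B_def)
  have "pmev ?\<chi> A = pmev (poly_shift 0 ?\<chi>) A" by simp
  also have "\<dots> = 0\<^sub>m n n"
    by (subst shift, subst pmev_pCons[OF A], subst main'[symmetric], subst rec0) (rule refl)
  finally show "pmev ?\<chi> A = 0\<^sub>m n n" .
qed

text \<open>The trace of the adjugate of \<open>t - A\<close> is the derivative of the characteristic polynomial. In
  characteristic zero this expresses the coefficients through traces of powers.\<close>

lemma char_poly_coeff_trace:
  fixes A :: "'a::idom mat"
  assumes A [simp]: "A \<in> carrier_mat n n" and "n > 0"
  shows "(of_nat n - of_nat j) * Polynomial.coeff (char_poly A) j =
    - mat_tr (A * pmev (poly_shift (Suc j) (char_poly A)) A)"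
proof -
  let ?M = "char_poly_matrix A" and ?\<chi> = "char_poly A"
  let ?S = "\<lambda>j. pmev (poly_shift j ?\<chi>) A"
  note S [simp] = pmev_carrier[OF A] and Sd [simp] = pmev_dim[OF A] dim_A[OF A]
  have M: "?M \<in> carrier_mat n n" by simp
  have cof: "cofactor ?M i i = char_poly (mat_delete A i i)" if "i < n" for i
  proof -
    have "mat_delete ?M i i = char_poly_matrix (mat_delete A i i)"
      using that by (intro eq_matI) (auto simp: mat_delete_def char_poly_matrix_def)
    then show ?thesis by (simp add: cofactor_def char_poly_def)
  qed
  have tr: "mat_tr (?S (Suc j)) = of_nat (Suc j) * Polynomial.coeff ?\<chi> (Suc j)" for j
  proof -
    have "mat_tr (?S (Suc j)) = (\<Sum>i<n. Polynomial.coeff (cofactor ?M i i) j)"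
      unfolding adj_char_poly_matrix[OF A, symmetric] mat_tr_def
      using A by (intro sum.cong) (auto simp: adj_mat_def char_poly_matrix_def)
    also have "\<dots> = Polynomial.coeff (pderiv ?\<chi>) j"
      by (simp add: pderiv_char_poly[OF A] cof coeff_sum)
    finally show ?thesis by (simp add: coeff_pderiv)
  qed
  have shift: "poly_shift j ?\<chi> = pCons (Polynomial.coeff ?\<chi> j) (poly_shift (Suc j) ?\<chi>)" for j
    by (rule poly_eqI) (simp add: coeff_poly_shift coeff_pCons split: nat.splits)
  have "mat_tr (?S j) = mat_tr (Polynomial.coeff ?\<chi> j \<cdot>\<^sub>m 1\<^sub>m n + A * ?S (Suc j))"
    by (subst shift, subst pmev_pCons[OF A]) (rule refl)
  also have "\<dots> = Polynomial.coeff ?\<chi> j * of_nat n + mat_tr (A * ?S (Suc j))"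
    by (subst mat_tr_add[of _ n]) (auto simp: mat_tr_smult[of _ n] mat_tr_one)
  also have "mat_tr (?S j) = of_nat j * Polynomial.coeff ?\<chi> j"
  proof (cases j)
    case 0
    have "mat_tr (0\<^sub>m n n :: 'a mat) = 0" by (simp add: mat_tr_def)
    then show ?thesis using 0 cayley_hamilton[OF A] by simp
  next
    case (Suc l)
    then show ?thesis using tr[of l] by simp
  qed
  finally show ?thesis by (simp add: algebra_simps)
qed

section \<open>The discriminant\<close>

lemma index_encode:
  fixes n :: nat
  assumes "a < n" "b < n"
  shows "a * n + b < n\<^sup>2" "(a * n + b) div n = a" "(a * n + b) mod n = b"
proof -
  have "a * n + b < Suc a * n" using assms by simp
  also have "\<dots> \<le> n * n" using assms by (intro mult_right_mono) auto
  finally show "a * n + b < n\<^sup>2" by (simp add: power2_eq_square)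
qed (use assms in auto)

lemma index_decode:
  fixes n :: nat
  assumes "q < n\<^sup>2"
  shows "q div n < n" "q mod n < n"
proof -
  have "n > 0" using assms by (cases n) auto
  then show "q mod n < n" by simp
  show "q div n < n" using assms by (simp add: less_mult_imp_div_less power2_eq_square)
qed

lemma sum_index:
  fixes f :: "nat \<Rightarrow> nat \<Rightarrow> 'a::comm_monoid_add"
  shows "(\<Sum>q<n\<^sup>2. f (q div n) (q mod n)) = (\<Sum>a<n. \<Sum>b<n. f a b)"
proof -
  have "(\<Sum>a<n. \<Sum>b<n. f a b) = (\<Sum>(a, b)\<in>{..<n} \<times> {..<n}. f a b)"
    by (simp add: sum.cartesian_product)
  also have "\<dots> = (\<Sum>q<n\<^sup>2. f (q div n) (q mod n))"
    by (rule sum.reindex_bij_witness[of _ "\<lambda>q. (q div n, q mod n)" "\<lambda>(a, b). a * n + b"])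
      (auto simp: index_encode index_decode)
  finally show ?thesis by simp
qed

lemma sum_index_cong:
  fixes f :: "nat \<Rightarrow> nat \<Rightarrow> 'a::comm_monoid_add"
  assumes "\<And>q. q < n\<^sup>2 \<Longrightarrow> g q = f (q div n) (q mod n)"
  shows "(\<Sum>q<n\<^sup>2. g q) = (\<Sum>a<n. \<Sum>b<n. f a b)"
  unfolding sum_index[symmetric] by (rule sum.cong) (simp_all add: assms)

definition disc_mat :: "nat \<Rightarrow> (nat \<Rightarrow> 'a::comm_ring_1 mat) \<Rightarrow> 'a mat"
  where "disc_mat n A = mat (n\<^sup>2) (n\<^sup>2) (\<lambda>(r, s). A r $$ (s div n, s mod n))"

lemma disc_mat_carrier [simp]: "disc_mat n A \<in> carrier_mat (n\<^sup>2) (n\<^sup>2)"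
  by (simp add: disc_mat_def)

lemma disc_mat_dim [simp]: "dim_row (disc_mat n A) = n\<^sup>2" "dim_col (disc_mat n A) = n\<^sup>2"
  by (simp_all add: disc_mat_def)

lemma discriminant_det: "discriminant n A = det (disc_mat n A)"
  by (simp add: discriminant_def disc_mat_def)

lemma disc_mat_entry: "r < n\<^sup>2 \<Longrightarrow> s < n\<^sup>2 \<Longrightarrow> disc_mat n A $$ (r, s) = A r $$ (s div n, s mod n)"
  by (simp add: disc_mat_def)

lemma discriminant_cong:
  assumes "\<And>r a b. r < n\<^sup>2 \<Longrightarrow> a < n \<Longrightarrow> b < n \<Longrightarrow> A r $$ (a, b) = B r $$ (a, b)"
  shows "discriminant n A = discriminant n B"
proof -
  have "disc_mat n A = disc_mat n B"
    by (rule eq_matI) (auto simp: disc_mat_def index_decode assms)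
  then show ?thesis by (simp add: discriminant_det)
qed

lemma discriminant_linear_map:
  assumes L: "L \<in> carrier_mat (n\<^sup>2) (n\<^sup>2)"
    and "\<And>r q. r < n\<^sup>2 \<Longrightarrow> q < n\<^sup>2 \<Longrightarrow> A' r $$ (q div n, q mod n) =
      (\<Sum>p<n\<^sup>2. A r $$ (p div n, p mod n) * L $$ (p, q))"
  shows "discriminant n A' = discriminant n A * det L"
proof -
  have "disc_mat n A' = disc_mat n A * L"
    by (rule eq_matI) (use L carrier_matD[OF L] in \<open>simp_all add: mult_entry[OF disc_mat_carrier L]
      disc_mat_entry assms(2) del: index_mult_mat(1)\<close>)
  then show ?thesis by (simp add: discriminant_det det_mult[OF disc_mat_carrier L])
qed

lemma discriminant_row_combination:
  assumes S: "S \<in> carrier_mat (n\<^sup>2) (n\<^sup>2)"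
    and "\<And>r a b. r < n\<^sup>2 \<Longrightarrow> a < n \<Longrightarrow> b < n \<Longrightarrow> A' r $$ (a, b) =
      (\<Sum>p<n\<^sup>2. S $$ (r, p) * A p $$ (a, b))"
  shows "discriminant n A' = det S * discriminant n A"
proof -
  have "disc_mat n A' = S * disc_mat n A"
    by (rule eq_matI) (use S carrier_matD[OF S] in \<open>simp_all add: mult_entry[OF S disc_mat_carrier]
      disc_mat_entry assms(2) index_decode del: index_mult_mat(1)\<close>)
  then show ?thesis by (simp add: discriminant_det det_mult[OF S disc_mat_carrier])
qed

text \<open>The matrices of left and right multiplication by \<open>B\<close>, acting on row vectors.\<close>

definition left_mult_mat :: "nat \<Rightarrow> 'a::comm_ring_1 mat \<Rightarrow> 'a mat"
  where "left_mult_mat n B = mat (n\<^sup>2) (n\<^sup>2)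
    (\<lambda>(p, q). if p mod n = q mod n then B $$ (q div n, p div n) else 0)"

definition right_mult_mat :: "nat \<Rightarrow> 'a::comm_ring_1 mat \<Rightarrow> 'a mat"
  where "right_mult_mat n B = mat (n\<^sup>2) (n\<^sup>2)
    (\<lambda>(p, q). if p div n = q div n then B $$ (p mod n, q mod n) else 0)"

lemma mult_mat_carriers [simp]:
  "left_mult_mat n B \<in> carrier_mat (n\<^sup>2) (n\<^sup>2)" "right_mult_mat n B \<in> carrier_mat (n\<^sup>2) (n\<^sup>2)"
  by (simp_all add: left_mult_mat_def right_mult_mat_def)

lemma left_mult_entry:
  assumes "A \<in> carrier_mat n n" "B \<in> carrier_mat n n" "q < n\<^sup>2"
  shows "(B * A) $$ (q div n, q mod n) =
    (\<Sum>p<n\<^sup>2. A $$ (p div n, p mod n) * left_mult_mat n B $$ (p, q))"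
proof -
  have "(\<Sum>p<n\<^sup>2. A $$ (p div n, p mod n) * left_mult_mat n B $$ (p, q)) =
    (\<Sum>a<n. \<Sum>b<n. if b = q mod n then A $$ (a, b) * B $$ (q div n, a) else 0)"
    by (rule sum_index_cong) (use assms(3) in \<open>auto simp: left_mult_mat_def\<close>)
  also have "\<dots> = (\<Sum>a<n. A $$ (a, q mod n) * B $$ (q div n, a))"
    using index_decode[OF assms(3)] by simp
  finally show ?thesis
    using mult_entry[OF assms(2,1) index_decode[OF assms(3)]] by (simp add: mult.commute)
qed

lemma right_mult_entry:
  assumes "A \<in> carrier_mat n n" "B \<in> carrier_mat n n" "q < n\<^sup>2"
  shows "(A * B) $$ (q div n, q mod n) =
    (\<Sum>p<n\<^sup>2. A $$ (p div n, p mod n) * right_mult_mat n B $$ (p, q))"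
proof -
  have "(\<Sum>p<n\<^sup>2. A $$ (p div n, p mod n) * right_mult_mat n B $$ (p, q)) =
    (\<Sum>a<n. \<Sum>b<n. if a = q div n then A $$ (a, b) * B $$ (b, q mod n) else 0)"
    by (rule sum_index_cong) (use assms(3) in \<open>auto simp: right_mult_mat_def\<close>)
  also have "\<dots> = (\<Sum>b<n. A $$ (q div n, b) * B $$ (b, q mod n))"
    using index_decode[OF assms(3)] by (subst sum.swap) simp
  finally show ?thesis
    using mult_entry[OF assms(1,2) index_decode[OF assms(3)]] by simp
qed

lemma discriminant_left_mult:
  assumes "\<And>r. r < n\<^sup>2 \<Longrightarrow> A r \<in> carrier_mat n n" "B \<in> carrier_mat n n"
  shows "discriminant n (\<lambda>r. B * A r) = discriminant n A * det (left_mult_mat n B)"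
  by (rule discriminant_linear_map[OF mult_mat_carriers(1)], rule left_mult_entry) (use assms in auto)

lemma discriminant_right_mult:
  assumes "\<And>r. r < n\<^sup>2 \<Longrightarrow> A r \<in> carrier_mat n n" "B \<in> carrier_mat n n"
  shows "discriminant n (\<lambda>r. A r * B) = discriminant n A * det (right_mult_mat n B)"
  by (rule discriminant_linear_map[OF mult_mat_carriers(2)], rule right_mult_entry) (use assms in auto)

lemma det_permute_cols:
  assumes A: "A \<in> carrier_mat N N" and p: "p permutes {0..<N}"
  shows "det (mat N N (\<lambda>(i, j). A $$ (i, p j))) = signof p * det A"
proof -
  have "det (mat N N (\<lambda>(i, j). A $$ (i, p j))) = det (mat N N (\<lambda>(i, j). A $$ (i, p j)))\<^sup>T"
    by (rule det_transpose[symmetric, of _ N]) simp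
  also have "(mat N N (\<lambda>(i, j). A $$ (i, p j)))\<^sup>T = mat N N (\<lambda>(i, j). A\<^sup>T $$ (p i, j))"
    by (rule eq_matI) (use A permutes_in_image[OF p] in \<open>auto\<close>)
  also have "det \<dots> = signof p * det A\<^sup>T"
    by (rule det_permute_rows[OF _ p]) (use A in auto)
  finally show ?thesis by (simp add: det_transpose[OF A])
qed

text \<open>Transposition of matrices interchanges the two multiplications, so they have the same
  determinant. Hence the discriminant is invariant under simultaneous conjugation.\<close>

lemma det_left_mult_mat:
  fixes B :: "'a::comm_ring_1 mat"
  assumes B: "B \<in> carrier_mat n n"
  shows "det (left_mult_mat n B) = det (right_mult_mat n B)"
proof -
  let ?N = "n\<^sup>2" and ?R = "right_mult_mat n B"
  define sw where "sw p = (if p < ?N then (p mod n) * n + p div n else p)" for p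
  have sw: "sw p < ?N" "sw p div n = p mod n" "sw p mod n = p div n" "sw (sw p) = p" if "p < ?N" for p
    using index_encode[OF index_decode(2,1), OF that that] that
    by (simp_all add: sw_def)
  have inv: "sw (sw p) = p" for p by (cases "p < ?N") (simp add: sw, simp add: sw_def)
  have perm: "sw permutes {0..<?N}"
    unfolding permutes_def
  proof (intro conjI allI impI)
    fix y show "\<exists>!x. sw x = y" using inv by metis
  qed (auto simp: sw_def)
  let ?M1 = "mat ?N ?N (\<lambda>(i, j). ?R $$ (i, sw j))"
  have "left_mult_mat n B = (mat ?N ?N (\<lambda>(i, j). ?M1 $$ (sw i, j)))\<^sup>T"
    by (rule eq_matI) (auto simp: left_mult_mat_def right_mult_mat_def sw)
  then have "det (left_mult_mat n B) = det (mat ?N ?N (\<lambda>(i, j). ?M1 $$ (sw i, j)))"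
    by (simp add: det_transpose[of _ ?N])
  also have "\<dots> = signof sw * det ?M1" by (rule det_permute_rows[OF _ perm]) simp
  also have "det ?M1 = signof sw * det ?R" by (rule det_permute_cols[OF _ perm]) simp
  finally show ?thesis by (simp add: sign_def)
qed

lemma det_right_mult_mat_inverse:
  fixes g h :: "'a::comm_ring_1 mat"
  assumes g: "g \<in> carrier_mat n n" and h: "h \<in> carrier_mat n n" and gh: "g * h = 1\<^sub>m n"
  shows "det (right_mult_mat n g) * det (right_mult_mat n h) = 1"
proof -
  have "right_mult_mat n g * right_mult_mat n h = 1\<^sub>m (n\<^sup>2)"
  proof (rule eq_matI)
    fix p q assume "p < dim_row (1\<^sub>m (n\<^sup>2))" "q < dim_col (1\<^sub>m (n\<^sup>2))"
    then have pq: "p < n\<^sup>2" "q < n\<^sup>2" by auto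
    have "(right_mult_mat n g * right_mult_mat n h) $$ (p, q) =
      (\<Sum>s<n\<^sup>2. right_mult_mat n g $$ (p, s) * right_mult_mat n h $$ (s, q))"
      by (rule mult_entry) (use pq in auto)
    also have "\<dots> = (\<Sum>a<n. \<Sum>b<n. if a = p div n then (if p div n = q div n then
        g $$ (p mod n, b) * h $$ (b, q mod n) else 0) else 0)"
      by (rule sum_index_cong) (use pq in \<open>auto simp: right_mult_mat_def\<close>)
    also have "\<dots> = (if p div n = q div n then (\<Sum>b<n. g $$ (p mod n, b) * h $$ (b, q mod n)) else 0)"
      using index_decode[OF pq(1)] by (subst sum.swap) simp
    also have "(\<Sum>b<n. g $$ (p mod n, b) * h $$ (b, q mod n)) = (g * h) $$ (p mod n, q mod n)"
      using mult_entry[OF g h index_decode(2)[OF pq(1)] index_decode(2)[OF pq(2)]] by simp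
    also have "(if p div n = q div n then (g * h) $$ (p mod n, q mod n) else 0) =
        (1\<^sub>m (n\<^sup>2) :: 'a mat) $$ (p, q)"
    proof (cases "p = q")
      case False
      then have "\<not> (p div n = q div n \<and> p mod n = q mod n)"
        using div_mod_decomp[of p n] div_mod_decomp[of q n] by metis
      then show ?thesis using False pq index_decode[OF pq(1)] index_decode[OF pq(2)] by (auto simp: gh)
    qed (use pq index_decode[OF pq(1)] in \<open>simp add: gh\<close>)
    finally show "(right_mult_mat n g * right_mult_mat n h) $$ (p, q) = (1\<^sub>m (n\<^sup>2)) $$ (p, q)" .
  qed (simp_all add: right_mult_mat_def)
  from arg_cong[OF this, of det] show ?thesis by (simp add: det_mult[of _ "n\<^sup>2"])
qed

lemma discriminant_conj:
  fixes g h :: "'a::comm_ring_1 mat"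
  assumes A: "\<And>r. r < n\<^sup>2 \<Longrightarrow> A r \<in> carrier_mat n n"
    and g: "g \<in> carrier_mat n n" and h: "h \<in> carrier_mat n n" and gh: "g * h = 1\<^sub>m n"
  shows "discriminant n (\<lambda>r. g * A r * h) = discriminant n A"
proof -
  have "discriminant n (\<lambda>r. g * A r * h) =
      discriminant n (\<lambda>r. g * A r) * det (right_mult_mat n h)"
    by (rule discriminant_right_mult) (use A g h in auto)
  also have "\<dots> = discriminant n A * (det (right_mult_mat n g) * det (right_mult_mat n h))"
    using discriminant_left_mult[OF A g] by (simp add: det_left_mult_mat[OF g] mult.assoc)
  finally show ?thesis by (simp add: det_right_mult_mat_inverse[OF g h gh])
qed

section \<open>The matrix \<open>Y\<close> of a tuple of matrices\<close>

locale generic_size =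
  fixes n m :: nat
  assumes n2: "n \<ge> 2" and m_def: "m = n\<^sup>2 - 1"
begin

lemma n_sq: "n\<^sup>2 = Suc m" and m3: "m \<ge> 3" and n0: "n > 0"
proof -
  have "2 * 2 \<le> n * n" using n2 by (intro mult_mono) auto
  then show "n\<^sup>2 = Suc m" "m \<ge> 3" "n > 0" using m_def n2 by (auto simp: power2_eq_square)
qed

definition tuple :: "(nat \<Rightarrow> 'a mat) \<Rightarrow> bool"
  where "tuple A \<longleftrightarrow> (\<forall>r<m. A r \<in> carrier_mat n n)"

lemma tupleD: "tuple A \<Longrightarrow> r < m \<Longrightarrow> A r \<in> carrier_mat n n"
  by (simp add: tuple_def)

definition Yt :: "(nat \<Rightarrow> 'a::comm_ring_1 mat) \<Rightarrow> 'a mat"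
  where "Yt A = mat n n (\<lambda>(i, j). discriminant n (\<lambda>r. if r < m then A r else mat_unit n j i))"

lemma Yt_carrier [simp]: "Yt A \<in> carrier_mat n n"
  by (simp add: Yt_def)

lemma Yt_dim [simp]: "dim_row (Yt A) = n" "dim_col (Yt A) = n"
  by (simp_all add: Yt_def)

text \<open>Expansion along the last row: \<open>Y\<close> represents the linear form \<open>\<Delta>(A\<^sub>1, ..., A\<^sub>m, -)\<close> with respect
  to the trace form. All properties of \<open>Y\<close> below follow from this description.\<close>

lemma tr_Yt:
  assumes Z: "Z \<in> carrier_mat n n"
  shows "mat_tr (Yt A * Z) = discriminant n (\<lambda>r. if r < m then A r else Z)"
proof -
  define cf where "cf s = cofactor (disc_mat n (\<lambda>r. if r < m then A r else 0\<^sub>m n n)) m s" for s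
  have exp: "discriminant n (\<lambda>r. if r < m then A r else W) =
      (\<Sum>a<n. \<Sum>b<n. W $$ (a, b) * cf (a * n + b))" for W
  proof -
    let ?D = "disc_mat n (\<lambda>r. if r < m then A r else W)"
    have "det ?D = (\<Sum>s<n\<^sup>2. ?D $$ (m, s) * cofactor ?D m s)"
      by (rule laplace_expansion_row[OF disc_mat_carrier]) (simp add: n_sq)
    also have "\<dots> = (\<Sum>s<n\<^sup>2. W $$ (s div n, s mod n) * cf ((s div n) * n + s mod n))"
    proof (rule sum.cong[OF refl])
      fix s assume s: "s \<in> {..<n\<^sup>2}"
      have "mat_delete ?D m s = mat_delete (disc_mat n (\<lambda>r. if r < m then A r else 0\<^sub>m n n)) m s"
        by (rule eq_matI) (auto simp: mat_delete_def disc_mat_def n_sq)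
      then have "cofactor ?D m s = cf s" by (simp add: cofactor_def cf_def)
      then show "?D $$ (m, s) * cofactor ?D m s = W $$ (s div n, s mod n) * cf ((s div n) * n + s mod n)"
        using s by (simp add: disc_mat_def n_sq)
    qed
    also have "\<dots> = (\<Sum>a<n. \<Sum>b<n. W $$ (a, b) * cf (a * n + b))"
      by (rule sum_index[of "\<lambda>a b. W $$ (a, b) * cf (a * n + b)"])
    finally show ?thesis by (simp add: discriminant_det)
  qed
  have "Yt A $$ (i, j) = cf (j * n + i)" if ij: "i < n" "j < n" for i j
  proof -
    have "Yt A $$ (i, j) = (\<Sum>a<n. \<Sum>b<n. mat_unit n j i $$ (a, b) * cf (a * n + b))"
      using ij by (simp add: Yt_def exp)
    also have "\<dots> = (\<Sum>a<n. \<Sum>b<n. if b = i then (if a = j then cf (a * n + b) else 0) else 0)"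
      by (intro sum.cong refl) (auto simp: mat_unit_def)
    finally show ?thesis using ij by simp
  qed
  then have "mat_tr (Yt A * Z) = (\<Sum>i<n. \<Sum>j<n. cf (j * n + i) * Z $$ (j, i))"
    by (simp add: mat_tr_mult[OF Yt_carrier Z])
  also have "\<dots> = (\<Sum>a<n. \<Sum>b<n. Z $$ (a, b) * cf (a * n + b))"
    by (subst sum.swap) (simp add: mult.commute)
  finally show ?thesis by (simp add: exp)
qed

lemma Yt_cong:
  assumes "\<And>r. r < m \<Longrightarrow> A r = B r"
  shows "Yt A = Yt B"
proof -
  have "(\<lambda>r. if r < m then A r else Z) = (\<lambda>r. if r < m then B r else Z)" for Z using assms by auto
  then show ?thesis by (simp add: Yt_def)
qed

lemma tr_Yt_self:
  assumes "tuple A" "r < m"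
  shows "mat_tr (Yt A * A r) = 0"
proof -
  let ?D = "disc_mat n (\<lambda>s. if s < m then A s else A r)"
  have "mat_tr (Yt A * A r) = det ?D"
    using tr_Yt[OF tupleD[OF assms]] by (simp add: discriminant_det)
  also have "det ?D = 0"
    by (rule det_identical_rows[of _ "n\<^sup>2" r m])
      (use assms in \<open>auto simp: n_sq disc_mat_def intro!: eq_vecI\<close>)
  finally show ?thesis .
qed

lemma hom_Yt:
  assumes "comm_ring_hom h" "tuple A"
  shows "map_mat h (Yt A) = Yt (\<lambda>r. map_mat h (A r))"
proof -
  interpret comm_ring_hom h by fact
  show ?thesis
  proof (rule eq_matI)
    fix i j assume "i < dim_row (Yt (\<lambda>r. map_mat h (A r)))" "j < dim_col (Yt (\<lambda>r. map_mat h (A r)))"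
    then have ij: "i < n" "j < n" by auto
    have "map_mat h (disc_mat n (\<lambda>r. if r < m then A r else mat_unit n j i)) =
      disc_mat n (\<lambda>r. if r < m then map_mat h (A r) else mat_unit n j i)"
    proof (rule eq_matI, goal_cases)
      case (1 r s)
      then have rs: "r < n\<^sup>2" "s < n\<^sup>2" by (auto simp: disc_mat_def)
      show ?case
      proof (cases "r < m")
        case True
        then show ?thesis using rs carrier_matD[OF tupleD[OF assms(2) True]] index_decode[OF rs(2)]
          by (simp add: disc_mat_def)
      next
        case False
        then show ?thesis using rs index_decode[OF rs(2)] by (auto simp: disc_mat_def mat_unit_def)
      qed
    qed (auto simp: disc_mat_def)
    then show "map_mat h (Yt A) $$ (i, j) = Yt (\<lambda>r. map_mat h (A r)) $$ (i, j)"
      using ij by (simp add: Yt_def discriminant_det flip: hom_det)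
  qed auto
qed

definition gact :: "'a::comm_ring_1 mat \<Rightarrow> (nat \<Rightarrow> 'a mat) \<Rightarrow> nat \<Rightarrow> 'a mat"
  where "gact g A h = mat n n (\<lambda>(i, j). \<Sum>l<m. g $$ (l, h) * A l $$ (i, j))"

lemma gact_tuple [simp]: "tuple (gact g A)" "gact g A h \<in> carrier_mat n n"
  by (auto simp: tuple_def gact_def)

text \<open>The rows of the discriminant that come from the tuple undergo a linear substitution of determinant
  \<open>det g\<close>, and the last row is kept.\<close>

lemma Yt_gact:
  fixes A :: "nat \<Rightarrow> 'a::comm_ring_1 mat"
  assumes g: "g \<in> carrier_mat m m"
  shows "Yt (gact g A) = det g \<cdot>\<^sub>m Yt A"
proof -
  define S where "S = mat (Suc m) (Suc m) (\<lambda>(r, p). if r < m \<and> p < m then g $$ (p, r)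
    else if r = p then 1 else 0)"
  have S: "S \<in> carrier_mat (n\<^sup>2) (n\<^sup>2)" by (simp add: S_def n_sq)
  have "det S = (\<Sum>p<n\<^sup>2. S $$ (m, p) * cofactor S m p)"
    by (rule laplace_expansion_row[OF S]) (simp add: n_sq)
  also have "\<dots> = (\<Sum>p<n\<^sup>2. if p = m then cofactor S m m else 0)"
    by (rule sum.cong) (auto simp: S_def n_sq)
  also have "\<dots> = det (mat_delete S m m)" by (simp add: n_sq cofactor_def flip: power_mult_distrib)
  also have "mat_delete S m m = g\<^sup>T"
    by (rule eq_matI) (use g in \<open>auto simp: mat_delete_def S_def\<close>)
  finally have detS: "det S = det g" by (simp add: det_transpose[OF g])
  show ?thesis
  proof (rule mat_eq_if_tr_eq[of _ n])
    fix Z :: "'a mat" assume Z: "Z \<in> carrier_mat n n"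
    have "discriminant n (\<lambda>r. if r < m then gact g A r else Z) =
        det S * discriminant n (\<lambda>r. if r < m then A r else Z)"
    proof (rule discriminant_row_combination[OF S])
      fix r a b assume r: "r < n\<^sup>2" and ab: "a < n" "b < n"
      have "(\<Sum>p<n\<^sup>2. S $$ (r, p) * (if p < m then A p else Z) $$ (a, b)) =
          (\<Sum>p<m. S $$ (r, p) * A p $$ (a, b)) + S $$ (r, m) * Z $$ (a, b)"
        by (simp add: n_sq)
      then show "(if r < m then gact g A r else Z) $$ (a, b) =
          (\<Sum>p<n\<^sup>2. S $$ (r, p) * (if p < m then A p else Z) $$ (a, b))"
        using r ab by (auto simp: n_sq S_def gact_def less_Suc_eq)
    qed
    then show "mat_tr (Yt (gact g A) * Z) = mat_tr (det g \<cdot>\<^sub>m Yt A * Z)"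
      using mult_smult_assoc_mat[OF Yt_carrier Z, of "det g" A]
      by (simp add: tr_Yt[OF Z] detS mat_tr_smult[OF mult_sq[OF Yt_carrier Z]])
  qed auto
qed

definition conj_tuple :: "'a::comm_ring_1 mat \<Rightarrow> 'a mat \<Rightarrow> (nat \<Rightarrow> 'a mat) \<Rightarrow> nat \<Rightarrow> 'a mat"
  where "conj_tuple g h A r = g * A r * h"

lemma conj_tuple [simp]:
  "tuple A \<Longrightarrow> g \<in> carrier_mat n n \<Longrightarrow> h \<in> carrier_mat n n \<Longrightarrow> tuple (conj_tuple g h A)"
  unfolding tuple_def conj_tuple_def by (meson mult_carrier_mat)

text \<open>The trace form and the discriminant are both invariant under conjugation.\<close>

lemma Yt_conj:
  fixes A :: "nat \<Rightarrow> 'a::comm_ring_1 mat"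
  assumes A: "tuple A" and g: "g \<in> carrier_mat n n" and h: "h \<in> carrier_mat n n"
    and gh: "g * h = 1\<^sub>m n" and hg: "h * g = 1\<^sub>m n"
  shows "Yt (conj_tuple g h A) = g * Yt A * h"
proof (rule mat_eq_if_tr_eq[of _ n])
  fix Z :: "'a mat" assume Z: "Z \<in> carrier_mat n n"
  let ?Z = "h * Z * g"
  have Z': "?Z \<in> carrier_mat n n" using g h Z by simp
  have gZ: "g * ?Z * h = Z"
  proof -
    have "g * ?Z * h = (g * h) * Z * (g * h)"
      using g h Z by (simp add: mat_assoc[where n = n])
    then show ?thesis using Z by (simp add: gh)
  qed
  have "mat_tr (Yt (conj_tuple g h A) * Z) =
      discriminant n (\<lambda>r. g * (if r < m then A r else ?Z) * h)"
    unfolding tr_Yt[OF Z] by (rule arg_cong[of _ _ "discriminant n"]) (auto simp: conj_tuple_def gZ)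
  also have "\<dots> = discriminant n (\<lambda>r. if r < m then A r else ?Z)"
    by (rule discriminant_conj[OF _ g h gh]) (use A Z' in \<open>auto simp: tuple_def\<close>)
  also have "\<dots> = mat_tr (Yt A * ?Z)" by (rule tr_Yt[OF Z', symmetric])
  also have "Yt A * ?Z = (Yt A * h * Z) * g" using g h Z by (simp add: mat_assoc[where n = n])
  also have "mat_tr \<dots> = mat_tr (g * (Yt A * h * Z))" by (rule mat_tr_comm[of _ n]) (use g h Z in auto)
  also have "g * (Yt A * h * Z) = g * Yt A * h * Z" using g h Z by (simp add: mat_assoc[where n = n])
  finally show "mat_tr (Yt (conj_tuple g h A) * Z) = mat_tr (g * Yt A * h * Z)" .
qed (use g h in auto)

lemma tr_gact:
  assumes A: "tuple A" and B: "B \<in> carrier_mat n n"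
  shows "mat_tr (B * gact g A h) = (\<Sum>l<m. g $$ (l, h) * mat_tr (B * A l))"
proof -
  have "mat_tr (B * gact g A h) = (\<Sum>i<n. \<Sum>j<n. \<Sum>l<m. g $$ (l, h) * (B $$ (i, j) * A l $$ (j, i)))"
    unfolding mat_tr_mult[OF B gact_tuple(2)]
    by (intro sum.cong refl) (simp add: gact_def sum_distrib_left mult.left_commute)
  also have "\<dots> = (\<Sum>l<m. \<Sum>i<n. \<Sum>j<n. g $$ (l, h) * (B $$ (i, j) * A l $$ (j, i)))"
    by (subst sum.swap[of _ "{..<m}"], subst sum.swap[of _ "{..<m}"]) (rule refl)
  also have "\<dots> = (\<Sum>l<m. g $$ (l, h) * mat_tr (B * A l))"
    by (rule sum.cong[OF refl]) (simp add: mat_tr_mult[OF B tupleD[OF A]] sum_distrib_left)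
  finally show ?thesis .
qed

text \<open>Two tuples with proportional nonzero \<open>Y\<close> span the same hyperplane of matrices, namely the
  orthogonal complement of \<open>Y\<close>; the change of basis has the factor of proportionality as
  determinant.\<close>

lemma Yt_transitive:
  fixes A A' :: "nat \<Rightarrow> 'a::field mat"
  assumes A: "tuple A" and A': "tuple A'" and Y: "Yt A' = t \<cdot>\<^sub>m Yt A" and t: "t \<noteq> 0"
    and nz: "Yt A \<noteq> 0\<^sub>m n n"
  obtains s where "s \<in> carrier_mat m m" "det s = t" "\<And>r. r < m \<Longrightarrow> A' r = gact s A r"
proof -
  obtain i j where ij: "i < n" "j < n" and y: "Yt A $$ (i, j) \<noteq> 0"
    using nz by (metis Yt_dim eq_matI index_zero_mat)
  let ?e = "mat_unit n j i :: 'a mat"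
  let ?D = "disc_mat n (\<lambda>r. if r < m then A r else ?e)"
  let ?D' = "disc_mat n (\<lambda>r. if r < m then A' r else ?e)"
  have "det ?D \<noteq> 0" using y ij by (simp add: Yt_def discriminant_det)
  then have "?D \<in> Units (ring_mat TYPE('a) (n\<^sup>2) ())" by (intro det_non_zero_imp_unit) auto
  then obtain I where I: "I \<in> carrier_mat (n\<^sup>2) (n\<^sup>2)" "I * ?D = 1\<^sub>m (n\<^sup>2)"
    by (auto simp: Units_def ring_mat_simps)
  define S where "S = ?D' * I"
  have S: "S \<in> carrier_mat (n\<^sup>2) (n\<^sup>2)" using I(1) by (simp add: S_def)
  have SD: "S * ?D = ?D'"
    unfolding S_def using I by (simp add: mat_assoc[where n = "n\<^sup>2"] right_mult_one_mat[OF disc_mat_carrier])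
  define s where "s = mat m m (\<lambda>(l, h). S $$ (h, l))"
  have dec: "A' r = gact s A r + S $$ (r, m) \<cdot>\<^sub>m ?e" if r: "r < m" for r
  proof (rule eq_matI)
    fix a b assume "a < dim_row (gact s A r + S $$ (r, m) \<cdot>\<^sub>m ?e)" "b < dim_col (gact s A r + S $$ (r, m) \<cdot>\<^sub>m ?e)"
    then have ab: "a < n" "b < n" by (auto simp: mat_unit_def)
    let ?q = "a * n + b"
    have "A' r $$ (a, b) = ?D' $$ (r, ?q)"
      using r ab index_encode[OF ab] by (simp add: disc_mat_def n_sq)
    also have "\<dots> = (\<Sum>p<n\<^sup>2. S $$ (r, p) * ?D $$ (p, ?q))"
      unfolding SD[symmetric] by (rule mult_entry[OF S disc_mat_carrier]) (use r index_encode[OF ab] n_sq in auto)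
    also have "\<dots> = (\<Sum>p<m. S $$ (r, p) * A p $$ (a, b)) + S $$ (r, m) * ?e $$ (a, b)"
      using ab index_encode[OF ab] by (simp add: disc_mat_def n_sq)
    finally show "A' r $$ (a, b) = (gact s A r + S $$ (r, m) \<cdot>\<^sub>m ?e) $$ (a, b)"
      using r ab by (simp add: gact_def s_def mat_unit_def)
  qed (use tupleD[OF A' r] in \<open>auto simp: mat_unit_def\<close>)
  have Sm: "S $$ (r, m) = 0" if r: "r < m" for r
  proof -
    have "t * mat_tr (Yt A * A' r) = mat_tr (Yt A' * A' r)"
      using tupleD[OF A' r] unfolding Y
      by (simp add: mult_smult_assoc_mat[OF Yt_carrier tupleD[OF A' r]] mat_tr_smult[of _ n])
    then have "mat_tr (Yt A * A' r) = 0" using tr_Yt_self[OF A' r] t by simp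
    also have "mat_tr (Yt A * A' r) = mat_tr (Yt A * gact s A r) + S $$ (r, m) * mat_tr (Yt A * ?e)"
      unfolding dec[OF r]
      by (subst mult_add_distrib_mat[of _ n n _ n])
        (auto simp: mat_tr_add[of _ n] mult_smult_distrib[of _ n n _ n] mat_tr_smult[of _ n])
    also have "mat_tr (Yt A * gact s A r) = 0"
      by (simp add: tr_gact[OF A Yt_carrier] tr_Yt_self[OF A])
    finally show ?thesis using y by (simp add: mat_tr_mult_unit[OF Yt_carrier ij])
  qed
  have eq: "A' r = gact s A r" if r: "r < m" for r
    unfolding dec[OF r] Sm[OF r] by (rule eq_matI) (auto simp: mat_unit_def gact_def)
  have sc: "s \<in> carrier_mat m m" by (simp add: s_def)
  have "t \<cdot>\<^sub>m Yt A = det s \<cdot>\<^sub>m Yt A"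
    using Yt_cong[OF eq] Yt_gact[OF sc, of A] Y by simp
  then have "(t \<cdot>\<^sub>m Yt A) $$ (i, j) = (det s \<cdot>\<^sub>m Yt A) $$ (i, j)" by simp
  then have "det s = t" using y ij by simp
  then show ?thesis using that sc eq by blast
qed

text \<open>A polynomial section of \<open>A \<mapsto> Y\<close> over the matrices whose \<open>(1, 0)\<close> entry is 1: a basis of the
  orthogonal complement of such a matrix \<open>v\<close> is formed by the \<open>e\<^sub>a\<^sub>b - v\<^sub>b\<^sub>a e\<^sub>0\<^sub>1\<close>. The signs of the
  transposition and of the zeroth element cancel.\<close>

definition pos_swap :: "nat \<Rightarrow> nat"
  where "pos_swap = Transposition.transpose 1 m"

definition slice :: "'a::comm_ring_1 mat \<Rightarrow> nat \<Rightarrow> 'a mat"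
  where "slice v r = (let q = pos_swap r; a = q div n; b = q mod n in
    (if r = 0 then - 1 else 1) \<cdot>\<^sub>m (mat_unit n a b - v $$ (b, a) \<cdot>\<^sub>m mat_unit n 0 1))"

lemma slice_tuple [simp]: "tuple (slice v)" "slice v r \<in> carrier_mat n n"
  by (auto simp: tuple_def slice_def Let_def mat_unit_def)

lemma slice_entry:
  assumes "i < n" "j < n"
  shows "slice v r $$ (i, j) = (if r = 0 then - 1 else 1) *
    ((if i = pos_swap r div n \<and> j = pos_swap r mod n then 1 else 0) -
      v $$ (pos_swap r mod n, pos_swap r div n) * (if i = 0 \<and> j = 1 then 1 else 0))"
  using assms by (simp add: slice_def Let_def mat_unit_def)

lemma pos_swap_perm: "pos_swap permutes {0..<n\<^sup>2}"
  unfolding pos_swap_def by (rule permutes_swap_id) (use m3 n_sq in auto)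

lemma pos_swap_less: "q < n\<^sup>2 \<Longrightarrow> pos_swap q < n\<^sup>2"
  using permutes_in_image[OF pos_swap_perm, of q] by simp

lemma Yt_slice:
  fixes v :: "'a::comm_ring_1 mat"
  assumes v: "v \<in> carrier_mat n n" and v1: "v $$ (1, 0) = 1"
  shows "Yt (slice v) = v"
proof -
  let ?y = "Yt (slice v)"
  let ?D = "disc_mat n (\<lambda>r. if r < m then slice v r else mat_unit n 0 1)"
  define U where "U = mat (n\<^sup>2) (n\<^sup>2) (\<lambda>(r, t). if r < m then (if r = 0 then - 1 else 1) *
    ((if t = r then 1 else 0) - (if t = m then v $$ (pos_swap r mod n, pos_swap r div n) else 0))
    else if t = m then 1 else (0 :: 'a))"
  have U: "U \<in> carrier_mat (n\<^sup>2) (n\<^sup>2)" by (simp add: U_def)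
  have one_idx: "q div n = 0 \<and> q mod n = Suc 0 \<longleftrightarrow> q = 1" if "q < n\<^sup>2" for q
  proof
    show "q = 1" if "q div n = 0 \<and> q mod n = Suc 0"
      using div_mod_decomp[of q n] that by (metis One_nat_def add_0 mult_zero_left)
  qed (use n2 in simp)
  have idx: "q div n = p div n \<and> q mod n = p mod n \<longleftrightarrow> q = p" for p q :: nat
    using div_mod_decomp[of q n] div_mod_decomp[of p n] by metis
  have sw: "pos_swap s = t \<longleftrightarrow> s = pos_swap t" for s t
    unfolding pos_swap_def by (metis transpose_involutory)
  have swm: "pos_swap s = m \<longleftrightarrow> s = 1" for s unfolding sw by (simp add: pos_swap_def)
  have "?D = mat (n\<^sup>2) (n\<^sup>2) (\<lambda>(r, s). U $$ (r, pos_swap s))"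
  proof (rule eq_matI)
    fix r s assume "r < dim_row (mat (n\<^sup>2) (n\<^sup>2) (\<lambda>(r, s). U $$ (r, pos_swap s)))"
      "s < dim_col (mat (n\<^sup>2) (n\<^sup>2) (\<lambda>(r, s). U $$ (r, pos_swap s)))"
    then have rs: "r < n\<^sup>2" "s < n\<^sup>2" by auto
    note d = index_decode[OF rs(2)]
    show "?D $$ (r, s) = mat (n\<^sup>2) (n\<^sup>2) (\<lambda>(r, s). U $$ (r, pos_swap s)) $$ (r, s)"
    proof (cases "r < m")
      case True
      then show ?thesis using rs pos_swap_less[OF rs(2)]
        by (simp add: disc_mat_def U_def slice_entry[OF d] idx one_idx[OF rs(2)] swm sw[of s r])
    next
      case False
      then show ?thesis using rs pos_swap_less[OF rs(2)] d
        by (simp add: disc_mat_def U_def mat_unit_def one_idx[OF rs(2)] swm)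
    qed
  qed (auto simp: disc_mat_def)
  then have "det ?D = signof pos_swap * det U"
    by (simp only: det_permute_cols[OF U pos_swap_perm])
  also have "det U = prod_list (diag_mat U)"
    by (rule det_upper_triangular[OF _ U]) (auto simp: upper_triangular_def U_def n_sq)
  also have "\<dots> = (\<Prod>i<n\<^sup>2. if i = 0 then - 1 else 1)"
  proof -
    have "diag_mat U = map (\<lambda>i. if i = 0 then - 1 else 1) [0..<n\<^sup>2]"
      unfolding diag_mat_def by (rule map_cong) (use m3 in \<open>auto simp: U_def n_sq\<close>)
    moreover have "(\<Prod>i<n\<^sup>2. if i = 0 then - 1 else 1 :: 'a) =
        prod_list (map (\<lambda>i. if i = 0 then - 1 else 1) [0..<n\<^sup>2])"
      by (subst prod.distinct_set_conv_list [symmetric]) (simp_all add: atLeast0LessThan)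
    ultimately show ?thesis by simp
  qed
  also have "\<dots> = - 1" using n_sq by (simp add: prod.delta)
  also have "signof pos_swap = (- 1 :: 'a)"
    unfolding pos_swap_def using m3 by (simp add: sign_swap_id)
  finally have detD: "det ?D = 1" by simp
  have y1: "?y $$ (1, 0) = 1"
    using detD n2 by (simp add: Yt_def discriminant_det del: One_nat_def)
  show ?thesis
  proof (rule eq_matI)
    fix i j assume "i < dim_row v" "j < dim_col v"
    then have ij: "i < n" "j < n" using v by auto
    let ?q = "j * n + i"
    note q = index_encode[OF ij(2,1)]
    show "?y $$ (i, j) = v $$ (i, j)"
    proof (cases "?q = 1")
      case True
      then have "i = 1" "j = 0" using q n2 by auto
      then show ?thesis using y1 v1 by simp
    next
      case False
      define r where "r = pos_swap ?q"
      have pr: "pos_swap r = ?q" by (simp add: r_def pos_swap_def)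
      have r: "r < m" using pos_swap_less[OF q(1)] False swm[of ?q] n_sq by (simp add: r_def)
      have "0 = mat_tr (?y * slice v r)" by (rule tr_Yt_self[symmetric, OF slice_tuple(1) r])
      also have "slice v r = (if r = 0 then - 1 else 1) \<cdot>\<^sub>m (mat_unit n j i - v $$ (i, j) \<cdot>\<^sub>m mat_unit n 0 1)"
        by (simp only: slice_def pr q Let_def)
      also have "mat_tr (?y * \<dots>) = (if r = 0 then - 1 else 1) * (?y $$ (i, j) - v $$ (i, j) * ?y $$ (1, 0))"
      proof -
        have "?y * (a \<cdot>\<^sub>m (mat_unit n j i - b \<cdot>\<^sub>m mat_unit n 0 1)) =
          a \<cdot>\<^sub>m (?y * mat_unit n j i + (- b) \<cdot>\<^sub>m (?y * mat_unit n 0 1))" for a b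
        proof -
          have W: "mat_unit n j i - b \<cdot>\<^sub>m mat_unit n 0 1 =
              mat_unit n j i + (- b) \<cdot>\<^sub>m (mat_unit n 0 1 :: 'a mat)"
            by (rule eq_matI) (auto simp: mat_unit_def)
          have "?y * (a \<cdot>\<^sub>m (mat_unit n j i + (- b) \<cdot>\<^sub>m mat_unit n 0 1)) =
              a \<cdot>\<^sub>m (?y * (mat_unit n j i + (- b) \<cdot>\<^sub>m mat_unit n 0 1))"
            by (rule mult_smult_distrib[of _ n n _ n]) auto
          also have "?y * (mat_unit n j i + (- b) \<cdot>\<^sub>m mat_unit n 0 1) =
              ?y * mat_unit n j i + ?y * ((- b) \<cdot>\<^sub>m mat_unit n 0 1)"
            by (rule mult_add_distrib_mat[of _ n n _ n]) auto
          also have "?y * ((- b) \<cdot>\<^sub>m mat_unit n 0 1) = (- b) \<cdot>\<^sub>m (?y * mat_unit n 0 1)"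
            by (rule mult_smult_distrib[of _ n n _ n]) auto
          finally show ?thesis unfolding W .
        qed
        moreover have "mat_tr (a \<cdot>\<^sub>m (?y * mat_unit n j i + (- b) \<cdot>\<^sub>m (?y * mat_unit n 0 1))) =
          a * (mat_tr (?y * mat_unit n j i) + (- b) * mat_tr (?y * mat_unit n 0 1))" for a b
          by (subst mat_tr_smult[of _ n], simp, subst mat_tr_add[of _ n], simp, simp, subst mat_tr_smult[of _ n], simp, rule refl)
        ultimately show ?thesis
          using n2 by (simp add: mat_tr_mult_unit[OF Yt_carrier ij] mat_tr_mult_unit[OF Yt_carrier]
            del: One_nat_def)
      qed
      finally have "0 = (if r = 0 then - 1 else 1) * (?y $$ (i, j) - v $$ (i, j))"
        using y1 by simp
      then show ?thesis by (cases "r = 0") simp_all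
    qed
  qed (use v in auto)
qed

end

section \<open>Companion matrices\<close>

lemma pmev_sum:
  assumes A: "A \<in> carrier_mat n n" and ij: "i < n" "j < n"
  shows "pmev (\<Sum>k\<in>S. f k) A $$ (i, j) = (\<Sum>k\<in>S. pmev (f k) A $$ (i, j))"
  using ij by (induction S rule: infinite_finite_induct)
    (simp_all add: pmev_0[OF A] pmev_add[OF A] pmev_dim[OF A])

lemma pmev_entry:
  assumes A: "A \<in> carrier_mat n n" and ij: "i < n" "j < n" and d: "\<And>k. k > d \<Longrightarrow> Polynomial.coeff q k = 0"
  shows "pmev q A $$ (i, j) = (\<Sum>k\<le>d. Polynomial.coeff q k * pmev (Polynomial.monom 1 k) A $$ (i, j))"
proof -
  have "q = (\<Sum>k\<le>d. Polynomial.smult (Polynomial.coeff q k) (Polynomial.monom 1 k))"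
    by (rule poly_eqI) (use d in \<open>auto simp: coeff_sum if_distrib cong: if_cong\<close>)
  then have "pmev q A $$ (i, j) =
      pmev (\<Sum>k\<le>d. Polynomial.smult (Polynomial.coeff q k) (Polynomial.monom 1 k)) A $$ (i, j)"
    by simp
  also have "\<dots> = (\<Sum>k\<le>d. Polynomial.coeff q k * pmev (Polynomial.monom 1 k) A $$ (i, j))"
    using ij by (simp add: pmev_sum[OF A ij] pmev_smult[OF A] pmev_dim[OF A])
  finally show ?thesis .
qed

lemma pmev_monom_Suc:
  assumes A: "A \<in> carrier_mat n n"
  shows "pmev (Polynomial.monom 1 (Suc k)) A = A * pmev (Polynomial.monom 1 k) A"
  by (simp add: monom_Suc pmev_pCons[OF A])
    (rule eq_matI, use A in \<open>simp_all add: pmev_dim[OF A] dim_A[OF A] del: index_mult_mat(1)\<close>)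

definition companion :: "nat \<Rightarrow> (nat \<Rightarrow> 'a::comm_ring_1) \<Rightarrow> 'a mat"
  where "companion n c = mat n n (\<lambda>(i, j). if j = n - 1 then - c (n - i) else if i = Suc j then 1 else 0)"

lemma companion_carrier [simp]: "companion n c \<in> carrier_mat n n"
  by (simp add: companion_def)

lemma companion_entry_10: "n \<ge> 2 \<Longrightarrow> companion n c $$ (1, 0) = 1"
  by (simp add: companion_def)

lemma hom_companion:
  assumes "comm_ring_hom h"
  shows "map_mat h (companion n c) = companion n (\<lambda>i. h (c i))"
proof -
  interpret comm_ring_hom h by fact
  show ?thesis by (rule eq_matI) (auto simp: companion_def hom_uminus)
qed

lemma mult_companion_entry:
  fixes P :: "'a::comm_ring_1 mat"
  assumes P: "P \<in> carrier_mat n n" and i: "i < n" and j: "j < n - 1"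
  shows "(P * companion n c) $$ (i, j) = P $$ (i, Suc j)"
proof -
  have "(P * companion n c) $$ (i, j) = (\<Sum>k<n. P $$ (i, k) * companion n c $$ (k, j))"
    by (rule mult_entry[OF P companion_carrier]) (use i j in auto)
  also have "\<dots> = (\<Sum>k<n. if k = Suc j then P $$ (i, k) else 0)"
    by (rule sum.cong) (use j in \<open>auto simp: companion_def\<close>)
  finally show ?thesis using j by simp
qed

text \<open>The zeroth basis vector is cyclic for the companion matrix, and a polynomial of degree less
  than \<open>n\<close> can be read off from the zeroth column of its value.\<close>

lemma pmev_companion_column:
  assumes "\<And>k. k \<ge> n \<Longrightarrow> Polynomial.coeff q k = 0" and "i < n"
  shows "pmev q (companion n c) $$ (i, 0) = Polynomial.coeff q i"
  using assms
proof (induction q arbitrary: i)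
  case 0
  then show ?case by (simp add: pmev_0[OF companion_carrier])
next
  case (pCons a q)
  note C = companion_carrier[of n c]
  have q0: "Polynomial.coeff q k = 0" if "k \<ge> n - 1" for k
    using pCons.prems(1)[of "Suc k"] that by simp
  have IH: "pmev q (companion n c) $$ (k, 0) = Polynomial.coeff q k" if "k < n" for k
    by (rule pCons.IH) (use q0 that in auto)
  have "(companion n c * pmev q (companion n c)) $$ (i, 0) = (\<Sum>k<n. companion n c $$ (i, k) * pmev q (companion n c) $$ (k, 0))"
    by (rule mult_entry[OF C pmev_carrier[OF C]]) (use pCons.prems in auto)
  also have "\<dots> = (\<Sum>k<n. if i = Suc k then Polynomial.coeff q k else 0)"
  proof (rule sum.cong[OF refl])
    fix k assume "k \<in> {..<n}"
    then show "companion n c $$ (i, k) * pmev q (companion n c) $$ (k, 0) = (if i = Suc k then Polynomial.coeff q k else 0)"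
      using pCons.prems(2) IH[of k] q0[of k] by (auto simp: companion_def)
  qed
  also have "\<dots> = (if i = 0 then 0 else Polynomial.coeff q (i - 1))"
    using pCons.prems(2) by (cases i) auto
  finally show ?case
    using pCons.prems(2) 
    by (simp add: pmev_pCons[OF C] pmev_dim[OF C] dim_A[OF C] coeff_pCons del: index_mult_mat(1)
      split: nat.splits)
qed

lemma char_poly_degree: 
  assumes "A \<in> carrier_mat n n"
  shows "Polynomial.coeff (char_poly A) n = 1" "k > n \<Longrightarrow> Polynomial.coeff (char_poly A) k = 0"
  using degree_monic_char_poly[OF assms] by (auto simp: coeff_eq_0)

lemma coeff_char_poly_companion:
  fixes c :: "nat \<Rightarrow> 'a::comm_ring_1"
  assumes i: "i < n"
  shows "Polynomial.coeff (char_poly (companion n c)) i = c (n - i)"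
proof -
  let ?C = "companion n c" and ?\<chi> = "char_poly (companion n c)"
  note C = companion_carrier[of n c]
  let ?p = "\<lambda>k. pmev (Polynomial.monom 1 k) ?C"
  have n: "n > 0" using i by simp
  have "0 = pmev ?\<chi> ?C $$ (i, 0)" using i by (simp add: cayley_hamilton[OF C])
  also have "\<dots> = (\<Sum>k\<le>n. Polynomial.coeff ?\<chi> k * ?p k $$ (i, 0))"
    by (rule pmev_entry[OF C]) (use i char_poly_degree[OF C] in auto)
  also have "\<dots> = (\<Sum>k<n. Polynomial.coeff ?\<chi> k * ?p k $$ (i, 0)) + ?p n $$ (i, 0)"
    using char_poly_degree(1)[OF C] by (simp add: lessThan_Suc_atMost[symmetric])
  also have "(\<Sum>k<n. Polynomial.coeff ?\<chi> k * ?p k $$ (i, 0)) = (\<Sum>k<n. if k = i then Polynomial.coeff ?\<chi> k else 0)"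
    by (rule sum.cong) (use i in \<open>auto simp: pmev_companion_column\<close>)
  also have "\<dots> = Polynomial.coeff ?\<chi> i" using i by simp
  also have "?p n $$ (i, 0) = (?C * ?p (n - 1)) $$ (i, 0)"
    using pmev_monom_Suc[OF C, of "n - 1"] n by simp
  also have "\<dots> = (\<Sum>k<n. ?C $$ (i, k) * ?p (n - 1) $$ (k, 0))"
    by (rule mult_entry[OF C pmev_carrier[OF C]]) (use i in auto)
  also have "\<dots> = (\<Sum>k<n. if k = n - 1 then ?C $$ (i, k) else 0)"
    by (rule sum.cong) (use i in \<open>auto simp: pmev_companion_column\<close>)
  also have "\<dots> = - c (n - i)" using i by (simp add: companion_def)
  finally show ?thesis by simp
qed

text \<open>Two matrices that commute with \<open>C\<close> agree if they agree on its cyclic vector.\<close>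

lemma companion_centralizer:
  fixes N :: "'a::comm_ring_1 mat"
  assumes N: "N \<in> carrier_mat n n" and comm: "N * companion n c = companion n c * N"
    and q: "\<And>k. k < n \<Longrightarrow> Polynomial.coeff q k = N $$ (k, 0)" "\<And>k. k \<ge> n \<Longrightarrow> Polynomial.coeff q k = 0"
  shows "N = pmev q (companion n c)"
proof -
  note C = companion_carrier[of n c]
  note Q = pmev_carrier[OF C, of q]
  have "\<forall>i<n. N $$ (i, j) = pmev q (companion n c) $$ (i, j)" if "j < n" for j
    using that
  proof (induction j)
    case 0
    then show ?case using q by (auto simp: pmev_companion_column)
  next
    case (Suc j)
    then have j: "j < n" "j < n - 1" by auto
    show ?case
    proof (intro allI impI)
      fix i assume i: "i < n"
      have "N $$ (i, Suc j) = (companion n c * N) $$ (i, j)"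
        using mult_companion_entry[OF N i j(2), of c] comm by simp
      also have "\<dots> = (\<Sum>k<n. companion n c $$ (i, k) * N $$ (k, j))"
        by (rule mult_entry[OF C N i j(1)])
      also have "\<dots> = (\<Sum>k<n. companion n c $$ (i, k) * pmev q (companion n c) $$ (k, j))"
        using Suc.IH[OF j(1)] by simp
      also have "\<dots> = (companion n c * pmev q (companion n c)) $$ (i, j)"
        by (rule mult_entry[OF C Q i j(1), symmetric])
      also have "\<dots> = (pmev q (companion n c) * companion n c) $$ (i, j)"
        by (simp only: pmev_commute[OF C C refl])
      also have "\<dots> = pmev q (companion n c) $$ (i, Suc j)" by (rule mult_companion_entry[OF Q i j(2)])
      finally show "N $$ (i, Suc j) = pmev q (companion n c) $$ (i, Suc j)" .
    qed
  qed
  then show ?thesis using carrier_matD[OF N] carrier_matD[OF Q] by (intro eq_matI) auto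
qed

text \<open>The columns are the images of the zeroth basis vector under the powers of \<open>A\<close>.\<close>

definition krylov :: "nat \<Rightarrow> 'a::comm_ring_1 mat \<Rightarrow> 'a mat"
  where "krylov n A = mat n n (\<lambda>(i, j). pmev (Polynomial.monom 1 j) A $$ (i, 0))"

lemma krylov_carrier [simp]: "krylov n A \<in> carrier_mat n n"
  by (simp add: krylov_def)

lemma hom_krylov:
  assumes h: "comm_ring_hom h" and A: "A \<in> carrier_mat n n"
  shows "map_mat h (krylov n A) = krylov n (map_mat h A)"
proof -
  interpret comm_ring_hom h by fact
  show ?thesis
  proof (rule eq_matI)
    fix i j assume "i < dim_row (krylov n (map_mat h A))" "j < dim_col (krylov n (map_mat h A))"
    then have ij: "i < n" "j < n" by (auto simp: krylov_def)
    have "map_mat h (pmev (Polynomial.monom 1 j) A) = pmev (Polynomial.monom 1 j) (map_mat h A)"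
      by (simp add: hom_pmev[OF h A] map_poly_monom)
    then show "map_mat h (krylov n A) $$ (i, j) = krylov n (map_mat h A) $$ (i, j)"
      using ij pmev_dim[OF A, of "Polynomial.monom 1 j"]
      by (simp add: krylov_def) (metis index_map_mat(1) less_nat_zero_code not_less_iff_gr_or_eq)
  qed (auto simp: krylov_def)
qed

lemma krylov_companion: "krylov n (companion n c) = 1\<^sub>m n"
  by (rule eq_matI) (auto simp: krylov_def pmev_companion_column)

text \<open>The coefficients of the characteristic polynomial in the numbering \<open>t\<^sup>n + c\<^sub>1 t\<^sup>n\<^sup>-\<^sup>1 + ... + c\<^sub>n\<close>.\<close>

definition cc :: "nat \<Rightarrow> 'a::comm_ring_1 mat \<Rightarrow> nat \<Rightarrow> 'a"
  where "cc n A i = Polynomial.coeff (char_poly A) (n - i)"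

lemma hom_cc:
  assumes "comm_ring_hom h" "A \<in> carrier_mat n n"
  shows "cc n (map_mat h A) i = h (cc n A i)"
proof -
  interpret comm_ring_hom h by fact
  show ?thesis by (simp add: cc_def char_poly_hom[OF assms(2)])
qed

lemma cc_companion: "1 \<le> i \<Longrightarrow> i \<le> n \<Longrightarrow> cc n (companion n c) i = c i"
  by (simp add: cc_def coeff_char_poly_companion)

lemma krylov_intertwines:
  fixes A :: "'a::comm_ring_1 mat"
  assumes A: "A \<in> carrier_mat n n" and n: "n > 0"
  shows "A * krylov n A = krylov n A * companion n (cc n A)"
proof (rule eq_matI)
  let ?p = "\<lambda>k. pmev (Polynomial.monom 1 k) A"
  note K = krylov_carrier[of n A]
  fix i j assume "i < dim_row (krylov n A * companion n (cc n A))" "j < dim_col (krylov n A * companion n (cc n A))"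
  then have ij: "i < n" "j < n" by (auto simp: krylov_def companion_def)
  have "(A * krylov n A) $$ (i, j) = (\<Sum>k<n. A $$ (i, k) * ?p j $$ (k, 0))"
    unfolding mult_entry[OF A K ij] using ij by (intro sum.cong) (auto simp: krylov_def)
  also have "\<dots> = (A * ?p j) $$ (i, 0)"
    by (rule mult_entry[OF A pmev_carrier[OF A], symmetric]) (use ij in auto)
  also have "\<dots> = ?p (Suc j) $$ (i, 0)" by (simp only: pmev_monom_Suc[OF A])
  finally have L: "(A * krylov n A) $$ (i, j) = ?p (Suc j) $$ (i, 0)" .
  show "(A * krylov n A) $$ (i, j) = (krylov n A * companion n (cc n A)) $$ (i, j)"
  proof (cases "j < n - 1")
    case True
    then show ?thesis unfolding L mult_companion_entry[OF K ij(1) True] using ij by (simp add: krylov_def)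
  next
    case False
    then have j: "j = n - 1" using ij by simp
    have "(krylov n A * companion n (cc n A)) $$ (i, j) = (\<Sum>k<n. krylov n A $$ (i, k) * companion n (cc n A) $$ (k, j))"
      by (rule mult_entry[OF K companion_carrier ij])
    also have "\<dots> = - (\<Sum>k<n. Polynomial.coeff (char_poly A) k * ?p k $$ (i, 0))"
      unfolding sum_negf[symmetric] using ij j by (intro sum.cong) (auto simp: krylov_def companion_def cc_def)
    also have "\<dots> = ?p n $$ (i, 0) - (\<Sum>k\<le>n. Polynomial.coeff (char_poly A) k * ?p k $$ (i, 0))"
      using char_poly_degree(1)[OF A] by (simp add: lessThan_Suc_atMost[symmetric])
    also have "(\<Sum>k\<le>n. Polynomial.coeff (char_poly A) k * ?p k $$ (i, 0)) = pmev (char_poly A) A $$ (i, 0)"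
      by (rule pmev_entry[OF A, symmetric]) (use ij char_poly_degree[OF A] in auto)
    also have "\<dots> = 0" using ij by (simp add: cayley_hamilton[OF A])
    finally show ?thesis using L j n by simp
  qed
qed (use A in \<open>auto simp: krylov_def companion_def\<close>)

lemma field_inverse_matrix:
  fixes A :: "'a::field mat"
  assumes A: "A \<in> carrier_mat n n" and d: "det A \<noteq> 0"
  obtains B where "B \<in> carrier_mat n n" "A * B = 1\<^sub>m n" "B * A = 1\<^sub>m n"
proof -
  have "A \<in> Units (ring_mat TYPE('a) n ())" by (rule det_non_zero_imp_unit[OF A d])
  then show ?thesis using that by (auto simp: Units_def ring_mat_simps)
qed

text \<open>The Krylov matrix itself conjugates \<open>A\<close> to its companion matrix.\<close>

lemma krylov_conj:
  fixes A :: "'a::field mat"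
  assumes A: "A \<in> carrier_mat n n" and n: "n > 0" and d: "det (krylov n A) \<noteq> 0"
  obtains P Q where "P \<in> carrier_mat n n" "Q \<in> carrier_mat n n" "P * Q = 1\<^sub>m n" "Q * P = 1\<^sub>m n"
    "P * A * Q = companion n (cc n A)"
proof -
  let ?K = "krylov n A"
  obtain P where P: "P \<in> carrier_mat n n" "?K * P = 1\<^sub>m n" "P * ?K = 1\<^sub>m n"
    using field_inverse_matrix[OF krylov_carrier d] by blast
  have "P * A * ?K = P * (A * ?K)" using P(1) A by (simp add: mat_assoc[where n = n])
  also have "\<dots> = (P * ?K) * companion n (cc n A)"
    unfolding krylov_intertwines[OF A n] using P(1) by (simp add: mat_assoc[where n = n])
  also have "\<dots> = companion n (cc n A)" using left_mult_one_mat[OF companion_carrier] by (simp add: P)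
  finally show ?thesis using that[OF P(1) krylov_carrier P(3,2)] by blast
qed

section \<open>Singular values of polynomials at companion matrices\<close>

text \<open>Over an algebraically closed field \<open>q(C)\<close> is a product of matrices \<open>C - b\<close> with roots \<open>b\<close> of \<open>q\<close>. If
  it is singular, then one of the factors is.\<close>

lemma det_pmev_eq_0:
  fixes C :: "'a::alg_closed_field mat"
  assumes C: "C \<in> carrier_mat n n" and q: "q \<noteq> 0" and d: "det (pmev q C) = 0"
  shows "\<exists>b. poly q b = 0 \<and> poly (char_poly C) b = 0"
proof -
  obtain S where S: "q = Polynomial.smult (Polynomial.lead_coeff q) (\<Prod>x\<in>#S. [:- x, 1:])"
    using alg_closed_imp_factorization[OF q] by blast
  have lc: "Polynomial.lead_coeff q \<noteq> 0" using q by simp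
  have "det (pmev (\<Prod>x\<in>#S. [:- x, 1:]) C) = (\<Prod>x\<in>#S. det (pmev [:- x, 1:] C))" for S
    by (induction S) (simp_all add: pmev_1[OF C] pmev_mult[OF C] det_mult[OF pmev_carrier[OF C] pmev_carrier[OF C]]
      del: mult_pCons_left)
  moreover have "det (pmev (\<Prod>x\<in>#S. [:- x, 1:]) C) = 0"
    using d lc by (subst (asm) S) (simp add: pmev_smult[OF C])
  ultimately obtain b where b: "b \<in># S" "det (pmev [:- b, 1:] C) = 0"
    by (auto simp: prod_mset_zero_iff)
  have "pmev [:- b, 1:] C = char_matrix C b"
  proof -
    have "[:- b, 1:] = [:- b:] + [:0, 1:]" by simp
    then have "pmev [:- b, 1:] C = (- b) \<cdot>\<^sub>m 1\<^sub>m n + C"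
      by (simp only: pmev_add[OF C] pmev_const[OF C] pmev_X[OF C])
    then show ?thesis using C by (auto simp: char_matrix_def intro!: eq_matI)
  qed
  then have "eigenvalue C b" using b(2) eigenvalue_det[OF C] by simp
  then have "poly (char_poly C) b = 0" using eigenvalue_root_char_poly[OF C] by simp
  moreover have "poly q b = 0"
    by (subst S) (use b(1) in \<open>auto simp: poly_prod_mset prod_mset_zero_iff\<close>)
  ultimately show ?thesis by blast
qed

lemma to_ac_hom: "comm_ring_hom (to_ac :: 'a::field \<Rightarrow> 'a alg_closure)"
  by unfold_locales simp_all

text \<open>A nonzero \<open>q\<close> has finitely many roots in the algebraic closure, and each of them is a root
  of \<open>t\<^sup>n + c\<^sub>1 t\<^sup>n\<^sup>-\<^sup>1 + ... + c\<^sub>n\<close> for just one value of the constant term \<open>c\<^sub>n\<close>.\<close>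

lemma companion_nonsingular_value:
  fixes q :: "'k::field_char_0 poly"
  assumes q: "q \<noteq> 0" and n: "n > 0"
  obtains s where "det (pmev q (companion n (c(n := s)))) \<noteq> 0"
proof -
  let ?q = "map_poly to_ac q"
  interpret ac: comm_ring_hom "to_ac :: 'k \<Rightarrow> _" by (rule to_ac_hom)
  interpret ac: inj_comm_ring_hom "to_ac :: 'k \<Rightarrow> _" by unfold_locales simp
  have q': "?q \<noteq> 0" using q by simp
  define \<chi> where "\<chi> s = char_poly (companion n (c(n := s)))" for s
  have \<chi>: "\<chi> s = \<chi> 0 + [:s:]" for s
  proof (rule poly_eqI)
    fix k show "Polynomial.coeff (\<chi> s) k = Polynomial.coeff (\<chi> 0 + [:s:]) k"
      unfolding \<chi>_def using n
      by (cases "k < n"; cases "k = n") (auto simp: coeff_char_poly_companion char_poly_degree[OF companion_carrier]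
        coeff_pCons split: nat.splits)
  qed
  let ?bad = "\<Union>b\<in>{b. poly ?q b = 0}. {s. to_ac s = - poly (map_poly to_ac (\<chi> 0)) b}"
  have "finite ?bad"
  proof (rule finite_UN_I)
    show "finite {b. poly ?q b = 0}" by (rule poly_roots_finite[OF q'])
    fix b show "finite {s. to_ac s = - poly (map_poly to_ac (\<chi> 0)) b}"
      by (rule finite_subset[of _ "{Hilbert_Choice.inv to_ac (- poly (map_poly to_ac (\<chi> 0)) b)}"])
        (auto simp: inv_f_f[OF inj_to_ac] dest!: arg_cong[where f = "Hilbert_Choice.inv to_ac"])
  qed
  moreover have "infinite (UNIV :: 'k set)" by (rule infinite_UNIV_char_0)
  ultimately obtain s where s: "s \<notin> ?bad" using ex_new_if_finite by blast
  have "det (pmev q (companion n (c(n := s)))) \<noteq> 0"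
  proof
    let ?C = "companion n (c(n := s))"
    assume "det (pmev q ?C) = 0"
    then have "det (map_mat to_ac (pmev q ?C)) = 0" by simp
    then have "det (pmev ?q (map_mat to_ac ?C)) = 0"
      by (simp add: hom_pmev[OF to_ac_hom companion_carrier])
    then obtain b where b: "poly ?q b = 0" "poly (char_poly (map_mat to_ac ?C)) b = 0"
      using det_pmev_eq_0[OF _ q', of "map_mat to_ac ?C" n] by auto
    have "char_poly (map_mat to_ac ?C) = map_poly to_ac (\<chi> s)"
      by (simp add: \<chi>_def ac.char_poly_hom[OF companion_carrier])
    also have "\<dots> = map_poly to_ac (\<chi> 0) + [:to_ac s:]"
      by (subst \<chi>) (rule poly_eqI, simp add: coeff_pCons split: nat.splits)
    finally have "poly (map_poly to_ac (\<chi> 0)) b + to_ac s = 0" using b(2) by simp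
    then show False using s b(1) by (auto simp: add_eq_0_iff)
  qed
  then show ?thesis using that by blast
qed

text \<open>Commutation with \<open>C\<close> will be tested with the invertible matrix \<open>C - e\<close> in place of \<open>C\<close>, since
  only invertible matrices act by conjugation.\<close>

lemma companion_commuting_unit:
  fixes C :: "'k::field_char_0 mat"
  assumes C: "C \<in> carrier_mat n n"
  obtains e where "det (char_matrix C e) \<noteq> 0"
proof -
  have "char_poly C \<noteq> 0" using degree_monic_char_poly[OF C] by auto
  then have "finite {e. poly (char_poly C) e = 0}" by (rule poly_roots_finite)
  then obtain e where "poly (char_poly C) e \<noteq> 0"
    using ex_new_if_finite[OF infinite_UNIV_char_0] by blast
  then show ?thesis using that eigenvalue_det[OF C] eigenvalue_root_char_poly[OF C] by blast
qed

section \<open>Normal forms of tuples\<close>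

context generic_size
begin

lemma Yt_slice_companion: "Yt (slice (companion n c)) = companion n c"
  by (rule Yt_slice) (use companion_entry_10[OF n2] in auto)

lemma Yt_slice_companion_nz: "Yt (slice (companion n (c :: nat \<Rightarrow> 'a::field))) \<noteq> 0\<^sub>m n n"
proof
  assume "Yt (slice (companion n c)) = 0\<^sub>m n n"
  then have "companion n c $$ (1, 0) = 0" using n2 by (simp add: Yt_slice_companion)
  then show False using companion_entry_10[OF n2, of c] by simp
qed

text \<open>Conjugation takes \<open>Y\<close> to its companion matrix, which is also the value of \<open>Y\<close> at a point of the slice; so
  \<open>Yt_transitive\<close> applies with the factor 1.\<close>

lemma normal_form:
  fixes A :: "nat \<Rightarrow> 'a::field mat"
  assumes A: "tuple A" and d: "det (krylov n (Yt A)) \<noteq> 0"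
  obtains P Q s where "P \<in> carrier_mat n n" "Q \<in> carrier_mat n n" "P * Q = 1\<^sub>m n" "Q * P = 1\<^sub>m n"
    "P * Yt A * Q = companion n (cc n (Yt A))" "s \<in> carrier_mat m m" "det s = 1"
    "\<And>r. r < m \<Longrightarrow> conj_tuple P Q A r = gact s (slice (companion n (cc n (Yt A)))) r"
proof -
  obtain P Q where PQ: "P \<in> carrier_mat n n" "Q \<in> carrier_mat n n" "P * Q = 1\<^sub>m n" "Q * P = 1\<^sub>m n"
    and C: "P * Yt A * Q = companion n (cc n (Yt A))"
    using krylov_conj[OF Yt_carrier n0 d] by blast
  let ?X = "slice (companion n (cc n (Yt A)))"
  have "Yt (conj_tuple P Q A) = 1 \<cdot>\<^sub>m Yt ?X"
    unfolding Yt_conj[OF A PQ] C Yt_slice_companion by (rule eq_matI) (auto simp: companion_def)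
  then obtain s where "s \<in> carrier_mat m m" "det s = 1" "\<And>r. r < m \<Longrightarrow> conj_tuple P Q A r = gact s ?X r"
    using Yt_transitive[of ?X "conj_tuple P Q A" 1] A PQ Yt_slice_companion_nz by auto
  then show ?thesis using that PQ C by blast
qed

text \<open>The conjugated point of the slice has the same \<open>Y\<close>, namely \<open>C\<close>, as the point itself.\<close>

lemma slice_centralizer:
  fixes c :: "nat \<Rightarrow> 'a::field"
  assumes gh: "g \<in> carrier_mat n n" "h \<in> carrier_mat n n" "g * h = 1\<^sub>m n" "h * g = 1\<^sub>m n"
    and comm: "g * companion n c = companion n c * g"
  obtains s where "s \<in> carrier_mat m m" "det s = 1"
    "\<And>r. r < m \<Longrightarrow> conj_tuple g h (slice (companion n c)) r = gact s (slice (companion n c)) r"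
proof -
  let ?X = "slice (companion n c)"
  have "Yt (conj_tuple g h ?X) = companion n c * g * h"
    unfolding Yt_conj[OF slice_tuple(1) gh] Yt_slice_companion comm by (rule refl)
  also have "\<dots> = companion n c * (g * h)" by (rule mat_assoc[of _ n]) (use gh in auto)
  also have "\<dots> = 1 \<cdot>\<^sub>m Yt ?X" unfolding gh Yt_slice_companion by (rule eq_matI) (auto simp: companion_def)
  finally show ?thesis
    using Yt_transitive[of ?X "conj_tuple g h ?X" 1] gh Yt_slice_companion_nz that by auto
qed

end

section \<open>Polarization\<close>

lemma sum_PiE_insert:
  assumes r: "r \<notin> V"
  shows "(\<Sum>a\<in>insert r V \<rightarrow>\<^sub>E S. F a) = (\<Sum>a\<in>V \<rightarrow>\<^sub>E S. \<Sum>v\<in>S. F (a(r := v)))"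
proof -
  have "(\<Sum>a\<in>insert r V \<rightarrow>\<^sub>E S. F a) = (\<Sum>a\<in>(\<lambda>(v, a). a(r := v)) ` (S \<times> (V \<rightarrow>\<^sub>E S)). F a)"
    by (simp add: PiE_insert_eq)
  also have "\<dots> = (\<Sum>(v, a)\<in>S \<times> (V \<rightarrow>\<^sub>E S). F (a(r := v)))"
    by (subst sum.reindex) (use inj_combinator[OF r, of "\<lambda>_. S"] in \<open>auto intro!: sum.cong simp: case_prod_unfold\<close>)
  also have "\<dots> = (\<Sum>v\<in>S. \<Sum>a\<in>V \<rightarrow>\<^sub>E S. F (a(r := v)))"
    by (rule sum.cartesian_product[symmetric])
  also have "\<dots> = (\<Sum>a\<in>V \<rightarrow>\<^sub>E S. \<Sum>v\<in>S. F (a(r := v)))"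
    by (rule sum.swap)
  finally show ?thesis .
qed

lemma sum_Pow_alternating:
  assumes "finite W"
  shows "(\<Sum>U\<in>Pow W. (- 1) ^ card U) = (if W = {} then 1 else (0 :: 'a::comm_ring_1))"
  using assms
proof (induction W rule: finite_induct)
  case (insert v W)
  have "(\<Sum>U\<in>Pow (insert v W). (- 1) ^ card U) =
      (\<Sum>U\<in>Pow W. (- 1) ^ card U) + (\<Sum>U\<in>insert v ` Pow W. (- 1) ^ card U :: 'a)"
    unfolding Pow_insert by (rule sum.union_disjoint) (use insert in auto)
  also have "(\<Sum>U\<in>insert v ` Pow W. (- 1) ^ card U :: 'a) = (\<Sum>U\<in>Pow W. (- 1) ^ card (insert v U))"
    by (rule sum.reindex_cong[OF _ refl refl]) (use insert in \<open>auto simp: inj_on_def\<close>)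
  also have "\<dots> = (\<Sum>U\<in>Pow W. - ((- 1) ^ card U))"
  proof (rule sum.cong[OF refl])
    fix U assume "U \<in> Pow W"
    then have "v \<notin> U" "finite U" using insert finite_subset by auto
    then show "(- 1) ^ card (insert v U) = - ((- 1 :: 'a) ^ card U)" by simp
  qed
  finally show ?case by (simp add: sum_negf)
qed simp

lemma sum_supersets_alternating:
  assumes "finite V" "T \<subseteq> V"
  shows "(\<Sum>S | T \<subseteq> S \<and> S \<subseteq> V. (- 1) ^ card (V - S)) = (if T = V then 1 else (0 :: 'a::comm_ring_1))"
proof -
  have "(\<Sum>S | T \<subseteq> S \<and> S \<subseteq> V. (- 1) ^ card (V - S)) = (\<Sum>U\<in>Pow (V - T). (- 1) ^ card U :: 'a)"
    by (rule sum.reindex_bij_witness[of _ "\<lambda>U. V - U" "\<lambda>S. V - S"])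
      (use assms in \<open>auto simp: double_diff\<close>)
  moreover have "V - T = {} \<longleftrightarrow> T = V" using assms(2) by blast
  ultimately show ?thesis using sum_Pow_alternating[of "V - T"] assms(1) by simp
qed

text \<open>The permanent as an alternating sum of products of row sums (Ryser's formula).\<close>

lemma permanent_alternating:
  fixes x :: "'i \<Rightarrow> 'i \<Rightarrow> 'a::comm_ring_1"
  assumes V: "finite V"
  shows "(\<Sum>S\<in>Pow V. (- 1) ^ card (V - S) * (\<Prod>r\<in>V. \<Sum>s\<in>S. x s r)) =
    (\<Sum>\<sigma> | \<sigma> permutes V. \<Prod>r\<in>V. x (\<sigma> r) r)"
proof -
  let ?F = "V \<rightarrow>\<^sub>E V"
  have fin: "finite ?F" using V by (intro finite_PiE) auto
  have "(\<Prod>r\<in>V. \<Sum>s\<in>S. x s r) = (\<Sum>f\<in>?F. if f ` V \<subseteq> S then \<Prod>r\<in>V. x (f r) r else 0)" if "S \<in> Pow V" for S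
  proof -
    have "(\<Prod>r\<in>V. \<Sum>s\<in>S. x s r) = (\<Sum>f\<in>V \<rightarrow>\<^sub>E S. \<Prod>r\<in>V. x (f r) r)"
      by (rule prod_sum_PiE) (use V that finite_subset in auto)
    also have "V \<rightarrow>\<^sub>E S = {f \<in> ?F. f ` V \<subseteq> S}" using that by (auto simp: PiE_iff extensional_def)
    also have "(\<Sum>f\<in>{f \<in> ?F. f ` V \<subseteq> S}. \<Prod>r\<in>V. x (f r) r) =
        (\<Sum>f\<in>?F. if f ` V \<subseteq> S then \<Prod>r\<in>V. x (f r) r else 0)"
      by (rule sum.inter_filter[OF fin])
    finally show ?thesis .
  qed
  then have "(\<Sum>S\<in>Pow V. (- 1) ^ card (V - S) * (\<Prod>r\<in>V. \<Sum>s\<in>S. x s r)) =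
    (\<Sum>S\<in>Pow V. \<Sum>f\<in>?F. if f ` V \<subseteq> S then (- 1) ^ card (V - S) * (\<Prod>r\<in>V. x (f r) r) else 0)"
    by (simp add: sum_distrib_left if_distrib cong: if_cong)
  also have "\<dots> = (\<Sum>f\<in>?F. \<Sum>S\<in>Pow V. if f ` V \<subseteq> S then (- 1) ^ card (V - S) * (\<Prod>r\<in>V. x (f r) r) else 0)"
    by (rule sum.swap)
  also have "\<dots> = (\<Sum>f\<in>?F. if f ` V = V then \<Prod>r\<in>V. x (f r) r else 0)"
  proof (rule sum.cong[OF refl])
    fix f assume f: "f \<in> ?F"
    have "(\<Sum>S\<in>Pow V. if f ` V \<subseteq> S then (- 1) ^ card (V - S) * (\<Prod>r\<in>V. x (f r) r) else 0) =
      (\<Sum>S | f ` V \<subseteq> S \<and> S \<subseteq> V. (- 1) ^ card (V - S) * (\<Prod>r\<in>V. x (f r) r))"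
      by (subst sum.inter_filter [symmetric]) (use V in \<open>auto intro: sum.cong\<close>)
    also have "\<dots> = (\<Sum>S | f ` V \<subseteq> S \<and> S \<subseteq> V. (- 1) ^ card (V - S)) * (\<Prod>r\<in>V. x (f r) r)"
      by (rule sum_distrib_right[symmetric])
    also have "(\<Sum>S | f ` V \<subseteq> S \<and> S \<subseteq> V. (- 1) ^ card (V - S)) = (if f ` V = V then 1 else (0 :: 'a))"
      by (rule sum_supersets_alternating[OF V]) (use f in auto)
    finally show "(\<Sum>S\<in>Pow V. if f ` V \<subseteq> S then (- 1) ^ card (V - S) * (\<Prod>r\<in>V. x (f r) r) else 0) =
      (if f ` V = V then \<Prod>r\<in>V. x (f r) r else 0)" by simp
  qed
  also have "\<dots> = (\<Sum>f\<in>{f \<in> ?F. f ` V = V}. \<Prod>r\<in>V. x (f r) r)"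
    by (rule sum.inter_filter[OF fin, symmetric])
  also have "\<dots> = (\<Sum>\<sigma> | \<sigma> permutes V. \<Prod>r\<in>V. x (\<sigma> r) r)"
  proof (rule sum.reindex_bij_witness[of _ "\<lambda>\<sigma>. restrict \<sigma> V" "\<lambda>f r. if r \<in> V then f r else r"], goal_cases)
    case (1 f)
    then show ?case by (auto simp: PiE_iff extensional_def)
  next
    case (2 f)
    then have "bij_betw f V V" using V by (auto simp: bij_betw_def intro: eq_card_imp_inj_on)
    then have "bij_betw (\<lambda>r. if r \<in> V then f r else r) V V" by (rule bij_betw_cong[THEN iffD1, rotated]) simp
    then show ?case by (auto intro: bij_imp_permutes)
  next
    case (3 \<sigma>)
    then show ?case by (auto simp: permutes_def)
  next
    case (4 \<sigma>)
    then show ?case using permutes_image[of \<sigma> V] permutes_in_image[of \<sigma> V] by auto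
  next
    case (5 f)
    then show ?case by simp
  qed
  finally show ?thesis .
qed

section \<open>The discriminant as a combination of trace monomials\<close>

context
  fixes n :: nat
begin

abbreviation "pos \<equiv> {..<n\<^sup>2}"
abbreviation "idx \<equiv> pos \<rightarrow>\<^sub>E {..<n}"

lemma finite_idx [simp]: "finite idx"
  by (intro finite_PiE) auto

lemma idx_less: "a \<in> idx \<Longrightarrow> r < n\<^sup>2 \<Longrightarrow> a r < n"
  by (auto simp: PiE_iff)

lemma idx_comp: "a \<in> idx \<Longrightarrow> \<sigma> permutes pos \<Longrightarrow> a \<circ> \<sigma> \<in> idx"
  using permutes_in_image[of \<sigma> pos] by (auto simp: PiE_iff extensional_def)

text \<open>The discriminants of tuples of matrix units; these are the matrix entries of an operator on the
  tensor power with \<open>n\<^sup>2\<close> factors.\<close>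

definition unit_disc :: "(nat \<Rightarrow> nat) \<Rightarrow> (nat \<Rightarrow> nat) \<Rightarrow> 'a::comm_ring_1"
  where "unit_disc a b = discriminant n (\<lambda>r. mat_unit n (a r) (b r))"

text \<open>Choosing the entry at \<open>(a r, b r)\<close> in each column \<open>r\<close> amounts to multiplying the matrix of the
  discriminant by a matrix with determinant \<open>unit_disc a b\<close>.\<close>

lemma det_select_entries:
  fixes A :: "nat \<Rightarrow> 'a::comm_ring_1 mat"
  assumes a: "a \<in> idx" and b: "b \<in> idx"
  shows "det (mat (n\<^sup>2) (n\<^sup>2) (\<lambda>(s, r). A s $$ (a r, b r))) = discriminant n A * unit_disc a b"
proof -
  let ?U = "disc_mat n (\<lambda>r. mat_unit n (a r) (b r)) :: 'a mat"
  have "mat (n\<^sup>2) (n\<^sup>2) (\<lambda>(s, r). A s $$ (a r, b r)) = disc_mat n A * ?U\<^sup>T"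
  proof (rule eq_matI, goal_cases)
    case (1 s r)
    then have sr: "s < n\<^sup>2" "r < n\<^sup>2" by auto
    have ab: "a r < n" "b r < n" using idx_less[OF a] idx_less[OF b] sr by auto
    have "(disc_mat n A * ?U\<^sup>T) $$ (s, r) = (\<Sum>q<n\<^sup>2. disc_mat n A $$ (s, q) * ?U\<^sup>T $$ (q, r))"
      by (rule mult_entry) (use sr in auto)
    also have "\<dots> = (\<Sum>i<n. \<Sum>j<n. if j = b r then (if i = a r then A s $$ (i, j) else 0) else 0)"
      by (rule sum_index_cong) (use sr index_decode in \<open>auto simp: disc_mat_def mat_unit_def\<close>)
    also have "\<dots> = A s $$ (a r, b r)" using ab by simp
    finally show ?case using sr by simp
  qed (auto simp: disc_mat_def)
  then show ?thesis
    by (simp add: det_mult[of _ "n\<^sup>2"] det_transpose[of _ "n\<^sup>2"] discriminant_det unit_disc_def)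
qed

text \<open>The left side is the Leibniz expansion of the determinant of the selected entries.\<close>

lemma antisymmetrized_entries:
  fixes A :: "nat \<Rightarrow> 'a::comm_ring_1 mat"
  assumes a: "a \<in> idx" and b: "b \<in> idx"
  shows "(\<Sum>\<tau> | \<tau> permutes pos. signof \<tau> * (\<Prod>r<n\<^sup>2. A (\<tau> r) $$ (a r, b r))) =
    discriminant n A * unit_disc a b"
proof -
  let ?M = "mat (n\<^sup>2) (n\<^sup>2) (\<lambda>(s, r). A s $$ (a r, b r))"
  have "discriminant n A * unit_disc a b = det ?M\<^sup>T"
    using det_select_entries[OF a b, of A] det_transpose[of ?M "n\<^sup>2"] by simp
  also have "\<dots> = (\<Sum>\<tau> | \<tau> permutes pos. signof \<tau> * (\<Prod>r<n\<^sup>2. ?M\<^sup>T $$ (r, \<tau> r)))"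
    using det_def'[of "?M\<^sup>T" "n\<^sup>2"] by (simp add: atLeast0LessThan)
  also have "\<dots> = (\<Sum>\<tau> | \<tau> permutes pos. signof \<tau> * (\<Prod>r<n\<^sup>2. A (\<tau> r) $$ (a r, b r)))"
  proof (intro sum.cong refl arg_cong2[of _ _ _ _ "(*)"] prod.cong)
    fix \<tau> r assume "\<tau> \<in> {\<tau>. \<tau> permutes pos}" "r \<in> pos"
    then show "?M\<^sup>T $$ (r, \<tau> r) = A (\<tau> r) $$ (a r, b r)"
      using permutes_in_image[of \<tau> "pos" r] by simp
  qed
  finally show ?thesis by simp
qed

lemma discriminant_expand:
  "discriminant n A = (\<Sum>p | p permutes pos. signof p * (\<Prod>r<n\<^sup>2. A r $$ (p r div n, p r mod n)))"
proof -
  have "discriminant n A = (\<Sum>p | p permutes {0..<n\<^sup>2}. signof p * (\<Prod>r=0..<n\<^sup>2. disc_mat n A $$ (r, p r)))"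
    unfolding discriminant_det by (rule det_def'[OF disc_mat_carrier])
  also have "\<dots> = (\<Sum>p | p permutes pos. signof p * (\<Prod>r<n\<^sup>2. A r $$ (p r div n, p r mod n)))"
    unfolding atLeast0LessThan
  proof (rule sum.cong[OF refl])
    fix p assume "p \<in> {p. p permutes pos}"
    then show "signof p * (\<Prod>r<n\<^sup>2. disc_mat n A $$ (r, p r)) =
        signof p * (\<Prod>r<n\<^sup>2. A r $$ (p r div n, p r mod n))"
      using permutes_in_image[of p pos] by (simp add: disc_mat_def)
  qed
  finally show ?thesis .
qed

lemma discriminant_multilinear:
  fixes F :: "nat \<Rightarrow> nat \<Rightarrow> 'a::comm_ring_1 mat"
  shows "(\<Sum>b\<in>idx. discriminant n (\<lambda>r. F r (b r)) * (\<Prod>r<n\<^sup>2. w r (b r))) =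
    discriminant n (\<lambda>r. mat n n (\<lambda>ij. \<Sum>b<n. w r b * F r b $$ ij))"
proof -
  have "(\<Sum>b\<in>idx. discriminant n (\<lambda>r. F r (b r)) * (\<Prod>r<n\<^sup>2. w r (b r))) =
    (\<Sum>b\<in>idx. \<Sum>p | p permutes pos. signof p * (\<Prod>r<n\<^sup>2. w r (b r) * F r (b r) $$ (p r div n, p r mod n)))"
    unfolding discriminant_expand sum_distrib_right
    by (intro sum.cong refl) (simp add: prod.distrib mult_ac)
  also have "\<dots> = (\<Sum>p | p permutes pos. signof p *
      (\<Sum>b\<in>idx. \<Prod>r<n\<^sup>2. w r (b r) * F r (b r) $$ (p r div n, p r mod n)))"
    by (subst sum.swap) (simp add: sum_distrib_left)
  also have "\<dots> = (\<Sum>p | p permutes pos. signof p *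
      (\<Prod>r<n\<^sup>2. mat n n (\<lambda>ij. \<Sum>b<n. w r b * F r b $$ ij) $$ (p r div n, p r mod n)))"
  proof (intro sum.cong refl arg_cong2[of _ _ _ _ "(*)"])
    fix p assume "p \<in> {p. p permutes pos}"
    then have p: "p r < n\<^sup>2" if "r < n\<^sup>2" for r using permutes_in_image[of p pos] that by auto
    have "(\<Sum>b\<in>idx. \<Prod>r<n\<^sup>2. w r (b r) * F r (b r) $$ (p r div n, p r mod n)) =
      (\<Prod>r<n\<^sup>2. \<Sum>b<n. w r b * F r b $$ (p r div n, p r mod n))"
      by (rule prod_sum_PiE[symmetric]) auto
    also have "\<dots> = (\<Prod>r<n\<^sup>2. mat n n (\<lambda>ij. \<Sum>b<n. w r b * F r b $$ ij) $$ (p r div n, p r mod n))"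
      by (rule prod.cong) (use p index_decode in auto)
    finally show "(\<Sum>b\<in>idx. \<Prod>r<n\<^sup>2. w r (b r) * F r (b r) $$ (p r div n, p r mod n)) =
      (\<Prod>r<n\<^sup>2. mat n n (\<lambda>ij. \<Sum>b<n. w r b * F r b $$ ij) $$ (p r div n, p r mod n))" .
  qed
  finally show ?thesis by (simp only: discriminant_expand)
qed

text \<open>Read \<open>unit_disc\<close> as an operator on the tensor power. It commutes with the diagonal action of
  every matrix, since left and right multiplication by a matrix have the same determinant.\<close>

lemma unit_disc_diagonal:
  fixes A :: "'a::comm_ring_1 mat"
  assumes A: "A \<in> carrier_mat n n" and a: "a \<in> idx" and c: "c \<in> idx"
  shows "(\<Sum>b\<in>idx. unit_disc a b * (\<Prod>r<n\<^sup>2. A $$ (b r, c r))) =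
    (\<Sum>d\<in>idx. unit_disc d c * (\<Prod>r<n\<^sup>2. A $$ (a r, d r)))"
proof -
  let ?e = "\<lambda>r. mat_unit n (a r) (c r) :: 'a mat"
  have AT: "A\<^sup>T \<in> carrier_mat n n" using A by simp
  have "(\<Sum>b\<in>idx. unit_disc a b * (\<Prod>r<n\<^sup>2. A $$ (b r, c r))) =
      discriminant n (\<lambda>r. mat n n (\<lambda>ij. \<Sum>b<n. A $$ (b, c r) * mat_unit n (a r) b $$ ij))"
    unfolding unit_disc_def by (rule discriminant_multilinear)
  also have "\<dots> = discriminant n (\<lambda>r. ?e r * A\<^sup>T)"
  proof (rule discriminant_cong)
    fix r i j assume r: "r < n\<^sup>2" and ij: "i < n" "j < n"
    have ac: "a r < n" "c r < n" using idx_less a c r by auto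
    have "(?e r * A\<^sup>T) $$ (i, j) = (\<Sum>k<n. ?e r $$ (i, k) * A\<^sup>T $$ (k, j))"
      by (rule mult_entry[OF mat_unit_carrier AT ij])
    also have "\<dots> = (\<Sum>k<n. if k = c r then (if i = a r then A $$ (j, k) else 0) else 0)"
      by (rule sum.cong) (use A ij in \<open>auto simp: mat_unit_def\<close>)
    also have "\<dots> = (\<Sum>b<n. if b = j then (if i = a r then A $$ (b, c r) else 0) else 0)"
      using ac ij by simp
    also have "\<dots> = (\<Sum>b<n. A $$ (b, c r) * mat_unit n (a r) b $$ (i, j))"
      by (rule sum.cong) (use ij in \<open>auto simp: mat_unit_def\<close>)
    finally show "mat n n (\<lambda>ij. \<Sum>b<n. A $$ (b, c r) * mat_unit n (a r) b $$ ij) $$ (i, j) = (?e r * A\<^sup>T) $$ (i, j)"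
      using ij by simp
  qed
  also have "\<dots> = discriminant n ?e * det (right_mult_mat n A\<^sup>T)"
    by (rule discriminant_right_mult) (use AT in auto)
  also have "\<dots> = discriminant n (\<lambda>r. A\<^sup>T * ?e r)"
    unfolding det_left_mult_mat[OF AT, symmetric]
    by (rule discriminant_left_mult[symmetric]) (use AT in auto)
  also have "\<dots> = discriminant n (\<lambda>r. mat n n (\<lambda>ij. \<Sum>d<n. A $$ (a r, d) * mat_unit n d (c r) $$ ij))"
  proof (rule discriminant_cong)
    fix r i j assume r: "r < n\<^sup>2" and ij: "i < n" "j < n"
    have ac: "a r < n" "c r < n" using idx_less a c r by auto
    have "(A\<^sup>T * ?e r) $$ (i, j) = (\<Sum>k<n. A\<^sup>T $$ (i, k) * ?e r $$ (k, j))"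
      by (rule mult_entry[OF AT mat_unit_carrier ij])
    also have "\<dots> = (\<Sum>k<n. if k = a r then (if j = c r then A $$ (k, i) else 0) else 0)"
      by (rule sum.cong) (use A ij in \<open>auto simp: mat_unit_def\<close>)
    also have "\<dots> = (\<Sum>d<n. if d = i then (if j = c r then A $$ (a r, d) else 0) else 0)"
      using ac ij by simp
    also have "\<dots> = (\<Sum>d<n. A $$ (a r, d) * mat_unit n d (c r) $$ (i, j))"
      by (rule sum.cong) (use ij in \<open>auto simp: mat_unit_def\<close>)
    finally show "(A\<^sup>T * ?e r) $$ (i, j) = mat n n (\<lambda>ij. \<Sum>d<n. A $$ (a r, d) * mat_unit n d (c r) $$ ij) $$ (i, j)"
      using ij by simp
  qed
  also have "\<dots> = (\<Sum>d\<in>idx. unit_disc d c * (\<Prod>r<n\<^sup>2. A $$ (a r, d r)))"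
    unfolding unit_disc_def by (rule discriminant_multilinear[symmetric])
  finally show ?thesis .
qed

text \<open>Polarizing, it commutes with all symmetrized products of matrix units.\<close>

lemma unit_disc_polarized:
  assumes a: "a \<in> idx" and b: "b \<in> idx" and c: "c \<in> idx" and d: "d \<in> idx"
  shows "(\<Sum>\<sigma> | \<sigma> permutes pos \<and> d \<circ> \<sigma> = c. unit_disc a (b \<circ> \<sigma>)) =
    (\<Sum>\<sigma> | \<sigma> permutes pos \<and> b \<circ> \<sigma> = a. unit_disc (d \<circ> \<sigma>) c :: 'a::comm_ring_1)"
proof -
  define A where "A S = mat n n (\<lambda>(i, j). \<Sum>s\<in>S. if i = b s \<and> j = d s then 1 else (0 :: 'a))" for S
  have finP: "finite {\<sigma>. \<sigma> permutes pos}" by (rule finite_permutations) simp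
  have filt: "(\<Sum>\<sigma> | \<sigma> permutes pos \<and> R \<sigma>. g \<sigma>) = (\<Sum>\<sigma> | \<sigma> permutes pos. if R \<sigma> then g \<sigma> else (0 :: 'a))"
    for R and g :: "(nat \<Rightarrow> nat) \<Rightarrow> 'a"
    using sum.inter_filter[OF finP, of g R] by (simp only: mem_Collect_eq)
  have ext: "f = g" if "f \<in> idx" "g \<in> idx" "\<And>r. r < n\<^sup>2 \<Longrightarrow> f r = g r" for f g
    by (rule PiE_ext[OF that(1,2)]) (use that(3) in auto)
  have eqs: "(\<Prod>r<n\<^sup>2. if f r = g r \<and> f' r = g' r then 1 else 0) = (if f = g \<and> f' = g' then 1 else (0 :: 'a))"
    if "f \<in> idx" "g \<in> idx" "f' \<in> idx" "g' \<in> idx" for f g f' g'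
  proof (cases "f = g \<and> f' = g'")
    case False
    have "\<exists>r<n\<^sup>2. \<not> (f r = g r \<and> f' r = g' r)"
      by (rule ccontr) (use False ext[OF that(1,2)] ext[OF that(3,4)] in blast)
    then obtain r where "r < n\<^sup>2" "\<not> (f r = g r \<and> f' r = g' r)" by blast
    then have "(\<Prod>r<n\<^sup>2. if f r = g r \<and> f' r = g' r then 1 else 0) = (0 :: 'a)"
      by (intro prod_zero) (auto intro!: bexI[of _ r])
    then show ?thesis using False by simp
  qed simp
  have perm: "(\<Sum>S\<in>Pow pos. (- 1) ^ card (pos - S) * (\<Prod>r<n\<^sup>2. A S $$ (f r, g r))) =
      (\<Sum>\<sigma> | \<sigma> permutes pos. if f = b \<circ> \<sigma> \<and> g = d \<circ> \<sigma> then 1 else 0)"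
    if f: "f \<in> idx" and g: "g \<in> idx" for f g
  proof -
    have "(\<Sum>S\<in>Pow pos. (- 1) ^ card (pos - S) * (\<Prod>r<n\<^sup>2. A S $$ (f r, g r))) =
      (\<Sum>S\<in>Pow pos. (- 1) ^ card (pos - S) * (\<Prod>r<n\<^sup>2. \<Sum>s\<in>S. if f r = b s \<and> g r = d s then 1 else 0))"
      by (intro sum.cong refl arg_cong2[of _ _ _ _ "(*)"] prod.cong) (use idx_less f g in \<open>auto simp: A_def\<close>)
    also have "\<dots> = (\<Sum>\<sigma> | \<sigma> permutes pos. \<Prod>r<n\<^sup>2. if f r = b (\<sigma> r) \<and> g r = d (\<sigma> r) then 1 else 0)"
      by (rule permanent_alternating) simp
    also have "\<dots> = (\<Sum>\<sigma> | \<sigma> permutes pos. if f = b \<circ> \<sigma> \<and> g = d \<circ> \<sigma> then 1 else 0)"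
      by (rule sum.cong[OF refl]) (use eqs[OF f idx_comp[OF b] g idx_comp[OF d]] in auto)
    finally show ?thesis .
  qed
  have "(\<Sum>\<sigma> | \<sigma> permutes pos \<and> d \<circ> \<sigma> = c. unit_disc a (b \<circ> \<sigma>)) =
      (\<Sum>\<sigma> | \<sigma> permutes pos. if d \<circ> \<sigma> = c then unit_disc a (b \<circ> \<sigma>) else (0 :: 'a))"
    by (simp only: filt)
  also have "\<dots> = (\<Sum>\<sigma> | \<sigma> permutes pos. \<Sum>f\<in>idx. if f = b \<circ> \<sigma> then
      (if c = d \<circ> \<sigma> then unit_disc a f else 0) else 0)"
    by (rule sum.cong[OF refl]) (use idx_comp[OF b] in auto)
  also have "\<dots> = (\<Sum>f\<in>idx. unit_disc a f * (\<Sum>\<sigma> | \<sigma> permutes pos. if f = b \<circ> \<sigma> \<and> c = d \<circ> \<sigma> then 1 else 0))"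
    unfolding sum_distrib_left by (subst sum.swap) (intro sum.cong refl, auto)
  also have "\<dots> = (\<Sum>S\<in>Pow pos. (- 1) ^ card (pos - S) * (\<Sum>f\<in>idx. unit_disc a f * (\<Prod>r<n\<^sup>2. A S $$ (f r, c r))))"
  proof -
    have "(\<Sum>f\<in>idx. unit_disc a f * (\<Sum>\<sigma> | \<sigma> permutes pos. if f = b \<circ> \<sigma> \<and> c = d \<circ> \<sigma> then 1 else 0)) =
      (\<Sum>f\<in>idx. \<Sum>S\<in>Pow pos. unit_disc a f * ((- 1) ^ card (pos - S) * (\<Prod>r<n\<^sup>2. A S $$ (f r, c r))))"
      by (rule sum.cong[OF refl]) (simp only: perm[OF _ c, symmetric] sum_distrib_left)
    also have "\<dots> = (\<Sum>S\<in>Pow pos. \<Sum>f\<in>idx. (- 1) ^ card (pos - S) * (unit_disc a f * (\<Prod>r<n\<^sup>2. A S $$ (f r, c r))))"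
      by (subst sum.swap) (simp only: mult.left_commute)
    finally show ?thesis by (simp only: sum_distrib_left)
  qed
  also have "\<dots> = (\<Sum>S\<in>Pow pos. (- 1) ^ card (pos - S) * (\<Sum>f\<in>idx. unit_disc f c * (\<Prod>r<n\<^sup>2. A S $$ (a r, f r))))"
    by (subst unit_disc_diagonal[OF _ a c]) (auto simp: A_def)
  also have "\<dots> = (\<Sum>f\<in>idx. unit_disc f c * (\<Sum>\<sigma> | \<sigma> permutes pos. if a = b \<circ> \<sigma> \<and> f = d \<circ> \<sigma> then 1 else 0))"
  proof -
    have "(\<Sum>f\<in>idx. unit_disc f c * (\<Sum>\<sigma> | \<sigma> permutes pos. if a = b \<circ> \<sigma> \<and> f = d \<circ> \<sigma> then 1 else 0)) =
      (\<Sum>f\<in>idx. \<Sum>S\<in>Pow pos. unit_disc f c * ((- 1) ^ card (pos - S) * (\<Prod>r<n\<^sup>2. A S $$ (a r, f r))))"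
      by (rule sum.cong[OF refl]) (simp only: perm[OF a, symmetric] sum_distrib_left)
    also have "\<dots> = (\<Sum>S\<in>Pow pos. \<Sum>f\<in>idx. (- 1) ^ card (pos - S) * (unit_disc f c * (\<Prod>r<n\<^sup>2. A S $$ (a r, f r))))"
      by (subst sum.swap) (simp only: mult.left_commute)
    finally show ?thesis by (simp only: sum_distrib_left)
  qed
  also have "\<dots> = (\<Sum>\<sigma> | \<sigma> permutes pos. \<Sum>f\<in>idx. if f = d \<circ> \<sigma> then
      (if a = b \<circ> \<sigma> then unit_disc f c else 0) else 0)"
    unfolding sum_distrib_left by (subst sum.swap) (intro sum.cong refl, auto)
  also have "\<dots> = (\<Sum>\<sigma> | \<sigma> permutes pos. if b \<circ> \<sigma> = a then unit_disc (d \<circ> \<sigma>) c else (0 :: 'a))"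
    by (rule sum.cong[OF refl]) (use idx_comp[OF d] in auto)
  also have "\<dots> = (\<Sum>\<sigma> | \<sigma> permutes pos \<and> b \<circ> \<sigma> = a. unit_disc (d \<circ> \<sigma>) c)"
    by (simp only: filt)
  finally show ?thesis .
qed

lemma unit_disc_standard: "unit_disc (restrict (\<lambda>r. r div n) pos) (restrict (\<lambda>r. r mod n) pos) = (1 :: 'a::comm_ring_1)"
proof -
  have idx: "q div n = p div n \<and> q mod n = p mod n \<longleftrightarrow> q = p" for p q :: nat
    using div_mod_decomp[of q n] div_mod_decomp[of p n] by metis
  have "disc_mat n (\<lambda>r. mat_unit n (restrict (\<lambda>r. r div n) pos r) (restrict (\<lambda>r. r mod n) pos r)) =
      (1\<^sub>m (n\<^sup>2) :: 'a mat)"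
    by (rule eq_matI) (auto simp: disc_mat_def mat_unit_def index_decode idx)
  then show ?thesis by (simp add: unit_disc_def discriminant_det)
qed

text \<open>The double centralizer theorem in the case that is needed: an operator that commutes with the
  symmetrized operators and is orthogonal to all permutation operators is zero. If \<open>E\<close> denotes
  the operator \<open>unit_disc\<close>, then \<open>h \<sigma>\<close> is the inner product of \<open>E E\<^sup>T\<close> with the permutation \<open>\<sigma>\<close>;
  commutation shows that \<open>\<Sum>\<^sub>\<sigma> h(\<sigma>) \<sigma> = 0\<close>, so \<open>\<Sum>\<^sub>\<sigma> h(\<sigma>)\<^sup>2 = 0\<close> and \<open>h(id)\<close>, the sum of the squares
  of the entries of \<open>E\<close>, vanishes.\<close>

lemma antisymmetrized_trace_nonzero:
  "\<exists>\<sigma>. \<sigma> permutes pos \<and> (\<Sum>a\<in>idx. unit_disc a (a \<circ> \<sigma>) :: int) \<noteq> 0"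
proof (rule ccontr)
  let ?P = "{\<sigma>. \<sigma> permutes pos}"
  let ?E = "unit_disc :: _ \<Rightarrow> _ \<Rightarrow> int"
  have finP: "finite ?P" by (rule finite_permutations) simp
  have filt: "(\<Sum>\<sigma> | \<sigma> permutes pos \<and> R \<sigma>. g \<sigma>) = (\<Sum>\<sigma> | \<sigma> permutes pos. if R \<sigma> then g \<sigma> else (0 :: int))"
    for R and g :: "(nat \<Rightarrow> nat) \<Rightarrow> int"
    using sum.inter_filter[OF finP, of g R] by (simp only: mem_Collect_eq)
  assume "\<not> ?thesis"
  then have zero: "(\<Sum>a\<in>idx. ?E a (a \<circ> \<sigma>)) = 0" if "\<sigma> permutes pos" for \<sigma> using that by blast
  define h where "h \<sigma> = (\<Sum>d\<in>idx. \<Sum>c\<in>idx. ?E (d \<circ> \<sigma>) c * ?E d c)" for \<sigma>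
  have hz: "(\<Sum>\<sigma>\<in>?P. if z \<circ> \<sigma> = a then h \<sigma> else 0) = 0" if a: "a \<in> idx" and z: "z \<in> idx" for a z
  proof -
    have "(\<Sum>\<sigma>\<in>?P. if z \<circ> \<sigma> = a then h \<sigma> else 0) =
      (\<Sum>\<sigma>\<in>?P. \<Sum>d\<in>idx. \<Sum>c\<in>idx. ?E d c * (if z \<circ> \<sigma> = a then ?E (d \<circ> \<sigma>) c else 0))"
      by (intro sum.cong refl) (auto simp: h_def mult.commute)
    also have "\<dots> = (\<Sum>d\<in>idx. \<Sum>c\<in>idx. ?E d c * (\<Sum>\<sigma>\<in>?P. if z \<circ> \<sigma> = a then ?E (d \<circ> \<sigma>) c else 0))"
      unfolding sum_distrib_left by (subst sum.swap, rule sum.cong[OF refl], rule sum.swap)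
    also have "\<dots> = (\<Sum>d\<in>idx. \<Sum>c\<in>idx. ?E d c * (\<Sum>\<sigma>\<in>?P. if d \<circ> \<sigma> = c then ?E a (z \<circ> \<sigma>) else 0))"
    proof (rule sum.cong[OF refl], rule sum.cong[OF refl], rule arg_cong2[of _ _ _ _ "(*)"], rule refl)
      fix d c assume dc: "d \<in> idx" "c \<in> idx"
      have "(\<Sum>\<sigma>\<in>?P. if z \<circ> \<sigma> = a then ?E (d \<circ> \<sigma>) c else 0) = (\<Sum>\<sigma> | \<sigma> permutes pos \<and> z \<circ> \<sigma> = a. ?E (d \<circ> \<sigma>) c)"
        by (simp only: filt)
      also have "\<dots> = (\<Sum>\<sigma> | \<sigma> permutes pos \<and> d \<circ> \<sigma> = c. ?E a (z \<circ> \<sigma>))"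
        by (rule unit_disc_polarized[OF a z dc(2,1), symmetric])
      also have "\<dots> = (\<Sum>\<sigma>\<in>?P. if d \<circ> \<sigma> = c then ?E a (z \<circ> \<sigma>) else 0)"
        by (simp only: filt)
      finally show "(\<Sum>\<sigma>\<in>?P. if z \<circ> \<sigma> = a then ?E (d \<circ> \<sigma>) c else 0) =
        (\<Sum>\<sigma>\<in>?P. if d \<circ> \<sigma> = c then ?E a (z \<circ> \<sigma>) else 0)" .
    qed
    also have "\<dots> = (\<Sum>d\<in>idx. \<Sum>\<sigma>\<in>?P. \<Sum>c\<in>idx. if c = d \<circ> \<sigma> then ?E d c * ?E a (z \<circ> \<sigma>) else 0)"
      unfolding sum_distrib_left by (rule sum.cong[OF refl], subst sum.swap) (intro sum.cong refl, auto)
    also have "\<dots> = (\<Sum>d\<in>idx. \<Sum>\<sigma>\<in>?P. ?E d (d \<circ> \<sigma>) * ?E a (z \<circ> \<sigma>))"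
      by (intro sum.cong refl) (use idx_comp in auto)
    also have "\<dots> = (\<Sum>\<sigma>\<in>?P. (\<Sum>d\<in>idx. ?E d (d \<circ> \<sigma>)) * ?E a (z \<circ> \<sigma>))"
      unfolding sum_distrib_right by (rule sum.swap)
    also have "\<dots> = 0" by (rule sum.neutral) (use zero in auto)
    finally show ?thesis .
  qed
  have "(\<Sum>\<sigma>\<in>?P. h \<sigma> * h \<sigma>) = (\<Sum>\<sigma>\<in>?P. \<Sum>d\<in>idx. \<Sum>c\<in>idx. \<Sum>a\<in>idx. if a = d \<circ> \<sigma> then h \<sigma> * (?E a c * ?E d c) else 0)"
    by (rule sum.cong[OF refl], subst (2) h_def) (use idx_comp in \<open>auto simp: sum_distrib_left\<close>)
  also have "\<dots> = (\<Sum>d\<in>idx. \<Sum>c\<in>idx. \<Sum>a\<in>idx. \<Sum>\<sigma>\<in>?P. if a = d \<circ> \<sigma> then h \<sigma> * (?E a c * ?E d c) else 0)"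
    by (subst sum.swap, rule sum.cong[OF refl], subst sum.swap, rule sum.cong[OF refl], rule sum.swap)
  also have "\<dots> = (\<Sum>d\<in>idx. \<Sum>c\<in>idx. \<Sum>a\<in>idx. (?E a c * ?E d c) * (\<Sum>\<sigma>\<in>?P. if d \<circ> \<sigma> = a then h \<sigma> else 0))"
    unfolding sum_distrib_left by (intro sum.cong refl) auto
  also have "\<dots> = 0" using hz by (intro sum.neutral ballI) simp
  finally have "h id * h id = 0"
    using sum_nonneg_0[OF finP, of "\<lambda>\<sigma>. h \<sigma> * h \<sigma>" id] permutes_id[of pos] by simp
  then have "h id = 0" by simp
  then have "(\<Sum>d\<in>idx. \<Sum>c\<in>idx. ?E d c * ?E d c) = 0" by (simp add: h_def)
  then have sq: "(\<Sum>c\<in>idx. ?E d c * ?E d c) = 0" if "d \<in> idx" for d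
    using sum_nonneg_0[OF finite_idx _ _ that, of "\<lambda>d. \<Sum>c\<in>idx. ?E d c * ?E d c"]
    by (simp add: sum_nonneg)
  have E0: "?E d c = 0" if "d \<in> idx" "c \<in> idx" for d c
    using sum_nonneg_0[OF finite_idx _ sq[OF that(1)] that(2)] by simp
  have "?E (restrict (\<lambda>r. r div n) pos) (restrict (\<lambda>r. r mod n) pos) = 0"
    by (rule E0) (use index_decode in auto)
  then show False by (simp add: unit_disc_standard)
qed

lemma unit_disc_of_int:
  "of_int (unit_disc a b) = (unit_disc a b :: 'a::comm_ring_1)"
proof -
  have hom: "comm_ring_hom (of_int :: int \<Rightarrow> 'a)" by unfold_locales simp_all
  have "map_mat of_int (disc_mat n (\<lambda>r. mat_unit n (a r) (b r))) = (disc_mat n (\<lambda>r. mat_unit n (a r) (b r)) :: 'a mat)"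
    by (rule eq_matI) (auto simp: disc_mat_def mat_unit_def index_decode)
  then show ?thesis unfolding unit_disc_def discriminant_det comm_ring_hom.hom_det[OF hom, symmetric] by simp
qed

text \<open>Antisymmetrization of the trace monomial of \<open>\<sigma>\<close> gives an alternating multilinear function, which is a
  multiple of the discriminant; for some \<open>\<sigma>\<close> the factor is not zero.\<close>

lemma discriminant_trace_expansion:
  obtains \<sigma> and z :: int where "\<sigma> permutes pos" "z \<noteq> 0"
    "\<And>A :: nat \<Rightarrow> 'a::comm_ring_1 mat. of_int z * discriminant n A =
      (\<Sum>\<tau> | \<tau> permutes pos. signof \<tau> * (\<Sum>a\<in>idx. \<Prod>r<n\<^sup>2. A (\<tau> r) $$ (a r, a (\<sigma> r))))"
proof -
  obtain \<sigma> where \<sigma>: "\<sigma> permutes pos" and z: "(\<Sum>a\<in>idx. unit_disc a (a \<circ> \<sigma>) :: int) \<noteq> 0"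
    using antisymmetrized_trace_nonzero by blast
  have "of_int (\<Sum>a\<in>idx. unit_disc a (a \<circ> \<sigma>)) * discriminant n A =
      (\<Sum>\<tau> | \<tau> permutes pos. signof \<tau> * (\<Sum>a\<in>idx. \<Prod>r<n\<^sup>2. A (\<tau> r) $$ (a r, a (\<sigma> r))))"
    for A :: "nat \<Rightarrow> 'a mat"
  proof -
    have "of_int (\<Sum>a\<in>idx. unit_disc a (a \<circ> \<sigma>)) * discriminant n A =
        (\<Sum>a\<in>idx. discriminant n A * unit_disc a (a \<circ> \<sigma>))"
      unfolding of_int_sum unit_disc_of_int sum_distrib_right by (simp only: mult.commute)
    also have "\<dots> = (\<Sum>a\<in>idx. \<Sum>\<tau> | \<tau> permutes pos. signof \<tau> * (\<Prod>r<n\<^sup>2. A (\<tau> r) $$ (a r, a (\<sigma> r))))"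
    proof (rule sum.cong[OF refl])
      fix a assume a: "a \<in> idx"
      show "discriminant n A * unit_disc a (a \<circ> \<sigma>) =
        (\<Sum>\<tau> | \<tau> permutes pos. signof \<tau> * (\<Prod>r<n\<^sup>2. A (\<tau> r) $$ (a r, a (\<sigma> r))))"
        using antisymmetrized_entries[OF a idx_comp[OF a \<sigma>], of A] by simp
    qed
    also have "\<dots> = (\<Sum>\<tau> | \<tau> permutes pos. signof \<tau> * (\<Sum>a\<in>idx. \<Prod>r<n\<^sup>2. A (\<tau> r) $$ (a r, a (\<sigma> r))))"
      by (subst sum.swap) (simp add: sum_distrib_left)
    finally show ?thesis .
  qed
  then show ?thesis using that \<sigma> z by blast
qed

end

text \<open>A trace monomial, as a function of one of its arguments, has the form \<open>B \<mapsto> tr (Q B)\<close> with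
  \<open>Q\<close> a product of the other arguments and of traces of products. The induction removes an argument
  by splitting off its trace, if it forms a cycle of its own, or by multiplying it to its
  predecessor in its cycle.\<close>

lemma trace_monomial_representable:
  fixes A :: "nat \<Rightarrow> 'a::comm_ring_1 mat"
  assumes "finite R" "p \<notin> R" "\<sigma> permutes insert p R" "\<And>r. r \<in> R \<Longrightarrow> A r \<in> G"
    and G: "G \<subseteq> carrier_mat n n" "\<And>M M'. M \<in> G \<Longrightarrow> M' \<in> G \<Longrightarrow> M * M' \<in> G"
    and T: "T \<subseteq> carrier_mat n n" "G \<subseteq> T" "1\<^sub>m n \<in> T" "\<And>M M'. M \<in> T \<Longrightarrow> M' \<in> T \<Longrightarrow> M * M' \<in> T"
      "\<And>M M'. M \<in> G \<Longrightarrow> M' \<in> T \<Longrightarrow> mat_tr M \<cdot>\<^sub>m M' \<in> T"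
  shows "\<exists>Q\<in>T. \<forall>B\<in>carrier_mat n n. (\<Sum>a\<in>insert p R \<rightarrow>\<^sub>E {..<n}. \<Prod>r\<in>insert p R.
    (A(p := B)) r $$ (a r, a (\<sigma> r))) = mat_tr (Q * B)"
  using assms(1-4)
proof (induction R arbitrary: \<sigma> A rule: finite_induct)
  case empty
  then have "\<sigma> = id" by simp
  have *: "(\<Sum>a\<in>{p} \<rightarrow>\<^sub>E {..<n}. \<Prod>r\<in>{p}. (A(p := B)) r $$ (a r, a (\<sigma> r))) = mat_tr (1\<^sub>m n * B)"
    if B: "B \<in> carrier_mat n n" for B
  proof -
    have "(\<Sum>a\<in>{p} \<rightarrow>\<^sub>E {..<n}. \<Prod>r\<in>{p}. B $$ (a r, a r)) = (\<Prod>r\<in>{p}. \<Sum>i<n. B $$ (i, i))"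
      by (rule prod_sum_PiE[symmetric]) auto
    then show ?thesis using B left_mult_one_mat[OF B] by (simp add: \<open>\<sigma> = id\<close> mat_tr_def)
  qed
  show ?case by (intro bexI[OF _ T(3)] ballI) (rule *)
next
  case (insert r R)
  let ?V = "insert p R"
  have r: "r \<notin> ?V" and finV: "finite ?V" using insert by auto
  have ins: "insert p (insert r R) = insert r ?V" by auto
  have Ar: "A r \<in> G" "A r \<in> carrier_mat n n" using insert.prems(3)[of r] G(1) by auto
  have pR: "p \<notin> R" using insert.prems(1) by auto
  note sum_split = sum_PiE_insert[OF r, of _ "{..<n}"]
  define \<sigma>' where "\<sigma>' = Transposition.transpose r (\<sigma> r) \<circ> \<sigma>"
  have perm: "\<sigma> permutes insert r ?V" using insert.prems(2) by (simp add: ins)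
  have perm': "\<sigma>' permutes ?V"
  proof -
    have "\<sigma>' permutes insert r ?V"
      unfolding \<sigma>'_def by (rule permutes_compose[OF perm permutes_swap_id])
        (use permutes_in_image[OF perm, of r] in auto)
    moreover have "\<sigma>' r = r" by (simp add: \<sigma>'_def)
    ultimately show ?thesis using r unfolding permutes_def by (metis insertE)
  qed
  have IH: "\<exists>Q\<in>T. \<forall>B\<in>carrier_mat n n. (\<Sum>a\<in>?V \<rightarrow>\<^sub>E {..<n}. \<Prod>x\<in>?V.
      (A'(p := B)) x $$ (a x, a (\<sigma>' x))) = mat_tr (Q * B)" if "\<And>x. x \<in> R \<Longrightarrow> A' x \<in> G" for A'
    by (rule insert.IH[OF pR perm']) (use that in auto)
  show ?case
  proof (cases "\<sigma> r = r")
    case True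
    then have \<sigma>': "\<sigma>' = \<sigma>" by (simp add: \<sigma>'_def)
    obtain Q where Q: "Q \<in> T" "\<And>B. B \<in> carrier_mat n n \<Longrightarrow> (\<Sum>a\<in>?V \<rightarrow>\<^sub>E {..<n}. \<Prod>x\<in>?V.
      (A(p := B)) x $$ (a x, a (\<sigma> x))) = mat_tr (Q * B)"
      using IH[of A] insert.prems(3) unfolding \<sigma>' by auto
    have "(\<Sum>a\<in>insert r ?V \<rightarrow>\<^sub>E {..<n}. \<Prod>x\<in>insert r ?V. (A(p := B)) x $$ (a x, a (\<sigma> x))) =
        mat_tr ((mat_tr (A r) \<cdot>\<^sub>m Q) * B)" if B: "B \<in> carrier_mat n n" for B
    proof -
      have "(\<Sum>v<n. \<Prod>x\<in>insert r ?V. (A(p := B)) x $$ ((a(r := v)) x, (a(r := v)) (\<sigma> x))) =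
          mat_tr (A r) * (\<Prod>x\<in>?V. (A(p := B)) x $$ (a x, a (\<sigma> x)))" for a
      proof -
        have "(\<Prod>x\<in>?V. (A(p := B)) x $$ ((a(r := v)) x, (a(r := v)) (\<sigma> x))) =
            (\<Prod>x\<in>?V. (A(p := B)) x $$ (a x, a (\<sigma> x)))" for v
        proof (rule prod.cong[OF refl])
          fix x assume "x \<in> ?V"
          then have "x \<noteq> r" using r by auto
          moreover from this have "\<sigma> x \<noteq> r" using permutes_inj[OF perm] True by (metis injD)
          ultimately show "(A(p := B)) x $$ ((a(r := v)) x, (a(r := v)) (\<sigma> x)) = (A(p := B)) x $$ (a x, a (\<sigma> x))" by simp
        qed
        then show ?thesis using r finV True Ar(2)
          by (simp add: mat_tr_def sum_distrib_right del: fun_upd_apply) (auto simp: sum_distrib_right)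
      qed
      then have "(\<Sum>a\<in>insert r ?V \<rightarrow>\<^sub>E {..<n}. \<Prod>x\<in>insert r ?V. (A(p := B)) x $$ (a x, a (\<sigma> x))) =
          mat_tr (A r) * mat_tr (Q * B)"
        unfolding sum_split Q(2)[OF B, symmetric] by (simp only: sum_distrib_left)
      also have "\<dots> = mat_tr ((mat_tr (A r) \<cdot>\<^sub>m Q) * B)"
        using Q(1) T(1) B by (subst mult_smult_assoc_mat[of _ n n _ n]) (auto simp: mat_tr_smult[of _ n])
      finally show ?thesis .
    qed
    then show ?thesis unfolding ins using T(5)[OF Ar(1) Q(1)] by blast
  next
    case False
    define t where "t = \<sigma> r"
    define q where "q = Hilbert_Choice.inv \<sigma> r"
    have q: "\<sigma> q = r" by (simp add: q_def permutes_inverses(1)[OF perm])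
    have qr: "q \<noteq> r" using q False by auto
    have qV: "q \<in> ?V" using permutes_in_image[OF perm, of q] q qr by auto
    have tV: "t \<in> ?V" using permutes_in_image[OF perm, of r] False by (auto simp: t_def)
    have \<sigma>'q: "\<sigma>' q = t" using q by (simp add: \<sigma>'_def t_def)
    have \<sigma>'x: "\<sigma>' x = \<sigma> x" "\<sigma> x \<noteq> r" if "x \<in> ?V" "x \<noteq> q" for x
    proof -
      show 1: "\<sigma> x \<noteq> r" using that q permutes_inj[OF perm] by (metis injD)
      have "\<sigma> x \<noteq> t" using that r permutes_inj[OF perm] unfolding t_def by (metis injD)
      then show "\<sigma>' x = \<sigma> x" using 1 by (simp add: \<sigma>'_def t_def transpose_def)
    qed
    have merge: "(\<Sum>a\<in>insert r ?V \<rightarrow>\<^sub>E {..<n}. \<Prod>x\<in>insert r ?V. C x $$ (a x, a (\<sigma> x))) =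
      (\<Sum>a\<in>?V \<rightarrow>\<^sub>E {..<n}. \<Prod>x\<in>?V. (C(q := C q * A r)) x $$ (a x, a (\<sigma>' x)))"
      if Cq: "C q \<in> carrier_mat n n" and Cr: "C r = A r" for C
      unfolding sum_split
    proof (rule sum.cong[OF refl])
      fix a assume a: "a \<in> ?V \<rightarrow>\<^sub>E {..<n}"
      have aq: "a q < n" "a t < n" using a qV tV by (auto simp: PiE_iff)
      let ?W = "\<Prod>x\<in>?V - {q}. C x $$ (a x, a (\<sigma> x))"
      have "(\<Prod>x\<in>insert r ?V. C x $$ ((a(r := v)) x, (a(r := v)) (\<sigma> x))) =
          A r $$ (v, a t) * (C q $$ (a q, v) * ?W)" for v
      proof -
        have "(\<Prod>x\<in>insert r ?V. C x $$ ((a(r := v)) x, (a(r := v)) (\<sigma> x))) =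
            C r $$ (v, a t) * (\<Prod>x\<in>?V. C x $$ ((a(r := v)) x, (a(r := v)) (\<sigma> x)))"
          using r finV False by (subst prod.insert) (auto simp: t_def)
        also have "(\<Prod>x\<in>?V. C x $$ ((a(r := v)) x, (a(r := v)) (\<sigma> x))) =
            C q $$ (a q, v) * (\<Prod>x\<in>?V - {q}. C x $$ ((a(r := v)) x, (a(r := v)) (\<sigma> x)))"
          using qV finV qr q by (subst prod.remove[of _ q]) auto
        also have "(\<Prod>x\<in>?V - {q}. C x $$ ((a(r := v)) x, (a(r := v)) (\<sigma> x))) = ?W"
          using r by (intro prod.cong refl) (auto simp: \<sigma>'x(2))
        finally show ?thesis by (simp add: Cr)
      qed
      then have "(\<Sum>v<n. \<Prod>x\<in>insert r ?V. C x $$ ((a(r := v)) x, (a(r := v)) (\<sigma> x))) =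
          (\<Sum>v<n. C q $$ (a q, v) * A r $$ (v, a t)) * ?W"
        unfolding sum_distrib_right by (intro sum.cong refl) (simp add: mult_ac)
      also have "(\<Sum>v<n. C q $$ (a q, v) * A r $$ (v, a t)) = (C q * A r) $$ (a q, a t)"
        by (rule mult_entry[OF Cq Ar(2) aq, symmetric])
      also have "?W = (\<Prod>x\<in>?V - {q}. (C(q := C q * A r)) x $$ (a x, a (\<sigma>' x)))"
        by (intro prod.cong refl) (auto simp: \<sigma>'x(1))
      also have "(C q * A r) $$ (a q, a t) * \<dots> = (\<Prod>x\<in>?V. (C(q := C q * A r)) x $$ (a x, a (\<sigma>' x)))"
        using prod.remove[OF finV qV, of "\<lambda>x. (C(q := C q * A r)) x $$ (a x, a (\<sigma>' x))"] \<sigma>'q by simp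
      finally show "(\<Sum>v<n. \<Prod>x\<in>insert r ?V. C x $$ ((a(r := v)) x, (a(r := v)) (\<sigma> x))) =
          (\<Prod>x\<in>?V. (C(q := C q * A r)) x $$ (a x, a (\<sigma>' x)))" .
    qed
    have rp: "r \<noteq> p" using r by auto
    show ?thesis
    proof (cases "q = p")
      case True
      obtain Q where Q: "Q \<in> T" "\<And>B. B \<in> carrier_mat n n \<Longrightarrow> (\<Sum>a\<in>?V \<rightarrow>\<^sub>E {..<n}. \<Prod>x\<in>?V.
          (A(p := B)) x $$ (a x, a (\<sigma>' x))) = mat_tr (Q * B)"
        using IH[of A] insert.prems(3) by auto
      have Qc: "Q \<in> carrier_mat n n" using Q(1) T(1) by auto
      have "(\<Sum>a\<in>insert r ?V \<rightarrow>\<^sub>E {..<n}. \<Prod>x\<in>insert r ?V. (A(p := B)) x $$ (a x, a (\<sigma> x))) =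
        mat_tr ((A r * Q) * B)" if B: "B \<in> carrier_mat n n" for B
      proof -
        have BA: "B * A r \<in> carrier_mat n n" using B Ar(2) by simp
        have "(\<Sum>a\<in>insert r ?V \<rightarrow>\<^sub>E {..<n}. \<Prod>x\<in>insert r ?V. (A(p := B)) x $$ (a x, a (\<sigma> x))) =
          mat_tr (Q * (B * A r))"
          using merge[of "A(p := B)"] Q(2)[OF BA] B True rp by simp
        also have "Q * (B * A r) = (Q * B) * A r" using Qc B Ar(2) by (simp add: mat_assoc[where n = n])
        also have "mat_tr \<dots> = mat_tr (A r * (Q * B))" by (rule mat_tr_comm[of _ n]) (use Qc B Ar(2) in auto)
        also have "A r * (Q * B) = (A r * Q) * B" using Qc B Ar(2) by (simp add: mat_assoc[where n = n])
        finally show ?thesis .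
      qed
      then show ?thesis unfolding ins using T(2,4) Ar(1) Q(1) by blast
    next
      case False
      then have "q \<in> R" using qV by auto
      then have Aq: "A q \<in> G" using insert.prems(3) by auto
      then have Aqc: "A q \<in> carrier_mat n n" using G(1) by auto
      let ?A' = "A(q := A q * A r)"
      have A'G: "?A' x \<in> G" if "x \<in> R" for x using insert.prems(3)[of x] that G(2)[OF Aq Ar(1)] by auto
      obtain Q where Q: "Q \<in> T" "\<And>B. B \<in> carrier_mat n n \<Longrightarrow> (\<Sum>a\<in>?V \<rightarrow>\<^sub>E {..<n}. \<Prod>x\<in>?V.
          (?A'(p := B)) x $$ (a x, a (\<sigma>' x))) = mat_tr (Q * B)"
        using IH[of ?A', OF A'G] by blast
      have "(\<Sum>a\<in>insert r ?V \<rightarrow>\<^sub>E {..<n}. \<Prod>x\<in>insert r ?V. (A(p := B)) x $$ (a x, a (\<sigma> x))) = mat_tr (Q * B)"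
        if B: "B \<in> carrier_mat n n" for B
      proof -
        have "(A(p := B))(q := (A(p := B)) q * A r) = ?A'(p := B)" using False by (auto simp: fun_upd_twist)
        then show ?thesis using merge[of "A(p := B)"] Q(2)[OF B] False Aqc rp by simp
      qed
      then show ?thesis unfolding ins using Q(1) by blast
    qed
  qed
qed

section \<open>Subrings of matrix rings\<close>

lemma mat_alg_uminus:
  fixes A :: "'a::comm_ring_1 mat"
  assumes A: "A \<in> carrier_mat n n"
  shows "\<ominus>\<^bsub>mat_alg n\<^esub> A = - A"
proof -
  interpret R: ring "mat_alg n :: 'a mat ring" by (rule ring_mat)
  have "- A + A = 0\<^sub>m n n" by (rule uminus_l_inv_mat[OF A])
  then show ?thesis
    using R.minus_equality[of "- A" A] A by (simp add: ring_mat_simps)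
qed

definition msum :: "nat \<Rightarrow> 'i set \<Rightarrow> ('i \<Rightarrow> 'a::comm_ring_1 mat) \<Rightarrow> 'a mat"
  where "msum n S f = mat n n (\<lambda>ij. \<Sum>t\<in>S. f t $$ ij)"

lemma msum_carrier [simp]: "msum n S f \<in> carrier_mat n n"
  by (simp add: msum_def)

lemma msum_entry: "i < n \<Longrightarrow> j < n \<Longrightarrow> msum n S f $$ (i, j) = (\<Sum>t\<in>S. f t $$ (i, j))"
  by (simp add: msum_def)

lemma mat_tr_msum:
  assumes "\<And>t. t \<in> S \<Longrightarrow> f t \<in> carrier_mat n n" "B \<in> carrier_mat n n"
  shows "mat_tr (msum n S f * B) = (\<Sum>t\<in>S. mat_tr (f t * B))"
proof -
  have "mat_tr (msum n S f * B) = (\<Sum>i<n. \<Sum>j<n. \<Sum>t\<in>S. f t $$ (i, j) * B $$ (j, i))"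
    by (simp add: mat_tr_mult[OF msum_carrier assms(2)] msum_entry sum_distrib_right)
  also have "\<dots> = (\<Sum>t\<in>S. \<Sum>i<n. \<Sum>j<n. f t $$ (i, j) * B $$ (j, i))"
    by (subst sum.swap[of _ S], subst sum.swap[of _ S]) (rule refl)
  also have "\<dots> = (\<Sum>t\<in>S. mat_tr (f t * B))"
    by (rule sum.cong[OF refl]) (simp add: mat_tr_mult[OF assms(1) assms(2)])
  finally show ?thesis .
qed

locale matrix_subring =
  fixes n :: nat and S :: "'a::comm_ring_1 mat set"
  assumes carrier: "S \<subseteq> carrier_mat n n" and one: "1\<^sub>m n \<in> S"
    and add: "\<And>A B. A \<in> S \<Longrightarrow> B \<in> S \<Longrightarrow> A + B \<in> S"
    and mult: "\<And>A B. A \<in> S \<Longrightarrow> B \<in> S \<Longrightarrow> A * B \<in> S"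
    and uminus: "\<And>A. A \<in> S \<Longrightarrow> - A \<in> S"
begin

lemma in_carrier: "A \<in> S \<Longrightarrow> A \<in> carrier_mat n n"
  using carrier by blast

lemma zero: "0\<^sub>m n n \<in> S"
  using add[OF uminus[OF one] one] uminus_l_inv_mat[of "1\<^sub>m n :: 'a mat" n n] by simp

lemma msum: "(\<And>t. t \<in> I \<Longrightarrow> f t \<in> S) \<Longrightarrow> msum n I f \<in> S"
proof (induction I rule: infinite_finite_induct)
  case (insert x I)
  have "msum n (insert x I) f = f x + msum n I f"
    using insert.hyps in_carrier[OF insert.prems[of x]] by (intro eq_matI) (auto simp: msum_def)
  then show ?case using insert by (auto intro: add)
next
  case empty
  have "msum n {} f = 0\<^sub>m n n" by (rule eq_matI) (auto simp: msum_def)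
  then show ?case using zero by simp
next
  case (infinite I)
  then have "msum n I f = 0\<^sub>m n n" by (intro eq_matI) (auto simp: msum_def)
  then show ?case using zero by simp
qed

lemma power: "A \<in> S \<Longrightarrow> A ^\<^sub>m k \<in> S"
proof (induction k)
  case 0
  then have "dim_row A = n" using in_carrier[of A] by auto
  then show ?case by (simp add: one)
qed (auto intro: mult)

lemma pmev:
  assumes A: "A \<in> S" and "\<And>i. Polynomial.coeff q i \<cdot>\<^sub>m 1\<^sub>m n \<in> S"
  shows "pmev q A \<in> S"
  using assms(2)
proof (induction q)
  case (pCons a q)
  have "Polynomial.coeff q i \<cdot>\<^sub>m 1\<^sub>m n \<in> S" for i using pCons.prems[of "Suc i"] by simp
  then have "pmev q A \<in> S" by (rule pCons.IH)
  then show ?case using pCons.prems[of 0] A by (auto simp: pmev_pCons[OF in_carrier[OF A]] intro: add mult)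
qed (simp add: pmev_0[OF in_carrier[OF A]] zero)

lemma smult: "a \<cdot>\<^sub>m 1\<^sub>m n \<in> S \<Longrightarrow> A \<in> S \<Longrightarrow> a \<cdot>\<^sub>m A \<in> S"
  using mult[of "a \<cdot>\<^sub>m 1\<^sub>m n" A] in_carrier[of A] by (simp add: mult_smult_assoc_mat[of _ n n _ n])

end

lemma generate_ring_mat_induct [consumes 2, case_names one incl uminus add mult]:
  fixes Z :: "'a::comm_ring_1 mat"
  assumes "Z \<in> generate_ring (mat_alg n) H" and H: "H \<subseteq> carrier_mat n n"
    and "P (1\<^sub>m n)" "\<And>A. A \<in> H \<Longrightarrow> P A"
    and "\<And>A. A \<in> carrier_mat n n \<Longrightarrow> P A \<Longrightarrow> P (- A)"
    and "\<And>A B. A \<in> carrier_mat n n \<Longrightarrow> B \<in> carrier_mat n n \<Longrightarrow> P A \<Longrightarrow> P B \<Longrightarrow> P (A + B)"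
    and "\<And>A B. A \<in> carrier_mat n n \<Longrightarrow> B \<in> carrier_mat n n \<Longrightarrow> P A \<Longrightarrow> P B \<Longrightarrow> P (A * B)"
  shows "P Z \<and> Z \<in> carrier_mat n n"
  using assms(1)
  by (induction rule: generate_ring.induct)
    (use assms in \<open>auto simp: ring_mat_simps mat_alg_uminus\<close>)

lemma generate_ring_subring:
  fixes H :: "'a::comm_ring_1 mat set"
  assumes H: "H \<subseteq> carrier_mat n n"
  shows "matrix_subring n (generate_ring (mat_alg n) H)"
proof -
  let ?S = "generate_ring (mat_alg n) H"
  have c: "?S \<subseteq> carrier_mat n n"
  proof
    fix Z assume "Z \<in> ?S"
    from generate_ring_mat_induct[OF this H, of "\<lambda>_. True"] show "Z \<in> carrier_mat n n" by simp
  qed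
  show ?thesis
  proof
    show "1\<^sub>m n \<in> ?S" using generate_ring.one[of "mat_alg n" H] by (simp add: ring_mat_simps)
    show "A + B \<in> ?S" if "A \<in> ?S" "B \<in> ?S" for A B
      using generate_ring.eng_add[OF that] by (simp add: ring_mat_simps)
    show "A * B \<in> ?S" if "A \<in> ?S" "B \<in> ?S" for A B
      using generate_ring.eng_mult[OF that] by (simp add: ring_mat_simps)
    show "- A \<in> ?S" if "A \<in> ?S" for A
      using generate_ring.a_inv[OF that] c that by (auto simp: mat_alg_uminus)
  qed (rule c)
qed

lemma generate_ring_least:
  fixes H :: "'a::comm_ring_1 mat set"
  assumes "matrix_subring n S" "H \<subseteq> S"
  shows "generate_ring (mat_alg n) H \<subseteq> S"
proof
  interpret matrix_subring n S by fact
  fix Z assume Z: "Z \<in> generate_ring (mat_alg n) H"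
  have H: "H \<subseteq> carrier_mat n n" using assms(2) carrier by blast
  show "Z \<in> S"
    using generate_ring_mat_induct[OF Z H, of "\<lambda>Z. Z \<in> S"] one add mult uminus assms(2) by blast
qed

section \<open>The trace ring\<close>

text \<open>The span of the products \<open>tr(W\<^sub>1) ... tr(W\<^sub>k) W\<close>.\<close>

inductive_set trace_span :: "nat \<Rightarrow> nat \<Rightarrow> 'k::field_char_0 gpol mat set" for m n
  where
    generic: "W \<in> generic_algebra m n \<Longrightarrow> W \<in> trace_span m n"
  | trace: "W \<in> generic_algebra m n \<Longrightarrow> Z \<in> trace_span m n \<Longrightarrow> mat_tr W \<cdot>\<^sub>m Z \<in> trace_span m n"
  | add: "Z \<in> trace_span m n \<Longrightarrow> Z' \<in> trace_span m n \<Longrightarrow> Z + Z' \<in> trace_span m n"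

context generic_size
begin

lemma mconst_commute: "mconst a \<cdot>\<^sub>m (mconst b \<cdot>\<^sub>m A) = mconst (a * b) \<cdot>\<^sub>m (A :: ('v, 'k::comm_ring_1) mpol mat)"
proof -
  interpret comm_ring_hom "mconst :: 'k \<Rightarrow> ('v, 'k) mpol" by (rule mconst_hom)
  show ?thesis by (rule eq_matI) (auto simp: hom_mult mult.assoc)
qed

lemma generic_mat_carrier [simp]: "generic_mat n h \<in> carrier_mat n n"
  by (simp add: generic_mat_def)

lemma base_scalars_carrier: "base_scalars n \<subseteq> carrier_mat n n"
  by (auto simp: base_scalars_def)

lemma GA_gens: "base_scalars n \<union> generic_mat n ` {..<m} \<subseteq> carrier_mat n n"
  using base_scalars_carrier by auto

sublocale GA: matrix_subring n "generic_algebra m n :: 'k::field_char_0 gpol mat set"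
  unfolding generic_algebra_def by (rule generate_ring_subring[OF GA_gens])

lemma TR_gens: "generic_algebra m n \<union> (\<lambda>Z. mat_tr Z \<cdot>\<^sub>m 1\<^sub>m n) ` generic_algebra m n \<subseteq> carrier_mat n n"
  using GA.carrier by auto

sublocale TR: matrix_subring n "trace_ring m n :: 'k::field_char_0 gpol mat set"
  unfolding trace_ring_def by (rule generate_ring_subring[OF TR_gens])

lemma GA_sub_TR: "generic_algebra m n \<subseteq> trace_ring m n"
  unfolding trace_ring_def by (auto intro: generate_ring.incl)

lemma GA_scalar: "mconst a \<cdot>\<^sub>m 1\<^sub>m n \<in> generic_algebra m n"
  unfolding generic_algebra_def by (auto intro!: generate_ring.incl simp: base_scalars_def)

lemma GA_generic: "r < m \<Longrightarrow> generic_mat n r \<in> generic_algebra m n"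
  unfolding generic_algebra_def by (auto intro: generate_ring.incl)

lemma TR_scalar: "mconst a \<cdot>\<^sub>m 1\<^sub>m n \<in> trace_ring m n"
  using GA_scalar GA_sub_TR by blast

lemma TR_trace_generic: "Z \<in> generic_algebra m n \<Longrightarrow> mat_tr Z \<cdot>\<^sub>m 1\<^sub>m n \<in> trace_ring m n"
  unfolding trace_ring_def by (auto intro: generate_ring.incl)

lemma GA_smult: "Z \<in> generic_algebra m n \<Longrightarrow> mconst a \<cdot>\<^sub>m Z \<in> generic_algebra m n"
  by (rule GA.smult[OF GA_scalar])

lemma TR_smult: "Z \<in> trace_ring m n \<Longrightarrow> mconst a \<cdot>\<^sub>m Z \<in> trace_ring m n"
  by (rule TR.smult[OF TR_scalar])

text \<open>The span is closed under multiplication because traces are scalars.\<close>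

lemma trace_span_eq: "(trace_span m n :: 'k::field_char_0 gpol mat set) = trace_ring m n"
proof
  let ?G = "generic_algebra m n :: 'k gpol mat set" and ?S = "trace_span m n :: 'k gpol mat set"
  show sub: "?S \<subseteq> trace_ring m n"
  proof
    fix Z :: "'k gpol mat" assume "Z \<in> trace_span m n"
    then show "Z \<in> trace_ring m n"
      by (induction rule: trace_span.induct)
        (use GA_sub_TR TR.smult[OF TR_trace_generic] TR.add in blast)+
  qed
  then have Sc: "Z \<in> carrier_mat n n" if "Z \<in> ?S" for Z using that TR.carrier by blast
  have GS: "W * Z \<in> ?S" if W: "W \<in> ?G" and Z: "Z \<in> ?S" for W Z
    using Z
  proof (induction rule: trace_span.induct)
    case (generic V)
    then show ?case using GA.mult[OF W] trace_span.generic by blast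
  next
    case (trace V Z)
    have "W * (mat_tr V \<cdot>\<^sub>m Z) = mat_tr V \<cdot>\<^sub>m (W * Z)"
      by (rule mult_smult_distrib[of _ n n _ n]) (use trace W GA.in_carrier Sc in auto)
    then show ?case using trace_span.trace trace by simp
  next
    case (add Z Z')
    have "W * (Z + Z') = W * Z + W * Z'"
      by (rule mult_add_distrib_mat[of _ n n _ n]) (use add W GA.in_carrier Sc in auto)
    then show ?case using trace_span.add add by simp
  qed
  have SS: "Z * Z' \<in> ?S" if Z: "Z \<in> ?S" and Z': "Z' \<in> ?S" for Z Z'
    using Z
  proof (induction rule: trace_span.induct)
    case (generic V)
    then show ?case using GS Z' by blast
  next
    case (trace V Z)
    have "(mat_tr V \<cdot>\<^sub>m Z) * Z' = mat_tr V \<cdot>\<^sub>m (Z * Z')"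
      by (rule mult_smult_assoc_mat[of _ n n _ n]) (use trace Sc Z' in auto)
    then show ?case using trace_span.trace trace by simp
  next
    case (add Z1 Z2)
    have "(Z1 + Z2) * Z' = Z1 * Z' + Z2 * Z'"
      by (rule add_mult_distrib_mat[of _ n n _ _ n]) (use add Sc Z' in auto)
    then show ?case using trace_span.add add by simp
  qed
  have "matrix_subring n ?S"
  proof
    show "?S \<subseteq> carrier_mat n n" using Sc by blast
    show "1\<^sub>m n \<in> ?S" using GA.one trace_span.generic by blast
    show "- Z \<in> ?S" if "Z \<in> ?S" for Z
    proof -
      have "- Z = - 1\<^sub>m n * Z" 
        using Sc[OF that] uminus_mult_left_mat[of "1\<^sub>m n" Z] by simp
      then show ?thesis using GS[OF GA.uminus[OF GA.one] that] by simp
    qed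
  qed (use trace_span.add SS in blast)+
  moreover have "?G \<union> (\<lambda>Z. mat_tr Z \<cdot>\<^sub>m 1\<^sub>m n) ` ?G \<subseteq> ?S"
    using trace_span.generic trace_span.trace[OF _ trace_span.generic[OF GA.one]] by blast
  ultimately show "trace_ring m n \<subseteq> ?S" unfolding trace_ring_def by (rule generate_ring_least)
qed

lemmas trace_ring_induct [consumes 1, case_names generic trace add] =
  trace_span.induct[of _ m n, unfolded trace_span_eq]

lemma TR_trace:
  fixes Z :: "'k::field_char_0 gpol mat"
  assumes "Z \<in> trace_ring m n"
  shows "mat_tr Z \<cdot>\<^sub>m 1\<^sub>m n \<in> trace_ring m n"
  using assms
proof (induction rule: trace_ring_induct)
  case (trace W Z)
  have "mat_tr (mat_tr W \<cdot>\<^sub>m Z) \<cdot>\<^sub>m 1\<^sub>m n = mat_tr W \<cdot>\<^sub>m (mat_tr Z \<cdot>\<^sub>m 1\<^sub>m n)"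
    by (rule eq_matI) (use TR.in_carrier[OF trace(2)] in \<open>auto simp: mat_tr_smult[of _ n]\<close>)
  then show ?case using TR.smult[OF TR_trace_generic[OF trace(1)] trace(3)] by simp
next
  case (add Z Z')
  have "mat_tr (Z + Z') \<cdot>\<^sub>m 1\<^sub>m n = mat_tr Z \<cdot>\<^sub>m 1\<^sub>m n + mat_tr Z' \<cdot>\<^sub>m (1\<^sub>m n :: 'k gpol mat)"
    by (rule eq_matI) (use TR.in_carrier[OF add(1)] TR.in_carrier[OF add(2)] in \<open>auto simp: mat_tr_add[of _ n]\<close>)
  then show ?case using TR.add add by simp
qed (rule TR_trace_generic)

text \<open>By Newton's identities the trace ring contains the coefficients of the characteristic
  polynomials of its elements.\<close>

lemma TR_char_poly:
  fixes Z :: "'k::field_char_0 gpol mat"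
  assumes Z: "Z \<in> trace_ring m n"
  shows "Polynomial.coeff (char_poly Z) j \<cdot>\<^sub>m 1\<^sub>m n \<in> trace_ring m n"
proof -
  note Zc = TR.in_carrier[OF Z]
  have big: "Polynomial.coeff (char_poly Z) j \<cdot>\<^sub>m 1\<^sub>m n \<in> trace_ring m n" if "j \<ge> n" for j
  proof (cases "j = n")
    case True
    then show ?thesis using char_poly_degree(1)[OF Zc] TR_scalar[of 1] by simp
  next
    case False
    then show ?thesis using char_poly_degree(2)[OF Zc, of j] TR_scalar[of 0] that by simp
  qed
  have "\<forall>i\<ge>j. Polynomial.coeff (char_poly Z) i \<cdot>\<^sub>m 1\<^sub>m n \<in> trace_ring m n" if "j \<le> n" for j
    using that
  proof (induction j rule: inc_induct)
    case (step j)
    let ?c = "Polynomial.coeff (char_poly Z) j"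
    let ?W = "Z * pmev (poly_shift (Suc j) (char_poly Z)) Z"
    have "pmev (poly_shift (Suc j) (char_poly Z)) Z \<in> trace_ring m n"
      by (rule TR.pmev[OF Z]) (use step.IH in \<open>auto simp: coeff_poly_shift\<close>)
    then have W: "?W \<in> trace_ring m n" using Z by (rule TR.mult[rotated])
    have eq: "(of_nat n - of_nat j) * ?c = - mat_tr ?W" by (rule char_poly_coeff_trace[OF Zc n0])
    let ?a = "of_nat n - of_nat j :: 'k"
    interpret mc: comm_ring_hom "mconst :: 'k \<Rightarrow> 'k gpol" by (rule mconst_hom)
    have oc: "(of_nat i :: 'k gpol) = mconst (of_nat i)" for i
      by (induction i) (simp_all add: mc.hom_add)
    have a: "?a \<noteq> 0" using step.hyps by simp
    have "?c = mconst (1 / ?a) * (mconst ?a * ?c)"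
      using a by (simp add: mult.assoc[symmetric] flip: mc.hom_mult)
    also have "mconst ?a * ?c = - mat_tr ?W" using eq by (simp add: oc mc.hom_minus)
    finally have c: "?c = mconst (- (1 / ?a)) * mat_tr ?W" by (simp add: mc.hom_uminus)
    have "?c \<cdot>\<^sub>m 1\<^sub>m n = mconst (- (1 / ?a)) \<cdot>\<^sub>m (mat_tr ?W \<cdot>\<^sub>m 1\<^sub>m n)"
      by (subst c) (rule eq_matI, auto)
    then have "?c \<cdot>\<^sub>m 1\<^sub>m n \<in> trace_ring m n" using TR_smult[OF TR_trace[OF W]] by simp
    then show ?case using step.IH by (metis Suc_leI le_neq_implies_less)
  qed (use big in auto)
  then show ?thesis by (cases "j \<le> n") (use big in auto)
qed

section \<open>Evaluation at tuples of matrices over the ground field\<close>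

definition pt :: "(nat \<Rightarrow> 'k mat) \<Rightarrow> nat \<times> nat \<times> nat \<Rightarrow> 'k"
  where "pt A = (\<lambda>(h, i, j). A h $$ (i, j))"

lemma pt_apply [simp]: "pt A (h, i, j) = A h $$ (i, j)"
  by (simp add: pt_def)

abbreviation evp :: "(nat \<Rightarrow> 'k::field_char_0 mat) \<Rightarrow> 'k gpol \<Rightarrow> 'k"
  where "evp A \<equiv> ev (pt A)"

abbreviation evm :: "(nat \<Rightarrow> 'k::field_char_0 mat) \<Rightarrow> 'k gpol mat \<Rightarrow> 'k mat"
  where "evm A \<equiv> map_mat (evp A)"

definition gvars :: "(nat \<times> nat \<times> nat) set"
  where "gvars = {(h, i, j). h < m \<and> i < n \<and> j < n}"

definition relevant :: "'k::field_char_0 gpol mat \<Rightarrow> bool"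
  where "relevant Z \<longleftrightarrow> Z \<in> carrier_mat n n \<and> (\<forall>i<n. \<forall>j<n. Z $$ (i, j) \<in> mpol_in gvars)"

lemma relevant_subring: "matrix_subring n (Collect relevant :: 'k::field_char_0 gpol mat set)"
proof
  fix A B :: "'k gpol mat" assume "A \<in> Collect relevant" "B \<in> Collect relevant"
  then have AB: "A \<in> carrier_mat n n" "B \<in> carrier_mat n n"
    "\<And>i j. i < n \<Longrightarrow> j < n \<Longrightarrow> A $$ (i, j) \<in> mpol_in gvars"
    "\<And>i j. i < n \<Longrightarrow> j < n \<Longrightarrow> B $$ (i, j) \<in> mpol_in gvars" by (auto simp: relevant_def)
  then show "A + B \<in> Collect relevant" by (auto simp: relevant_def intro: mpol_in_add)
  show "A * B \<in> Collect relevant"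
    using AB by (auto simp: relevant_def mult_entry[OF AB(1,2)] simp del: index_mult_mat(1)
      intro!: mpol_in_sum mpol_in_mult)
  show "- A \<in> Collect relevant"
    using AB(3) carrier_matD[OF AB(1)] AB(1) by (simp add: relevant_def mpol_in_uminus)
qed (auto simp: relevant_def)

lemma TR_relevant:
  fixes Z :: "'k::field_char_0 gpol mat"
  assumes "Z \<in> trace_ring m n"
  shows "relevant Z"
proof -
  have "relevant (mconst a \<cdot>\<^sub>m 1\<^sub>m n :: 'k gpol mat)" for a
    by (auto simp: relevant_def)
  moreover have "relevant (generic_mat n r :: 'k gpol mat)" if "r < m" for r
    using that by (auto simp: relevant_def generic_mat_def gvars_def)
  ultimately have G: "(generic_algebra m n :: 'k gpol mat set) \<subseteq> Collect relevant"
    unfolding generic_algebra_def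
    by (intro generate_ring_least[OF relevant_subring]) (auto simp: base_scalars_def)
  have "relevant (mat_tr W \<cdot>\<^sub>m 1\<^sub>m n)" if "W \<in> generic_algebra m n" for W :: "'k gpol mat"
  proof -
    have "mat_tr W \<in> mpol_in gvars"
      using G GA.in_carrier[OF that] that by (auto simp: mat_tr_def relevant_def intro!: mpol_in_sum)
    then show ?thesis by (auto simp: relevant_def)
  qed
  then have "(trace_ring m n :: 'k gpol mat set) \<subseteq> Collect relevant"
    unfolding trace_ring_def using G by (intro generate_ring_least[OF relevant_subring]) auto
  then show ?thesis using assms by auto
qed

lemma evp_hom: "comm_ring_hom (evp A)"
  by (rule ev_hom)

lemma evp_eq_0:
  fixes p :: "'k::field_char_0 gpol"
  assumes p: "p \<in> mpol_in gvars" and "\<And>A. tuple A \<Longrightarrow> evp A p = 0"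
  shows "p = 0"
proof (rule mpol_eq_0_if_ev_0)
  fix f :: "nat \<times> nat \<times> nat \<Rightarrow> 'k"
  let ?A = "\<lambda>h. mat n n (\<lambda>(i, j). f (h, i, j))"
  have "ev f p = evp ?A p"
    by (rule mpol_eval_cong[OF p id_hom]) (auto simp: gvars_def pt_def)
  also have "\<dots> = 0" by (rule assms(2)) (simp add: tuple_def)
  finally show "ev f p = 0" .
qed

text \<open>Identities may be checked on the complement of a hypersurface.\<close>

lemma evm_eqI:
  fixes Z W :: "'k::field_char_0 gpol mat"
  assumes Z: "relevant Z" and W: "relevant W" and q: "q \<in> mpol_in gvars" "q \<noteq> 0"
    and eq: "\<And>A. tuple A \<Longrightarrow> evp A q \<noteq> 0 \<Longrightarrow> evm A Z = evm A W"
  shows "Z = W"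
proof (rule eq_matI)
  fix i j assume "i < dim_row W" "j < dim_col W"
  then have ij: "i < n" "j < n" using W by (auto simp: relevant_def)
  have "(Z $$ (i, j) - W $$ (i, j)) * q = 0"
  proof (rule evp_eq_0)
    show "(Z $$ (i, j) - W $$ (i, j)) * q \<in> mpol_in gvars"
      unfolding diff_conv_add_uminus
      by (intro mpol_in_mult mpol_in_add mpol_in_uminus q) (use Z W ij in \<open>auto simp: relevant_def\<close>)
    fix A :: "nat \<Rightarrow> 'k mat" assume A: "tuple A"
    interpret e: comm_ring_hom "evp A" by (rule evp_hom)
    show "evp A ((Z $$ (i, j) - W $$ (i, j)) * q) = 0"
    proof (cases "evp A q = 0")
      case False
      then have "evm A Z $$ (i, j) = evm A W $$ (i, j)" using eq[OF A] by simp
      then show ?thesis using Z W ij by (auto simp: relevant_def e.hom_mult e.hom_minus)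
    qed (simp add: e.hom_mult)
  qed
  then show "Z $$ (i, j) = W $$ (i, j)" using q by simp
qed (use Z W in \<open>auto simp: relevant_def\<close>)

lemma evm_carrier [simp]: "Z \<in> carrier_mat n n \<Longrightarrow> evm A Z \<in> carrier_mat n n"
  by simp

lemma evm_mult: "Z \<in> carrier_mat n n \<Longrightarrow> W \<in> carrier_mat n n \<Longrightarrow> evm A (Z * W) = evm A Z * evm A W"
proof -
  interpret e: comm_ring_hom "evp A" by (rule evp_hom)
  show "Z \<in> carrier_mat n n \<Longrightarrow> W \<in> carrier_mat n n \<Longrightarrow> evm A (Z * W) = evm A Z * evm A W"
    by (rule e.mat_hom_mult)
qed

lemma evm_add: "Z \<in> carrier_mat n n \<Longrightarrow> W \<in> carrier_mat n n \<Longrightarrow> evm A (Z + W) = evm A Z + evm A W"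
proof -
  interpret e: comm_ring_hom "evp A" by (rule evp_hom)
  show "Z \<in> carrier_mat n n \<Longrightarrow> W \<in> carrier_mat n n \<Longrightarrow> evm A (Z + W) = evm A Z + evm A W"
    by (rule eq_matI) (auto simp: e.hom_add)
qed

lemma evm_smult: "evm A (p \<cdot>\<^sub>m Z) = evp A p \<cdot>\<^sub>m evm A Z"
proof -
  interpret e: comm_ring_hom "evp A" by (rule evp_hom)
  show ?thesis by (rule eq_matI) (auto simp: e.hom_mult)
qed

lemma evm_uminus: "evm A (- Z) = - evm A Z"
proof -
  interpret e: comm_ring_hom "evp A" by (rule evp_hom)
  show ?thesis by (rule eq_matI) (auto simp: e.hom_uminus)
qed

lemma evm_one: "evm A (1\<^sub>m n) = 1\<^sub>m n"
proof -
  interpret e: comm_ring_hom "evp A" by (rule evp_hom)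
  show ?thesis by (rule eq_matI) auto
qed

lemma evm_generic: "tuple A \<Longrightarrow> r < m \<Longrightarrow> evm A (generic_mat n r) = A r"
  by (rule eq_matI) (auto simp: generic_mat_def pt_def tuple_def)

lemma Y_mat_Yt: "Y_mat m n = Yt (generic_mat n)"
  by (simp add: Y_mat_def Yt_def)

lemma evm_Y: "tuple A \<Longrightarrow> evm A (Y_mat m n) = Yt A"
proof -
  assume A: "tuple A"
  have "evm A (Y_mat m n) = Yt (\<lambda>r. evm A (generic_mat n r))"
    unfolding Y_mat_Yt by (rule hom_Yt[OF evp_hom]) (simp add: tuple_def)
  also have "\<dots> = Yt A" by (rule Yt_cong) (rule evm_generic[OF A])
  finally show ?thesis .
qed

lemma evm_conj:
  fixes Z :: "'k::field_char_0 gpol mat"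
  assumes Z: "Z \<in> trace_ring m n" and A: "tuple A"
    and gh: "g \<in> carrier_mat n n" "h \<in> carrier_mat n n" "g * h = 1\<^sub>m n" "h * g = 1\<^sub>m n"
  shows "evm (conj_tuple g h A) Z = g * evm A Z * h"
proof -
  let ?A = "conj_tuple g h A"
  have A': "tuple ?A" using A gh by simp
  have smult: "(a \<cdot>\<^sub>m (g * B * h)) = g * (a \<cdot>\<^sub>m B) * h" if "B \<in> carrier_mat n n" for a B
    using that gh by (simp add: mult_smult_distrib[of _ n n _ n] mult_smult_assoc_mat[of _ n n _ n])
  have one: "a \<cdot>\<^sub>m 1\<^sub>m n = g * (a \<cdot>\<^sub>m 1\<^sub>m n) * h" for a
    using smult[of "1\<^sub>m n" a] gh right_mult_one_mat[OF gh(1)] by simp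
  have add: "g * B * h + g * C * h = g * (B + C) * h" if "B \<in> carrier_mat n n" "C \<in> carrier_mat n n" for B C
    using that gh by (simp add: mult_add_distrib_mat[of _ n n _ n] add_mult_distrib_mat[of _ n n _ _ n])
  have G: "evm ?A Z = g * evm A Z * h" if "Z \<in> generic_algebra m n" for Z :: "'k gpol mat"
  proof -
    have "evm ?A Z = g * evm A Z * h \<and> Z \<in> carrier_mat n n"
      using that GA_gens unfolding generic_algebra_def
    proof (induction rule: generate_ring_mat_induct)
      case one
      then show ?case using one[of 1] gh right_mult_one_mat[OF gh(1)] by (simp add: evm_one)
    next
      case (incl Z)
      then consider a where "Z = mconst a \<cdot>\<^sub>m 1\<^sub>m n" | r where "r < m" "Z = generic_mat n r"
        by (auto simp: base_scalars_def)
      then show ?case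
      proof cases
        case 1 then show ?thesis using one[of a] by (simp add: evm_smult evm_one)
      next
        case 2
        show ?thesis unfolding 2(2) evm_generic[OF A' 2(1)] evm_generic[OF A 2(1)]
          by (simp add: conj_tuple_def)
      qed
    next
      case (uminus Z)
      have "- B = (- 1) \<cdot>\<^sub>m B" for B :: "'k mat" by (rule eq_matI) auto
      then show ?case using uminus smult[of "evm A Z" "- 1"] by (simp add: evm_uminus)
    next
      case (add Z W)
      then show ?case using \<open>\<And>B C. _ \<Longrightarrow> _ \<Longrightarrow> g * B * h + g * C * h = g * (B + C) * h\<close>[of "evm A Z" "evm A W"]
        by (simp add: evm_add)
    next
      case (mult Z W)
      have hg: "h * (g * M) = M" if "M \<in> carrier_mat n n" for M
        using that gh by (simp flip: mat_assoc[where n = n])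
      have "(g * evm A Z * h) * (g * evm A W * h) = g * (evm A Z * evm A W) * h"
        using gh(1,2) mult by (simp add: mat_assoc[where n = n] hg)
      then show ?case using mult by (simp add: evm_mult)
    qed
    then show ?thesis by simp
  qed
  show ?thesis
    using Z
  proof (induction rule: trace_ring_induct)
    case (generic W) then show ?case by (rule G)
  next
    case (trace W Z)
    note Wc = GA.in_carrier[OF trace(1)]
    have "evp ?A (mat_tr W) = mat_tr (g * evm A W * h)"
      using hom_mat_tr[OF evp_hom Wc] G[OF trace(1)] by metis
    also have "\<dots> = mat_tr (h * (g * evm A W))" by (rule mat_tr_comm[of _ n]) (use gh Wc in auto)
    also have "h * (g * evm A W) = (h * g) * evm A W"
      by (rule mat_assoc[of _ n, symmetric]) (use gh Wc in auto)
    also have "mat_tr \<dots> = evp A (mat_tr W)" using Wc by (simp add: gh hom_mat_tr[OF evp_hom Wc])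
    finally show ?case using trace smult[of "evm A Z" "evp A (mat_tr W)"] TR.in_carrier[OF trace(2)]
      by (simp add: evm_smult)
  next
    case (add Z W)
    then show ?case using TR.in_carrier[OF add(1)] TR.in_carrier[OF add(2)]
        \<open>\<And>B C. _ \<Longrightarrow> _ \<Longrightarrow> g * B * h + g * C * h = g * (B + C) * h\<close>[of "evm A Z" "evm A W"]
      by (simp add: evm_add)
  qed
qed

lemma act_hom: "comm_ring_hom (act m g)"
  unfolding act_def by (rule mpol_eval_hom[OF mconst_hom])

lemma evp_act:
  fixes p :: "'k::field_char_0 gpol"
  assumes p: "p \<in> mpol_in gvars"
  shows "evp A (act m g p) = evp (gact g A) p"
proof -
  interpret e: comm_ring_hom "evp A" by (rule evp_hom)
  have "evp A (act m g p) = mpol_eval (\<lambda>a. evp A (mconst a)) (\<lambda>v. evp A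
    ((\<lambda>(h, a, b). if h < m then (\<Sum>i<m. mconst (g $$ (i, h)) * mvar (i, a, b)) else mvar (h, a, b)) v)) p"
    unfolding act_def by (rule hom_mpol_eval[OF mconst_hom evp_hom])
  also have "\<dots> = evp (gact g A) p"
    unfolding ev_mconst
    by (rule mpol_eval_cong[OF p id_hom])
      (auto simp: gvars_def gact_def e.hom_sum e.hom_mult)
  finally show ?thesis .
qed

lemma evm_act:
  assumes "relevant Z"
  shows "evm A (map_mat (act m g) Z) = evm (gact g A) Z"
  by (rule eq_matI) (use assms in \<open>auto simp: relevant_def evp_act\<close>)

lemma act_relevant:
  assumes p: "p \<in> mpol_in gvars"
  shows "act m g p \<in> mpol_in gvars"
proof -
  interpret a: comm_ring_hom "act m g :: 'a gpol \<Rightarrow> _" by (rule act_hom)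
  show ?thesis
    using p
  proof (induction rule: mpol_induct)
    case (const a)
    then show ?case by (simp add: act_def mpol_eval_mconst[OF mconst_hom])
  next
    case (var v)
    then show ?case
      by (auto simp: gvars_def act_mvar intro!: mpol_in_sum mpol_in_mult)
  qed (simp_all add: a.hom_add a.hom_mult mpol_in_add mpol_in_mult)
qed

section \<open>The matrix \<open>Y\<close> belongs to the trace ring\<close>

text \<open>Both sides of the trace expansion of the discriminant are linear in the last argument. The left
  side is represented by \<open>Y\<close> and the right side by an element of the trace ring.\<close>

lemma Y_in_TR: "Y_mat m n \<in> (trace_ring m n :: 'k::field_char_0 gpol mat set)"
proof -
  let ?T = "trace_ring m n :: 'k gpol mat set"
  let ?P = "{\<tau>. \<tau> permutes {..<n\<^sup>2}}"
  let ?idx = "{..<n\<^sup>2} \<rightarrow>\<^sub>E {..<n}"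
  obtain \<sigma> and z :: int where \<sigma>: "\<sigma> permutes {..<n\<^sup>2}" and z: "z \<noteq> 0"
    and exp: "\<And>A :: nat \<Rightarrow> 'k gpol mat. of_int z * discriminant n A =
      (\<Sum>\<tau>\<in>?P. signof \<tau> * (\<Sum>a\<in>?idx. \<Prod>r<n\<^sup>2. A (\<tau> r) $$ (a r, a (\<sigma> r))))"
    using discriminant_trace_expansion[of n] by blast
  define X' where "X' B r = (if r < m then generic_mat n r else B)" for B :: "'k gpol mat" and r
  have ex: "\<exists>Q\<in>?T. \<forall>B\<in>carrier_mat n n. (\<Sum>a\<in>?idx. \<Prod>r<n\<^sup>2. X' B (\<tau> r) $$ (a r, a (\<sigma> r))) = mat_tr (Q * B)"
    if \<tau>: "\<tau> \<in> ?P" for \<tau>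
  proof -
    have perm: "\<tau> permutes {..<n\<^sup>2}" using \<tau> by simp
    define p where "p = Hilbert_Choice.inv \<tau> m"
    have \<tau>p: "\<tau> p = m" by (simp add: p_def permutes_inverses(1)[OF perm])
    have p: "p \<in> {..<n\<^sup>2}" using permutes_in_image[OF perm, of p] \<tau>p n_sq by simp
    define R where "R = {..<n\<^sup>2} - {p}"
    have ins: "insert p R = {..<n\<^sup>2}" using p by (auto simp: R_def)
    have "\<exists>Q\<in>?T. \<forall>B\<in>carrier_mat n n. (\<Sum>a\<in>insert p R \<rightarrow>\<^sub>E {..<n}. \<Prod>r\<in>insert p R.
      ((\<lambda>r. generic_mat n (\<tau> r))(p := B)) r $$ (a r, a (\<sigma> r))) = mat_tr (Q * B)"
    proof (rule trace_monomial_representable[where G = "generic_algebra m n"])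
      show "\<sigma> permutes insert p R" using \<sigma> ins by simp
      fix r assume r: "r \<in> R"
      then have "\<tau> r < n\<^sup>2" using permutes_in_image[OF perm, of r] by (auto simp: R_def)
      moreover have "\<tau> r \<noteq> m" using r \<tau>p permutes_inj[OF perm] by (auto simp: R_def dest: injD)
      ultimately show "generic_mat n (\<tau> r) \<in> generic_algebra m n" using n_sq by (intro GA_generic) auto
    next
      fix M M' :: "'k gpol mat" assume "M \<in> generic_algebra m n" "M' \<in> ?T"
      then show "mat_tr M \<cdot>\<^sub>m M' \<in> ?T" by (rule TR.smult[OF TR_trace_generic])
    qed (simp_all add: R_def GA.carrier TR.carrier GA.mult TR.mult TR.one GA_sub_TR)
    then obtain Q where Q: "Q \<in> ?T" "\<And>B. B \<in> carrier_mat n n \<Longrightarrow> (\<Sum>a\<in>?idx. \<Prod>r<n\<^sup>2.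
      ((\<lambda>r. generic_mat n (\<tau> r))(p := B)) r $$ (a r, a (\<sigma> r))) = mat_tr (Q * B)"
      unfolding ins by blast
    have eq: "((\<lambda>r. generic_mat n (\<tau> r))(p := B)) r = X' B (\<tau> r)" if "r < n\<^sup>2" for B r
    proof (cases "r = p")
      case False
      then have "\<tau> r \<noteq> m" using \<tau>p permutes_inj[OF perm] by (auto dest: injD)
      moreover have "\<tau> r < n\<^sup>2" using permutes_in_image[OF perm, of r] that by auto
      ultimately show ?thesis using False n_sq by (simp add: X'_def)
    qed (simp add: X'_def \<tau>p)
    have "(\<Sum>a\<in>?idx. \<Prod>r<n\<^sup>2. X' B (\<tau> r) $$ (a r, a (\<sigma> r))) = mat_tr (Q * B)"
      if "B \<in> carrier_mat n n" for B
      unfolding Q(2)[OF that, symmetric] by (intro sum.cong prod.cong refl) (simp only: eq lessThan_iff)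
    then show ?thesis using Q(1) by blast
  qed
  have "\<exists>Q. \<forall>\<tau>\<in>?P. Q \<tau> \<in> ?T \<and> (\<forall>B\<in>carrier_mat n n.
      (\<Sum>a\<in>?idx. \<Prod>r<n\<^sup>2. X' B (\<tau> r) $$ (a r, a (\<sigma> r))) = mat_tr (Q \<tau> * B))"
    by (rule bchoice, rule ballI, rule ex[unfolded Bex_def])
  then obtain Q where Q0: "\<forall>\<tau>\<in>?P. Q \<tau> \<in> ?T \<and> (\<forall>B\<in>carrier_mat n n.
      (\<Sum>a\<in>?idx. \<Prod>r<n\<^sup>2. X' B (\<tau> r) $$ (a r, a (\<sigma> r))) = mat_tr (Q \<tau> * B))"
    by (rule exE)
  have Q: "Q \<tau> \<in> ?T" "B \<in> carrier_mat n n \<Longrightarrow>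
      (\<Sum>a\<in>?idx. \<Prod>r<n\<^sup>2. X' B (\<tau> r) $$ (a r, a (\<sigma> r))) = mat_tr (Q \<tau> * B)"
    if "\<tau> \<in> ?P" for \<tau> B
    using bspec[OF Q0 that] by (rule conjunct1, rule bspec[OF conjunct2])
  have oc: "(of_int i :: 'k gpol) = mconst (of_int i)" for i
  proof -
    interpret mc: comm_ring_hom "mconst :: 'k \<Rightarrow> 'k gpol" by (rule mconst_hom)
    have "(of_nat j :: 'k gpol) = mconst (of_nat j)" for j by (induction j) (simp_all add: mc.hom_add)
    then show ?thesis by (cases i) (simp_all add: mc.hom_uminus mc.hom_minus mc.hom_add)
  qed
  define W where "W = msum n ?P (\<lambda>\<tau>. mconst (of_int (sign \<tau>)) \<cdot>\<^sub>m Q \<tau>)"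
  have W: "W \<in> ?T" unfolding W_def by (rule TR.msum, rule TR_smult, rule Q(1))
  have "mconst (of_int z) \<cdot>\<^sub>m Y_mat m n = W"
  proof (rule mat_eq_if_tr_eq[of _ n])
    fix B :: "'k gpol mat" assume B: "B \<in> carrier_mat n n"
    have "mat_tr (mconst (of_int z) \<cdot>\<^sub>m Y_mat m n * B) = of_int z * discriminant n (X' B)"
      unfolding Y_mat_Yt X'_def tr_Yt[OF B, symmetric] oc
      by (subst mult_smult_assoc_mat[of _ n n _ n]) (use B in \<open>auto simp: mat_tr_smult[of _ n]\<close>)
    also have "\<dots> = (\<Sum>\<tau>\<in>?P. signof \<tau> * mat_tr (Q \<tau> * B))"
      unfolding exp by (rule sum.cong[OF refl]) (simp add: Q(2)[OF _ B])
    also have "\<dots> = (\<Sum>\<tau>\<in>?P. mat_tr ((mconst (of_int (sign \<tau>)) \<cdot>\<^sub>m Q \<tau>) * B))"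
    proof (rule sum.cong[OF refl])
      fix \<tau> assume "\<tau> \<in> ?P"
      then have Qc: "Q \<tau> \<in> carrier_mat n n" by (rule TR.in_carrier[OF Q(1)])
      show "signof \<tau> * mat_tr (Q \<tau> * B) = mat_tr ((mconst (of_int (sign \<tau>)) \<cdot>\<^sub>m Q \<tau>) * B)"
        by (simp only: oc mult_smult_assoc_mat[OF Qc B] mat_tr_smult[OF mult_sq[OF Qc B]])
    qed
    also have "\<dots> = mat_tr (W * B)"
      unfolding W_def
      by (rule mat_tr_msum[symmetric, OF smult_carrier_mat[OF TR.in_carrier[OF Q(1)]] B])
    finally show "mat_tr (mconst (of_int z) \<cdot>\<^sub>m Y_mat m n * B) = mat_tr (W * B)" .
  qed (use W TR.in_carrier in \<open>auto simp: Y_mat_Yt\<close>)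
  then have "mconst (1 / of_int z) \<cdot>\<^sub>m (mconst (of_int z) \<cdot>\<^sub>m Y_mat m n) \<in> ?T" using TR_smult[OF W] by simp
  moreover have "1 \<cdot>\<^sub>m Y_mat m n = (Y_mat m n :: 'k gpol mat)" by (rule eq_matI) auto
  ultimately show ?thesis using z by (simp add: mconst_commute)
qed

end

section \<open>Denominators for the trace ring\<close>

text \<open>The word \<open>y\<^sub>0 x\<^sub>0 y\<^sub>1 x\<^sub>1 ... x\<^sub>k\<^sub>-\<^sub>1 y\<^sub>k\<close>.\<close>

fun cword :: "(nat \<Rightarrow> 'a::comm_ring_1 mat) \<Rightarrow> (nat \<Rightarrow> 'a mat) \<Rightarrow> nat \<Rightarrow> 'a mat"
  where
    "cword y x 0 = y 0"
  | "cword y x (Suc k) = cword y x k * (x k * y (Suc k))"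

lemma cword_cong: "(\<And>r. r < k \<Longrightarrow> x r = x' r) \<Longrightarrow> cword y x k = cword y x' k"
  by (induction k) auto

lemma (in matrix_subring) cword:
  "(\<And>r. r \<le> k \<Longrightarrow> y r \<in> S) \<Longrightarrow> (\<And>r. r < k \<Longrightarrow> x r \<in> S) \<Longrightarrow> cword y x k \<in> S"
  by (induction k) (auto intro: mult)

lemma carrier_subring: "matrix_subring n (carrier_mat n n :: 'a::comm_ring_1 mat set)"
  by unfold_locales auto

definition unit_at :: "nat \<Rightarrow> nat \<Rightarrow> 'a::comm_ring_1 mat"
  where "unit_at n q = mat_unit n (q div n) (q mod n)"

lemma unit_at_carrier [simp]: "unit_at n q \<in> carrier_mat n n"
  by (simp add: unit_at_def)

lemma mult_mat_unit:
  assumes "a < n" "b < n" "c < n" "d < n"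
  shows "mat_unit n a b * mat_unit n c d = (if b = c then mat_unit n a d else (0\<^sub>m n n :: 'a::comm_ring_1 mat))"
proof (rule eq_matI, goal_cases)
  case (1 i j)
  then have ij: "i < n" "j < n" by (auto simp: mat_unit_def split: if_splits)
  have "(mat_unit n a b * mat_unit n c d :: 'a mat) $$ (i, j) =
      (\<Sum>k<n. mat_unit n a b $$ (i, k) * mat_unit n c d $$ (k, j))"
    by (rule mult_entry[OF mat_unit_carrier mat_unit_carrier ij])
  also have "\<dots> = (\<Sum>k<n. if k = b then (if i = a \<and> b = c \<and> j = d then 1 else 0) else 0)"
    by (rule sum.cong) (use ij in \<open>auto simp: mat_unit_def\<close>)
  finally show ?case using ij assms by (auto simp: mat_unit_def)
qed (auto simp: mat_unit_def split: if_splits)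

lemma mult_expand_units:
  fixes A B :: "'a::comm_ring_1 mat"
  assumes A: "A \<in> carrier_mat n n" and B: "B \<in> carrier_mat n n" and ij: "i < n" "j < n"
  shows "(A * B) $$ (i, j) = (\<Sum>q<n\<^sup>2. A $$ (q div n, q mod n) * (unit_at n q * B) $$ (i, j))"
proof -
  have u: "(mat_unit n a b * B) $$ (i, j) = (if i = a then B $$ (b, j) else 0)" if "a < n" "b < n" for a b
  proof -
    have "(mat_unit n a b * B) $$ (i, j) = (\<Sum>k<n. mat_unit n a b $$ (i, k) * B $$ (k, j))"
      by (rule mult_entry[OF mat_unit_carrier B ij])
    also have "\<dots> = (\<Sum>k<n. if k = b then (if i = a then B $$ (k, j) else 0) else 0)"
      by (rule sum.cong) (use ij in \<open>auto simp: mat_unit_def\<close>)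
    finally show ?thesis using that by simp
  qed
  have "(\<Sum>q<n\<^sup>2. A $$ (q div n, q mod n) * (unit_at n q * B) $$ (i, j)) =
      (\<Sum>a<n. \<Sum>b<n. if a = i then A $$ (a, b) * B $$ (b, j) else 0)"
    by (rule sum_index_cong) (use index_decode in \<open>auto simp: unit_at_def u simp del: index_mult_mat(1)\<close>)
  also have "\<dots> = (\<Sum>b<n. A $$ (i, b) * B $$ (b, j))" using ij by (subst sum.swap) simp
  finally show ?thesis using mult_entry[OF A B ij] by simp
qed

lemma cword_expand:
  fixes x y :: "nat \<Rightarrow> 'a::comm_ring_1 mat"
  assumes "\<And>r. r < k \<Longrightarrow> x r \<in> carrier_mat n n" "\<And>r. r \<le> k \<Longrightarrow> y r \<in> carrier_mat n n"
    and "i < n" "j < n"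
  shows "cword y x k $$ (i, j) = (\<Sum>f\<in>{..<k} \<rightarrow>\<^sub>E {..<n\<^sup>2}.
    (\<Prod>r<k. x r $$ (f r div n, f r mod n)) * cword y (\<lambda>r. unit_at n (f r)) k $$ (i, j))"
  using assms
proof (induction k arbitrary: j)
  case (Suc k)
  interpret C: matrix_subring n "carrier_mat n n :: 'a mat set" by (rule carrier_subring)
  let ?y = "y (Suc k)"
  have y: "?y \<in> carrier_mat n n" and x: "x k \<in> carrier_mat n n" using Suc.prems by auto
  have cw: "cword y z k \<in> carrier_mat n n" if "\<And>r. r < k \<Longrightarrow> z r \<in> carrier_mat n n" for z
    by (rule C.cword) (use Suc.prems that in auto)
  have cx: "cword y x k \<in> carrier_mat n n" by (rule cw) (use Suc.prems in auto)
  let ?p = "\<lambda>f. \<Prod>r<k. x r $$ (f r div n, f r mod n)"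
  let ?c = "\<lambda>f. cword y (\<lambda>r. unit_at n (f r)) k"
  have cu: "?c f \<in> carrier_mat n n" for f by (rule cw) simp
  have xy: "x k * ?y \<in> carrier_mat n n" "\<And>q. unit_at n q * ?y \<in> carrier_mat n n" using x y by auto
  have "cword y x (Suc k) $$ (i, j) = (\<Sum>l<n. cword y x k $$ (i, l) * (x k * ?y) $$ (l, j))"
    unfolding cword.simps by (rule mult_entry[OF cx xy(1) Suc.prems(3,4)])
  also have "\<dots> = (\<Sum>l<n. (\<Sum>f\<in>{..<k} \<rightarrow>\<^sub>E {..<n\<^sup>2}. ?p f * ?c f $$ (i, l)) *
      (\<Sum>q<n\<^sup>2. x k $$ (q div n, q mod n) * (unit_at n q * ?y) $$ (l, j)))"
  proof (rule sum.cong[OF refl], rule arg_cong2[of _ _ _ _ "(*)"])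
    fix l assume l: "l \<in> {..<n}"
    then show "cword y x k $$ (i, l) = (\<Sum>f\<in>{..<k} \<rightarrow>\<^sub>E {..<n\<^sup>2}. ?p f * ?c f $$ (i, l))"
      by (intro Suc.IH) (use Suc.prems in auto)
    show "(x k * ?y) $$ (l, j) = (\<Sum>q<n\<^sup>2. x k $$ (q div n, q mod n) * (unit_at n q * ?y) $$ (l, j))"
      by (rule mult_expand_units[OF x y _ Suc.prems(4)]) (use l in simp)
  qed
  also have "\<dots> = (\<Sum>l<n. \<Sum>f\<in>{..<k} \<rightarrow>\<^sub>E {..<n\<^sup>2}. \<Sum>q<n\<^sup>2.
      ?p f * x k $$ (q div n, q mod n) * (?c f $$ (i, l) * (unit_at n q * ?y) $$ (l, j)))"
    by (rule sum.cong[OF refl], subst sum_product) (intro sum.cong refl, simp only: mult_ac)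
  also have "\<dots> = (\<Sum>f\<in>{..<k} \<rightarrow>\<^sub>E {..<n\<^sup>2}. \<Sum>q<n\<^sup>2. \<Sum>l<n.
      ?p f * x k $$ (q div n, q mod n) * (?c f $$ (i, l) * (unit_at n q * ?y) $$ (l, j)))"
    by (subst sum.swap, rule sum.cong[OF refl], rule sum.swap)
  also have "\<dots> = (\<Sum>f\<in>{..<k} \<rightarrow>\<^sub>E {..<n\<^sup>2}. \<Sum>q<n\<^sup>2.
      ?p f * x k $$ (q div n, q mod n) * (?c f * (unit_at n q * ?y)) $$ (i, j))"
    by (intro sum.cong refl) (simp only: sum_distrib_left mult_entry[OF cu xy(2) Suc.prems(3,4)])
  also have "\<dots> = (\<Sum>f\<in>{..<k} \<rightarrow>\<^sub>E {..<n\<^sup>2}. \<Sum>q<n\<^sup>2.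
      (\<Prod>r<Suc k. x r $$ ((f(k := q)) r div n, (f(k := q)) r mod n)) *
      cword y (\<lambda>r. unit_at n ((f(k := q)) r)) (Suc k) $$ (i, j))"
  proof (intro sum.cong refl arg_cong2[of _ _ _ _ "(*)"])
    fix f q
    show "?p f * x k $$ (q div n, q mod n) = (\<Prod>r<Suc k. x r $$ ((f(k := q)) r div n, (f(k := q)) r mod n))"
      by simp
    have "cword y (\<lambda>r. unit_at n ((f(k := q)) r)) k = ?c f" by (rule cword_cong) simp
    then show "(?c f * (unit_at n q * ?y)) $$ (i, j) = cword y (\<lambda>r. unit_at n ((f(k := q)) r)) (Suc k) $$ (i, j)"
      by simp
  qed
  also have "\<dots> = (\<Sum>f\<in>{..<Suc k} \<rightarrow>\<^sub>E {..<n\<^sup>2}. (\<Prod>r<Suc k. x r $$ (f r div n, f r mod n)) *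
      cword y (\<lambda>r. unit_at n (f r)) (Suc k) $$ (i, j))"
    unfolding lessThan_Suc[of k] by (rule sum_PiE_insert[symmetric]) simp
  finally show ?case .
qed simp

text \<open>The Capelli polynomial in \<open>x\<close> and \<open>y\<close>. Being multilinear and alternating in the \<open>n\<^sup>2\<close> matrices
  \<open>x\<close>, it is the discriminant of \<open>x\<close> times a matrix that only depends on \<open>y\<close>.\<close>

definition capelli :: "nat \<Rightarrow> (nat \<Rightarrow> 'a::comm_ring_1 mat) \<Rightarrow> (nat \<Rightarrow> 'a mat) \<Rightarrow> 'a mat"
  where "capelli n y x = msum n {\<tau>. \<tau> permutes {..<n\<^sup>2}} (\<lambda>\<tau>. signof \<tau> \<cdot>\<^sub>m cword y (\<lambda>r. x (\<tau> r)) (n\<^sup>2))"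

lemma capelli_factor:
  fixes y :: "nat \<Rightarrow> 'a::comm_ring_1 mat"
  assumes y: "\<And>r. r \<le> n\<^sup>2 \<Longrightarrow> y r \<in> carrier_mat n n"
  shows "\<exists>D\<in>carrier_mat n n. \<forall>x. (\<forall>r<n\<^sup>2. x r \<in> carrier_mat n n) \<longrightarrow>
    capelli n y x = discriminant n x \<cdot>\<^sub>m D"
proof -
  let ?P = "{\<tau>. \<tau> permutes {..<n\<^sup>2}}" and ?F = "{..<n\<^sup>2} \<rightarrow>\<^sub>E {..<n\<^sup>2}"
  define a where "a f = restrict (\<lambda>r. f r div n) {..<n\<^sup>2}" for f :: "nat \<Rightarrow> nat"
  define b where "b f = restrict (\<lambda>r. f r mod n) {..<n\<^sup>2}" for f :: "nat \<Rightarrow> nat"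
  have ab: "a f \<in> {..<n\<^sup>2} \<rightarrow>\<^sub>E {..<n}" "b f \<in> {..<n\<^sup>2} \<rightarrow>\<^sub>E {..<n}" if "f \<in> ?F" for f
  proof -
    have "f r div n < n \<and> f r mod n < n" if "r < n\<^sup>2" for r
      using index_decode[of "f r" n] PiE_mem[OF \<open>f \<in> ?F\<close>, of r] that by auto
    then show "a f \<in> {..<n\<^sup>2} \<rightarrow>\<^sub>E {..<n}" "b f \<in> {..<n\<^sup>2} \<rightarrow>\<^sub>E {..<n}" by (auto simp: a_def b_def)
  qed
  define D where "D = mat n n (\<lambda>ij. \<Sum>f\<in>?F. unit_disc n (a f) (b f) *
      cword y (\<lambda>r. unit_at n (f r)) (n\<^sup>2) $$ ij)"
  interpret C: matrix_subring n "carrier_mat n n :: 'a mat set" by (rule carrier_subring)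
  have "capelli n y x = discriminant n x \<cdot>\<^sub>m D" if x: "\<And>r. r < n\<^sup>2 \<Longrightarrow> x r \<in> carrier_mat n n" for x
  proof (rule eq_matI)
    fix i j assume "i < dim_row (discriminant n x \<cdot>\<^sub>m D)" "j < dim_col (discriminant n x \<cdot>\<^sub>m D)"
    then have ij: "i < n" "j < n" by (auto simp: D_def)
    have x\<tau>: "x (\<tau> r) \<in> carrier_mat n n" if "\<tau> \<in> ?P" "r < n\<^sup>2" for \<tau> r
      using x[of "\<tau> r"] permutes_in_image[of \<tau> "{..<n\<^sup>2}" r] that by auto
    have cw: "cword y (\<lambda>r. x (\<tau> r)) (n\<^sup>2) \<in> carrier_mat n n" if "\<tau> \<in> ?P" for \<tau>
      by (rule C.cword) (use y x\<tau>[OF that] in auto)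
    have "capelli n y x $$ (i, j) = (\<Sum>\<tau>\<in>?P. signof \<tau> * cword y (\<lambda>r. x (\<tau> r)) (n\<^sup>2) $$ (i, j))"
      unfolding capelli_def msum_entry[OF ij]
    proof (rule sum.cong[OF refl])
      fix \<tau> assume "\<tau> \<in> ?P"
      then show "(signof \<tau> \<cdot>\<^sub>m cword y (\<lambda>r. x (\<tau> r)) (n\<^sup>2)) $$ (i, j) = signof \<tau> * cword y (\<lambda>r. x (\<tau> r)) (n\<^sup>2) $$ (i, j)"
        using carrier_matD[OF cw] ij by simp
    qed
    also have "\<dots> = (\<Sum>\<tau>\<in>?P. \<Sum>f\<in>?F. signof \<tau> * (\<Prod>r<n\<^sup>2. x (\<tau> r) $$ (a f r, b f r)) *
        cword y (\<lambda>r. unit_at n (f r)) (n\<^sup>2) $$ (i, j))"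
    proof (rule sum.cong[OF refl])
      fix \<tau> assume \<tau>: "\<tau> \<in> ?P"
      have "cword y (\<lambda>r. x (\<tau> r)) (n\<^sup>2) $$ (i, j) = (\<Sum>f\<in>?F. (\<Prod>r<n\<^sup>2. x (\<tau> r) $$ (f r div n, f r mod n)) *
          cword y (\<lambda>r. unit_at n (f r)) (n\<^sup>2) $$ (i, j))"
        by (rule cword_expand) (use y x\<tau>[OF \<tau>] ij in auto)
      also have "\<dots> = (\<Sum>f\<in>?F. (\<Prod>r<n\<^sup>2. x (\<tau> r) $$ (a f r, b f r)) *
          cword y (\<lambda>r. unit_at n (f r)) (n\<^sup>2) $$ (i, j))"
        by (intro sum.cong refl arg_cong2[of _ _ _ _ "(*)"] prod.cong) (auto simp: a_def b_def)
      finally show "signof \<tau> * cword y (\<lambda>r. x (\<tau> r)) (n\<^sup>2) $$ (i, j) =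
        (\<Sum>f\<in>?F. signof \<tau> * (\<Prod>r<n\<^sup>2. x (\<tau> r) $$ (a f r, b f r)) * cword y (\<lambda>r. unit_at n (f r)) (n\<^sup>2) $$ (i, j))"
        by (simp only: sum_distrib_left mult.assoc)
    qed
    also have "\<dots> = (\<Sum>f\<in>?F. discriminant n x * unit_disc n (a f) (b f) * cword y (\<lambda>r. unit_at n (f r)) (n\<^sup>2) $$ (i, j))"
      by (subst sum.swap, rule sum.cong[OF refl])
        (simp only: antisymmetrized_entries[OF ab, symmetric] sum_distrib_right)
    also have "\<dots> = (discriminant n x \<cdot>\<^sub>m D) $$ (i, j)"
      using ij by (simp add: D_def sum_distrib_left mult.assoc)
    finally show "capelli n y x $$ (i, j) = (discriminant n x \<cdot>\<^sub>m D) $$ (i, j)" .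
  qed (auto simp: capelli_def D_def msum_def)
  moreover have "D \<in> carrier_mat n n" by (simp add: D_def)
  ultimately show ?thesis by blast
qed

text \<open>Left multiplication by \<open>Z\<close> acts on the top exterior power as its trace, which is \<open>n tr Z\<close>.\<close>

lemma discriminant_derivation:
  fixes Z :: "'a::comm_ring_1 mat"
  assumes x: "\<And>r. r < n\<^sup>2 \<Longrightarrow> x r \<in> carrier_mat n n" and Z: "Z \<in> carrier_mat n n"
  shows "(\<Sum>s<n\<^sup>2. discriminant n (x(s := Z * x s))) = of_nat n * mat_tr Z * discriminant n x"
proof -
  let ?D = "disc_mat n x" and ?L = "left_mult_mat n Z"
  note L = mult_mat_carriers(1)[of n Z]
  have DL: "?D * ?L \<in> carrier_mat (n\<^sup>2) (n\<^sup>2)" using L by simp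
  note Ad = adj_mat(1)[OF disc_mat_carrier[of n x]]
  have row: "discriminant n (x(s := Z * x s)) = ((?D * ?L) * adj_mat ?D) $$ (s, s)" if s: "s < n\<^sup>2" for s
  proof -
    let ?D' = "disc_mat n (x(s := Z * x s))"
    have "discriminant n (x(s := Z * x s)) = (\<Sum>q<n\<^sup>2. ?D' $$ (s, q) * cofactor ?D' s q)"
      unfolding discriminant_det by (rule laplace_expansion_row[OF disc_mat_carrier s])
    also have "\<dots> = (\<Sum>q<n\<^sup>2. (?D * ?L) $$ (s, q) * adj_mat ?D $$ (q, s))"
    proof (rule sum.cong[OF refl], rule arg_cong2[of _ _ _ _ "(*)"])
      fix q assume "q \<in> {..<n\<^sup>2}"
      then have q: "q < n\<^sup>2" by simp
      have "?D' $$ (s, q) = (Z * x s) $$ (q div n, q mod n)" using s q by (simp add: disc_mat_def)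
      also have "\<dots> = (\<Sum>p<n\<^sup>2. x s $$ (p div n, p mod n) * ?L $$ (p, q))" by (rule left_mult_entry[OF x[OF s] Z q])
      also have "\<dots> = (?D * ?L) $$ (s, q)"
        unfolding mult_entry[OF disc_mat_carrier L s q] using s by (intro sum.cong refl) (simp add: disc_mat_def)
      finally show "?D' $$ (s, q) = (?D * ?L) $$ (s, q)" .
      have "mat_delete ?D' s q = mat_delete ?D s q"
        by (rule eq_matI) (auto simp: mat_delete_def disc_mat_def)
      then show "cofactor ?D' s q = adj_mat ?D $$ (q, s)" using s q by (simp add: adj_mat_def cofactor_def)
    qed
    also have "\<dots> = ((?D * ?L) * adj_mat ?D) $$ (s, s)" by (rule mult_entry[OF DL Ad s s, symmetric])
    finally show ?thesis .
  qed
  have "(\<Sum>s<n\<^sup>2. discriminant n (x(s := Z * x s))) = mat_tr ((?D * ?L) * adj_mat ?D)"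
    using row carrier_matD[OF mult_sq[OF DL Ad]] by (simp add: mat_tr_def del: index_mult_mat(1))
  also have "\<dots> = mat_tr (adj_mat ?D * (?D * ?L))" by (rule mat_tr_comm[OF DL Ad])
  also have "adj_mat ?D * (?D * ?L) = (adj_mat ?D * ?D) * ?L"
    by (rule mat_assoc[OF Ad disc_mat_carrier L, symmetric])
  also have "\<dots> = det ?D \<cdot>\<^sub>m ?L"
    unfolding adj_mat(3)[OF disc_mat_carrier] using left_mult_one_mat[OF L]
    by (simp add: mult_smult_assoc_mat[of _ "n\<^sup>2" "n\<^sup>2" _ "n\<^sup>2"])
  also have "mat_tr (det ?D \<cdot>\<^sub>m ?L) = det ?D * mat_tr ?L" by (rule mat_tr_smult[OF L])
  also have "mat_tr ?L = (\<Sum>a<n. \<Sum>b<n. Z $$ (a, a))"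
  proof -
    have "mat_tr ?L = (\<Sum>p<n\<^sup>2. Z $$ (p div n, p div n))"
      by (simp add: mat_tr_def left_mult_mat_def)
    then show ?thesis by (simp add: sum_index_cong[of n "\<lambda>p. Z $$ (p div n, p div n)" "\<lambda>a b. Z $$ (a, a)"])
  qed
  also have "\<dots> = of_nat n * mat_tr Z" using Z by (simp add: mat_tr_def sum_distrib_left)
  finally show ?thesis by (simp only: discriminant_det mult_ac)
qed

lemma capelli_trace:
  fixes Z :: "'a::comm_ring_1 mat"
  assumes y: "\<And>r. r \<le> n\<^sup>2 \<Longrightarrow> y r \<in> carrier_mat n n"
    and x: "\<And>r. r < n\<^sup>2 \<Longrightarrow> x r \<in> carrier_mat n n" and Z: "Z \<in> carrier_mat n n"
  shows "(of_nat n * mat_tr Z) \<cdot>\<^sub>m capelli n y x = msum n {..<n\<^sup>2} (\<lambda>s. capelli n y (x(s := Z * x s)))"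
proof -
  obtain D where D: "D \<in> carrier_mat n n" and fact: "\<forall>x. (\<forall>r<n\<^sup>2. x r \<in> carrier_mat n n) \<longrightarrow>
      capelli n y x = discriminant n x \<cdot>\<^sub>m D"
    using capelli_factor[of n y] y by blast
  have c: "capelli n y (x(s := Z * x s)) = discriminant n (x(s := Z * x s)) \<cdot>\<^sub>m D" if "s < n\<^sup>2" for s
    using fact x Z that by auto
  have c0: "capelli n y x = discriminant n x \<cdot>\<^sub>m D" using fact x by auto
  show ?thesis
  proof (rule eq_matI)
    fix i j assume "i < dim_row (msum n {..<n\<^sup>2} (\<lambda>s. capelli n y (x(s := Z * x s))))"
      "j < dim_col (msum n {..<n\<^sup>2} (\<lambda>s. capelli n y (x(s := Z * x s))))"
    then have ij: "i < n" "j < n" by (auto simp: msum_def)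
    have "msum n {..<n\<^sup>2} (\<lambda>s. capelli n y (x(s := Z * x s))) $$ (i, j) =
        (\<Sum>s<n\<^sup>2. discriminant n (x(s := Z * x s))) * D $$ (i, j)"
      unfolding msum_entry[OF ij] sum_distrib_right using ij D by (intro sum.cong refl) (simp add: c)
    also have "\<dots> = ((of_nat n * mat_tr Z) \<cdot>\<^sub>m capelli n y x) $$ (i, j)"
      using ij D unfolding c0 by (simp add: discriminant_derivation[OF x Z])
    finally show "((of_nat n * mat_tr Z) \<cdot>\<^sub>m capelli n y x) $$ (i, j) =
      msum n {..<n\<^sup>2} (\<lambda>s. capelli n y (x(s := Z * x s))) $$ (i, j)" by simp
  qed (auto simp: msum_def capelli_def)
qed

text \<open>At the matrix units, a suitable word picks out a single term of the Capelli polynomial.\<close>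

text \<open>If the \<open>y\<^sub>r\<close> are the matrix units at these positions, then the word with the matrix units in their standard
  order as \<open>x\<^sub>r\<close> is a closed path from \<open>i\<close> to \<open>i\<close>, and in any other order the path is broken.\<close>

definition path :: "nat \<Rightarrow> nat \<Rightarrow> nat \<Rightarrow> nat \<times> nat"
  where "path n i r = ((if r = 0 then i else (r - 1) mod n), (if r = n\<^sup>2 then i else r div n))"

lemma cword_units:
  assumes n: "n > 0" and i: "i < n" and \<tau>: "\<tau> permutes {..<n\<^sup>2}" and k: "k \<le> n\<^sup>2"
  shows "cword (\<lambda>r. mat_unit n (fst (path n i r)) (snd (path n i r))) (\<lambda>r. unit_at n (\<tau> r)) k =
    (if \<forall>r<k. \<tau> r = r then mat_unit n i (snd (path n i k)) else (0\<^sub>m n n :: 'a::comm_ring_1 mat))"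
  using k
proof (induction k)
  case 0
  then show ?case by (simp add: path_def)
next
  case (Suc k)
  let ?y = "\<lambda>r. mat_unit n (fst (path n i r)) (snd (path n i r)) :: 'a mat"
  have k: "k < n\<^sup>2" using Suc.prems by simp
  have tk: "\<tau> k < n\<^sup>2" using permutes_in_image[OF \<tau>, of k] k by simp
  have snd_less: "snd (path n i r) < n" if "r \<le> n\<^sup>2" for r
    using that i index_decode(1)[of r n] by (auto simp: path_def)
  have pk: "snd (path n i k) = k div n" using k by (simp add: path_def)
  have "unit_at n (\<tau> k) * ?y (Suc k) =
      (if \<tau> k mod n = k mod n then mat_unit n (\<tau> k div n) (snd (path n i (Suc k))) else 0\<^sub>m n n)"
    unfolding unit_at_def using index_decode[OF tk] index_decode[OF k] snd_less[OF Suc.prems] n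
    by (subst mult_mat_unit) (auto simp: path_def)
  then have step: "mat_unit n i (k div n) * (unit_at n (\<tau> k) * ?y (Suc k)) =
      (if \<tau> k = k then mat_unit n i (snd (path n i (Suc k))) else 0\<^sub>m n n)"
  proof (cases "\<tau> k mod n = k mod n")
    case True
    have "\<tau> k = k \<longleftrightarrow> k div n = \<tau> k div n"
      using True div_mod_decomp[of "\<tau> k" n] div_mod_decomp[of k n] by metis
    moreover assume "unit_at n (\<tau> k) * ?y (Suc k) =
      (if \<tau> k mod n = k mod n then mat_unit n (\<tau> k div n) (snd (path n i (Suc k))) else 0\<^sub>m n n)"
    ultimately show ?thesis
      using True index_decode[OF tk] index_decode[OF k] snd_less[OF Suc.prems] i by (simp add: mult_mat_unit)
  next
    case False
    moreover assume "unit_at n (\<tau> k) * ?y (Suc k) =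
      (if \<tau> k mod n = k mod n then mat_unit n (\<tau> k div n) (snd (path n i (Suc k))) else 0\<^sub>m n n)"
    moreover have "\<tau> k \<noteq> k" using False by auto
    ultimately show ?thesis using right_mult_zero_mat[OF mat_unit_carrier] by simp
  qed
  have IH: "cword ?y (\<lambda>r. unit_at n (\<tau> r)) k = (if \<forall>r<k. \<tau> r = r then mat_unit n i (k div n) else 0\<^sub>m n n)"
    using Suc.IH[OF less_imp_le[OF k]] unfolding pk .
  show ?case
  proof (cases "\<forall>r<k. \<tau> r = r")
    case True
    then show ?thesis unfolding cword.simps IH using step by (simp add: less_Suc_eq all_conj_distrib)
  next
    case False
    then have nall: "\<not> (\<forall>r<Suc k. \<tau> r = r)" by (meson less_SucI)
    show ?thesis unfolding cword.simps IH if_not_P[OF False] if_not_P[OF nall]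
      using left_mult_zero_mat[OF mult_sq[OF unit_at_carrier mat_unit_carrier]] by blast
  qed
qed

lemma capelli_units:
  assumes n: "n > 0" and i: "i < n"
  shows "capelli n (\<lambda>r. mat_unit n (fst (path n i r)) (snd (path n i r))) (unit_at n) =
    (mat_unit n i i :: 'a::comm_ring_1 mat)"
proof (rule eq_matI)
  let ?P = "{\<tau>. \<tau> permutes {..<n\<^sup>2}}"
  let ?w = "\<lambda>\<tau>. cword (\<lambda>r. mat_unit n (fst (path n i r)) (snd (path n i r))) (\<lambda>r. unit_at n (\<tau> r)) (n\<^sup>2) :: 'a mat"
  fix a b assume "a < dim_row (mat_unit n i i :: 'a mat)" "b < dim_col (mat_unit n i i :: 'a mat)"
  then have ab: "a < n" "b < n" by (auto simp: mat_unit_def)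
  have w: "?w \<tau> = (if \<tau> = id then mat_unit n i i else 0\<^sub>m n n)" if "\<tau> \<in> ?P" for \<tau>
  proof -
    have "\<tau> = id" if "\<forall>r<n\<^sup>2. \<tau> r = r"
    proof
      fix r show "\<tau> r = id r"
        using that \<open>\<tau> \<in> ?P\<close> by (cases "r < n\<^sup>2") (auto simp: permutes_def)
    qed
    then have iff: "(\<forall>r<n\<^sup>2. \<tau> r = r) \<longleftrightarrow> \<tau> = id" by auto
    have end_path: "snd (path n i (n\<^sup>2)) = i" by (simp add: path_def)
    have "?w \<tau> = (if \<forall>r<n\<^sup>2. \<tau> r = r then mat_unit n i (snd (path n i (n\<^sup>2))) else 0\<^sub>m n n)"
      by (rule cword_units[OF n i _ le_refl]) (use that in simp)
    then show ?thesis unfolding iff end_path .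
  qed
  have "capelli n (\<lambda>r. mat_unit n (fst (path n i r)) (snd (path n i r))) (unit_at n) $$ (a, b) =
      (\<Sum>\<tau>\<in>?P. if \<tau> = id then mat_unit n i i $$ (a, b) else (0 :: 'a))"
    unfolding capelli_def msum_entry[OF ab]
  proof (rule sum.cong[OF refl])
    fix \<tau> assume "\<tau> \<in> ?P"
    then show "(signof \<tau> \<cdot>\<^sub>m ?w \<tau>) $$ (a, b) = (if \<tau> = id then mat_unit n i i $$ (a, b) else 0)"
      unfolding w[OF \<open>\<tau> \<in> ?P\<close>] using ab by (cases "\<tau> = id") (simp_all add: mat_unit_def)
  qed
  also have "\<dots> = mat_unit n i i $$ (a, b)"
    using finite_permutations[of "{..<n\<^sup>2}"] permutes_id[of "{..<n\<^sup>2}"] by simp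
  finally show "capelli n (\<lambda>r. mat_unit n (fst (path n i r)) (snd (path n i r))) (unit_at n) $$ (a, b) =
    (mat_unit n i i :: 'a mat) $$ (a, b)" .
qed (auto simp: capelli_def msum_def mat_unit_def)

context generic_size
begin

abbreviation unit_tuple :: "nat \<Rightarrow> 'a::comm_ring_1 mat"
  where "unit_tuple \<equiv> unit_at n"

lemma unit_tuple: "tuple unit_tuple"
  by (simp add: tuple_def)

text \<open>All matrix units but the last one are entries of the tuple, and the last one is the identity minus
  the other diagonal units. This is why one generic matrix less than \<open>n\<^sup>2\<close> suffices.\<close>

lemma unit_lift:
  assumes q: "q < n\<^sup>2"
  shows "\<exists>u\<in>generic_algebra m n. evm unit_tuple u = (unit_at n q :: 'k::field_char_0 mat)"
proof (cases "q < m")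
  case True
  then show ?thesis using GA_generic[OF True] evm_generic[OF unit_tuple True] by blast
next
  case False
  then have qm: "q = m" using q n_sq by simp
  let ?d = "\<lambda>k. mat n n (\<lambda>(i, j). if i = j \<and> i < k then 1 else 0) :: 'k mat"
  have "\<exists>u\<in>generic_algebra m n. evm unit_tuple u = ?d k" if "k \<le> n - 1" for k
    using that
  proof (induction k)
    case 0
    have "evm unit_tuple (0\<^sub>m n n) = ?d 0" by (rule eq_matI) (auto simp: mpol_eval_0[OF id_hom])
    then show ?case using GA.zero by blast
  next
    case (Suc k)
    then obtain u where u: "u \<in> generic_algebra m n" "evm unit_tuple u = ?d k" by auto
    have k: "k < n - 1" using Suc.prems by simp
    let ?r = "k * n + k"
    have "?r < m"
    proof -
      have "?r < k * n + n" using k by simp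
      also have "\<dots> = Suc k * n" by simp
      also have "\<dots> \<le> (n - 1) * n" using k by (intro mult_right_mono) auto
      also have "\<dots> = Suc m - n" using n_sq by (simp add: power2_eq_square diff_mult_distrib)
      also have "\<dots> < m" using n2 m3 by linarith
      finally show ?thesis .
    qed
    then have "evm unit_tuple (u + generic_mat n ?r) = ?d k + unit_at n ?r"
      using u GA.in_carrier[OF u(1)] by (simp add: evm_add evm_generic[OF unit_tuple])
    also have "\<dots> = ?d (Suc k)"
      using k index_encode[of k n k] by (intro eq_matI) (auto simp: unit_at_def mat_unit_def)
    finally show ?case using GA.add[OF u(1) GA_generic[OF \<open>?r < m\<close>]] by blast
  qed
  then obtain u where u: "u \<in> generic_algebra m n" "evm unit_tuple u = ?d (n - 1)" by blast
  have qd: "q div n = n - 1" "q mod n = n - 1"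
  proof -
    obtain l where "n = Suc l" using n0 gr0_implies_Suc by blast
    then have "q = (n - 1) * n + (n - 1)" using qm n_sq by (simp add: power2_eq_square)
    then show "q div n = n - 1" "q mod n = n - 1" using index_encode[of "n - 1" n "n - 1"] n0 by auto
  qed
  have "evm unit_tuple (1\<^sub>m n + - u) = 1\<^sub>m n + - ?d (n - 1)"
    using u GA.in_carrier[OF u(1)] by (simp add: evm_add evm_uminus evm_one)
  also have "\<dots> = unit_at n q"
    by (rule eq_matI) (auto simp: unit_at_def mat_unit_def qd)
  finally show ?thesis using GA.add[OF GA.one GA.uminus[OF u(1)]] by blast
qed

lemma evm_cword:
  assumes "\<And>r. r \<le> k \<Longrightarrow> y r \<in> carrier_mat n n" "\<And>r. r < k \<Longrightarrow> x r \<in> carrier_mat n n"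
  shows "evm A (cword y x k) = cword (\<lambda>r. evm A (y r)) (\<lambda>r. evm A (x r)) k"
  using assms
proof (induction k)
  case (Suc k)
  interpret C: matrix_subring n "carrier_mat n n :: 'a gpol mat set" by (rule carrier_subring)
  have "cword y x k \<in> carrier_mat n n" by (rule C.cword) (use Suc.prems in auto)
  then show ?case using Suc by (simp add: evm_mult)
qed simp

lemma evm_msum:
  assumes "\<And>t. t \<in> S \<Longrightarrow> f t \<in> carrier_mat n n"
  shows "evm A (msum n S f) = msum n S (\<lambda>t. evm A (f t))"
proof -
  interpret e: comm_ring_hom "evp A" by (rule evp_hom)
  show ?thesis
  proof (rule eq_matI)
    fix i j assume "i < dim_row (msum n S (\<lambda>t. evm A (f t)))" "j < dim_col (msum n S (\<lambda>t. evm A (f t)))"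
    then have ij: "i < n" "j < n" by (auto simp: msum_def)
    show "evm A (msum n S f) $$ (i, j) = msum n S (\<lambda>t. evm A (f t)) $$ (i, j)"
    proof -
      have "evm A (msum n S f) $$ (i, j) = (\<Sum>t\<in>S. evp A (f t $$ (i, j)))"
        using ij by (simp add: msum_def e.hom_sum)
      also have "\<dots> = (\<Sum>t\<in>S. evm A (f t) $$ (i, j))"
      proof (rule sum.cong[OF refl])
        fix t assume "t \<in> S"
        then show "evp A (f t $$ (i, j)) = evm A (f t) $$ (i, j)" using carrier_matD[OF assms] ij by simp
      qed
      finally show ?thesis using ij by (simp only: msum_entry)
    qed
  qed (auto simp: msum_def)
qed

lemma evm_capelli:
  assumes y: "\<And>r. r \<le> n\<^sup>2 \<Longrightarrow> y r \<in> carrier_mat n n" and x: "\<And>r. r < n\<^sup>2 \<Longrightarrow> x r \<in> carrier_mat n n"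
  shows "evm A (capelli n y x) = capelli n (\<lambda>r. evm A (y r)) (\<lambda>r. evm A (x r))"
proof -
  interpret C: matrix_subring n "carrier_mat n n :: 'a gpol mat set" by (rule carrier_subring)
  interpret e: comm_ring_hom "evp A" by (rule evp_hom)
  have x\<tau>: "x (\<tau> r) \<in> carrier_mat n n" if "\<tau> permutes {..<n\<^sup>2}" "r < n\<^sup>2" for \<tau> r
    using x[of "\<tau> r"] permutes_in_image[of \<tau> "{..<n\<^sup>2}" r] that by auto
  have cw: "cword y (\<lambda>r. x (\<tau> r)) (n\<^sup>2) \<in> carrier_mat n n" if "\<tau> permutes {..<n\<^sup>2}" for \<tau>
    by (rule C.cword) (use y x\<tau>[OF that] in auto)
  have "evm A (capelli n y x) = msum n {\<tau>. \<tau> permutes {..<n\<^sup>2}} (\<lambda>\<tau>. evm A (signof \<tau> \<cdot>\<^sub>m cword y (\<lambda>r. x (\<tau> r)) (n\<^sup>2)))"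
    unfolding capelli_def by (rule evm_msum) (use cw in auto)
  also have "\<dots> = capelli n (\<lambda>r. evm A (y r)) (\<lambda>r. evm A (x r))"
  proof -
    have "evm A (signof \<tau> \<cdot>\<^sub>m cword y (\<lambda>r. x (\<tau> r)) (n\<^sup>2)) =
        signof \<tau> \<cdot>\<^sub>m cword (\<lambda>r. evm A (y r)) (\<lambda>r. evm A (x (\<tau> r))) (n\<^sup>2)" if "\<tau> permutes {..<n\<^sup>2}" for \<tau>
    proof -
      have "evm A (cword y (\<lambda>r. x (\<tau> r)) (n\<^sup>2)) = cword (\<lambda>r. evm A (y r)) (\<lambda>r. evm A (x (\<tau> r))) (n\<^sup>2)"
        by (rule evm_cword) (use y x\<tau>[OF that] in auto)
      then show ?thesis by (simp only: evm_smult e.hom_signof)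
    qed
    then show ?thesis unfolding capelli_def msum_def by (intro cong_mat refl sum.cong) simp
  qed
  finally show ?thesis .
qed

lemma GA_signof: "Z \<in> generic_algebra m n \<Longrightarrow> signof \<tau> \<cdot>\<^sub>m Z \<in> (generic_algebra m n :: 'k::field_char_0 gpol mat set)"
proof -
  assume Z: "Z \<in> generic_algebra m n"
  have "(- 1) \<cdot>\<^sub>m Z = - Z" "1 \<cdot>\<^sub>m Z = Z" by (rule eq_matI; auto)+
  then show ?thesis using Z GA.uminus[OF Z] by (auto simp: sign_def)
qed

lemma GA_capelli:
  assumes y: "\<And>r. r \<le> n\<^sup>2 \<Longrightarrow> y r \<in> generic_algebra m n" and x: "\<And>r. r < n\<^sup>2 \<Longrightarrow> x r \<in> generic_algebra m n"
  shows "capelli n y x \<in> (generic_algebra m n :: 'k::field_char_0 gpol mat set)"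
  unfolding capelli_def
proof (rule GA.msum, rule GA_signof, rule GA.cword)
  fix \<tau> r assume "\<tau> \<in> {\<tau>. \<tau> permutes {..<n\<^sup>2}}" "r < n\<^sup>2"
  then show "x (\<tau> r) \<in> generic_algebra m n"
    using x[of "\<tau> r"] permutes_in_image[of \<tau> "{..<n\<^sup>2}" r] by auto
qed (use y in auto)

text \<open>The sum \<open>B\<close> of Capelli polynomials takes the identity matrix as a value. By \<open>capelli_trace\<close> the product
  of \<open>n tr Z\<close> with it is a sum of values of Capelli polynomials in the generic matrix algebra.\<close>

lemma GA_trace_denominator:
  obtains B :: "'k::field_char_0 gpol mat" where "B \<in> generic_algebra m n" "det B \<noteq> 0"
    "\<And>Z. Z \<in> generic_algebra m n \<Longrightarrow> mat_tr Z \<cdot>\<^sub>m B \<in> generic_algebra m n"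
proof -
  let ?G = "generic_algebra m n :: 'k gpol mat set"
  have "\<exists>u. \<forall>q\<in>{..<n\<^sup>2}. u q \<in> ?G \<and> evm unit_tuple (u q) = unit_at n q"
    by (rule bchoice, rule ballI) (use unit_lift in auto)
  then obtain u where u: "\<And>q. q < n\<^sup>2 \<Longrightarrow> u q \<in> ?G" "\<And>q. q < n\<^sup>2 \<Longrightarrow> evm unit_tuple (u q) = unit_at n q"
    by auto
  define y where "y i r = u (fst (path n i r) * n + snd (path n i r))" for i r
  have path: "fst (path n i r) < n" "snd (path n i r) < n" if "i < n" "r \<le> n\<^sup>2" for i r
    using that n0 index_decode(1)[of r n] by (auto simp: path_def)
  have y: "y i r \<in> ?G" "evm unit_tuple (y i r) = mat_unit n (fst (path n i r)) (snd (path n i r))"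
    if "i < n" "r \<le> n\<^sup>2" for i r
    using u index_encode[OF path[OF that]] by (auto simp: y_def unit_at_def)
  have uc: "u q \<in> carrier_mat n n" if "q < n\<^sup>2" for q by (rule GA.in_carrier[OF u(1)[OF that]])
  have yc: "y i r \<in> carrier_mat n n" if "i < n" "r \<le> n\<^sup>2" for i r by (rule GA.in_carrier[OF y(1)[OF that]])
  define B where "B = msum n {..<n} (\<lambda>i. capelli n (y i) u)"
  have BG: "B \<in> ?G" unfolding B_def by (rule GA.msum, rule GA_capelli) (use y u in auto)
  have "evm unit_tuple B = msum n {..<n} (\<lambda>i. evm unit_tuple (capelli n (y i) u))"
    unfolding B_def by (rule evm_msum) (simp add: capelli_def)
  also have "\<dots> = msum n {..<n} (\<lambda>i. mat_unit n i i)"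
    unfolding msum_def
  proof (intro cong_mat refl sum.cong)
    fix i j :: nat and t assume t: "t \<in> {..<n}"
    then have ti: "t < n" by simp
    have "evm unit_tuple (capelli n (y t) u) = capelli n (\<lambda>r. evm unit_tuple (y t r)) (\<lambda>r. evm unit_tuple (u r))"
      by (rule evm_capelli) (use yc[OF ti] uc in auto)
    also have "\<dots> = capelli n (\<lambda>r. mat_unit n (fst (path n t r)) (snd (path n t r))) (unit_at n)"
    proof -
      have "cword (\<lambda>r. evm unit_tuple (y t r)) (\<lambda>r. evm unit_tuple (u (\<tau> r))) k =
          cword (\<lambda>r. mat_unit n (fst (path n t r)) (snd (path n t r))) (\<lambda>r. unit_at n (\<tau> r)) k"
        if \<tau>: "\<tau> permutes {..<n\<^sup>2}" and k: "k \<le> n\<^sup>2" for \<tau> k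
        using k
      proof (induction k)
        case (Suc k)
        then have "\<tau> k < n\<^sup>2" using permutes_in_image[OF \<tau>, of k] by simp
        then show ?case using Suc y(2)[OF ti] u(2) by simp
      qed (simp add: y(2)[OF ti])
      then show ?thesis unfolding capelli_def msum_def by (intro cong_mat refl sum.cong) simp
    qed
    also have "\<dots> = mat_unit n t t" by (rule capelli_units[OF n0 ti])
    finally show "evm unit_tuple (capelli n (y t) u) $$ (i, j) = mat_unit n t t $$ (i, j)" by simp
  qed
  also have "\<dots> = 1\<^sub>m n"
  proof (rule eq_matI)
    fix i j assume "i < dim_row (1\<^sub>m n)" "j < dim_col (1\<^sub>m n)"
    then have ij: "i < n" "j < n" by auto
    have "(\<Sum>t<n. mat_unit n t t $$ (i, j)) = (\<Sum>t<n. if t = i then (if i = j then 1 else 0) else (0 :: 'k))"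
      by (rule sum.cong) (use ij in \<open>auto simp: mat_unit_def\<close>)
    then show "msum n {..<n} (\<lambda>i. mat_unit n i i) $$ (i, j) = (1\<^sub>m n :: 'k mat) $$ (i, j)"
      using ij by (simp add: msum_entry)
  qed (auto simp: msum_def)
  finally have ev1: "evm unit_tuple B = 1\<^sub>m n" .
  have d: "det B \<noteq> 0"
  proof
    interpret e: comm_ring_hom "evp (unit_tuple :: nat \<Rightarrow> 'k mat)" by (rule evp_hom)
    assume "det B = 0"
    then have "det (evm unit_tuple B) = 0" by simp
    then show False by (simp add: ev1)
  qed
  have "mat_tr Z \<cdot>\<^sub>m B \<in> ?G" if Z: "Z \<in> ?G" for Z
  proof -
    note Zc = GA.in_carrier[OF Z]
    have "mconst (of_nat n) = (of_nat n :: 'k gpol)"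
    proof -
      interpret mc: comm_ring_hom "mconst :: 'k \<Rightarrow> 'k gpol" by (rule mconst_hom)
      show ?thesis by (induction n) (simp_all add: mc.hom_add)
    qed
    have "mconst (of_nat n) \<cdot>\<^sub>m (mat_tr Z \<cdot>\<^sub>m B) = msum n {..<n} (\<lambda>i. (of_nat n * mat_tr Z) \<cdot>\<^sub>m capelli n (y i) u)"
      unfolding \<open>mconst (of_nat n) = of_nat n\<close> B_def msum_def
      by (rule eq_matI) (auto simp: sum_distrib_left mult.assoc capelli_def msum_def)
    also have "\<dots> = msum n {..<n} (\<lambda>i. msum n {..<n\<^sup>2} (\<lambda>s. capelli n (y i) (u(s := Z * u s))))"
    proof -
      have "(of_nat n * mat_tr Z) \<cdot>\<^sub>m capelli n (y i) u = msum n {..<n\<^sup>2} (\<lambda>s. capelli n (y i) (u(s := Z * u s)))"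
        if "i < n" for i
        by (rule capelli_trace) (use yc[OF that] uc Zc in auto)
      then show ?thesis unfolding msum_def by (intro cong_mat refl sum.cong) simp
    qed
    also have "\<dots> \<in> ?G"
      by (rule GA.msum, rule GA.msum, rule GA_capelli) (use y u GA.mult[OF Z] in auto)
    finally have "mconst (1 / of_nat n) \<cdot>\<^sub>m (mconst (of_nat n) \<cdot>\<^sub>m (mat_tr Z \<cdot>\<^sub>m B)) \<in> ?G" by (rule GA_smult)
    moreover have "1 \<cdot>\<^sub>m (mat_tr Z \<cdot>\<^sub>m B) = mat_tr Z \<cdot>\<^sub>m B" by (rule eq_matI) auto
    ultimately show ?thesis using n0 by (simp add: mconst_commute)
  qed
  then show ?thesis using that[OF BG d] by blast
qed

text \<open>Each trace in a product of traces with an element of the generic matrix algebra takes up one factor \<open>B\<close>.\<close>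

lemma TR_denominator:
  obtains B :: "'k::field_char_0 gpol mat" where "B \<in> generic_algebra m n" "det B \<noteq> 0"
    "\<And>Z. Z \<in> trace_ring m n \<Longrightarrow> \<exists>r. \<forall>s\<ge>r. Z * B ^\<^sub>m s \<in> generic_algebra m n"
proof -
  obtain B :: "'k gpol mat" where B: "B \<in> generic_algebra m n" "det B \<noteq> 0"
    and tr: "\<And>Z. Z \<in> generic_algebra m n \<Longrightarrow> mat_tr Z \<cdot>\<^sub>m B \<in> generic_algebra m n"
    using GA_trace_denominator by blast
  note Bc = GA.in_carrier[OF B(1)]
  note Bp = pow_carrier_mat[OF Bc]
  have "\<exists>r. \<forall>s\<ge>r. Z * B ^\<^sub>m s \<in> generic_algebra m n" if "Z \<in> trace_ring m n" for Z
    using that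
  proof (induction rule: trace_ring_induct)
    case (generic W)
    then show ?case using GA.mult GA.power[OF B(1)] by blast
  next
    case (trace W Z)
    note Zc = TR.in_carrier[OF trace(2)]
    obtain r where r: "\<And>s. s \<ge> r \<Longrightarrow> Z * B ^\<^sub>m s \<in> generic_algebra m n" using trace.IH by blast
    have "(mat_tr W \<cdot>\<^sub>m Z) * B ^\<^sub>m s \<in> generic_algebra m n" if s: "s \<ge> Suc r" for s
    proof -
      obtain t where t: "s = Suc t" "t \<ge> r" using s by (cases s) auto
      have "(mat_tr W \<cdot>\<^sub>m Z) * B ^\<^sub>m s = (Z * B ^\<^sub>m t) * (mat_tr W \<cdot>\<^sub>m B)"
        using Zc Bc Bp[of t] unfolding t(1)
        by (simp add: mult_smult_assoc_mat[of _ n n _ n] mult_smult_distrib[of _ n n _ n] mat_assoc[where n = n])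
      then show ?thesis using GA.mult[OF r[OF t(2)] tr[OF trace(1)]] by simp
    qed
    then show ?case by blast
  next
    case (add Z Z')
    note c = TR.in_carrier[OF add(1)] TR.in_carrier[OF add(2)]
    obtain r r' where "\<And>s. s \<ge> r \<Longrightarrow> Z * B ^\<^sub>m s \<in> generic_algebra m n"
      "\<And>s. s \<ge> r' \<Longrightarrow> Z' * B ^\<^sub>m s \<in> generic_algebra m n" using add.IH by blast
    then have "(Z + Z') * B ^\<^sub>m s \<in> generic_algebra m n" if "s \<ge> max r r'" for s
      using that by (subst add_mult_distrib_mat[OF c Bp]) (auto intro: GA.add)
    then show ?case by blast
  qed
  then show ?thesis using that B by blast
qed

end

section \<open>Polynomials in the coefficients and in \<open>Y\<close>\<close>

lemma map_poly_hom: "comm_ring_hom h \<Longrightarrow> comm_ring_hom (map_poly h)"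
proof -
  assume "comm_ring_hom h"
  then interpret map_poly_comm_ring_hom h by (simp add: map_poly_comm_ring_hom_def)
  show ?thesis by unfold_locales
qed

lemma const_poly_hom: "comm_ring_hom (\<lambda>a::'a::comm_ring_1. [:a:])"
  by unfold_locales (simp_all add: one_pCons)

lemma poly_eval_hom: "comm_ring_hom (\<lambda>p. poly p (x::'a::comm_ring_1))"
  by unfold_locales simp_all

text \<open>The variable \<open>n\<close> stands for the indeterminate of the univariate polynomial, the others for
  scalars.\<close>

definition cpoly :: "nat \<Rightarrow> ('k::comm_ring_1 \<Rightarrow> 'a::comm_ring_1) \<Rightarrow> (nat \<Rightarrow> 'a) \<Rightarrow> (nat, 'k) mpol \<Rightarrow> 'a poly"
  where "cpoly n \<iota> c = mpol_eval (\<lambda>a. [:\<iota> a:]) (\<lambda>i. if i = n then [:0, 1:] else [:c i:])"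

lemma cpoly_hom: "comm_ring_hom \<iota> \<Longrightarrow> comm_ring_hom (cpoly n \<iota> c)"
  unfolding cpoly_def by (intro mpol_eval_hom comm_ring_hom_comp[OF const_poly_hom])

lemma cpoly_simps:
  assumes "comm_ring_hom \<iota>"
  shows "cpoly n \<iota> c (mconst a) = [:\<iota> a:]" "cpoly n \<iota> c (mvar i) = (if i = n then [:0, 1:] else [:c i:])"
  unfolding cpoly_def
  by (simp_all add: mpol_eval_mconst[OF comm_ring_hom_comp[OF const_poly_hom assms]]
    mpol_eval_mvar[OF comm_ring_hom_comp[OF const_poly_hom assms]])

lemma cpoly_cong:
  assumes "comm_ring_hom \<iota>" "p \<in> mpol_in I" "\<And>i. i \<in> I \<Longrightarrow> i \<noteq> n \<Longrightarrow> c i = c' i"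
  shows "cpoly n \<iota> c p = cpoly n \<iota> c' p"
  unfolding cpoly_def
  by (rule mpol_eval_cong[OF assms(2) comm_ring_hom_comp[OF const_poly_hom assms(1)]]) (simp add: assms(3))

lemma hom_cpoly:
  fixes \<iota> :: "'k::comm_ring_1 \<Rightarrow> 'a::comm_ring_1"
  assumes h: "comm_ring_hom h" and \<iota>: "comm_ring_hom \<iota>"
  shows "map_poly h (cpoly n \<iota> c p) = cpoly n (\<lambda>a. h (\<iota> a)) (\<lambda>i. h (c i)) p"
proof -
  interpret h: comm_ring_hom h by (rule h)
  have c1: "map_poly h [:a:] = [:h a:]" for a by (simp add: h.map_poly_pCons_hom)
  have "map_poly h (cpoly n \<iota> c p) = mpol_eval (\<lambda>a. map_poly h [:\<iota> a:])
      (\<lambda>i. map_poly h (if i = n then [:0, 1:] else [:c i:])) p"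
    unfolding cpoly_def by (rule hom_mpol_eval[OF comm_ring_hom_comp[OF const_poly_hom \<iota>] map_poly_hom[OF h]])
  also have "(\<lambda>i. map_poly h (if i = n then [:0, 1:] else [:c i:])) = (\<lambda>i. if i = n then [:0, 1:] else [:h (c i):])"
    by (auto simp: c1 h.map_poly_pCons_hom)
  finally show ?thesis by (simp add: cpoly_def c1)
qed

lemma poly_cpoly:
  assumes "comm_ring_hom \<iota>"
  shows "poly (cpoly n \<iota> c p) x = mpol_eval \<iota> (c(n := x)) p"
proof -
  have "poly (cpoly n \<iota> c p) x = mpol_eval (\<lambda>a. poly [:\<iota> a:] x) (\<lambda>i. poly (if i = n then [:0, 1:] else [:c i:]) x) p"
    unfolding cpoly_def
    by (rule hom_mpol_eval[OF comm_ring_hom_comp[OF const_poly_hom assms] poly_eval_hom])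
  also have "(\<lambda>i. poly (if i = n then [:0, 1:] else [:c i:]) x) = c(n := x)" by auto
  finally show ?thesis by (simp add: fun_upd_def)
qed

text \<open>Specializing all variables but one leaves a nonzero polynomial in one variable.\<close>

lemma cpoly_companion_nonsingular:
  fixes p :: "(nat, 'k::field_char_0) mpol"
  assumes n: "n > 0" and a: "ev a p \<noteq> 0"
  obtains s where "det (pmev (cpoly n (\<lambda>a. a) a p) (companion n (a(n := s)))) \<noteq> 0"
proof -
  have "poly (cpoly n (\<lambda>a. a) a p) (a n) = ev a p" by (simp add: poly_cpoly[OF id_hom])
  then have "cpoly n (\<lambda>a. a) a p \<noteq> 0" using a by auto
  then show ?thesis using companion_nonsingular_value[OF _ n, of _ a] that by blast
qed

text \<open>Compare the characteristic polynomials of \<open>t A\<close> at \<open>t x\<close> and of \<open>A\<close> at \<open>x\<close>.\<close>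

lemma cc_smult:
  fixes A :: "'k::field_char_0 mat"
  assumes A: "A \<in> carrier_mat n n" and i: "i \<le> n" and t: "t \<noteq> 0"
  shows "cc n (t \<cdot>\<^sub>m A) i = t ^ i * cc n A i"
proof -
  have tA: "t \<cdot>\<^sub>m A \<in> carrier_mat n n" using A by simp
  have "poly (char_poly (t \<cdot>\<^sub>m A) \<circ>\<^sub>p [:0, t:]) x = poly (Polynomial.smult (t ^ n) (char_poly A)) x" for x
  proof -
    have "- char_matrix (t \<cdot>\<^sub>m A) (t * x) = t \<cdot>\<^sub>m (- char_matrix A x)"
      using A by (intro eq_matI) (auto simp: char_matrix_def algebra_simps)
    then have "poly (char_poly (t \<cdot>\<^sub>m A)) (t * x) = t ^ n * poly (char_poly A) x"
      using A by (simp add: char_poly_matrix[OF A] char_poly_matrix[OF tA] char_matrix_def)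
    then show ?thesis by (simp add: poly_pcompose mult.commute)
  qed
  then have eq: "char_poly (t \<cdot>\<^sub>m A) \<circ>\<^sub>p [:0, t:] = Polynomial.smult (t ^ n) (char_poly A)"
    by (simp add: poly_eq_poly_eq_iff[symmetric] fun_eq_iff)
  have "Polynomial.coeff (char_poly (t \<cdot>\<^sub>m A)) (n - i) * t ^ (n - i) = t ^ n * Polynomial.coeff (char_poly A) (n - i)"
    using arg_cong[OF eq, of "\<lambda>p. Polynomial.coeff p (n - i)"] by (simp add: coeff_pcompose_linear mult.commute)
  also have "t ^ n = t ^ i * t ^ (n - i)" using i by (simp flip: power_add)
  finally show ?thesis using t by (simp add: cc_def)
qed

lemma mat_eq_uminus_if_add_eq_0:
  assumes "A \<in> carrier_mat n n" "B \<in> carrier_mat n n" "0\<^sub>m n n = A + (B :: 'a::comm_ring_1 mat)"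
  shows "A = - B"
proof (rule eq_matI)
  fix i j assume ij: "i < dim_row (- B)" "j < dim_col (- B)"
  then have "A $$ (i, j) + B $$ (i, j) = 0"
    using arg_cong[OF assms(3), of "\<lambda>M. M $$ (i, j)"] assms(1,2) by simp
  then show "A $$ (i, j) = (- B) $$ (i, j)" using ij by (simp add: eq_neg_iff_add_eq_0)
qed (use assms(1,2) in auto)

context generic_size
begin

lemma gact_gact:
  assumes "tuple A" and that: "r < m"
  shows "gact g (gact g' A) r = gact (mat m m (\<lambda>(k, h). \<Sum>l<m. g' $$ (k, l) * g $$ (l, h))) A r"
proof (rule eq_matI)
  fix i j assume "i < dim_row (gact (mat m m (\<lambda>(k, h). \<Sum>l<m. g' $$ (k, l) * g $$ (l, h))) A r)"
    "j < dim_col (gact (mat m m (\<lambda>(k, h). \<Sum>l<m. g' $$ (k, l) * g $$ (l, h))) A r)"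
  then have ij: "i < n" "j < n" by (auto simp: gact_def)
  have "gact g (gact g' A) r $$ (i, j) = (\<Sum>l<m. \<Sum>k<m. g' $$ (k, l) * g $$ (l, r) * A k $$ (i, j))"
    using ij by (simp add: gact_def sum_distrib_left mult_ac)
  also have "\<dots> = (\<Sum>k<m. \<Sum>l<m. g' $$ (k, l) * g $$ (l, r) * A k $$ (i, j))" by (rule sum.swap)
  also have "\<dots> = gact (mat m m (\<lambda>(k, h). \<Sum>l<m. g' $$ (k, l) * g $$ (l, h))) A r $$ (i, j)"
    using ij that by (simp add: gact_def sum_distrib_right)
  finally show "gact g (gact g' A) r $$ (i, j) = gact (mat m m (\<lambda>(k, h). \<Sum>l<m. g' $$ (k, l) * g $$ (l, h))) A r $$ (i, j)" .
qed (auto simp: gact_def)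

lemma gact_mult:
  assumes A: "tuple A" and g: "g \<in> carrier_mat m m" "g' \<in> carrier_mat m m" and r: "r < m"
  shows "gact g (gact g' A) r = gact (g' * g) A r"
proof -
  have "mat m m (\<lambda>(k, h). \<Sum>l<m. g' $$ (k, l) * g $$ (l, h)) = g' * g"
    by (rule eq_matI) (use g carrier_matD[OF g(1)] carrier_matD[OF g(2)] in
      \<open>simp_all add: mult_entry[OF g(2,1)] del: index_mult_mat(1)\<close>)
  then show ?thesis using gact_gact[OF A r, of g g'] by simp
qed

lemma gact_cong: "(\<And>r. r < m \<Longrightarrow> A r = B r) \<Longrightarrow> gact g A r = gact g B r"
  by (simp add: gact_def)

lemma conj_gact:
  assumes A: "tuple A" and g: "P \<in> carrier_mat n n" "Q \<in> carrier_mat n n"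
  shows "conj_tuple P Q (gact g A) r = gact g (conj_tuple P Q A) r"
proof (rule eq_matI)
  fix i j assume "i < dim_row (gact g (conj_tuple P Q A) r)" "j < dim_col (gact g (conj_tuple P Q A) r)"
  then have ij: "i < n" "j < n" by (auto simp: gact_def)
  have e: "(P * B * Q) $$ (i, j) = (\<Sum>b<n. \<Sum>a<n. P $$ (i, a) * B $$ (a, b) * Q $$ (b, j))"
    if "B \<in> carrier_mat n n" for B
    using mult_entry[OF mult_sq[OF g(1) that] g(2) ij] mult_entry[OF g(1) that ij(1)]
    by (simp add: sum_distrib_right del: index_mult_mat(1))
  have "conj_tuple P Q (gact g A) r $$ (i, j) =
      (\<Sum>b<n. \<Sum>a<n. \<Sum>l<m. g $$ (l, r) * (P $$ (i, a) * A l $$ (a, b) * Q $$ (b, j)))"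
    unfolding conj_tuple_def e[OF gact_tuple(2)]
    by (intro sum.cong refl) (simp add: gact_def sum_distrib_left sum_distrib_right mult_ac)
  also have "\<dots> = (\<Sum>l<m. \<Sum>b<n. \<Sum>a<n. g $$ (l, r) * (P $$ (i, a) * A l $$ (a, b) * Q $$ (b, j)))"
    by (subst sum.swap[of _ "{..<m}"], subst sum.swap[of _ "{..<m}"]) (rule refl)
  also have "\<dots> = (\<Sum>l<m. g $$ (l, r) * (P * A l * Q) $$ (i, j))"
    by (rule sum.cong[OF refl]) (use e[OF tupleD[OF A]] in \<open>simp add: sum_distrib_left del: index_mult_mat(1)\<close>)
  also have "\<dots> = gact g (conj_tuple P Q A) r $$ (i, j)"
    using ij by (simp add: gact_def conj_tuple_def del: index_mult_mat(1))
  finally show "conj_tuple P Q (gact g A) r $$ (i, j) = gact g (conj_tuple P Q A) r $$ (i, j)" .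
qed (use g in \<open>auto simp: conj_tuple_def gact_def\<close>)

lemma evp_cong:
  fixes p :: "'k::field_char_0 gpol"
  assumes "p \<in> mpol_in gvars" "\<And>r. r < m \<Longrightarrow> A r = B r"
  shows "evp A p = evp B p"
  by (rule mpol_eval_cong[OF assms(1) id_hom]) (auto simp: gvars_def assms(2))

lemma evm_cong:
  assumes "relevant Z" "\<And>r. r < m \<Longrightarrow> A r = B r"
  shows "evm A Z = evm B Z"
  by (rule eq_matI) (use assms(1) evp_cong[OF _ assms(2)] in \<open>auto simp: relevant_def\<close>)

lemma mpol_in_of_int: "of_int z \<in> (mpol_in I :: ('v, 'k::field_char_0) mpol set)"
proof -
  have "of_nat j \<in> (mpol_in I :: ('v, 'k) mpol set)" for j by (induction j) (auto intro: mpol_in_add)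
  then show ?thesis by (cases z) (auto intro!: mpol_in_uminus simp: mpol_in_add simp del: of_nat_Suc)
qed

lemma mpol_in_det:
  fixes A :: "('v, 'k::field_char_0) mpol mat"
  assumes A: "A \<in> carrier_mat l l" "\<And>i j. i < l \<Longrightarrow> j < l \<Longrightarrow> A $$ (i, j) \<in> mpol_in I"
  shows "det A \<in> mpol_in I"
  unfolding det_def'[OF A(1)]
  by (intro mpol_in_sum mpol_in_mult mpol_in_of_int mpol_in_prod A(2))
    (use permutes_in_image in fastforce)+

lemma TR_relevant_entry: "Z \<in> trace_ring m n \<Longrightarrow> i < n \<Longrightarrow> j < n \<Longrightarrow> Z $$ (i, j) \<in> mpol_in gvars"
  using TR_relevant by (auto simp: relevant_def)

lemma TR_scalar_relevant: "p \<cdot>\<^sub>m 1\<^sub>m n \<in> trace_ring m n \<Longrightarrow> p \<in> mpol_in gvars"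
  using TR_relevant_entry[of "p \<cdot>\<^sub>m 1\<^sub>m n" 0 0] n0 by simp

abbreviation YY :: "'k::field_char_0 gpol mat"
  where "YY \<equiv> Y_mat m n"

lemma YY_carrier [simp]: "YY \<in> carrier_mat n n"
  by (simp add: Y_mat_Yt)

abbreviation cY :: "nat \<Rightarrow> 'k::field_char_0 gpol"
  where "cY \<equiv> cc n YY"

lemma evp_cY: "tuple A \<Longrightarrow> evp A (cY i) = cc n (Yt A) i"
  using hom_cc[OF evp_hom YY_carrier] evm_Y by metis

text \<open>The value of a polynomial at \<open>c\<^sub>1, ..., c\<^sub>n\<^sub>-\<^sub>1\<close> and, for the variable \<open>n\<close>, at \<open>Y\<close>.\<close>

definition phi :: "(nat, 'k::field_char_0) mpol \<Rightarrow> 'k gpol mat"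
  where "phi p = pmev (cpoly n mconst cY p) YY"

lemma phi_carrier [simp]: "phi p \<in> carrier_mat n n"
  unfolding phi_def by (rule pmev_carrier[OF YY_carrier])

lemma phi_add: "phi (p + q) = phi p + phi q"
proof -
  interpret comm_ring_hom "cpoly n mconst cY :: (nat, 'a) mpol \<Rightarrow> _" by (rule cpoly_hom[OF mconst_hom])
  show ?thesis by (simp add: phi_def hom_add pmev_add[OF YY_carrier])
qed

lemma phi_mult: "phi (p * q) = phi p * phi q"
proof -
  interpret comm_ring_hom "cpoly n mconst cY :: (nat, 'a) mpol \<Rightarrow> _" by (rule cpoly_hom[OF mconst_hom])
  show ?thesis by (simp add: phi_def hom_mult pmev_mult[OF YY_carrier])
qed

lemma phi_simps: "phi (mconst a) = mconst a \<cdot>\<^sub>m 1\<^sub>m n" "phi (mvar n) = YY"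
  "i \<noteq> n \<Longrightarrow> phi (mvar i) = cY i \<cdot>\<^sub>m 1\<^sub>m n"
  by (simp_all add: phi_def cpoly_simps[OF mconst_hom] pmev_const[OF YY_carrier] pmev_X[OF YY_carrier])

lemma phi_one: "phi 1 = (1\<^sub>m n :: 'a::field_char_0 gpol mat)"
proof -
  have "phi (mconst 1) = mconst 1 \<cdot>\<^sub>m (1\<^sub>m n :: 'a gpol mat)" by (rule phi_simps(1))
  also have "\<dots> = 1\<^sub>m n" by (rule eq_matI) auto
  finally show ?thesis by simp
qed

lemma phi_uminus: "phi (- p) = - phi p"
proof -
  interpret comm_ring_hom "cpoly n mconst cY :: (nat, 'a) mpol \<Rightarrow> _" by (rule cpoly_hom[OF mconst_hom])
  have "pmev (- q) YY = - pmev q YY" for q :: "'a gpol poly"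
  proof -
    have "- q = Polynomial.smult (- 1) q" by simp
    then have "pmev (- q) YY = (- 1) \<cdot>\<^sub>m pmev q YY" by (simp only: pmev_smult[OF YY_carrier])
    also have "\<dots> = - pmev q YY" by (rule eq_matI) auto
    finally show ?thesis .
  qed
  then show ?thesis by (simp add: phi_def hom_uminus)
qed

lemma evm_phi:
  assumes A: "tuple A"
  shows "evm A (phi p) = pmev (cpoly n (\<lambda>a. a) (cc n (Yt A)) p) (Yt A)"
proof -
  have "evm A (phi p) = pmev (map_poly (evp A) (cpoly n mconst cY p)) (evm A YY)"
    unfolding phi_def by (rule hom_pmev[OF evp_hom YY_carrier])
  then show ?thesis by (simp add: hom_cpoly[OF evp_hom mconst_hom] evm_Y[OF A] evp_cY[OF A])
qed

lemma evm_phi_slice: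
  assumes p: "p \<in> mpol_in {1..n}"
  shows "evm (slice (companion n c)) (phi p) = pmev (cpoly n (\<lambda>a. a) c p) (companion n c)"
proof -
  have "cpoly n (\<lambda>a. a) (cc n (companion n c)) p = cpoly n (\<lambda>a. a) c p"
    by (rule cpoly_cong[OF id_hom p]) (auto simp: cc_companion)
  then show ?thesis by (simp add: evm_phi Yt_slice_companion)
qed

text \<open>The values of \<open>Y\<close> on the slice are the companion matrices; the constant term of the characteristic polynomial
  does not occur among the arguments of \<open>p\<close> and can be chosen freely.\<close>

lemma det_phi:
  fixes p :: "(nat, 'k::field_char_0) mpol"
  assumes p: "p \<in> mpol_in {1..n}" "p \<noteq> 0"
  shows "det (phi p) \<noteq> 0"
proof
  assume z: "det (phi p) = 0"
  obtain a where "ev a p \<noteq> 0" using mpol_eq_0_if_ev_0[of p] p(2) by blast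
  then obtain s where s: "det (pmev (cpoly n (\<lambda>a. a) a p) (companion n (a(n := s)))) \<noteq> 0"
    using cpoly_companion_nonsingular[OF n0] by blast
  have "cpoly n (\<lambda>a. a) a p = cpoly n (\<lambda>a. a) (a(n := s)) p"
    by (rule cpoly_cong[OF id_hom p(1)]) simp
  then have nz: "det (evm (slice (companion n (a(n := s)))) (phi p)) \<noteq> 0"
    using s by (simp add: evm_phi_slice[OF p(1)])
  interpret e: comm_ring_hom "evp (slice (companion n (a(n := s))))" by (rule evp_hom)
  show False using z nz by simp
qed

definition cY_ring :: "'k::field_char_0 gpol mat set"
  where "cY_ring = generate_ring (mat_alg n) (base_scalars n \<union> {cY i \<cdot>\<^sub>m 1\<^sub>m n | i. 1 \<le> i \<and> i \<le> n - 1} \<union> {YY})"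

lemma cY_ring_gens: "base_scalars n \<union> {cY i \<cdot>\<^sub>m 1\<^sub>m n | i. 1 \<le> i \<and> i \<le> n - 1} \<union> {YY} \<subseteq> carrier_mat n n"
  using base_scalars_carrier by auto

sublocale cY_ring: matrix_subring n "cY_ring :: 'k::field_char_0 gpol mat set"
  unfolding cY_ring_def by (rule generate_ring_subring[OF cY_ring_gens])

lemma cY_ring_gen: "mconst a \<cdot>\<^sub>m 1\<^sub>m n \<in> cY_ring" "1 \<le> i \<Longrightarrow> i \<le> n - 1 \<Longrightarrow> cY i \<cdot>\<^sub>m 1\<^sub>m n \<in> cY_ring" "YY \<in> cY_ring"
  unfolding cY_ring_def by (auto intro!: generate_ring.incl simp: base_scalars_def)

lemma phi_cY_ring: "p \<in> mpol_in {1..n} \<Longrightarrow> phi p \<in> cY_ring"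
proof (induction rule: mpol_induct)
  case (var v)
  then show ?case by (cases "v = n") (auto simp: phi_simps intro!: cY_ring_gen)
qed (auto simp: phi_simps phi_add phi_mult intro: cY_ring_gen cY_ring.add cY_ring.mult)

lemma cY_ring_phi: "cY_ring = phi ` mpol_in {1..n}"
proof
  have "matrix_subring n (phi ` mpol_in {1..n})"
  proof
    show "1\<^sub>m n \<in> phi ` mpol_in {1..n}" by (rule image_eqI[of _ _ 1]) (simp_all add: phi_one)
  qed (auto simp: phi_add[symmetric] phi_mult[symmetric] phi_uminus[symmetric] mpol_in_add mpol_in_mult
    mpol_in_uminus)
  moreover have "base_scalars n \<union> {cY i \<cdot>\<^sub>m 1\<^sub>m n | i. 1 \<le> i \<and> i \<le> n - 1} \<union> {YY} \<subseteq> phi ` mpol_in {1..n}"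
  proof -
    have "cY i \<cdot>\<^sub>m 1\<^sub>m n \<in> phi ` mpol_in {1..n}" if "1 \<le> i" "i \<le> n - 1" for i
      by (rule image_eqI[of _ _ "mvar i"]) (use that n0 in \<open>auto simp: phi_simps\<close>)
    moreover have "mconst a \<cdot>\<^sub>m 1\<^sub>m n \<in> phi ` mpol_in {1..n}" for a
      by (rule image_eqI[of _ _ "mconst a"]) (auto simp: phi_simps)
    moreover have "YY \<in> phi ` mpol_in {1..n}"
      by (rule image_eqI[of _ _ "mvar n"]) (use n0 in \<open>auto simp: phi_simps\<close>)
    ultimately show ?thesis by (auto simp: base_scalars_def)
  qed
  ultimately show "cY_ring \<subseteq> phi ` mpol_in {1..n}" unfolding cY_ring_def by (rule generate_ring_least)
qed (use phi_cY_ring in auto)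

lemma cY_ring_sub_TR: "cY_ring \<subseteq> (trace_ring m n :: 'k::field_char_0 gpol mat set)"
  unfolding cY_ring_def by (rule generate_ring_least[OF TR.matrix_subring_axioms])
    (auto simp: base_scalars_def TR_scalar Y_in_TR cc_def intro: TR_char_poly)

text \<open>The last coefficient is a polynomial in the others and \<open>Y\<close> by the Cayley--Hamilton theorem.\<close>

lemma cY_ring_cY: "cY i \<cdot>\<^sub>m 1\<^sub>m n \<in> (cY_ring :: 'k::field_char_0 gpol mat set)"
proof -
  let ?\<chi> = "char_poly YY :: 'k gpol poly"
  have Yc: "(YY :: 'k gpol mat) \<in> carrier_mat n n" by simp
  have cf: "Polynomial.coeff ?\<chi> j \<cdot>\<^sub>m 1\<^sub>m n \<in> cY_ring" if "j \<ge> 1" for j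
  proof -
    consider "j < n" | "j = n" | "j > n" by linarith
    then show ?thesis
    proof cases
      case 1
      then have j: "1 \<le> n - j" "n - j \<le> n - 1" "n - (n - j) = j" using that by auto
      show ?thesis using cY_ring_gen(2)[OF j(1,2)] by (simp only: cc_def j(3))
    next
      case 2
      then show ?thesis using cY_ring.one char_poly_degree(1)[OF Yc] cY_ring_gen(1)[of 1] by simp
    next
      case 3
      then show ?thesis using char_poly_degree(2)[OF Yc] cY_ring_gen(1)[of 0] by simp
    qed
  qed
  let ?W = "YY * pmev (poly_shift 1 ?\<chi>) YY"
  have W: "?W \<in> cY_ring"
    by (intro cY_ring.mult cY_ring_gen cY_ring.pmev) (simp add: coeff_poly_shift cf)
  have "?\<chi> = pCons (Polynomial.coeff ?\<chi> 0) (poly_shift 1 ?\<chi>)"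
    by (rule poly_eqI) (simp add: coeff_poly_shift coeff_pCons split: nat.splits)
  then have "0\<^sub>m n n = Polynomial.coeff ?\<chi> 0 \<cdot>\<^sub>m 1\<^sub>m n + ?W"
    using cayley_hamilton[OF Yc] pmev_pCons[OF Yc] by metis
  moreover have Wc: "?W \<in> carrier_mat n n" by (rule cY_ring.in_carrier[OF W])
  ultimately have "Polynomial.coeff ?\<chi> 0 \<cdot>\<^sub>m 1\<^sub>m n = - ?W"
    by (intro mat_eq_uminus_if_add_eq_0[OF _ Wc]) simp_all
  then have "Polynomial.coeff ?\<chi> 0 \<cdot>\<^sub>m 1\<^sub>m n \<in> cY_ring" using cY_ring.uminus[OF W] by simp
  then have "Polynomial.coeff ?\<chi> j \<cdot>\<^sub>m 1\<^sub>m n \<in> cY_ring" for j using cf[of j] by (cases j) auto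
  then show ?thesis by (simp add: cc_def)
qed

abbreviation subY :: "(nat, 'k::field_char_0) mpol \<Rightarrow> 'k gpol"
  where "subY \<equiv> mpol_eval mconst cY"

lemma cY_ring_subY: "subY p \<cdot>\<^sub>m 1\<^sub>m n \<in> cY_ring"
proof -
  interpret s: comm_ring_hom "subY :: (nat, 'a) mpol \<Rightarrow> _" by (rule mpol_eval_hom[OF mconst_hom])
  have "p \<in> mpol_in UNIV" by simp
  then show ?thesis
  proof (induction rule: mpol_induct)
    case (add p q)
    have "(subY p + subY q) \<cdot>\<^sub>m 1\<^sub>m n = subY p \<cdot>\<^sub>m 1\<^sub>m n + subY q \<cdot>\<^sub>m (1\<^sub>m n :: 'a gpol mat)"
      by (rule eq_matI) auto
    then show ?case using cY_ring.add[OF add] by (simp add: s.hom_add)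
  next
    case (mult p q)
    have "(subY p * subY q) \<cdot>\<^sub>m 1\<^sub>m n = subY p \<cdot>\<^sub>m (subY q \<cdot>\<^sub>m (1\<^sub>m n :: 'a gpol mat))"
      by (rule eq_matI) auto
    then show ?case using cY_ring.smult[OF mult] by (simp add: s.hom_mult)
  qed (simp_all add: mpol_eval_mconst[OF mconst_hom] mpol_eval_mvar[OF mconst_hom] cY_ring_gen cY_ring_cY)
qed

lemma evp_subY:
  assumes "tuple A"
  shows "evp A (subY p) = ev (cc n (Yt A)) p"
  using hom_mpol_eval[OF mconst_hom evp_hom, of A cY p] by (simp add: evp_cY[OF assms])

section \<open>Restriction of rational concomitants to a slice\<close>

text \<open>A rational concomitant is written as \<open>Z / d\<close>. On the slice \<open>gact h (slice C)\<close>, where \<open>C\<close> is a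
  companion matrix, its values commute with everything that commutes with \<open>C\<close>, because conjugation by
  such matrices can be undone by the special linear group. So the value is the polynomial in \<open>C\<close>
  whose coefficients are the entries of its zeroth column. Every generic tuple can be moved to the
  slice, which determines \<open>Z / d\<close> everywhere.\<close>

definition slice_at :: "'k::field_char_0 mat \<Rightarrow> (nat \<Rightarrow> 'k) \<Rightarrow> nat \<Rightarrow> 'k mat"
  where "slice_at h c = gact h (slice (companion n c))"

lemma slice_at_tuple [simp]: "tuple (slice_at h c)"
  by (simp add: slice_at_def)

definition column_poly :: "'a::comm_ring_1 mat \<Rightarrow> 'a poly"
  where "column_poly N = (\<Sum>i<n. Polynomial.monom (N $$ (i, 0)) i)"

lemma coeff_column_poly: "Polynomial.coeff (column_poly N) k = (if k < n then N $$ (k, 0) else 0)"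
  by (simp add: column_poly_def coeff_sum)

lemma slice_values:
  fixes Z :: "'k::field_char_0 gpol mat" and h :: "'k mat"
  assumes Z: "relevant Z" and d: "d \<in> mpol_in gvars"
    and Zconj: "\<And>A P Q. tuple A \<Longrightarrow> P \<in> carrier_mat n n \<Longrightarrow> Q \<in> carrier_mat n n \<Longrightarrow> P * Q = 1\<^sub>m n \<Longrightarrow>
      Q * P = 1\<^sub>m n \<Longrightarrow> evm (conj_tuple P Q A) Z = P * evm A Z * Q"
    and dconj: "\<And>A P Q. tuple A \<Longrightarrow> P \<in> carrier_mat n n \<Longrightarrow> Q \<in> carrier_mat n n \<Longrightarrow> P * Q = 1\<^sub>m n \<Longrightarrow>
      Q * P = 1\<^sub>m n \<Longrightarrow> evp (conj_tuple P Q A) d = evp A d"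
    and inv: "\<And>A g. tuple A \<Longrightarrow> g \<in> H \<Longrightarrow> evp A d \<cdot>\<^sub>m evm (gact g A) Z = evp (gact g A) d \<cdot>\<^sub>m evm A Z"
    and H: "SL m \<subseteq> H"
    and h: "h \<in> carrier_mat m m" "det h \<noteq> 0"
    and nz: "evp (slice_at h c) d \<noteq> 0"
  shows "evm (slice_at h c) Z = pmev (column_poly (evm (slice_at h c) Z)) (companion n c)"
proof -
  let ?C = "companion n c" and ?N = "evm (slice_at h c) Z"
  have Zc: "Z \<in> carrier_mat n n" using Z by (simp add: relevant_def)
  have N: "?N \<in> carrier_mat n n" using Zc by simp
  obtain e where e: "det (char_matrix ?C e) \<noteq> 0" using companion_commuting_unit[OF companion_carrier] by blast
  let ?g = "char_matrix ?C e"
  have g: "?g \<in> carrier_mat n n" by simp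
  obtain gi where gi: "gi \<in> carrier_mat n n" "?g * gi = 1\<^sub>m n" "gi * ?g = 1\<^sub>m n"
    using field_inverse_matrix[OF g e] by blast
  have gC: "?g = ?C + (- e) \<cdot>\<^sub>m 1\<^sub>m n" by (simp add: char_matrix_def companion_def)
  have comm: "?g * M = M * ?g \<longleftrightarrow> ?C * M = M * ?C" if M: "M \<in> carrier_mat n n" for M
  proof -
    have L: "?g * M = ?C * M + (- e) \<cdot>\<^sub>m M"
      unfolding gC by (subst add_mult_distrib_mat[of _ n n _ _ n])
        (use M in \<open>auto simp: mult_smult_assoc_mat[of _ n n _ n] left_mult_one_mat[OF M]\<close>)
    have R: "M * ?g = M * ?C + (- e) \<cdot>\<^sub>m M"
      unfolding gC by (subst mult_add_distrib_mat[of _ n n _ n])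
        (use M in \<open>auto simp: mult_smult_distrib[of _ n n _ n] right_mult_one_mat[OF M]\<close>)
    have "A = B" if "A + M' = B + M'" "A \<in> carrier_mat n n" "B \<in> carrier_mat n n" "M' \<in> carrier_mat n n"
      for A B M' :: "'k mat"
    proof (rule eq_matI)
      fix i j assume "i < dim_row B" "j < dim_col B"
      then show "A $$ (i, j) = B $$ (i, j)"
        using arg_cong[OF that(1), of "\<lambda>M. M $$ (i, j)"] that(2-4) by auto
    qed (use that in auto)
    then show ?thesis unfolding L R
      using M mult_sq[OF companion_carrier M] mult_sq[OF M companion_carrier] by (metis smult_carrier_mat)
  qed
  have "?g * ?C = ?C * ?g" using comm[OF companion_carrier] by simp
  then obtain s where s: "s \<in> carrier_mat m m" "det s = 1"
    "\<And>r. r < m \<Longrightarrow> conj_tuple ?g gi (slice ?C) r = gact s (slice ?C) r"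
    using slice_centralizer[OF g gi] by blast
  obtain hi where hi: "hi \<in> carrier_mat m m" "h * hi = 1\<^sub>m m" "hi * h = 1\<^sub>m m"
    using field_inverse_matrix[OF h] by blast
  \<comment> \<open>The translated point is moved by the conjugate of \<open>s\<close>, which again has determinant 1.\<close>
  let ?s = "hi * s * h"
  have dhi: "det h * det hi = 1" using det_mult[OF h(1) hi(1)] hi(2) by simp
  have s': "?s \<in> carrier_mat m m" "det ?s = 1"
  proof -
    show "?s \<in> carrier_mat m m" using hi s h by simp
    show "det ?s = 1" using dhi s(2)
      by (simp add: det_mult[OF mult_sq[OF hi(1) s(1)] h(1)] det_mult[OF hi(1) s(1)] mult.commute)
  qed
  have conj: "conj_tuple ?g gi (slice_at h c) r = gact ?s (slice_at h c) r" if r: "r < m" for r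
  proof -
    have "conj_tuple ?g gi (slice_at h c) r = gact h (conj_tuple ?g gi (slice ?C)) r"
      unfolding slice_at_def by (rule conj_gact) (use g gi in auto)
    also have "\<dots> = gact h (gact s (slice ?C)) r" by (rule gact_cong) (rule s(3))
    also have "\<dots> = gact (s * h) (slice ?C) r" by (rule gact_mult) (use h s r in auto)
    also have "s * h = h * ?s"
    proof -
      have sh: "s * h \<in> carrier_mat m m" using s h by simp
      have "h * ?s = h * (hi * (s * h))" by (simp only: assoc_mult_mat[OF hi(1) s(1) h(1)])
      also have "\<dots> = (h * hi) * (s * h)" by (rule assoc_mult_mat[OF h(1) hi(1) sh, symmetric])
      also have "\<dots> = s * h" by (simp only: hi(2) left_mult_one_mat[OF sh])
      finally show ?thesis by simp
    qed
    also have "gact (h * ?s) (slice ?C) r = gact ?s (gact h (slice ?C)) r"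
      by (rule gact_mult[symmetric]) (use h s' r in auto)
    finally show ?thesis by (simp add: slice_at_def)
  qed
  have sH: "?s \<in> H" using s' H by (auto simp: SL_def)
  have "evp (gact ?s (slice_at h c)) d = evp (conj_tuple ?g gi (slice_at h c)) d"
    by (rule evp_cong[OF d, symmetric]) (rule conj)
  also have "\<dots> = evp (slice_at h c) d" by (rule dconj) (use g gi in auto)
  finally have "evp (slice_at h c) d \<cdot>\<^sub>m evm (gact ?s (slice_at h c)) Z = evp (slice_at h c) d \<cdot>\<^sub>m ?N"
    using inv[OF slice_at_tuple sH] by simp
  then have "evm (gact ?s (slice_at h c)) Z = ?N"
  proof -
    assume eq: "evp (slice_at h c) d \<cdot>\<^sub>m evm (gact ?s (slice_at h c)) Z = evp (slice_at h c) d \<cdot>\<^sub>m ?N"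
    show ?thesis
    proof (rule eq_matI)
      fix i j assume "i < dim_row ?N" "j < dim_col ?N"
      then show "evm (gact ?s (slice_at h c)) Z $$ (i, j) = ?N $$ (i, j)"
        using arg_cong[OF eq, of "\<lambda>M. M $$ (i, j)"] nz by simp
    qed simp_all
  qed
  also have "evm (gact ?s (slice_at h c)) Z = evm (conj_tuple ?g gi (slice_at h c)) Z"
    by (rule evm_cong[OF Z, symmetric]) (rule conj)
  also have "\<dots> = ?g * ?N * gi" by (rule Zconj) (use g gi in auto)
  finally have "?g * ?N * gi * ?g = ?N * ?g" by simp
  then have "?g * ?N = ?N * ?g"
    using g gi N right_mult_one_mat[OF mult_sq[OF g N]] by (simp add: mat_assoc[where n = n])
  then have "?N * ?C = ?C * ?N" using comm[OF N] by simp
  then show ?thesis by (rule companion_centralizer[OF N]) (simp_all add: coeff_column_poly)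
qed

lemma slice_determines:
  fixes Z :: "'k::field_char_0 gpol mat" and h :: "'k mat"
  assumes Z: "relevant Z" and d: "d \<in> mpol_in gvars"
    and Zconj: "\<And>A P Q. tuple A \<Longrightarrow> P \<in> carrier_mat n n \<Longrightarrow> Q \<in> carrier_mat n n \<Longrightarrow> P * Q = 1\<^sub>m n \<Longrightarrow>
      Q * P = 1\<^sub>m n \<Longrightarrow> evm (conj_tuple P Q A) Z = P * evm A Z * Q"
    and dconj: "\<And>A P Q. tuple A \<Longrightarrow> P \<in> carrier_mat n n \<Longrightarrow> Q \<in> carrier_mat n n \<Longrightarrow> P * Q = 1\<^sub>m n \<Longrightarrow>
      Q * P = 1\<^sub>m n \<Longrightarrow> evp (conj_tuple P Q A) d = evp A d"
    and inv: "\<And>A g. tuple A \<Longrightarrow> g \<in> H \<Longrightarrow> evp A d \<cdot>\<^sub>m evm (gact g A) Z = evp (gact g A) d \<cdot>\<^sub>m evm A Z"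
    and H: "SL m \<subseteq> H"
    and h: "h \<in> carrier_mat m m" "det h \<noteq> 0"
    and nz: "evp (slice_at h c) d \<noteq> 0"
    and A: "tuple A" and k: "k \<in> H"
    and PQ: "P \<in> carrier_mat n n" "Q \<in> carrier_mat n n" "P * Q = 1\<^sub>m n" "Q * P = 1\<^sub>m n"
    and A_slice: "\<And>r. r < m \<Longrightarrow> conj_tuple P Q A r = gact k (slice_at h c) r"
  shows "evp (slice_at h c) d \<cdot>\<^sub>m evm A Z =
    evp A d \<cdot>\<^sub>m pmev (column_poly (evm (slice_at h c) Z)) (Q * companion n c * P)"
proof -
  let ?N = "evm (slice_at h c) Z" and ?C = "companion n c"
  have Zc: "Z \<in> carrier_mat n n" using Z by (simp add: relevant_def)
  have c: "evm A Z \<in> carrier_mat n n" "?N \<in> carrier_mat n n" using Zc by simp_all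
  have eZ: "P * evm A Z * Q = evm (gact k (slice_at h c)) Z"
    using Zconj[OF A PQ] evm_cong[OF Z, of "conj_tuple P Q A" "gact k (slice_at h c)", OF A_slice] by simp
  have ed: "evp A d = evp (gact k (slice_at h c)) d"
    using dconj[OF A PQ] evp_cong[OF d, of "conj_tuple P Q A" "gact k (slice_at h c)", OF A_slice] by simp
  have "evp (slice_at h c) d \<cdot>\<^sub>m (P * evm A Z * Q) = evp A d \<cdot>\<^sub>m ?N"
    unfolding eZ ed by (rule inv[OF slice_at_tuple k])
  then have "Q * (evp (slice_at h c) d \<cdot>\<^sub>m (P * evm A Z * Q)) * P = Q * (evp A d \<cdot>\<^sub>m ?N) * P" by simp
  moreover have "Q * (t \<cdot>\<^sub>m (P * M * Q)) * P = t \<cdot>\<^sub>m M" if M: "M \<in> carrier_mat n n" for t M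
  proof -
    have "Q * (t \<cdot>\<^sub>m (P * M * Q)) * P = t \<cdot>\<^sub>m (Q * (P * M * Q) * P)"
      using PQ(1,2) M by (simp add: mult_smult_distrib[of _ n n _ n] mult_smult_assoc_mat[of _ n n _ n])
    also have "Q * (P * M * Q) * P = (Q * P) * M * (Q * P)" using PQ(1,2) M by (simp add: mat_assoc[where n = n])
    finally show ?thesis using M by (simp add: PQ)
  qed
  moreover have "Q * (t \<cdot>\<^sub>m M) * P = t \<cdot>\<^sub>m (Q * M * P)" if M: "M \<in> carrier_mat n n" for t M
    using PQ(1,2) M by (simp add: mult_smult_distrib[of _ n n _ n] mult_smult_assoc_mat[of _ n n _ n])
  ultimately have "evp (slice_at h c) d \<cdot>\<^sub>m evm A Z = evp A d \<cdot>\<^sub>m (Q * ?N * P)" using c by simp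
  also have "Q * ?N * P = Q * pmev (column_poly ?N) ?C * P"
    by (rule arg_cong[where f = "\<lambda>M. Q * M * P", OF slice_values[OF Z d Zconj dconj inv H h nz]])
  also have "\<dots> = pmev (column_poly ?N) (Q * ?C * P)"
    by (rule pmev_conj[OF companion_carrier PQ(2,1,3,4), symmetric])
  finally show ?thesis .
qed

end

context generic_size
begin

text \<open>The pairs \<open>(Z, d)\<close> for which \<open>Z / d\<close> commutes with simultaneous conjugation and is invariant
  under \<open>H\<close>, as seen on points.\<close>

definition concomitant :: "'k::field_char_0 mat set \<Rightarrow> 'k gpol mat \<Rightarrow> 'k gpol \<Rightarrow> bool"
  where "concomitant H Z d \<longleftrightarrow> relevant Z \<and> d \<in> mpol_in gvars \<and> d \<noteq> 0 \<and>
    (\<forall>A P Q. tuple A \<longrightarrow> P \<in> carrier_mat n n \<longrightarrow> Q \<in> carrier_mat n n \<longrightarrow> P * Q = 1\<^sub>m n \<longrightarrow>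
      Q * P = 1\<^sub>m n \<longrightarrow> evm (conj_tuple P Q A) Z = P * evm A Z * Q \<and> evp (conj_tuple P Q A) d = evp A d) \<and>
    (\<forall>A g. tuple A \<longrightarrow> g \<in> H \<longrightarrow> evp A d \<cdot>\<^sub>m evm (gact g A) Z = evp (gact g A) d \<cdot>\<^sub>m evm A Z)"

lemma map_mat_add_hom:
  assumes "comm_ring_hom h" "A \<in> carrier_mat n n" "B \<in> carrier_mat n n"
  shows "map_mat h (A + B) = map_mat h A + map_mat h B"
proof -
  interpret comm_ring_hom h by fact
  show ?thesis by (rule eq_matI) (use assms in \<open>auto simp: hom_add\<close>)
qed

lemma relevant_smult: "p \<in> mpol_in gvars \<Longrightarrow> relevant Z \<Longrightarrow> relevant (p \<cdot>\<^sub>m Z)"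
  by (auto simp: relevant_def mpol_in_mult)

lemma slice_hom:
  assumes "comm_ring_hom h" and v: "v \<in> carrier_mat n n" and l: "l < m"
  shows "map_mat h (slice v l) = slice (map_mat h v) l"
proof -
  interpret comm_ring_hom h by fact
  show ?thesis
  proof (rule eq_matI)
    fix i j assume "i < dim_row (slice (map_mat h v) l)" "j < dim_col (slice (map_mat h v) l)"
    then have ij: "i < n" "j < n" using slice_tuple(2)[of "map_mat h v" l] by auto
    have "l < n\<^sup>2" using l n_sq by simp
    then have "pos_swap l < n * n" using pos_swap_less by (simp add: power2_eq_square)
    then have p: "pos_swap l div n < n" "pos_swap l mod n < n"
      using n0 by (simp_all add: less_mult_imp_div_less)
    have v': "map_mat h v $$ (pos_swap l mod n, pos_swap l div n) = h (v $$ (pos_swap l mod n, pos_swap l div n))"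
      using p v by simp
    have if_hom: "h (if b then x else y) = (if b then h x else h y)" for b x y by simp
    have "map_mat h (slice v l) $$ (i, j) = h (slice v l $$ (i, j))"
      using ij carrier_matD[OF slice_tuple(2), of v l] by simp
    also have "\<dots> = slice (map_mat h v) l $$ (i, j)"
      unfolding slice_entry[OF ij] v' by (simp only: hom_mult hom_minus hom_uminus hom_one hom_zero if_hom)
    finally show "map_mat h (slice v l) $$ (i, j) = slice (map_mat h v) l $$ (i, j)" .
  qed (use carrier_matD[OF slice_tuple(2), of v l] carrier_matD[OF slice_tuple(2), of "map_mat h v" l] in auto)
qed

text \<open>The restriction of \<open>p\<close> to the translate of the slice by \<open>s\<close>, as a polynomial in the entries of the
  companion matrix.\<close>

definition slice_poly :: "'k::field_char_0 mat \<Rightarrow> 'k gpol \<Rightarrow> (nat, 'k) mpol"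
  where "slice_poly s p = mpol_eval mconst
    (\<lambda>(a, i, j). gact (map_mat mconst s) (slice (companion n mvar)) a $$ (i, j)) p"

lemma ev_slice_poly:
  fixes p :: "'k::field_char_0 gpol"
  assumes s: "s \<in> carrier_mat m m" and p: "p \<in> mpol_in gvars"
  shows "ev c (slice_poly s p) = evp (slice_at s c) p"
proof -
  interpret e: comm_ring_hom "ev c :: (nat, 'k) mpol \<Rightarrow> 'k" by (rule ev_hom)
  have C: "map_mat (ev c) (companion n mvar) = companion n c"
    by (simp add: hom_companion[OF ev_hom] ev_mvar)
  have "ev c (gact (map_mat mconst s) (slice (companion n mvar)) a $$ (i, j)) = slice_at s c a $$ (i, j)"
    if "a < m" "i < n" "j < n" for a i j
  proof -
    have *: "ev c (slice (companion n mvar) l $$ (i, j)) = slice (companion n c) l $$ (i, j)" if "l < m" for l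
    proof -
      have "map_mat (ev c) (slice (companion n mvar) l) = slice (companion n c) l"
        using slice_hom[OF ev_hom companion_carrier that, of c] by (simp only: C)
      from arg_cong[OF this, of "\<lambda>M. M $$ (i, j)"] show ?thesis
        using \<open>i < n\<close> \<open>j < n\<close> by (simp only: index_map_mat(1) carrier_matD[OF slice_tuple(2)])
    qed
    show ?thesis using that s carrier_matD[OF s]
      by (simp add: slice_at_def gact_def e.hom_sum e.hom_mult * ev_mconst)
  qed
  then have "mpol_eval (\<lambda>a. ev c (mconst a))
      (\<lambda>v. ev c ((\<lambda>(a, i, j). gact (map_mat mconst s) (slice (companion n mvar)) a $$ (i, j)) v)) p =
    evp (slice_at s c) p"
    unfolding ev_mconst by (intro mpol_eval_cong[OF p id_hom]) (auto simp: gvars_def)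
  then show ?thesis
    by (simp only: slice_poly_def hom_mpol_eval[OF mconst_hom e.comm_ring_hom_axioms])
qed

text \<open>Where this determinant does not vanish, \<open>Y\<close> is conjugate to its companion matrix.\<close>

abbreviation kry :: "'k::field_char_0 gpol"
  where "kry \<equiv> det (krylov n YY)"

lemma evp_kry: "tuple A \<Longrightarrow> evp A kry = det (krylov n (Yt A))"
proof -
  assume A: "tuple A"
  interpret e: comm_ring_hom "evp A" by (rule evp_hom)
  show ?thesis using hom_krylov[OF evp_hom YY_carrier, of A] evm_Y[OF A] by (metis e.hom_det)
qed

lemma kry_in: "(kry :: 'a::field_char_0 gpol) \<in> mpol_in gvars"
proof (rule mpol_in_det[OF krylov_carrier])
  fix i j assume ij: "i < n" "j < n"
  have "pmev (Polynomial.monom 1 j) YY \<in> (trace_ring m n :: 'a gpol mat set)"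
  proof (rule TR.pmev[OF Y_in_TR])
    fix l show "Polynomial.coeff (Polynomial.monom 1 j) l \<cdot>\<^sub>m 1\<^sub>m n \<in> (trace_ring m n :: 'a gpol mat set)"
      using TR_scalar[of "if j = l then 1 else 0"] by (auto split: if_splits)
  qed
  from TR_relevant_entry[OF this ij(1) n0]
  show "krylov n (YY :: 'a gpol mat) $$ (i, j) \<in> mpol_in gvars" using ij by (simp add: krylov_def)
qed

lemma kry_nz: "(kry :: 'k::field_char_0 gpol) \<noteq> 0"
proof
  assume z: "(kry :: 'k gpol) = 0"
  interpret e: comm_ring_hom "evp (slice (companion n (\<lambda>_. 0 :: 'k)))" by (rule evp_hom)
  show False using evp_kry[OF slice_tuple(1), of "companion n (\<lambda>_. 0 :: 'k)"] z
    by (simp add: Yt_slice_companion krylov_companion)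
qed

text \<open>Where \<open>slice_determines\<close> applies, \<open>Z / d\<close> is the polynomial in \<open>Y\<close> with coefficients \<open>Z\<^sub>i\<^sub>0 / d\<close>, taken at the
  point of the slice with the same characteristic polynomial. Restricted to the slice, the numerators and the
  denominator are polynomials in \<open>c\<^sub>1, ..., c\<^sub>n\<close>. The slice is translated by \<open>s\<close> so that the
  denominator does not vanish on it.\<close>

theorem SL_concomitant:
  fixes Z :: "'k::field_char_0 gpol mat"
  assumes conc: "concomitant (SL m) Z d"
  obtains s W where "W \<in> cY_ring" "subY (slice_poly s d) \<cdot>\<^sub>m Z = d \<cdot>\<^sub>m W" "subY (slice_poly s d) \<noteq> 0"
proof -
  have Z: "relevant Z" and d: "d \<in> mpol_in gvars" "d \<noteq> 0"
    and Zconj: "\<And>A P Q. tuple A \<Longrightarrow> P \<in> carrier_mat n n \<Longrightarrow> Q \<in> carrier_mat n n \<Longrightarrow> P * Q = 1\<^sub>m n \<Longrightarrow>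
      Q * P = 1\<^sub>m n \<Longrightarrow> evm (conj_tuple P Q A) Z = P * evm A Z * Q"
    and dconj: "\<And>A P Q. tuple A \<Longrightarrow> P \<in> carrier_mat n n \<Longrightarrow> Q \<in> carrier_mat n n \<Longrightarrow> P * Q = 1\<^sub>m n \<Longrightarrow>
      Q * P = 1\<^sub>m n \<Longrightarrow> evp (conj_tuple P Q A) d = evp A d"
    and inv: "\<And>A g. tuple A \<Longrightarrow> g \<in> SL m \<Longrightarrow> evp A d \<cdot>\<^sub>m evm (gact g A) Z = evp (gact g A) d \<cdot>\<^sub>m evm A Z"
    using conc unfolding concomitant_def by simp_all
  have Zc: "Z \<in> carrier_mat n n" using Z by (simp add: relevant_def)
  \<comment> \<open>The normal form of a tuple with nonzero denominator determines the translation \<open>s\<close>.\<close>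
  have "\<exists>A. tuple A \<and> evp A (d * kry) \<noteq> 0"
    using evp_eq_0[of "d * kry"] mpol_in_mult[OF d(1) kry_in] d(2) kry_nz by auto
  then obtain X0 where X0: "tuple X0" "evp X0 (d * kry) \<noteq> 0" by blast
  interpret e0: comm_ring_hom "evp X0" by (rule evp_hom)
  have X0d: "evp X0 d \<noteq> 0" and X0k: "det (krylov n (Yt X0)) \<noteq> 0"
    using X0(2) by (auto simp: e0.hom_mult evp_kry[OF X0(1)])
  obtain P0 Q0 s where s: "P0 \<in> carrier_mat n n" "Q0 \<in> carrier_mat n n" "P0 * Q0 = 1\<^sub>m n" "Q0 * P0 = 1\<^sub>m n"
    "s \<in> carrier_mat m m" "det s = 1"
    "\<And>r. r < m \<Longrightarrow> conj_tuple P0 Q0 X0 r = gact s (slice (companion n (cc n (Yt X0)))) r"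
    using normal_form[OF X0(1) X0k] by metis
  let ?\<delta> = "slice_poly s d" and ?q = "\<Sum>i<n. Polynomial.monom (subY (slice_poly s (Z $$ (i, 0)))) i"
  let ?W = "pmev ?q YY"
  have ev\<delta>: "evp A (subY (slice_poly s p)) = evp (slice_at s (cc n (Yt A))) p"
    if "tuple A" "p \<in> mpol_in gvars" for A and p :: "'k gpol"
    by (simp only: evp_subY[OF that(1)] ev_slice_poly[OF s(5) that(2)])
  have "evp X0 (subY ?\<delta>) = evp (conj_tuple P0 Q0 X0) d"
    unfolding ev\<delta>[OF X0(1) d(1)] by (rule evp_cong[OF d(1)]) (simp add: s(7) slice_at_def)
  then have "evp X0 (subY ?\<delta>) \<noteq> 0" using dconj[OF X0(1) s(1-4)] X0d by simp
  then have \<delta>nz: "subY ?\<delta> \<noteq> 0" by auto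
  have \<delta>in: "subY ?\<delta> \<in> mpol_in gvars"
    by (rule TR_scalar_relevant) (use cY_ring_subY cY_ring_sub_TR in blast)
  have WR: "?W \<in> cY_ring"
  proof (rule cY_ring.pmev[OF cY_ring_gen(3)])
    interpret s: comm_ring_hom "subY :: (nat, 'k) mpol \<Rightarrow> _" by (rule mpol_eval_hom[OF mconst_hom])
    fix l
    have "Polynomial.coeff ?q l = subY (if l < n then slice_poly s (Z $$ (l, 0)) else 0)"
      by (simp add: coeff_sum)
    then show "Polynomial.coeff ?q l \<cdot>\<^sub>m 1\<^sub>m n \<in> cY_ring" by (simp only: cY_ring_subY)
  qed
  have Wrel: "relevant ?W" using WR cY_ring_sub_TR TR_relevant by blast
  have "subY ?\<delta> \<cdot>\<^sub>m Z = d \<cdot>\<^sub>m ?W"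
  proof (rule evm_eqI[OF relevant_smult[OF \<delta>in Z] relevant_smult[OF d(1) Wrel]])
    show "kry * subY ?\<delta> \<in> mpol_in gvars" by (rule mpol_in_mult[OF kry_in \<delta>in])
    show "kry * subY ?\<delta> \<noteq> 0" using kry_nz \<delta>nz by simp
    fix A :: "nat \<Rightarrow> 'k mat" assume A: "tuple A" "evp A (kry * subY ?\<delta>) \<noteq> 0"
    interpret e: comm_ring_hom "evp A" by (rule evp_hom)
    let ?c = "cc n (Yt A)"
    have k: "det (krylov n (Yt A)) \<noteq> 0" and nz: "evp (slice_at s ?c) d \<noteq> 0"
      using A(2) by (auto simp: e.hom_mult evp_kry[OF A(1)] ev\<delta>[OF A(1) d(1)])
    obtain P Q s' where PQ: "P \<in> carrier_mat n n" "Q \<in> carrier_mat n n" "P * Q = 1\<^sub>m n" "Q * P = 1\<^sub>m n"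
      and C: "P * Yt A * Q = companion n ?c" and s': "s' \<in> carrier_mat m m" "det s' = 1"
      "\<And>r. r < m \<Longrightarrow> conj_tuple P Q A r = gact s' (slice (companion n ?c)) r"
      using normal_form[OF A(1) k] by metis
    obtain si where si: "si \<in> carrier_mat m m" "s * si = 1\<^sub>m m" "si * s = 1\<^sub>m m"
      using field_inverse_matrix[OF s(5)] s(6) by (metis one_neq_zero)
    have "det si = 1" using det_mult[OF s(5) si(1)] si(2) s(6) by simp
    then have t: "si * s' \<in> SL m" using si s' by (simp add: SL_def det_mult[OF si(1) s'(1)])
    have A_slice: "conj_tuple P Q A r = gact (si * s') (slice_at s ?c) r" if r: "r < m" for r
    proof -
      have "s' = s * (si * s')"
        by (simp only: assoc_mult_mat[OF s(5) si(1) s'(1), symmetric] si(2) left_mult_one_mat[OF s'(1)])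
      then have "gact s' (slice (companion n ?c)) r = gact (s * (si * s')) (slice (companion n ?c)) r" by simp
      also have "\<dots> = gact (si * s') (slice_at s ?c) r"
        unfolding slice_at_def by (rule gact_mult[symmetric]) (use s si s' r in auto)
      finally show ?thesis using s'(3)[OF r] by simp
    qed
    have QP: "Q * companion n ?c * P = Yt A"
    proof -
      have "Q * (P * Yt A * Q) * P = (Q * P) * Yt A * (Q * P)"
        using PQ(1,2) by (simp add: mat_assoc[where n = n])
      then show ?thesis unfolding C by (simp add: PQ left_mult_one_mat[OF Yt_carrier] right_mult_one_mat[OF Yt_carrier])
    qed
    have col: "map_poly (evp A) ?q = column_poly (evm (slice_at s ?c) Z)"
    proof (rule poly_eqI)
      fix l
      have "Z $$ (l, 0) \<in> mpol_in gvars" if "l < n" using Z n0 that by (simp add: relevant_def)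
      then show "Polynomial.coeff (map_poly (evp A) ?q) l = Polynomial.coeff (column_poly (evm (slice_at s ?c) Z)) l"
        using Zc n0 by (simp add: coeff_column_poly coeff_sum e.hom_sum ev\<delta>[OF A(1)] if_distrib[of "evp A"])
    qed
    have "evm A (subY ?\<delta> \<cdot>\<^sub>m Z) = evp (slice_at s ?c) d \<cdot>\<^sub>m evm A Z"
      by (simp only: evm_smult ev\<delta>[OF A(1) d(1)])
    also have "\<dots> = evp A d \<cdot>\<^sub>m pmev (column_poly (evm (slice_at s ?c) Z)) (Q * companion n ?c * P)"
      by (rule slice_determines[OF Z d(1) Zconj dconj inv subset_refl s(5) _ nz A(1) t PQ A_slice])
        (simp_all add: s(6))
    also have "\<dots> = evp A d \<cdot>\<^sub>m pmev (map_poly (evp A) ?q) (evm A YY)"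
      by (simp only: QP col evm_Y[OF A(1)])
    also have "\<dots> = evm A (d \<cdot>\<^sub>m ?W)"
      by (simp only: evm_smult hom_pmev[OF evp_hom YY_carrier])
    finally show "evm A (subY ?\<delta> \<cdot>\<^sub>m Z) = evm A (d \<cdot>\<^sub>m ?W)" .
  qed
  then show ?thesis using that[OF WR _ \<delta>nz] by blast
qed

section \<open>The action on polynomials in the coefficients and \<open>Y\<close>\<close>

lemma act_YY:
  fixes g :: "'k::field_char_0 mat"
  assumes g: "g \<in> carrier_mat m m"
  shows "map_mat (act m g) YY = mconst (det g) \<cdot>\<^sub>m YY"
proof -
  have rel: "relevant (YY :: 'k gpol mat)" using TR_relevant Y_in_TR by blast
  have r1: "relevant (map_mat (act m g) YY)"
    using rel by (simp add: relevant_def act_relevant carrier_matD[OF YY_carrier])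
  show ?thesis
  proof (rule evm_eqI[OF r1 relevant_smult[OF _ rel], of _ 1])
    fix A :: "nat \<Rightarrow> 'k mat" assume A: "tuple A"
    show "evm A (map_mat (act m g) YY) = evm A (mconst (det g) \<cdot>\<^sub>m YY)"
      by (simp add: evm_act[OF rel] evm_smult evm_Y A Yt_gact[OF g] ev_mconst)
  qed auto
qed

lemma act_cY:
  fixes g :: "'k::field_char_0 mat"
  assumes g: "g \<in> carrier_mat m m" "det g \<noteq> 0" and i: "i \<le> n"
  shows "act m g (cY i) = mconst (det g ^ i) * cY i"
proof -
  have cin: "cY i \<in> mpol_in gvars"
    by (rule TR_scalar_relevant) (use cY_ring_cY cY_ring_sub_TR in blast)
  have "act m g (cY i) - mconst (det g ^ i) * cY i = 0"
  proof (rule evp_eq_0)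
    show "act m g (cY i) - mconst (det g ^ i) * cY i \<in> mpol_in gvars"
      using mpol_in_add[OF act_relevant[OF cin, of g] mpol_in_uminus[OF mpol_in_mult[OF _ cin, of "mconst (det g ^ i)"]]]
      by simp
    fix A :: "nat \<Rightarrow> 'k mat" assume A: "tuple A"
    interpret e: comm_ring_hom "evp A" by (rule evp_hom)
    show "evp A (act m g (cY i) - mconst (det g ^ i) * cY i) = 0"
      using A by (simp add: e.hom_minus e.hom_mult evp_act[OF cin] evp_cY Yt_gact[OF g(1)] ev_mconst
        cc_smult[OF Yt_carrier i g(2)])
  qed
  then show ?thesis by simp
qed

definition weight :: "nat \<Rightarrow> nat"
  where "weight i = (if i = n then 1 else i)"

text \<open>The effect of an element of determinant \<open>t\<close> on the polynomials in \<open>c\<^sub>1, ..., c\<^sub>n\<^sub>-\<^sub>1\<close> and \<open>Y\<close>.\<close>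

definition scale :: "'k::field_char_0 \<Rightarrow> (nat, 'k) mpol \<Rightarrow> (nat, 'k) mpol"
  where "scale t = mpol_eval mconst (\<lambda>i. mconst (t ^ weight i) * mvar i)"

lemma scale_in: "p \<in> mpol_in I \<Longrightarrow> scale t p \<in> mpol_in I"
  unfolding scale_def
  by (induction rule: mpol_induct)
    (simp_all add: mpol_eval_mconst[OF mconst_hom] mpol_eval_mvar[OF mconst_hom] mpol_eval_add[OF mconst_hom]
      mpol_eval_mult[OF mconst_hom] mpol_in_add mpol_in_mult)

lemma ev_scale: "ev y (scale t p) = ev (\<lambda>i. t ^ weight i * y i) p"
proof -
  interpret e: comm_ring_hom "ev y :: _ \<Rightarrow> 'a" by (rule ev_hom)
  show ?thesis
    unfolding scale_def using hom_mpol_eval[OF mconst_hom ev_hom, of y "\<lambda>i. mconst (t ^ weight i) * mvar i" p]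
    by (simp add: e.hom_mult ev_mconst ev_mvar)
qed

lemma scale_1: "scale 1 p = p"
proof -
  have "p \<in> mpol_in UNIV" by simp
  then show ?thesis unfolding scale_def
    by (induction rule: mpol_induct)
      (simp_all add: mpol_eval_mconst[OF mconst_hom] mpol_eval_mvar[OF mconst_hom] mpol_eval_add[OF mconst_hom]
      mpol_eval_mult[OF mconst_hom])
qed

lemma act_phi:
  fixes g :: "'k::field_char_0 mat"
  assumes g: "g \<in> carrier_mat m m" "det g \<noteq> 0" and p: "p \<in> mpol_in {1..n}"
  shows "map_mat (act m g) (phi p) = phi (scale (det g) p)"
proof -
  interpret a: comm_ring_hom "act m g" by (rule act_hom)
  have smult: "phi (mconst t * r) = mconst t \<cdot>\<^sub>m phi r" for t :: 'k and r
    by (simp add: phi_mult phi_simps mult_smult_assoc_mat[of _ n n _ n] left_mult_one_mat[OF phi_carrier])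
  have act_const: "act m g (mconst t) = mconst t" for t
    by (simp add: act_def mpol_eval_mconst[OF mconst_hom])
  show ?thesis using p
  proof (induction rule: mpol_induct)
    case (const t)
    have "map_mat (act m g) (mconst t \<cdot>\<^sub>m 1\<^sub>m n) = mconst t \<cdot>\<^sub>m 1\<^sub>m n"
      by (rule eq_matI) (auto simp: act_const a.hom_mult)
    then show ?case by (simp add: phi_simps scale_def mpol_eval_mconst[OF mconst_hom])
  next
    case (var i)
    have sc: "scale (det g) (mvar i) = mconst (det g ^ weight i) * mvar i"
      by (simp add: scale_def mpol_eval_mvar[OF mconst_hom])
    show ?case
    proof (cases "i = n")
      case True
      then show ?thesis unfolding sc smult by (simp add: phi_simps act_YY[OF g(1)] weight_def)
    next
      case False
      have "map_mat (act m g) (cY i \<cdot>\<^sub>m 1\<^sub>m n) = (mconst (det g ^ i) * cY i) \<cdot>\<^sub>m 1\<^sub>m n"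
        using var act_cY[OF g, of i] by (intro eq_matI) (auto simp: a.hom_mult)
      also have "\<dots> = mconst (det g ^ i) \<cdot>\<^sub>m (cY i \<cdot>\<^sub>m 1\<^sub>m n)" by (rule eq_matI) (auto simp: mult.assoc)
      finally show ?thesis unfolding sc smult using False by (simp add: phi_simps weight_def)
    qed
  next
    case (add p q)
    have "scale (det g) (p + q) = scale (det g) p + scale (det g) q"
      by (simp add: scale_def mpol_eval_add[OF mconst_hom])
    then show ?case using add by (simp add: phi_add map_mat_add_hom[OF act_hom phi_carrier phi_carrier])
  next
    case (mult p q)
    have "scale (det g) (p * q) = scale (det g) p * scale (det g) q"
      by (simp add: scale_def mpol_eval_mult[OF mconst_hom])
    then show ?case using mult by (simp add: phi_mult a.mat_hom_mult[OF phi_carrier phi_carrier])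
  qed
qed

lemma act_phi_SL:
  assumes "g \<in> SL m" "p \<in> mpol_in {1..n}"
  shows "map_mat (act m g) (phi p) = phi p"
  using act_phi[of g p] assms by (simp add: SL_def scale_1)

theorem SL_invariants: "mat_invariants m (SL m) (trace_ring m n) = (cY_ring :: 'k::field_char_0 gpol mat set)"
proof
  show "cY_ring \<subseteq> mat_invariants m (SL m) (trace_ring m n :: 'k gpol mat set)"
  proof
    fix Z :: "'k gpol mat" assume Z: "Z \<in> cY_ring"
    then obtain p where "p \<in> mpol_in {1..n}" "Z = phi p" unfolding cY_ring_phi by blast
    then show "Z \<in> mat_invariants m (SL m) (trace_ring m n)"
      using act_phi_SL cY_ring_sub_TR Z by (auto simp: mat_invariants_def)
  qed
  show "mat_invariants m (SL m) (trace_ring m n) \<subseteq> (cY_ring :: 'k gpol mat set)"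
  proof
    fix Z :: "'k gpol mat" assume "Z \<in> mat_invariants m (SL m) (trace_ring m n)"
    then have Z: "Z \<in> trace_ring m n" and inv: "\<And>g. g \<in> SL m \<Longrightarrow> map_mat (act m g) Z = Z"
      by (auto simp: mat_invariants_def)
    have rel: "relevant Z" by (rule TR_relevant[OF Z])
    have one: "evp A 1 = 1" for A :: "nat \<Rightarrow> 'k mat"
      using ev_mconst[of "pt A" 1] by simp
    have "concomitant (SL m) Z 1"
      unfolding concomitant_def
    proof (intro conjI allI impI rel)
      fix A :: "nat \<Rightarrow> 'k mat" and g :: "'k mat" assume "tuple A" "g \<in> SL m"
      then show "evp A 1 \<cdot>\<^sub>m evm (gact g A) Z = evp (gact g A) 1 \<cdot>\<^sub>m evm A Z"
        using evm_act[OF rel, of A g] inv[of g] by (simp add: one)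
    qed (use evm_conj[OF Z] in \<open>simp_all add: one\<close>)
    then obtain s W where W: "W \<in> cY_ring" "subY (slice_poly s 1) \<cdot>\<^sub>m Z = 1 \<cdot>\<^sub>m W"
      using SL_concomitant by blast
    have "slice_poly s 1 = 1" using mpol_eval_mconst[OF mconst_hom, of _ 1] by (simp add: slice_poly_def)
    then have "subY (slice_poly s 1) = 1" using mpol_eval_mconst[OF mconst_hom, of _ 1] by simp
    then have "1 \<cdot>\<^sub>m Z = 1 \<cdot>\<^sub>m W" using W(2) by simp
    moreover have "1 \<cdot>\<^sub>m M = M" for M :: "'k gpol mat" by (rule eq_matI) auto
    ultimately show "Z \<in> cY_ring" using W(1) by simp
  qed
qed

end

section \<open>Skew fields of fractions inside matrix rings\<close>

lemma mat_alg_inv: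
  fixes A :: "'a::comm_ring_1 mat"
  assumes "A \<in> carrier_mat n n" "B \<in> carrier_mat n n" "A * B = 1\<^sub>m n" "B * A = 1\<^sub>m n"
  shows "inv\<^bsub>mat_alg n\<^esub> A = B" "A \<in> Units (mat_alg n)"
proof -
  interpret R: ring "mat_alg n :: 'a mat ring" by (rule ring_mat)
  show "inv\<^bsub>mat_alg n\<^esub> A = B"
    using R.inv_char[of A B] assms by (simp add: ring_mat_simps)
  show "A \<in> Units (mat_alg n)" using assms by (auto simp: Units_def ring_mat_simps)
qed

lemma generate_field_least:
  fixes T :: "'a::comm_ring_1 mat set"
  assumes "S \<subseteq> T" "T \<subseteq> carrier_mat n n" "1\<^sub>m n \<in> T"
    and "\<And>A B. A \<in> T \<Longrightarrow> B \<in> T \<Longrightarrow> A + B \<in> T" "\<And>A B. A \<in> T \<Longrightarrow> B \<in> T \<Longrightarrow> A * B \<in> T"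
    and "\<And>A. A \<in> T \<Longrightarrow> - A \<in> T" "\<And>A. A \<in> T \<Longrightarrow> A \<noteq> 0\<^sub>m n n \<Longrightarrow> inv\<^bsub>mat_alg n\<^esub> A \<in> T"
  shows "generate_field (mat_alg n) S \<subseteq> T"
proof
  fix A assume "A \<in> generate_field (mat_alg n) S"
  then show "A \<in> T"
  proof (induction rule: generate_field.induct)
    case (a_inv h)
    then have "h \<in> carrier_mat n n" using assms(2) by blast
    then show ?case using assms(6) a_inv by (simp add: mat_alg_uminus)
  qed (use assms in \<open>auto simp: ring_mat_simps\<close>)
qed

lemma generate_field_mat:
  fixes S :: "'a::comm_ring_1 mat set"
  shows "A \<in> generate_field (mat_alg n) S \<Longrightarrow> B \<in> generate_field (mat_alg n) S \<Longrightarrow>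
      A + B \<in> generate_field (mat_alg n) S"
    "A \<in> generate_field (mat_alg n) S \<Longrightarrow> B \<in> generate_field (mat_alg n) S \<Longrightarrow>
      A * B \<in> generate_field (mat_alg n) S"
    "A \<in> generate_field (mat_alg n) S \<Longrightarrow> A \<noteq> 0\<^sub>m n n \<Longrightarrow>
      inv\<^bsub>mat_alg n\<^esub> A \<in> generate_field (mat_alg n) S"
    "A \<in> S \<Longrightarrow> A \<in> generate_field (mat_alg n) S"
  using generate_field.eng_add[of A "mat_alg n" S B] generate_field.eng_mult[of A "mat_alg n" S B]
    generate_field.m_inv[of A "mat_alg n" S] generate_field.incl[of A S "mat_alg n"]
  by (simp_all add: ring_mat_simps)

lemma to_fract_hom: "comm_ring_hom (to_fract :: 'a::idom \<Rightarrow> _)"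
  by unfold_locales simp_all

lemma frac_mat_mult:
  "A \<in> carrier_mat n n \<Longrightarrow> B \<in> carrier_mat n n \<Longrightarrow> frac_mat (A * B) = frac_mat A * frac_mat (B :: 'a::idom mat)"
proof -
  interpret t: comm_ring_hom "to_fract :: 'a \<Rightarrow> _" by (rule to_fract_hom)
  show "A \<in> carrier_mat n n \<Longrightarrow> B \<in> carrier_mat n n \<Longrightarrow> frac_mat (A * B) = frac_mat A * frac_mat B"
    by (rule t.mat_hom_mult)
qed

lemma frac_mat_smult: "frac_mat (a \<cdot>\<^sub>m A) = to_fract a \<cdot>\<^sub>m frac_mat A"
  by (rule eq_matI) auto

lemma frac_mat_one: "frac_mat (1\<^sub>m n) = (1\<^sub>m n :: 'a::idom fract mat)"
  by (rule eq_matI) auto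

lemma det_frac_mat: "det (frac_mat A) = to_fract (det (A :: 'a::idom mat))"
proof -
  interpret t: comm_ring_hom "to_fract :: 'a \<Rightarrow> _" by (rule to_fract_hom)
  show ?thesis by simp
qed

lemma frac_mat_inj: "frac_mat A = frac_mat B \<Longrightarrow> A = (B :: 'a::idom mat)"
proof (rule eq_matI)
  assume eq: "frac_mat A = frac_mat B"
  show d: "dim_row A = dim_row B" "dim_col A = dim_col B"
    using arg_cong[OF eq, of dim_row] arg_cong[OF eq, of dim_col] by simp_all
  fix i j assume "i < dim_row B" "j < dim_col B"
  then show "A $$ (i, j) = B $$ (i, j)" using arg_cong[OF eq, of "\<lambda>M. M $$ (i, j)"] d by simp
qed

lemma frac_inverse:
  fixes B :: "'a::idom mat"
  assumes B: "B \<in> carrier_mat n n" "det B \<noteq> 0"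
  obtains V where "V \<in> carrier_mat n n" "frac_mat B * V = 1\<^sub>m n" "V * frac_mat B = 1\<^sub>m n"
    "inv\<^bsub>mat_alg n\<^esub> (frac_mat B) = V" "frac_mat B \<in> Units (mat_alg n)"
proof -
  have FB: "frac_mat B \<in> carrier_mat n n" using B by simp
  have "det (frac_mat B) \<noteq> 0" using B(2) by (simp add: det_frac_mat)
  then obtain V where "V \<in> carrier_mat n n" "frac_mat B * V = 1\<^sub>m n" "V * frac_mat B = 1\<^sub>m n"
    using field_inverse_matrix[OF FB] by blast
  then show ?thesis using that mat_alg_inv[OF FB] by blast
qed

lemma smult_cancel:
  fixes A :: "'a::field mat"
  assumes "a \<cdot>\<^sub>m A = a \<cdot>\<^sub>m B" "a \<noteq> 0" "A \<in> carrier_mat n n" "B \<in> carrier_mat n n"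
  shows "A = B"
proof (rule eq_matI)
  fix i j assume "i < dim_row B" "j < dim_col B"
  then show "A $$ (i, j) = B $$ (i, j)"
    using arg_cong[OF assms(1), of "\<lambda>M. M $$ (i, j)"] assms(2-4) by simp
qed (use assms(3,4) in auto)

lemma frac_ext_hom:
  fixes h :: "'a::idom \<Rightarrow> 'a"
  assumes h: "comm_ring_hom h" and nz: "\<And>q. q \<noteq> 0 \<Longrightarrow> h q \<noteq> 0"
  shows "comm_ring_hom (frac_ext h)" "frac_ext h (to_fract p) = to_fract (h p)"
proof -
  interpret comm_ring_hom h by (rule h)
  note ext = frac_ext_Fract[of h, OF hom_mult nz]
  show e: "frac_ext h (to_fract p) = to_fract (h p)" for p
    using ext[of 1 p] by (simp add: to_fract_def)
  show "comm_ring_hom (frac_ext h)"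
  proof
    show "frac_ext h 1 = 1" using e[of 1] by simp
    show "frac_ext h 0 = 0" using e[of 0] by simp
    fix x y :: "'a fract"
    obtain a b where x: "x = Fract a b" "b \<noteq> 0" by (cases x) auto
    obtain c d where y: "y = Fract c d" "d \<noteq> 0" by (cases y) auto
    show "frac_ext h (x + y) = frac_ext h x + frac_ext h y"
      using x(2) y(2) nz[OF x(2)] nz[OF y(2)] by (simp add: x(1) y(1) ext hom_add hom_mult)
    show "frac_ext h (x * y) = frac_ext h x * frac_ext h y"
      using x(2) y(2) nz[OF x(2)] nz[OF y(2)] by (simp add: x(1) y(1) ext hom_mult)
  qed
qed

text \<open>The action is invertible. In particular it is injective and extends to fractions.\<close>

lemma act_act:
  fixes g :: "'k::field_char_0 mat"
  assumes g: "g \<in> carrier_mat m m" "g' \<in> carrier_mat m m" "g' * g = 1\<^sub>m m"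
  shows "act m g' (act m g p) = p"
proof -
  interpret a: comm_ring_hom "act m g'" unfolding act_def by (rule mpol_eval_hom[OF mconst_hom])
  interpret b: comm_ring_hom "act m g" unfolding act_def by (rule mpol_eval_hom[OF mconst_hom])
  have ac: "act m g (mconst t) = mconst t" for g :: "'k mat" and t
    by (simp add: act_def mpol_eval_mconst[OF mconst_hom])
  have p: "p \<in> mpol_in UNIV" by simp
  interpret mc: comm_ring_hom "mconst :: 'k \<Rightarrow> 'k gpol" by (rule mconst_hom)
  show ?thesis using p
  proof (induction rule: mpol_induct)
    case (var v)
    obtain h a b where v: "v = (h, a, b)" by (cases v) auto
    show ?case
    proof (cases "h < m")
      case h: True
      have "act m g' (act m g (mvar v)) =
          (\<Sum>i<m. mconst (g $$ (i, h)) * (\<Sum>l<m. mconst (g' $$ (l, i)) * mvar (l, a, b)))"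
        unfolding v act_mvar[OF h] by (simp add: a.hom_sum a.hom_mult ac act_mvar)
      also have "\<dots> = (\<Sum>l<m. \<Sum>i<m. mconst (g' $$ (l, i) * g $$ (i, h)) * mvar (l, a, b))"
        unfolding sum_distrib_left by (subst sum.swap) (simp add: mc.hom_mult mult_ac)
      also have "\<dots> = (\<Sum>l<m. mconst ((g' * g) $$ (l, h)) * mvar (l, a, b))"
        by (rule sum.cong[OF refl])
          (use h in \<open>simp add: mult_entry[OF g(2,1)] mc.hom_sum sum_distrib_right del: index_mult_mat(1)\<close>)
      also have "\<dots> = (\<Sum>l<m. if l = h then mvar (l, a, b) else 0)"
        unfolding g(3) by (rule sum.cong[OF refl]) (use h in auto)
      finally show ?thesis using h by (simp add: v)
    next
      case False
      then show ?thesis by (simp add: v act_def mpol_eval_mvar[OF mconst_hom])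
    qed
  qed (simp_all add: ac a.hom_add b.hom_add a.hom_mult b.hom_mult)
qed

context generic_size
begin

lemma frac_act:
  fixes g :: "'k::field_char_0 mat"
  assumes g: "g \<in> GL m"
  shows "comm_ring_hom (frac_ext (act m g))"
    "map_mat (frac_ext (act m g)) (frac_mat Z) = frac_mat (map_mat (act m g) Z)"
proof -
  have gc: "g \<in> carrier_mat m m" "det g \<noteq> 0" using g by (auto simp: GL_def)
  obtain g' where g': "g' \<in> carrier_mat m m" "g' * g = 1\<^sub>m m" using field_inverse_matrix[OF gc] by blast
  interpret g': comm_ring_hom "act m g'" by (rule act_hom)
  have nz: "act m g q \<noteq> 0" if "q \<noteq> 0" for q
    using act_act[OF gc(1) g', of q] that by (metis g'.hom_zero)
  note h = frac_ext_hom[of "act m g", OF act_hom nz]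
  show "comm_ring_hom (frac_ext (act m g))" by (rule h(1))
  show "map_mat (frac_ext (act m g)) (frac_mat Z) = frac_mat (map_mat (act m g) Z)"
    by (rule eq_matI) (simp_all add: h(2))
qed

lemma SL_GL: "SL m \<subseteq> GL m"
  by (auto simp: SL_def GL_def)

lemma UD_iff:
  "U \<in> UD m n \<longleftrightarrow> U \<in> carrier_mat n n \<and>
    (\<exists>A B. A \<in> generic_algebra m n \<and> B \<in> (generic_algebra m n :: 'k::field_char_0 gpol mat set) \<and> det B \<noteq> 0 \<and>
      U * frac_mat B = frac_mat A)"
proof
  assume "U \<in> UD m n"
  then obtain A B :: "'k gpol mat" where AB: "A \<in> generic_algebra m n" "B \<in> generic_algebra m n"
    "frac_mat B \<in> Units (mat_alg n)" "U = frac_mat A * inv\<^bsub>mat_alg n\<^esub> (frac_mat B)"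
    by (auto simp: UD_def ring_mat_simps)
  note c = GA.in_carrier[OF AB(1)] GA.in_carrier[OF AB(2)]
  obtain V where V: "V \<in> carrier_mat n n" "frac_mat B * V = 1\<^sub>m n"
    using AB(3) by (auto simp: Units_def ring_mat_simps)
  have FB: "frac_mat B \<in> carrier_mat n n" using c by simp
  have "det (frac_mat B) * det V = 1" using det_mult[OF FB V(1)] V(2) by simp
  then have d: "det B \<noteq> 0" by (auto simp: det_frac_mat)
  obtain W where W: "W \<in> carrier_mat n n" "W * frac_mat B = 1\<^sub>m n" "inv\<^bsub>mat_alg n\<^esub> (frac_mat B) = W"
    using frac_inverse[OF c(2) d] by metis
  have FA: "frac_mat A \<in> carrier_mat n n" using c by simp
  have "U * frac_mat B = frac_mat A"
    unfolding AB(4) W(3) assoc_mult_mat[OF FA W(1) FB] W(2) by (rule right_mult_one_mat[OF FA])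
  moreover have "U \<in> carrier_mat n n" unfolding AB(4) W(3) by (rule mult_carrier_mat[OF FA W(1)])
  ultimately show "U \<in> carrier_mat n n \<and> (\<exists>A B. A \<in> generic_algebra m n \<and>
      B \<in> (generic_algebra m n :: 'k gpol mat set) \<and> det B \<noteq> 0 \<and> U * frac_mat B = frac_mat A)"
    using AB(1,2) d by blast
next
  assume "U \<in> carrier_mat n n \<and> (\<exists>A B. A \<in> generic_algebra m n \<and>
      B \<in> (generic_algebra m n :: 'k gpol mat set) \<and> det B \<noteq> 0 \<and> U * frac_mat B = frac_mat A)"
  then obtain A B :: "'k gpol mat" where U: "U \<in> carrier_mat n n" and AB: "A \<in> generic_algebra m n"
    "B \<in> generic_algebra m n" "det B \<noteq> 0" "U * frac_mat B = frac_mat A" by blast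
  note c = GA.in_carrier[OF AB(1)] GA.in_carrier[OF AB(2)]
  obtain W where W: "W \<in> carrier_mat n n" "frac_mat B * W = 1\<^sub>m n" "inv\<^bsub>mat_alg n\<^esub> (frac_mat B) = W"
    "frac_mat B \<in> Units (mat_alg n)"
    using frac_inverse[OF c(2) AB(3)] by metis
  have FB: "frac_mat B \<in> carrier_mat n n" using c by simp
  have "U = frac_mat A * W"
    unfolding AB(4)[symmetric] assoc_mult_mat[OF U FB W(1)] W(2) by (rule right_mult_one_mat[OF U, symmetric])
  then show "U \<in> UD m n"
    using AB(1,2) W(3,4) by (auto simp: UD_def ring_mat_simps)
qed

abbreviation Fp :: "(nat, 'k::field_char_0) mpol \<Rightarrow> 'k gpol fract mat"
  where "Fp p \<equiv> frac_mat (phi p)"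

lemma Fp_carrier: "Fp p \<in> carrier_mat n n"
  using phi_carrier by simp

lemma Fp_mult: "Fp (p * q) = Fp p * Fp q"
  unfolding phi_mult by (rule frac_mat_mult[OF phi_carrier phi_carrier])

lemma Fp_add: "Fp (p + q) = Fp p + Fp q"
  unfolding phi_add by (rule map_mat_add_hom[OF to_fract_hom phi_carrier phi_carrier])

lemma Fp_one: "Fp 1 = 1\<^sub>m n"
  by (simp only: phi_one frac_mat_one)

lemma Fp_zero: "Fp 0 = 0\<^sub>m n n"
proof -
  have "phi (mconst 0) = (0\<^sub>m n n :: 'a gpol mat)" unfolding phi_simps by (rule eq_matI) auto
  then have "phi 0 = (0\<^sub>m n n :: 'a gpol mat)" by simp
  then show ?thesis by (intro eq_matI) auto
qed

lemma Fp_cancel: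
  assumes A: "A \<in> carrier_mat n n" "B \<in> carrier_mat n n" and q: "q \<in> mpol_in {1..n}" "q \<noteq> 0"
    and eq: "A * Fp q = B * Fp q"
  shows "A = B"
proof -
  obtain V where V: "V \<in> carrier_mat n n" "Fp q * V = 1\<^sub>m n"
    using frac_inverse[OF phi_carrier det_phi[OF q]] by metis
  have "A * Fp q * V = B * Fp q * V" using eq by simp
  then show ?thesis
    unfolding assoc_mult_mat[OF A(1) Fp_carrier V(1)] assoc_mult_mat[OF A(2) Fp_carrier V(1)] V(2)
    by (simp only: right_mult_one_mat[OF A(1)] right_mult_one_mat[OF A(2)])
qed

lemma phi_inj:
  fixes p :: "(nat, 'k::field_char_0) mpol"
  assumes "p \<in> mpol_in {1..n}" "q \<in> mpol_in {1..n}" "phi p = phi q"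
  shows "p = q"
proof (rule ccontr)
  assume "p \<noteq> q"
  moreover have "p - q \<in> mpol_in {1..n}"
    using mpol_in_add[OF assms(1) mpol_in_uminus[OF assms(2)]] by simp
  ultimately have "det (phi (p - q)) \<noteq> 0" using det_phi[of "p - q"] by simp
  moreover have "phi (p - q) = 0\<^sub>m n n"
  proof -
    have "phi (p + - q) = phi q + - phi q" unfolding phi_add phi_uminus assms(3) ..
    also have "\<dots> = 0\<^sub>m n n" by (rule eq_matI) (auto simp: carrier_matD[OF phi_carrier])
    finally show ?thesis by simp
  qed
  ultimately show False using n0 by simp
qed

text \<open>The fractions \<open>U = P Q\<inverse>\<close> with \<open>P\<close> and \<open>Q \<noteq> 0\<close> in the ring generated by the coefficients and \<open>Y\<close>.\<close>

definition cY_field :: "'k::field_char_0 gpol fract mat set"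
  where "cY_field = {U \<in> carrier_mat n n. \<exists>p q. p \<in> mpol_in {1..n} \<and> q \<in> mpol_in {1..n} \<and> q \<noteq> 0 \<and> U * Fp q = Fp p}"

lemma cY_fieldI: "U \<in> carrier_mat n n \<Longrightarrow> p \<in> mpol_in {1..n} \<Longrightarrow> q \<in> mpol_in {1..n} \<Longrightarrow> q \<noteq> 0 \<Longrightarrow> U * Fp q = Fp p \<Longrightarrow> U \<in> cY_field"
  unfolding cY_field_def by blast

lemma cY_fieldE:
  assumes "U \<in> cY_field"
  obtains p q where "U \<in> carrier_mat n n" "p \<in> mpol_in {1..n}" "q \<in> mpol_in {1..n}" "q \<noteq> 0" "U * Fp q = Fp p"
  using assms unfolding cY_field_def by blast

lemma Fp_expand:
  assumes "U \<in> carrier_mat n n" "U * Fp q = Fp p"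
  shows "U * Fp (q * r) = Fp (p * r)" "U * Fp (r * q) = Fp (r * p)"
proof -
  show 1: "U * Fp (q * r) = Fp (p * r)" for r
    unfolding Fp_mult assms(2)[symmetric] by (rule assoc_mult_mat[OF assms(1) Fp_carrier Fp_carrier, symmetric])
  show "U * Fp (r * q) = Fp (r * p)" using 1[of r] by (simp only: mult.commute)
qed

lemma cY_field_comm:
  assumes U: "U \<in> cY_field"
  shows "U * Fp r = Fp r * U"
proof -
  obtain p q where pq: "U \<in> carrier_mat n n" "p \<in> mpol_in {1..n}" "q \<in> mpol_in {1..n}" "q \<noteq> 0" "U * Fp q = Fp p"
    by (rule cY_fieldE[OF U])
  have "U * Fp r * Fp q = Fp (r * p)"
    unfolding assoc_mult_mat[OF pq(1) Fp_carrier Fp_carrier] Fp_mult[symmetric] by (rule Fp_expand(2)[OF pq(1,5)])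
  also have "\<dots> = Fp r * U * Fp q"
    unfolding assoc_mult_mat[OF Fp_carrier pq(1) Fp_carrier] pq(5) Fp_mult ..
  finally show ?thesis
    by (rule Fp_cancel[rotated 4]) (use pq Fp_carrier mult_sq in auto)
qed

lemma cY_field_add:
  assumes "U \<in> cY_field" "U' \<in> cY_field"
  shows "U + U' \<in> cY_field"
proof -
  obtain p q where pq: "U \<in> carrier_mat n n" "p \<in> mpol_in {1..n}" "q \<in> mpol_in {1..n}" "q \<noteq> 0" "U * Fp q = Fp p"
    by (rule cY_fieldE[OF assms(1)])
  obtain p' q' where pq': "U' \<in> carrier_mat n n" "p' \<in> mpol_in {1..n}" "q' \<in> mpol_in {1..n}" "q' \<noteq> 0" "U' * Fp q' = Fp p'"
    by (rule cY_fieldE[OF assms(2)])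
  have "(U + U') * Fp (q * q') = Fp (p * q' + q * p')"
    unfolding add_mult_distrib_mat[OF pq(1) pq'(1) Fp_carrier] Fp_expand(1)[OF pq(1,5)] Fp_expand(2)[OF pq'(1,5)] Fp_add ..
  then show ?thesis
    by (rule cY_fieldI[rotated 4]) (use pq pq' in \<open>auto intro: mpol_in_add mpol_in_mult\<close>)
qed

lemma cY_field_mult:
  assumes "U \<in> cY_field" "U' \<in> cY_field"
  shows "U * U' \<in> cY_field"
proof -
  obtain p q where pq: "U \<in> carrier_mat n n" "p \<in> mpol_in {1..n}" "q \<in> mpol_in {1..n}" "q \<noteq> 0" "U * Fp q = Fp p"
    by (rule cY_fieldE[OF assms(1)])
  obtain p' q' where pq': "U' \<in> carrier_mat n n" "p' \<in> mpol_in {1..n}" "q' \<in> mpol_in {1..n}" "q' \<noteq> 0" "U' * Fp q' = Fp p'"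
    by (rule cY_fieldE[OF assms(2)])
  have "U * U' * Fp (q' * q) = Fp (p * p')"
    unfolding assoc_mult_mat[OF pq(1) pq'(1) Fp_carrier] Fp_expand(1)[OF pq'(1,5)]
    using Fp_expand(2)[OF pq(1,5), of p'] by (simp only: mult.commute)
  then show ?thesis
    by (rule cY_fieldI[rotated 4]) (use pq pq' in \<open>auto intro: mpol_in_mult\<close>)
qed

lemma Fp_cY_field: "p \<in> mpol_in {1..n} \<Longrightarrow> Fp p \<in> cY_field"
  by (rule cY_fieldI[OF Fp_carrier, of p 1]) (simp_all add: Fp_one right_mult_one_mat[OF Fp_carrier])

lemma cY_field_carrier: "U \<in> cY_field \<Longrightarrow> U \<in> carrier_mat n n"
  by (rule cY_fieldE)

lemma cY_field_uminus: "U \<in> cY_field \<Longrightarrow> - U \<in> (cY_field :: 'k::field_char_0 gpol fract mat set)"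
proof -
  assume U: "U \<in> cY_field"
  have "Fp (- 1 :: (nat, 'k) mpol) * U \<in> cY_field"
    by (rule cY_field_mult[OF Fp_cY_field U]) (simp add: mpol_in_uminus)
  moreover have "Fp (- 1 :: (nat, 'k) mpol) = (- 1) \<cdot>\<^sub>m 1\<^sub>m n"
    unfolding phi_uminus phi_one by (rule eq_matI) auto
  moreover have "((- 1) \<cdot>\<^sub>m 1\<^sub>m n) * U = - U"
    using cY_field_carrier[OF U] by (simp add: mult_smult_assoc_mat[of _ n n _ n] left_mult_one_mat[OF cY_field_carrier[OF U]])
      (rule eq_matI, auto)
  ultimately show ?thesis by simp
qed

lemma cY_field_inv:
  assumes U: "U \<in> cY_field" "U \<noteq> 0\<^sub>m n n"
  shows "inv\<^bsub>mat_alg n\<^esub> U \<in> cY_field" "U * inv\<^bsub>mat_alg n\<^esub> U = 1\<^sub>m n" "inv\<^bsub>mat_alg n\<^esub> U * U = 1\<^sub>m n"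
proof -
  obtain p q where pq: "U \<in> carrier_mat n n" "p \<in> mpol_in {1..n}" "q \<in> mpol_in {1..n}" "q \<noteq> 0" "U * Fp q = Fp p"
    by (rule cY_fieldE[OF U(1)])
  have p: "p \<noteq> 0"
  proof
    assume "p = 0"
    then have "U * Fp q = 0\<^sub>m n n * Fp q"
      using pq(5) Fp_zero left_mult_zero_mat[OF Fp_carrier] by metis
    then show False using Fp_cancel[OF pq(1) zero_carrier_mat pq(3,4)] U(2) by blast
  qed
  obtain V where V: "V \<in> carrier_mat n n" "Fp p * V = 1\<^sub>m n" "V * Fp p = 1\<^sub>m n"
    using frac_inverse[OF phi_carrier det_phi[OF pq(2) p]] by metis
  let ?Y = "Fp q * V"
  have Y: "?Y \<in> carrier_mat n n" by (rule mult_carrier_mat[OF Fp_carrier V(1)])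
  have XY: "U * ?Y = 1\<^sub>m n"
    by (simp only: assoc_mult_mat[OF pq(1) Fp_carrier V(1), symmetric] pq(5) V(2))
  have YX: "?Y * U = 1\<^sub>m n" by (rule mat_mult_left_right_inverse[OF pq(1) Y XY])
  have i: "inv\<^bsub>mat_alg n\<^esub> U = ?Y" by (rule mat_alg_inv(1)[OF pq(1) Y XY YX])
  show "U * inv\<^bsub>mat_alg n\<^esub> U = 1\<^sub>m n" "inv\<^bsub>mat_alg n\<^esub> U * U = 1\<^sub>m n" unfolding i by (rule XY, rule YX)
  have "?Y * Fp p = Fp q"
    by (simp only: assoc_mult_mat[OF Fp_carrier V(1) Fp_carrier] V(3) right_mult_one_mat[OF Fp_carrier])
  then show "inv\<^bsub>mat_alg n\<^esub> U \<in> cY_field" unfolding i by (rule cY_fieldI[OF Y pq(3,2) p])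
qed

text \<open>Numerator and denominator lie in the trace ring; multiplication by a common right denominator moves both
  into the generic matrix algebra.\<close>

lemma cY_field_UD:
  fixes U :: "'k::field_char_0 gpol fract mat"
  assumes U: "U \<in> cY_field"
  shows "U \<in> UD m n"
proof -
  obtain p q where pq: "U \<in> carrier_mat n n" "p \<in> mpol_in {1..n}" "q \<in> mpol_in {1..n}" "q \<noteq> 0" "U * Fp q = Fp p"
    by (rule cY_fieldE[OF U])
  obtain B :: "'k gpol mat" where B: "B \<in> generic_algebra m n" "det B \<noteq> 0"
    and den: "\<And>Z. Z \<in> trace_ring m n \<Longrightarrow> \<exists>r. \<forall>s\<ge>r. Z * B ^\<^sub>m s \<in> generic_algebra m n"
    using TR_denominator by metis
  have TR: "phi p \<in> trace_ring m n" "phi q \<in> trace_ring m n"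
    using phi_cY_ring[OF pq(2)] phi_cY_ring[OF pq(3)] cY_ring_sub_TR by auto
  obtain r r' where r: "\<forall>s\<ge>r. phi p * B ^\<^sub>m s \<in> generic_algebra m n"
    "\<forall>s\<ge>r'. phi q * B ^\<^sub>m s \<in> generic_algebra m n" using den TR by metis
  let ?C = "B ^\<^sub>m (max r r')"
  note Bc = GA.in_carrier[OF B(1)]
  have C: "?C \<in> carrier_mat n n" by (rule pow_carrier_mat[OF Bc])
  have FC: "frac_mat ?C \<in> carrier_mat n n" using C by simp
  have "det (B ^\<^sub>m k) \<noteq> 0" for k
    by (induction k) (use B(2) Bc in \<open>auto simp: det_mult[OF pow_carrier_mat[OF Bc] Bc]\<close>)
  then have "det (phi q * ?C) \<noteq> 0"
    using det_phi[OF pq(3,4)] by (simp add: det_mult[OF phi_carrier C])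
  moreover have "U * frac_mat (phi q * ?C) = frac_mat (phi p * ?C)"
    by (simp only: frac_mat_mult[OF phi_carrier C] assoc_mult_mat[OF pq(1) Fp_carrier FC, symmetric] pq(5))
  moreover have "phi p * ?C \<in> generic_algebra m n" "phi q * ?C \<in> generic_algebra m n" using r by simp_all
  ultimately show "U \<in> UD m n" using pq(1) UD_iff by blast
qed

lemma frac_act_Fp:
  assumes g: "g \<in> GL m" and p: "p \<in> mpol_in {1..n}"
  shows "map_mat (frac_ext (act m g)) (Fp p) = Fp (scale (det g) p)"
  using g act_phi[OF _ _ p, of g] by (simp only: frac_act(2)) (simp add: GL_def)

lemma frac_act_mult:
  assumes g: "g \<in> GL m" and U: "U \<in> carrier_mat n n" "U' \<in> carrier_mat n n"
  shows "map_mat (frac_ext (act m g)) (U * U') = map_mat (frac_ext (act m g)) U * map_mat (frac_ext (act m g)) U'"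
proof -
  interpret e: comm_ring_hom "frac_ext (act m g)" by (rule frac_act(1)[OF g])
  show ?thesis by (rule e.mat_hom_mult[OF U])
qed

lemma scale_nz:
  fixes q :: "(nat, 'k::field_char_0) mpol"
  assumes "q \<noteq> 0" "t \<noteq> 0"
  shows "scale t q \<noteq> 0"
proof
  assume z: "scale t q = 0"
  have "ev a q = 0" for a
  proof -
    interpret e: comm_ring_hom "ev (\<lambda>i. a i / t ^ weight i) :: _ \<Rightarrow> 'k" by (rule ev_hom)
    have "ev (\<lambda>i. a i / t ^ weight i) (scale t q) = ev a q" using assms(2) by (simp add: ev_scale)
    then show ?thesis unfolding z by simp
  qed
  then show False using assms(1) mpol_eq_0_if_ev_0 by blast
qed

text \<open>Cross multiplication, together with the injectivity of \<open>phi\<close>.\<close>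

lemma GL_fixes_iff:
  fixes U :: "'k::field_char_0 gpol fract mat"
  assumes g: "g \<in> GL m" and pq: "U \<in> carrier_mat n n" "p \<in> mpol_in {1..n}" "q \<in> mpol_in {1..n}" "q \<noteq> 0"
    "U * Fp q = Fp p"
  shows "map_mat (frac_ext (act m g)) U = U \<longleftrightarrow> scale (det g) p * q = p * scale (det g) q"
proof -
  let ?\<psi> = "map_mat (frac_ext (act m g))" and ?t = "det g"
  have t: "?t \<noteq> 0" using g by (simp add: GL_def)
  have \<psi>U: "?\<psi> U \<in> carrier_mat n n" using pq(1) by simp
  have "?\<psi> U * Fp (scale ?t q) = Fp (scale ?t p)"
    using frac_act_mult[OF g pq(1) Fp_carrier, of q] by (simp only: pq(5) frac_act_Fp[OF g pq(2)] frac_act_Fp[OF g pq(3)])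
  note e = Fp_expand(1)[OF \<psi>U this, of q] Fp_expand(2)[OF pq(1,5), of "scale ?t q"]
  have i: "scale ?t p * q \<in> mpol_in {1..n}" "scale ?t q * p \<in> mpol_in {1..n}" "scale ?t q * q \<in> mpol_in {1..n}"
    using pq by (simp_all add: mpol_in_mult scale_in)
  have "?\<psi> U = U \<longleftrightarrow> ?\<psi> U * Fp (scale ?t q * q) = U * Fp (scale ?t q * q)"
    using Fp_cancel[OF \<psi>U pq(1) i(3)] scale_nz[OF pq(4) t] pq(4) by auto
  also have "\<dots> \<longleftrightarrow> scale ?t p * q = scale ?t q * p"
    unfolding e using phi_inj[OF i(1,2)] frac_mat_inj by metis
  finally show ?thesis by (simp only: mult.commute)
qed

text \<open>By the Cayley--Hamilton theorem a denominator \<open>B\<close> divides a nonzero scalar \<open>d\<close> inside the trace ring. So the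
  fraction is \<open>Z / d\<close> with \<open>Z\<close> in the trace ring.\<close>

lemma UD_SL_cY_field:
  assumes U: "U \<in> UD m n" and inv: "\<And>g. g \<in> SL m \<Longrightarrow> map_mat (frac_ext (act m g)) U = U"
  shows "U \<in> (cY_field :: 'k::field_char_0 gpol fract mat set)"
proof -
  obtain A B :: "'k gpol mat" where Uc: "U \<in> carrier_mat n n" and AB: "A \<in> generic_algebra m n" "B \<in> generic_algebra m n"
    "det B \<noteq> 0" "U * frac_mat B = frac_mat A" using U UD_iff by blast
  note c = GA.in_carrier[OF AB(1)] GA.in_carrier[OF AB(2)]
  have TR: "A \<in> trace_ring m n" "B \<in> trace_ring m n" using AB GA_sub_TR by auto
  define d where "d = - Polynomial.coeff (char_poly B) 0"
  let ?B = "pmev (poly_shift 1 (char_poly B)) B"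
  have BT: "?B \<in> trace_ring m n"
    by (rule TR.pmev[OF TR(2)]) (simp add: coeff_poly_shift TR_char_poly[OF TR(2)])
  note Bc = TR.in_carrier[OF BT]
  have BB: "B * ?B = d \<cdot>\<^sub>m 1\<^sub>m n"
  proof -
    have "char_poly B = pCons (Polynomial.coeff (char_poly B) 0) (poly_shift 1 (char_poly B))"
      by (rule poly_eqI) (simp add: coeff_poly_shift coeff_pCons split: nat.splits)
    then have "0\<^sub>m n n = Polynomial.coeff (char_poly B) 0 \<cdot>\<^sub>m 1\<^sub>m n + B * ?B"
      using cayley_hamilton[OF c(2)] pmev_pCons[OF c(2)] by metis
    then have "Polynomial.coeff (char_poly B) 0 \<cdot>\<^sub>m 1\<^sub>m n = - (B * ?B)"
      by (intro mat_eq_uminus_if_add_eq_0[of _ n] mult_carrier_mat[OF c(2) Bc]) simp_all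
    then have "B * ?B = - (Polynomial.coeff (char_poly B) 0 \<cdot>\<^sub>m 1\<^sub>m n)" by simp
    also have "\<dots> = d \<cdot>\<^sub>m 1\<^sub>m n" by (rule eq_matI) (auto simp: d_def)
    finally show ?thesis .
  qed
  have d0: "d \<noteq> 0"
  proof -
    interpret t: comm_ring_hom "to_fract :: 'k gpol \<Rightarrow> _" by (rule to_fract_hom)
    have FB: "frac_mat B \<in> carrier_mat n n" using c by simp
    have "to_fract (Polynomial.coeff (char_poly B) 0) = poly (char_poly (frac_mat B)) 0"
      using hom_cc[OF to_fract_hom c(2), of n] by (simp add: cc_def poly_0_coeff_0)
    also have "\<dots> = det (- char_matrix (frac_mat B) 0)" by (rule char_poly_matrix[OF FB])
    also have "- char_matrix (frac_mat B) 0 = (- 1) \<cdot>\<^sub>m frac_mat B"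
      using FB by (intro eq_matI) (auto simp: char_matrix_def)
    also have "det \<dots> \<noteq> 0" using AB(3) by (simp add: det_frac_mat)
    finally show ?thesis by (auto simp: d_def)
  qed
  have dT: "d \<cdot>\<^sub>m 1\<^sub>m n \<in> trace_ring m n"
    using TR.mult[OF TR(2) BT] BB by simp
  have dg: "d \<in> mpol_in gvars" by (rule TR_scalar_relevant[OF dT])
  define Z where "Z = A * ?B"
  have ZT: "Z \<in> trace_ring m n" unfolding Z_def by (rule TR.mult[OF TR(1) BT])
  note Zc = TR.in_carrier[OF ZT]
  have rel: "relevant Z" by (rule TR_relevant[OF ZT])
  have FZ: "frac_mat Z = to_fract d \<cdot>\<^sub>m U"
  proof -
    have FB: "frac_mat B \<in> carrier_mat n n" "frac_mat ?B \<in> carrier_mat n n" using c Bc by simp_all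
    have "frac_mat Z = U * frac_mat (B * ?B)"
      unfolding Z_def frac_mat_mult[OF c(1) Bc] frac_mat_mult[OF c(2) Bc] AB(4)[symmetric]
      by (rule assoc_mult_mat[OF Uc FB])
    also have "\<dots> = to_fract d \<cdot>\<^sub>m (U * 1\<^sub>m n)"
      unfolding BB frac_mat_smult frac_mat_one by (rule mult_smult_distrib[OF Uc one_carrier_mat])
    finally show ?thesis by (simp only: right_mult_one_mat[OF Uc])
  qed
  have "concomitant (SL m) Z d"
    unfolding concomitant_def
  proof (intro conjI allI impI rel dg d0)
    fix A' :: "nat \<Rightarrow> 'k mat" and P Q :: "'k mat" assume A': "tuple A'"
      and PQ: "P \<in> carrier_mat n n" "Q \<in> carrier_mat n n" "P * Q = 1\<^sub>m n" "Q * P = 1\<^sub>m n"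
    show "evm (conj_tuple P Q A') Z = P * evm A' Z * Q" by (rule evm_conj[OF ZT A' PQ])
    have "evp (conj_tuple P Q A') d \<cdot>\<^sub>m 1\<^sub>m n = P * (evp A' d \<cdot>\<^sub>m 1\<^sub>m n) * Q"
      using evm_conj[OF dT A' PQ] by (simp only: evm_smult evm_one)
    also have "\<dots> = evp A' d \<cdot>\<^sub>m (P * Q)"
      using PQ(1,2) by (simp add: mult_smult_distrib[of _ n n _ n] mult_smult_assoc_mat[of _ n n _ n] right_mult_one_mat[OF PQ(1)])
    finally have "evp (conj_tuple P Q A') d \<cdot>\<^sub>m 1\<^sub>m n = evp A' d \<cdot>\<^sub>m 1\<^sub>m n" by (simp only: PQ(3))
    from arg_cong[OF this, of "\<lambda>M. M $$ (0, 0)"] show "evp (conj_tuple P Q A') d = evp A' d" using n0 by simp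
  next
    fix A' :: "nat \<Rightarrow> 'k mat" and g :: "'k mat" assume A': "tuple A'" and g: "g \<in> SL m"
    then have gG: "g \<in> GL m" using SL_GL by blast
    have smult: "map_mat (frac_ext (act m g)) (to_fract d \<cdot>\<^sub>m U) = to_fract (act m g d) \<cdot>\<^sub>m U"
    proof -
      interpret e: comm_ring_hom "frac_ext (act m g)" by (rule frac_act(1)[OF gG])
      have "map_mat (frac_ext (act m g)) (frac_mat (d \<cdot>\<^sub>m 1\<^sub>m 1)) = frac_mat (map_mat (act m g) (d \<cdot>\<^sub>m 1\<^sub>m 1))"
        by (rule frac_act(2)[OF gG])
      from arg_cong[OF this, of "\<lambda>M. M $$ (0, 0)"] have "frac_ext (act m g) (to_fract d) = to_fract (act m g d)" by simp
      then have "map_mat (frac_ext (act m g)) (to_fract d \<cdot>\<^sub>m U) = to_fract (act m g d) \<cdot>\<^sub>m map_mat (frac_ext (act m g)) U"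
        by (intro eq_matI) (auto simp: e.hom_mult)
      then show ?thesis by (simp only: inv[OF g])
    qed
    have "frac_mat (map_mat (act m g) Z) = to_fract (act m g d) \<cdot>\<^sub>m U"
      unfolding frac_act(2)[OF gG, symmetric] FZ smult ..
    then have "frac_mat (d \<cdot>\<^sub>m map_mat (act m g) Z) = frac_mat (act m g d \<cdot>\<^sub>m Z)"
      unfolding frac_mat_smult FZ by (intro eq_matI) (auto simp: mult_ac)
    then have "d \<cdot>\<^sub>m map_mat (act m g) Z = act m g d \<cdot>\<^sub>m Z" by (rule frac_mat_inj)
    from arg_cong[OF this, of "evm A'"]
    show "evp A' d \<cdot>\<^sub>m evm (gact g A') Z = evp (gact g A') d \<cdot>\<^sub>m evm A' Z"
      by (simp only: evm_smult evm_act[OF rel] evp_act[OF dg])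
  qed
  then obtain s W where W: "W \<in> cY_ring" "subY (slice_poly s d) \<cdot>\<^sub>m Z = d \<cdot>\<^sub>m W" and nz: "subY (slice_poly s d) \<noteq> 0"
    by (rule SL_concomitant)
  let ?e = "subY (slice_poly s d)"
  obtain p where p: "p \<in> mpol_in {1..n}" "W = phi p" using W(1) unfolding cY_ring_phi by blast
  have "?e \<cdot>\<^sub>m 1\<^sub>m n \<in> cY_ring" by (rule cY_ring_subY)
  then obtain q where q: "q \<in> mpol_in {1..n}" "?e \<cdot>\<^sub>m 1\<^sub>m n = phi q" unfolding cY_ring_phi by blast
  have q0: "q \<noteq> 0"
  proof
    assume "q = 0"
    then have "frac_mat (?e \<cdot>\<^sub>m 1\<^sub>m n) = 0\<^sub>m n n" using Fp_zero q(2) by simp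
    from arg_cong[OF this, of "\<lambda>M. M $$ (0, 0)"] show False using nz n0 by simp
  qed
  have XFq: "U * Fp q = to_fract ?e \<cdot>\<^sub>m U"
    unfolding q(2)[symmetric] frac_mat_smult frac_mat_one
    using mult_smult_distrib[OF Uc one_carrier_mat] by (simp only: right_mult_one_mat[OF Uc])
  have "to_fract d \<cdot>\<^sub>m (U * Fp q) = to_fract ?e \<cdot>\<^sub>m frac_mat Z"
    unfolding XFq FZ by (rule eq_matI) (auto simp: mult_ac)
  also have "\<dots> = to_fract d \<cdot>\<^sub>m Fp p"
    unfolding frac_mat_smult[symmetric] W(2) p(2) ..
  finally have "U * Fp q = Fp p"
    by (rule smult_cancel) (use d0 mult_carrier_mat[OF Uc Fp_carrier] Fp_carrier in auto)
  then show ?thesis by (rule cY_fieldI[OF Uc p(1) q(1) q0])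
qed

lemma SL_frac_invariants: "frac_invariants m (SL m) (UD m n) = (cY_field :: 'k::field_char_0 gpol fract mat set)"
proof -
  have "map_mat (frac_ext (act m g)) U = U" if U: "U \<in> cY_field" and g: "g \<in> SL m" for U and g :: "'k mat"
  proof -
    obtain p q where pq: "U \<in> carrier_mat n n" "p \<in> mpol_in {1..n}" "q \<in> mpol_in {1..n}" "q \<noteq> 0" "U * Fp q = Fp p"
      by (rule cY_fieldE[OF U])
    have "g \<in> GL m" using g SL_GL by blast
    moreover have "det g = 1" using g by (simp add: SL_def)
    ultimately show ?thesis using GL_fixes_iff[OF _ pq, of g] by (simp add: scale_1)
  qed
  then show ?thesis unfolding frac_invariants_def
    by (intro equalityI subsetI CollectI conjI ballI; (elim CollectE conjE)?) (auto intro: cY_field_UD UD_SL_cY_field)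
qed

lemma cY_field_generate_field:
  assumes S: "S \<subseteq> cY_field" and Fp: "\<And>p. p \<in> mpol_in {1..n} \<Longrightarrow> Fp p \<in> generate_field (mat_alg n) S"
  shows "generate_field (mat_alg n) S = (cY_field :: 'k::field_char_0 gpol fract mat set)"
proof
  have "(1\<^sub>m n :: 'k gpol fract mat) \<in> cY_field" using Fp_cY_field[of "1 :: (nat, 'k) mpol"] by (simp add: Fp_one)
  then show "generate_field (mat_alg n) S \<subseteq> cY_field"
    by (intro generate_field_least[OF S] subsetI cY_field_carrier cY_field_add cY_field_mult cY_field_uminus cY_field_inv(1))
  show "cY_field \<subseteq> generate_field (mat_alg n) S"
  proof
    fix U :: "'k gpol fract mat" assume U: "U \<in> cY_field"
    obtain p q where pq: "U \<in> carrier_mat n n" "p \<in> mpol_in {1..n}" "q \<in> mpol_in {1..n}" "q \<noteq> 0" "U * Fp q = Fp p"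
      by (rule cY_fieldE[OF U])
    obtain V where V: "V \<in> carrier_mat n n" "Fp q * V = 1\<^sub>m n" "V * Fp q = 1\<^sub>m n" "inv\<^bsub>mat_alg n\<^esub> (Fp q) = V"
      using frac_inverse[OF phi_carrier det_phi[OF pq(3,4)]] by metis
    have "Fp q \<noteq> 0\<^sub>m n n"
    proof
      assume "Fp q = 0\<^sub>m n n"
      then have "1\<^sub>m n = (0\<^sub>m n n :: 'k gpol fract mat)" using V(2) left_mult_zero_mat[OF V(1)] by metis
      from arg_cong[OF this, of "\<lambda>M. M $$ (0, 0)"] show False using n0 by simp
    qed
    then have "V \<in> generate_field (mat_alg n) S" using generate_field_mat(3)[OF Fp[OF pq(3)]] V(4) by simp
    then have "Fp p * V \<in> generate_field (mat_alg n) S" by (rule generate_field_mat(2)[OF Fp[OF pq(2)]])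
    moreover have "Fp p * V = U"
      by (simp only: pq(5)[symmetric] assoc_mult_mat[OF pq(1) Fp_carrier V(1)] V(2) right_mult_one_mat[OF pq(1)])
    ultimately show "U \<in> generate_field (mat_alg n) S" by simp
  qed
qed

theorem SL_invariant_field:
  "frac_invariants m (SL m) (UD m n) = generate_field (mat_alg n)
    (frac_mat ` base_scalars n \<union> {to_fract (cY i) \<cdot>\<^sub>m 1\<^sub>m n | i. 1 \<le> i \<and> i \<le> n - 1} \<union>
     {frac_mat (YY :: 'k::field_char_0 gpol mat)})"
  (is "_ = generate_field _ ?S")
  unfolding SL_frac_invariants
proof (rule cY_field_generate_field[symmetric])
  have Fc: "to_fract (cY i) \<cdot>\<^sub>m 1\<^sub>m n = Fp (mvar i :: (nat, 'k) mpol)" if "i \<le> n - 1" for i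
    using that n0 by (simp add: phi_simps frac_mat_smult frac_mat_one)
  have FS: "frac_mat (mconst a \<cdot>\<^sub>m 1\<^sub>m n) = Fp (mconst a :: (nat, 'k) mpol)" for a
    by (simp add: phi_simps)
  have FY: "frac_mat YY = Fp (mvar n :: (nat, 'k) mpol)" by (simp add: phi_simps)
  have mv: "(mvar i :: (nat, 'k) mpol) \<in> mpol_in {1..n}" if "1 \<le> i" "i \<le> n" for i using that by simp
  show "?S \<subseteq> cY_field"
    using n0 by (auto simp: base_scalars_def Fc FS FY intro!: Fp_cY_field)
  fix p :: "(nat, 'k) mpol" assume "p \<in> mpol_in {1..n}"
  then show "Fp p \<in> generate_field (mat_alg n) ?S"
  proof (induction rule: mpol_induct)
    case (const a)
    show ?case by (rule generate_field_mat(4)) (auto simp: base_scalars_def FS[symmetric])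
  next
    case (var i)
    show ?case
    proof (rule generate_field_mat(4), cases "i = n")
      case False
      then have i: "1 \<le> i" "i \<le> n - 1" using var by auto
      show "Fp (mvar i) \<in> ?S"
        by (rule UnI1, rule UnI2, rule CollectI, rule exI[of _ i]) (simp only: Fc[OF i(2)] i simp_thms)
    qed (simp add: FY)
  qed (simp_all only: Fp_add Fp_mult generate_field_mat(1,2))
qed

end

section \<open>Invariants of the general linear group\<close>

lemma mvar_nz: "(mvar i :: ('v, 'k::field_char_0) mpol) \<noteq> 0"
proof
  assume z: "(mvar i :: ('v, 'k) mpol) = 0"
  interpret e: comm_ring_hom "ev (\<lambda>_. 1) :: ('v, 'k) mpol \<Rightarrow> 'k" by (rule ev_hom)
  have "ev (\<lambda>_. 1) (mvar i :: ('v, 'k) mpol) = 1" by (simp only: ev_mvar)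
  then show False unfolding z by simp
qed

context generic_size
begin

lemma GL_with_det: "t \<noteq> 0 \<Longrightarrow> \<exists>g \<in> GL m. det g = (t :: 'k::field)"
proof (rule bexI[of _ "multrow_mat m 0 t"])
  have "0 < m" using m3 by simp
  then show d: "det (multrow_mat m 0 t) = t" by (rule det_multrow_mat)
  assume "t \<noteq> 0"
  then show "multrow_mat m 0 t \<in> GL m" using d by (simp add: GL_def)
qed

lemma cY_1_nz: "(cY 1 :: 'k::field_char_0 gpol) \<noteq> 0"
proof
  assume z: "(cY 1 :: 'k gpol) = 0"
  have "det (phi (mvar 1 :: (nat, 'k) mpol)) \<noteq> 0" by (rule det_phi[OF _ mvar_nz]) (use n0 in simp)
  then show False using z n2 n0 by (simp add: phi_simps)
qed

definition quotient_gens :: "'k::field_char_0 gpol fract mat set"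
  where "quotient_gens = frac_mat ` base_scalars n \<union>
      {(to_fract (cY i) / to_fract (cY 1) ^ i) \<cdot>\<^sub>m 1\<^sub>m n | i. 2 \<le> i \<and> i \<le> n - 1} \<union>
      {(1 / to_fract (cY 1)) \<cdot>\<^sub>m frac_mat YY}"

lemma Fp_scalar_mult:
  assumes "i \<noteq> n"
  shows "Fp (mvar i ^ M * p) = to_fract (cY i) ^ M \<cdot>\<^sub>m Fp (p :: (nat, 'k::field_char_0) mpol)"
proof (induction M)
  case 0
  show ?case by (rule eq_matI) auto
next
  case (Suc M)
  have "Fp (mvar i ^ Suc M * p) = Fp (mvar i) * Fp (mvar i ^ M * p)" by (simp only: Fp_mult[symmetric] power_Suc mult.assoc)
  also have "\<dots> = to_fract (cY i) \<cdot>\<^sub>m Fp (mvar i ^ M * p)"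
    using assms by (simp add: phi_simps frac_mat_smult frac_mat_one mult_smult_assoc_mat[of _ n n _ n]
      left_mult_one_mat[OF Fp_carrier])
  also have "\<dots> = to_fract (cY i) ^ Suc M \<cdot>\<^sub>m Fp p" unfolding Suc by (rule eq_matI) (auto simp: mult.assoc)
  finally show ?case .
qed

lemma one_ne_n: "1 \<noteq> n"
  using n2 by simp

text \<open>The generating quotients are weighted homogeneous of degree zero.\<close>

lemma quotient_gens:
  fixes U :: "'k::field_char_0 gpol fract mat"
  assumes "U \<in> quotient_gens"
  obtains p q where "U \<in> carrier_mat n n" "p \<in> mpol_in {1..n}" "q \<in> mpol_in {1..n}" "q \<noteq> 0" "U * Fp q = Fp p"
    "\<forall>t. scale t p * q = p * scale t q"
proof -
  let ?C = "to_fract (cY 1 :: 'k gpol)"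
  have C: "?C \<noteq> 0" using cY_1_nz by simp
  have scm: "scale t (mvar i) = mconst (t ^ weight i) * mvar i" for t :: 'k and i
    by (simp add: scale_def mpol_eval_mvar[OF mconst_hom])
  have scc: "scale t (mconst a) = mconst a" for t a :: 'k
    by (simp add: scale_def mpol_eval_mconst[OF mconst_hom])
  have sch: "comm_ring_hom (scale t :: (nat, 'k) mpol \<Rightarrow> _)" for t
    unfolding scale_def by (rule mpol_eval_hom[OF mconst_hom])
  have X1: "(mvar 1 :: (nat, 'k) mpol) ^ k \<noteq> 0" for k
    by (simp add: mvar_nz)
  have mc: "mconst (t ^ j) = (mconst t ^ j :: (nat, 'k) mpol)" for t :: 'k and j
  proof -
    interpret mc: comm_ring_hom "mconst :: 'k \<Rightarrow> (nat, 'k) mpol" by (rule mconst_hom)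
    show ?thesis by (rule mc.hom_power)
  qed
  have cancel: "(a / ?C ^ j) \<cdot>\<^sub>m B * Fp (mvar 1 ^ j) = a \<cdot>\<^sub>m B" if B: "B \<in> carrier_mat n n" for a B j
  proof -
    have "Fp (mvar 1 ^ j * 1) = ?C ^ j \<cdot>\<^sub>m (1\<^sub>m n :: 'k gpol fract mat)"
      unfolding Fp_scalar_mult[OF one_ne_n] Fp_one ..
    then have "(a / ?C ^ j) \<cdot>\<^sub>m B * Fp (mvar 1 ^ j) = ?C ^ j \<cdot>\<^sub>m ((a / ?C ^ j) \<cdot>\<^sub>m (B * 1\<^sub>m n))"
      using B by (simp add: mult_smult_assoc_mat[of _ n n _ n] mult_smult_distrib[of _ n n _ n])
    also have "\<dots> = a \<cdot>\<^sub>m B" unfolding right_mult_one_mat[OF B] using C by (intro eq_matI) auto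
    finally show ?thesis .
  qed
  consider a where "U = frac_mat (mconst a \<cdot>\<^sub>m 1\<^sub>m n)"
    | i where "2 \<le> i" "i \<le> n - 1" "U = (to_fract (cY i) / ?C ^ i) \<cdot>\<^sub>m 1\<^sub>m n"
    | "U = (1 / ?C) \<cdot>\<^sub>m frac_mat YY"
    using assms unfolding quotient_gens_def base_scalars_def by blast
  then show ?thesis
  proof cases
    case 1
    have U: "U = Fp (mconst a)" by (simp add: 1 phi_simps)
    show ?thesis
      by (rule that[of "mconst a" 1])
        (use scc[of _ 1] Fp_carrier in \<open>auto simp: U scc Fp_one right_mult_one_mat[OF Fp_carrier]\<close>)
  next
    case (2 i)
    have i: "i \<noteq> n" "i \<in> {1..n}" using 2 n2 by auto
    show ?thesis
    proof (rule that[of "mvar i" "mvar 1 ^ i"])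
      show "U * Fp (mvar 1 ^ i) = Fp (mvar i)"
        unfolding 2(3) cancel[OF one_carrier_mat] phi_simps(3)[OF i(1)] frac_mat_smult frac_mat_one ..
      have "scale t (mvar 1 ^ j) = scale t (mvar 1) ^ j" for t :: 'k and j
      proof -
        interpret s: comm_ring_hom "scale t :: (nat, 'k) mpol \<Rightarrow> _" by (rule sch)
        show ?thesis by (rule s.hom_power)
      qed
      then show "\<forall>t::'k. scale t (mvar i) * mvar 1 ^ i = mvar i * scale t (mvar 1 ^ i)"
        using i one_ne_n by (simp add: scm weight_def mc power_mult_distrib mult_ac)
    qed (use 2 i n0 X1 in \<open>auto simp: mpol_in_power\<close>)
  next
    case 3
    show ?thesis
    proof (rule that[of "mvar n" "mvar 1"])
      show "U * Fp (mvar 1) = Fp (mvar n)"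
        using cancel[of "frac_mat YY" 1 1] carrier_matD[OF YY_carrier]
        unfolding 3 phi_simps(2) by (simp, intro eq_matI) auto
      show "\<forall>t::'k. scale t (mvar n) * mvar 1 = mvar n * scale t (mvar 1)"
        using one_ne_n by (simp add: scm weight_def mult_ac)
    qed (use n0 X1[of 1] in \<open>auto simp: 3\<close>)
  qed
qed

lemma quotient_field_sub: "generate_field (mat_alg n) quotient_gens \<subseteq>
  {U \<in> cY_field. \<forall>g \<in> GL m. map_mat (frac_ext (act m g)) U = (U :: 'k::field_char_0 gpol fract mat)}" (is "_ \<subseteq> ?T")
proof (rule generate_field_least)
  show "quotient_gens \<subseteq> ?T"
  proof
    fix U :: "'k gpol fract mat" assume "U \<in> quotient_gens"
    then obtain p q where pq: "U \<in> carrier_mat n n" "p \<in> mpol_in {1..n}" "q \<in> mpol_in {1..n}" "q \<noteq> 0" "U * Fp q = Fp p"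
      and sc: "\<forall>t. scale t p * q = p * scale t q"
      by (rule quotient_gens)
    have "map_mat (frac_ext (act m g)) U = U" if "g \<in> GL m" for g
      using GL_fixes_iff[OF that pq] sc by blast
    then show "U \<in> ?T" using cY_fieldI[OF pq] by blast
  qed
  show "?T \<subseteq> carrier_mat n n" using cY_field_carrier by blast
  have inv1: "map_mat (frac_ext (act m g)) (1\<^sub>m n) = (1\<^sub>m n :: 'k gpol fract mat)" if "g \<in> GL m" for g
  proof -
    interpret e: comm_ring_hom "frac_ext (act m g)" by (rule frac_act(1)[OF that])
    show ?thesis by (rule e.mat_hom_one)
  qed
  have "(1\<^sub>m n :: 'k gpol fract mat) \<in> cY_field" using Fp_cY_field[of "1 :: (nat, 'k) mpol"] by (simp add: Fp_one)
  then show "1\<^sub>m n \<in> ?T" using inv1 by blast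
  fix A :: "'k gpol fract mat" assume A: "A \<in> ?T"
  then have Ac: "A \<in> carrier_mat n n" using cY_field_carrier by blast
  show "- A \<in> ?T"
  proof -
    have "map_mat (frac_ext (act m g)) (- A) = - A" if g: "g \<in> GL m" for g
    proof -
      interpret e: comm_ring_hom "frac_ext (act m g)" by (rule frac_act(1)[OF g])
      have "map_mat (frac_ext (act m g)) (- A) = - map_mat (frac_ext (act m g)) A"
        by (rule eq_matI) (auto simp: e.hom_uminus)
      then show ?thesis using A g by simp
    qed
    then show ?thesis using A cY_field_uminus by blast
  qed
  show "inv\<^bsub>mat_alg n\<^esub> A \<in> ?T" if nz: "A \<noteq> 0\<^sub>m n n"
  proof -
    have AK: "A \<in> cY_field" using A by blast
    let ?B = "inv\<^bsub>mat_alg n\<^esub> A"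
    note B = cY_field_inv[OF AK nz]
    have Bc: "?B \<in> carrier_mat n n" by (rule cY_field_carrier[OF B(1)])
    have "map_mat (frac_ext (act m g)) ?B = ?B" if g: "g \<in> GL m" for g
    proof -
      let ?\<psi> = "map_mat (frac_ext (act m g))"
      have Bc': "?\<psi> ?B \<in> carrier_mat n n" using Bc by simp
      have "?\<psi> ?B * A = ?\<psi> (?B * A)" using frac_act_mult[OF g Bc Ac] A g by simp
      also have "\<dots> = 1\<^sub>m n" unfolding B(3) by (rule inv1[OF g])
      finally have "?\<psi> ?B * A * ?B = ?B" by (simp only: left_mult_one_mat[OF Bc])
      then show ?thesis
        by (simp only: assoc_mult_mat[OF Bc' Ac Bc] B(2) right_mult_one_mat[OF Bc'])
    qed
    then show ?thesis using B(1) by blast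
  qed
  fix B :: "'k gpol fract mat" assume B: "B \<in> ?T"
  then have Bc: "B \<in> carrier_mat n n" using cY_field_carrier by blast
  show "A * B \<in> ?T"
    using A B cY_field_mult frac_act_mult[OF _ Ac Bc] by (intro CollectI conjI ballI) auto
  have "map_mat (frac_ext (act m g)) (A + B) = A + B" if g: "g \<in> GL m" for g
    using map_mat_add_hom[OF frac_act(1)[OF g] Ac Bc] A B g by simp
  then show "A + B \<in> ?T" using A B cY_field_add by blast
qed

lemma quotient_field_cY_field: "generate_field (mat_alg n) quotient_gens \<subseteq> cY_field"
  using quotient_field_sub by blast

text \<open>Substituting the quotients \<open>s c\<^sub>i / c\<^sub>1\<^sup>i\<close> and \<open>s Y / c\<^sub>1\<close> into a polynomial and clearing the
  denominator.\<close>

lemma dehomogenize: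
  fixes p :: "(nat, 'k::field_char_0) mpol" and s :: 'k
  defines "K \<equiv> generate_field (mat_alg n) quotient_gens"
  assumes p: "p \<in> mpol_in {1..n}"
  shows "\<exists>M p' G. p' \<in> mpol_in {1..n} \<and> G \<in> K \<and> Fp p' = to_fract (cY 1) ^ M \<cdot>\<^sub>m G \<and>
    (\<forall>y. y 1 \<noteq> 0 \<longrightarrow> ev y p' = y 1 ^ M * ev (\<lambda>i. (s / y 1) ^ weight i * y i) p)"
proof -
  let ?C = "to_fract (cY 1 :: 'k gpol)"
  have C: "?C \<noteq> 0" using cY_1_nz by simp
  have base: "Fp (mconst a) \<in> K" for a :: 'k
    unfolding K_def quotient_gens_def by (rule generate_field_mat(4)) (auto simp: base_scalars_def phi_simps)
  have const: "Fp (mconst a * q) = frac_mat (phi (mconst a)) * Fp q" for a :: 'k and q by (rule Fp_mult)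
  have lin: "A * (t \<cdot>\<^sub>m B) = t \<cdot>\<^sub>m (A * B)" "t \<cdot>\<^sub>m A * B = t \<cdot>\<^sub>m (A * B)"
    if "A \<in> carrier_mat n n" "B \<in> carrier_mat n n" for A B :: "'k gpol fract mat" and t
    using that by (simp_all add: mult_smult_distrib[of _ n n _ n] mult_smult_assoc_mat[of _ n n _ n])
  have ss: "a \<cdot>\<^sub>m (b \<cdot>\<^sub>m A) = (a * b) \<cdot>\<^sub>m A" for a b and A :: "'k gpol fract mat"
    by (rule eq_matI) (auto simp: mult.assoc)
  have Kc: "A \<in> carrier_mat n n" if "A \<in> K" for A
    using quotient_field_cY_field that cY_field_carrier unfolding K_def by blast
  show ?thesis using p
  proof (induction rule: mpol_induct)
    case (const a)
    show ?case
      by (rule exI[of _ 0], rule exI[of _ "mconst a"], rule exI[of _ "Fp (mconst a)"])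
        (use base in \<open>auto simp: ev_mconst intro!: eq_matI\<close>)
  next
    case (var i)
    have w: "Fp (mconst (s ^ weight i) * mvar i) = ?C ^ weight i \<cdot>\<^sub>m (Fp (mconst (s ^ weight i)) * H)"
      if "Fp (mvar i) = ?C ^ weight i \<cdot>\<^sub>m H" "H \<in> carrier_mat n n" for H
      unfolding Fp_mult that(1) by (rule lin(1)[OF Fp_carrier that(2)])
    have "\<exists>H \<in> K. Fp (mvar i :: (nat, 'k) mpol) = ?C ^ weight i \<cdot>\<^sub>m H"
    proof -
      consider "i = n" | "i = 1" "i \<noteq> n" | "2 \<le> i" "i \<le> n - 1" using var by fastforce
      then show ?thesis
      proof cases
        case 1
        have "(1 / ?C) \<cdot>\<^sub>m frac_mat YY \<in> K" unfolding K_def quotient_gens_def by (rule generate_field_mat(4)) simp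
        moreover have "Fp (mvar i :: (nat, 'k) mpol) = ?C ^ weight i \<cdot>\<^sub>m ((1 / ?C) \<cdot>\<^sub>m frac_mat YY)"
          unfolding ss using C 1 by (intro eq_matI) (auto simp: phi_simps weight_def)
        ultimately show ?thesis by blast
      next
        case 2
        have "Fp (mconst 1 :: (nat, 'k) mpol) \<in> K" by (rule base)
        moreover have "Fp (mvar i :: (nat, 'k) mpol) = ?C ^ weight i \<cdot>\<^sub>m Fp (mconst 1 :: (nat, 'k) mpol)"
          unfolding phi_simps(1) phi_simps(3)[OF 2(2)] using 2 by (intro eq_matI) (auto simp: weight_def)
        ultimately show ?thesis by blast
      next
        case 3
        have "(to_fract (cY i) / ?C ^ i) \<cdot>\<^sub>m 1\<^sub>m n \<in> K"
          unfolding K_def quotient_gens_def by (rule generate_field_mat(4)) (use 3 in blast)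
        moreover have "Fp (mvar i :: (nat, 'k) mpol) = ?C ^ weight i \<cdot>\<^sub>m ((to_fract (cY i) / ?C ^ i) \<cdot>\<^sub>m 1\<^sub>m n)"
          unfolding ss using C 3 n0 by (intro eq_matI) (auto simp: phi_simps weight_def)
        ultimately show ?thesis by blast
      qed
    qed
    then obtain H where H: "H \<in> K" "Fp (mvar i :: (nat, 'k) mpol) = ?C ^ weight i \<cdot>\<^sub>m H" by blast
    show ?case
    proof (intro exI conjI allI impI)
      show "mconst (s ^ weight i) * mvar i \<in> mpol_in {1..n}" using var by (simp add: mpol_in_mult)
      show "Fp (mconst (s ^ weight i)) * H \<in> K"
        using generate_field_mat(2) base H(1) unfolding K_def by blast
      show "Fp (mconst (s ^ weight i) * mvar i) = ?C ^ weight i \<cdot>\<^sub>m (Fp (mconst (s ^ weight i)) * H)"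
        by (rule w[OF H(2) Kc[OF H(1)]])
      fix y :: "nat \<Rightarrow> 'k" assume y: "y 1 \<noteq> 0"
      interpret e: comm_ring_hom "ev y :: _ \<Rightarrow> 'k" by (rule ev_hom)
      show "ev y (mconst (s ^ weight i) * mvar i) = y 1 ^ weight i * ev (\<lambda>i. (s / y 1) ^ weight i * y i) (mvar i)"
        using y by (simp add: e.hom_mult ev_mvar ev_mconst power_divide)
    qed
  next
    case (add p q)
    obtain M p' G where P: "p' \<in> mpol_in {1..n}" "G \<in> K" "Fp p' = ?C ^ M \<cdot>\<^sub>m G"
      "\<And>y. y 1 \<noteq> 0 \<Longrightarrow> ev y p' = y 1 ^ M * ev (\<lambda>i. (s / y 1) ^ weight i * y i) p"
      using add(1) by (elim exE conjE) (rule that, auto)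
    obtain N q' H where Q: "q' \<in> mpol_in {1..n}" "H \<in> K" "Fp q' = ?C ^ N \<cdot>\<^sub>m H"
      "\<And>y. y 1 \<noteq> 0 \<Longrightarrow> ev y q' = y 1 ^ N * ev (\<lambda>i. (s / y 1) ^ weight i * y i) q"
      using add(2) by (elim exE conjE) (rule that, auto)
    show ?case
    proof (intro exI conjI allI impI)
      show "mvar 1 ^ N * p' + mvar 1 ^ M * q' \<in> mpol_in {1..n}"
        using P(1) Q(1) n0 by (simp add: mpol_in_add mpol_in_mult mpol_in_power)
      show "G + H \<in> K" using generate_field_mat(1) P(2) Q(2) unfolding K_def by blast
      show "Fp (mvar 1 ^ N * p' + mvar 1 ^ M * q') = ?C ^ (N + M) \<cdot>\<^sub>m (G + H)"
        unfolding Fp_add Fp_scalar_mult[OF one_ne_n] P(3) Q(3) ss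
        using Kc[OF P(2)] Kc[OF Q(2)] by (intro eq_matI) (auto simp: power_add algebra_simps)
      fix y :: "nat \<Rightarrow> 'k" assume y: "y 1 \<noteq> 0"
      interpret e: comm_ring_hom "ev y :: _ \<Rightarrow> 'k" by (rule ev_hom)
      interpret e': comm_ring_hom "ev (\<lambda>i. (s / y 1) ^ weight i * y i) :: _ \<Rightarrow> 'k" by (rule ev_hom)
      show "ev y (mvar 1 ^ N * p' + mvar 1 ^ M * q') =
          y 1 ^ (N + M) * ev (\<lambda>i. (s / y 1) ^ weight i * y i) (p + q)"
        unfolding e.hom_add e.hom_mult e.hom_power e'.hom_add ev_mvar P(4)[of y, OF y] Q(4)[of y, OF y]
        by (simp only: power_add distrib_left mult_ac)
    qed
  next
    case (mult p q)
    obtain M p' G where P: "p' \<in> mpol_in {1..n}" "G \<in> K" "Fp p' = ?C ^ M \<cdot>\<^sub>m G"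
      "\<And>y. y 1 \<noteq> 0 \<Longrightarrow> ev y p' = y 1 ^ M * ev (\<lambda>i. (s / y 1) ^ weight i * y i) p"
      using mult(1) by (elim exE conjE) (rule that, auto)
    obtain N q' H where Q: "q' \<in> mpol_in {1..n}" "H \<in> K" "Fp q' = ?C ^ N \<cdot>\<^sub>m H"
      "\<And>y. y 1 \<noteq> 0 \<Longrightarrow> ev y q' = y 1 ^ N * ev (\<lambda>i. (s / y 1) ^ weight i * y i) q"
      using mult(2) by (elim exE conjE) (rule that, auto)
    show ?case
    proof (intro exI conjI allI impI)
      show "p' * q' \<in> mpol_in {1..n}" using P(1) Q(1) by (rule mpol_in_mult)
      show "G * H \<in> K" using generate_field_mat(2) P(2) Q(2) unfolding K_def by blast
      have c: "G \<in> carrier_mat n n" "?C ^ N \<cdot>\<^sub>m H \<in> carrier_mat n n" "H \<in> carrier_mat n n"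
        using Kc[OF P(2)] Kc[OF Q(2)] by simp_all
      show "Fp (p' * q') = ?C ^ (M + N) \<cdot>\<^sub>m (G * H)"
        unfolding Fp_mult P(3) Q(3) lin(2)[OF c(1,2)] lin(1)[OF c(1,3)] ss power_add ..
      fix y :: "nat \<Rightarrow> 'k" assume y: "y 1 \<noteq> 0"
      interpret e: comm_ring_hom "ev y :: _ \<Rightarrow> 'k" by (rule ev_hom)
      interpret e': comm_ring_hom "ev (\<lambda>i. (s / y 1) ^ weight i * y i) :: _ \<Rightarrow> 'k" by (rule ev_hom)
      show "ev y (p' * q') = y 1 ^ (M + N) * ev (\<lambda>i. (s / y 1) ^ weight i * y i) (p * q)"
        unfolding e.hom_mult e'.hom_mult P(4)[of y, OF y] Q(4)[of y, OF y]
        by (simp only: power_add mult_ac)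
    qed
  qed
qed

text \<open>If \<open>U = p / q\<close> is fixed, then \<open>p(t y) q(y) = p(y) q(t y)\<close> for all factors \<open>t\<close>. Substituting
  \<open>s / c\<^sub>1\<close> for \<open>t\<close> expresses \<open>U\<close> through the generating quotients.\<close>

theorem GL_invariant_field:
  "frac_invariants m (GL m) (UD m n) = generate_field (mat_alg n) (quotient_gens :: 'k::field_char_0 gpol fract mat set)"
proof
  show "generate_field (mat_alg n) quotient_gens \<subseteq> (frac_invariants m (GL m) (UD m n) :: 'k gpol fract mat set)"
    using quotient_field_sub cY_field_UD by (auto simp: frac_invariants_def)
  show "frac_invariants m (GL m) (UD m n) \<subseteq> generate_field (mat_alg n) (quotient_gens :: 'k gpol fract mat set)"
  proof
    fix U :: "'k gpol fract mat" assume "U \<in> frac_invariants m (GL m) (UD m n)"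
    then have UD: "U \<in> UD m n" and inv: "\<And>g. g \<in> GL m \<Longrightarrow> map_mat (frac_ext (act m g)) U = U"
      by (auto simp: frac_invariants_def)
    have UK: "U \<in> cY_field" by (rule UD_SL_cY_field[OF UD]) (rule inv, use SL_GL in blast)
    obtain p q where pq: "U \<in> carrier_mat n n" "p \<in> mpol_in {1..n}" "q \<in> mpol_in {1..n}" "q \<noteq> 0" "U * Fp q = Fp p"
      by (rule cY_fieldE[OF UK])
    have sc: "scale t p * q = p * scale t q" if "t \<noteq> 0" for t
      using GL_with_det[OF that] GL_fixes_iff[OF _ pq] inv by blast
    have "q * mvar 1 \<noteq> 0" using pq(4) mvar_nz by simp
    then obtain z where z: "ev z (q * mvar 1) \<noteq> 0" using mpol_eq_0_if_ev_0 by blast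
    interpret ez: comm_ring_hom "ev z :: _ \<Rightarrow> 'k" by (rule ev_hom)
    have z': "z 1 \<noteq> 0" "ev z q \<noteq> 0" using z by (auto simp: ez.hom_mult ev_mvar)
    let ?C = "to_fract (cY 1 :: 'k gpol)" and ?K = "generate_field (mat_alg n) (quotient_gens :: 'k gpol fract mat set)"
    have C: "?C \<noteq> 0" using cY_1_nz by simp
    \<comment> \<open>With this factor the polynomial \<open>q\<close> does not vanish under the substitution.\<close>
    define s where "s = z 1"
    obtain M p' G where P: "p' \<in> mpol_in {1..n}" "G \<in> ?K" "Fp p' = ?C ^ M \<cdot>\<^sub>m G"
      "\<And>y. y 1 \<noteq> 0 \<Longrightarrow> ev y p' = y 1 ^ M * ev (\<lambda>i. (s / y 1) ^ weight i * y i) p"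
      using dehomogenize[OF pq(2), of s] by (elim exE conjE) (rule that, auto)
    obtain N q' H where Q: "q' \<in> mpol_in {1..n}" "H \<in> ?K" "Fp q' = ?C ^ N \<cdot>\<^sub>m H"
      "\<And>y. y 1 \<noteq> 0 \<Longrightarrow> ev y q' = y 1 ^ N * ev (\<lambda>i. (s / y 1) ^ weight i * y i) q"
      using dehomogenize[OF pq(3), of s] by (elim exE conjE) (rule that, auto)
    have "ev z q' = z 1 ^ N * ev z q" using Q(4)[of z, OF z'(1)] z'(1) by (simp add: s_def)
    then have q'0: "q' \<noteq> 0" using z' by auto
    have eq: "mvar 1 ^ N * (p' * q) = mvar 1 ^ M * (q' * p)"
    proof -
      have "(mvar 1 ^ N * (p' * q) - mvar 1 ^ M * (q' * p)) * mvar 1 = 0"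
      proof (rule mpol_eq_0_if_ev_0)
        fix y :: "nat \<Rightarrow> 'k"
        interpret e: comm_ring_hom "ev y :: _ \<Rightarrow> 'k" by (rule ev_hom)
        have "ev y p' * y 1 ^ N * ev y q = y 1 ^ M * ev y q' * ev y p" if y: "y 1 \<noteq> 0"
        proof -
          have "s / y 1 \<noteq> 0" using y z'(1) by (simp add: s_def)
          from arg_cong[OF sc[OF this], of "ev y"]
          show ?thesis using P(4)[of y, OF y] Q(4)[of y, OF y] by (simp add: e.hom_mult ev_scale mult_ac)
        qed
        then show "ev y ((mvar 1 ^ N * (p' * q) - mvar 1 ^ M * (q' * p)) * mvar 1) = 0"
          by (cases "y 1 = 0") (simp_all add: e.hom_mult e.hom_minus e.hom_power ev_mvar mult_ac)
      qed
      then show ?thesis by (simp add: mvar_nz)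
    qed
    have Gc: "G \<in> carrier_mat n n" "H \<in> carrier_mat n n" "H \<in> cY_field"
      using P(2) Q(2) quotient_field_cY_field cY_field_carrier by blast+
    have "?C ^ (N + M) \<cdot>\<^sub>m (G * Fp q) = ?C ^ (N + M) \<cdot>\<^sub>m (H * Fp p)"
    proof -
      have "?C ^ N \<cdot>\<^sub>m (?C ^ M \<cdot>\<^sub>m G * Fp q) = ?C ^ M \<cdot>\<^sub>m (?C ^ N \<cdot>\<^sub>m H * Fp p)"
        using arg_cong[OF eq, of Fp] unfolding Fp_scalar_mult[OF one_ne_n] unfolding Fp_mult P(3) Q(3) .
      then have "?C ^ N \<cdot>\<^sub>m (?C ^ M \<cdot>\<^sub>m (G * Fp q)) = ?C ^ M \<cdot>\<^sub>m (?C ^ N \<cdot>\<^sub>m (H * Fp p))"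
        unfolding mult_smult_assoc_mat[OF Gc(1) Fp_carrier] mult_smult_assoc_mat[OF Gc(2) Fp_carrier] .
      moreover have "a \<cdot>\<^sub>m (b \<cdot>\<^sub>m A) = (a * b) \<cdot>\<^sub>m A" for a b and A :: "'k gpol fract mat"
        by (rule eq_matI) (auto simp: mult.assoc)
      ultimately show ?thesis by (simp only: power_add mult.commute)
    qed
    then have "G * Fp q = H * Fp p"
      by (rule smult_cancel[of _ _ _ n]) (use C mult_carrier_mat[OF Gc(1) Fp_carrier] mult_carrier_mat[OF Gc(2) Fp_carrier] in auto)
    also have "\<dots> = U * Fp q * H" unfolding pq(5) by (rule cY_field_comm[OF Gc(3)])
    also have "\<dots> = U * H * Fp q"
      unfolding assoc_mult_mat[OF pq(1) Fp_carrier Gc(2)] assoc_mult_mat[OF pq(1) Gc(2) Fp_carrier] cY_field_comm[OF Gc(3)] ..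
    finally have G: "G = U * H"
      by (rule Fp_cancel[OF Gc(1) mult_carrier_mat[OF pq(1) Gc(2)] pq(3,4)])
    have H0: "H \<noteq> 0\<^sub>m n n"
    proof
      assume "H = 0\<^sub>m n n"
      then have "Fp q' = 0\<^sub>m n n" unfolding Q(3) by (intro eq_matI) auto
      then have "1\<^sub>m n * Fp q' = 0\<^sub>m n n * Fp q'"
        using left_mult_zero_mat[OF Fp_carrier] left_mult_one_mat[OF Fp_carrier] by metis
      then have "1\<^sub>m n = (0\<^sub>m n n :: 'k gpol fract mat)"
        by (rule Fp_cancel[OF one_carrier_mat zero_carrier_mat Q(1) q'0])
      from arg_cong[OF this, of "\<lambda>M. M $$ (0, 0)"] show False using n0 by simp
    qed
    note Hi = cY_field_inv[OF Gc(3) H0]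
    have "G * inv\<^bsub>mat_alg n\<^esub> H = U"
      unfolding G assoc_mult_mat[OF pq(1) Gc(2) cY_field_carrier[OF Hi(1)]] Hi(2) by (rule right_mult_one_mat[OF pq(1)])
    then show "U \<in> ?K"
      using generate_field_mat(2)[OF P(2) generate_field_mat(3)[OF Q(2) H0]] by simp
  qed
qed

end

section \<open>Algebraic independence of the eigenvalues\<close>

text \<open>Coefficients of the quotient of \<open>t\<^sup>r + c\<^sub>1 t\<^sup>r\<^sup>-\<^sup>1 + ... + c\<^sub>r\<close> by a linear factor \<open>t - x\<close>, as polynomials in
  \<open>x\<close> (Horner's scheme); \<open>x\<close> itself stands at position \<open>r\<close>, and the later values are kept.\<close>

definition horner :: "nat \<Rightarrow> (nat \<Rightarrow> 'a::comm_ring_1) \<Rightarrow> nat \<Rightarrow> 'a poly"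
  where "horner r c i = (if i = 0 then 0 else if i < r then
      (\<Sum>l\<le>i. Polynomial.monom (if l = 0 then 1 else c l) (i - l))
    else if i = r then [:0, 1:] else [:c i:])"

lemma hom_horner:
  assumes "comm_ring_hom h"
  shows "map_poly h (horner r c i) = horner r (\<lambda>i. h (c i)) i"
proof -
  interpret h: comm_ring_hom h by fact
  interpret mp: comm_ring_hom "map_poly h" by (rule map_poly_hom[OF assms])
  have m: "map_poly h (Polynomial.monom a k) = Polynomial.monom (h a) k" for a k
    by (rule poly_eqI) simp
  have c1: "map_poly h [:a:] = [:h a:]" for a by (simp add: h.map_poly_pCons_hom)
  have if_h: "h (if b then x else y) = (if b then h x else h y)" for b x y by simp
  show ?thesis unfolding horner_def
    by (simp add: mp.hom_sum m c1 h.map_poly_pCons_hom if_h cong: if_cong)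
qed

lemma horner_cong: "(\<And>j. j \<noteq> r \<Longrightarrow> c j = c' j) \<Longrightarrow> horner r c i = horner r c' i"
  unfolding horner_def by (auto intro!: sum.cong)

lemma poly_horner:
  "poly (horner r c i) x = (if i = 0 then 0 else if i < r then
      (\<Sum>l\<le>i. (if l = 0 then 1 else c l) * x ^ (i - l)) else if i = r then x else c i)"
  by (simp add: horner_def poly_sum poly_monom)

definition hpoly :: "nat \<Rightarrow> ('k::comm_ring_1 \<Rightarrow> 'a::comm_ring_1) \<Rightarrow> (nat \<Rightarrow> 'a) \<Rightarrow> (nat, 'k) mpol \<Rightarrow> 'a poly"
  where "hpoly r \<iota> c p = mpol_eval (\<lambda>a. [:\<iota> a:]) (horner r c) p"

lemma hom_hpoly:
  fixes \<iota> :: "'k::comm_ring_1 \<Rightarrow> 'a::comm_ring_1"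
  assumes h: "comm_ring_hom h" and \<iota>: "comm_ring_hom \<iota>"
  shows "map_poly h (hpoly r \<iota> c p) = hpoly r (\<lambda>a. h (\<iota> a)) (\<lambda>i. h (c i)) p"
proof -
  interpret h: comm_ring_hom h by (rule h)
  have c1: "map_poly h [:a:] = [:h a:]" for a by (simp add: h.map_poly_pCons_hom)
  have "map_poly h (hpoly r \<iota> c p) = mpol_eval (\<lambda>a. map_poly h [:\<iota> a:]) (\<lambda>i. map_poly h (horner r c i)) p"
    unfolding hpoly_def by (rule hom_mpol_eval[OF comm_ring_hom_comp[OF const_poly_hom \<iota>] map_poly_hom[OF h]])
  then show ?thesis by (simp only: hom_horner[OF h] c1 hpoly_def)
qed

lemma poly_hpoly:
  assumes "comm_ring_hom \<iota>"
  shows "poly (hpoly r \<iota> c p) x = mpol_eval \<iota> (\<lambda>i. poly (horner r c i) x) p"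
proof -
  have "poly (hpoly r \<iota> c p) x = mpol_eval (\<lambda>a. poly [:\<iota> a:] x) (\<lambda>i. poly (horner r c i) x) p"
    unfolding hpoly_def
    by (rule hom_mpol_eval[OF comm_ring_hom_comp[OF const_poly_hom assms] poly_eval_hom])
  then show ?thesis by simp
qed

lemma char_poly_companion:
  fixes f :: "'a::comm_ring_1 poly"
  assumes "Polynomial.coeff f r = 1" "\<And>k. k > r \<Longrightarrow> Polynomial.coeff f k = 0"
    and c: "\<And>i. 1 \<le> i \<Longrightarrow> i \<le> r \<Longrightarrow> c i = Polynomial.coeff f (r - i)"
  shows "char_poly (companion r c) = f"
proof (rule poly_eqI)
  fix k
  consider "k < r" | "k = r" | "k > r" by linarith
  then show "Polynomial.coeff (char_poly (companion r c)) k = Polynomial.coeff f k"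
  proof cases
    case 1
    then show ?thesis using c[of "r - k"] by (simp add: coeff_char_poly_companion)
  qed (simp_all add: assms(1,2) char_poly_degree[OF companion_carrier])
qed

text \<open>An eigenvector for the common root is in the kernel.\<close>

lemma det_pmev_root:
  fixes A :: "'a::field mat"
  assumes A: "A \<in> carrier_mat r r" and x: "poly (char_poly A) x = 0" "poly q x = 0"
  shows "det (pmev q A) = 0"
proof -
  have "eigenvalue A x" using x(1) eigenvalue_root_char_poly[OF A] by simp
  then obtain w where w: "w \<in> carrier_vec r" "w \<noteq> 0\<^sub>v r" "A *\<^sub>v w = x \<cdot>\<^sub>v w"
    using A by (auto simp: eigenvalue_def eigenvector_def)
  have "pmev q A *\<^sub>v w = 0\<^sub>v r"
    unfolding pmev_eigenvector[OF A w(1,3)] x(2) using w(1) by (intro eq_vecI) auto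
  then show ?thesis using det_0_iff_vec_prod_zero[OF pmev_carrier[OF A, of q]] w(1,2) by blast
qed

definition roots_poly :: "(nat \<Rightarrow> 'a::comm_ring_1) \<Rightarrow> nat \<Rightarrow> 'a poly"
  where "roots_poly \<mu> r = (\<Prod>i\<in>{1..r}. [:- \<mu> i, 1:])"

lemma roots_poly_Suc: "roots_poly \<mu> (Suc r) = [:- \<mu> (Suc r), 1:] * roots_poly \<mu> r"
  by (simp add: roots_poly_def atLeastAtMostSuc_conv)

lemma roots_poly_coeff:
  "Polynomial.coeff (roots_poly \<mu> r) r = 1" "k > r \<Longrightarrow> Polynomial.coeff (roots_poly \<mu> r) k = 0"
proof (induction r arbitrary: k)
  case 0
  { case 1 then show ?case by (simp add: roots_poly_def) }
  { case 2 then show ?case by (simp add: roots_poly_def) }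
next
  case (Suc r)
  { case 1 then show ?case using Suc by (simp add: roots_poly_Suc) }
  { case 2 then show ?case using Suc(2)[of k] Suc(2)[of "k - 1"] by (cases k) (auto simp: roots_poly_Suc) }
qed

lemma coeff_roots_poly_Suc:
  fixes \<mu> :: "nat \<Rightarrow> 'a::comm_ring_1"
  assumes "i \<le> r"
  shows "Polynomial.coeff (roots_poly \<mu> r) (r - i) =
    (\<Sum>l\<le>i. Polynomial.coeff (roots_poly \<mu> (Suc r)) (Suc r - l) * \<mu> (Suc r) ^ (i - l))"
  using assms
proof (induction i)
  case 0
  show ?case by (simp add: roots_poly_coeff)
next
  case (Suc i)
  let ?m = "\<mu> (Suc r)" and ?b = "\<lambda>l. Polynomial.coeff (roots_poly \<mu> (Suc r)) (Suc r - l)"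
  have "?b (Suc i) = Polynomial.coeff (roots_poly \<mu> r) (r - Suc i) - ?m * Polynomial.coeff (roots_poly \<mu> r) (r - i)"
    using Suc.prems by (simp add: roots_poly_Suc coeff_pCons Suc_diff_le split: nat.split)
      (metis Suc_diff_Suc Suc_le_lessD diff_Suc_1)
  then have "Polynomial.coeff (roots_poly \<mu> r) (r - Suc i) = ?b (Suc i) + ?m * (\<Sum>l\<le>i. ?b l * ?m ^ (i - l))"
    using Suc by simp
  also have "?m * (\<Sum>l\<le>i. ?b l * ?m ^ (i - l)) = (\<Sum>l\<le>i. ?b l * ?m ^ (Suc i - l))"
    unfolding sum_distrib_left by (rule sum.cong[OF refl]) (simp add: Suc_diff_le mult_ac)
  finally show ?case by (simp add: add.commute)
qed

text \<open>The first \<open>r\<close> coordinates are the coefficients of the polynomial with the first \<open>r\<close> roots, the others are the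
  remaining roots. The coordinates outside \<open>1, ..., n\<close> get the default value zero.\<close>

definition partial_point :: "nat \<Rightarrow> (nat \<Rightarrow> 'a::comm_ring_1) \<Rightarrow> nat \<Rightarrow> nat \<Rightarrow> 'a"
  where "partial_point n \<mu> r i = (if i = 0 \<or> i > n then 0
    else if i \<le> r then Polynomial.coeff (roots_poly \<mu> r) (r - i) else \<mu> i)"

text \<open>If the coefficients of the polynomial with roots \<open>\<mu>\<close> are algebraically independent, then so are
  the roots. The coefficients are replaced by roots one at a time: from a polynomial that vanishes
  after the replacement, the determinant of its value at a companion matrix makes one that vanishes
  before it.\<close>

lemma roots_independent:
  fixes \<iota> :: "'k::field_char_0 \<Rightarrow> 'a::field" and \<mu> :: "nat \<Rightarrow> 'a"
  assumes \<iota>: "comm_ring_hom \<iota>"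
    and indep: "\<And>a (p :: (nat, 'k) mpol). (\<forall>i. i = 0 \<or> i > n \<longrightarrow> a i = 0) \<Longrightarrow> ev a p \<noteq> 0 \<Longrightarrow>
      mpol_eval \<iota> (partial_point n \<mu> n) p \<noteq> 0"
    and a: "\<forall>i. i = 0 \<or> i > n \<longrightarrow> a i = 0" "ev a (p :: (nat, 'k) mpol) \<noteq> 0"
  shows "mpol_eval \<iota> (partial_point n \<mu> 0) p \<noteq> 0"
proof -
  have "\<forall>a (p :: (nat, 'k) mpol). (\<forall>i. i = 0 \<or> i > n \<longrightarrow> a i = 0) \<longrightarrow> ev a p \<noteq> 0 \<longrightarrow>
      mpol_eval \<iota> (partial_point n \<mu> r) p \<noteq> 0" if "r \<le> n" for r
    using that
  proof (induction r rule: inc_induct)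
    case base
    then show ?case using indep by blast
  next
    case (step r)
    show ?case
    proof (intro allI impI notI)
      fix a and p :: "(nat, 'k) mpol"
      assume a: "\<forall>i. i = 0 \<or> i > n \<longrightarrow> a i = 0" "ev a p \<noteq> 0"
        and z: "mpol_eval \<iota> (partial_point n \<mu> r) p = 0"
      let ?r = "Suc r" and ?v = "partial_point n \<mu> (Suc r)"
      let ?q = "hpoly ?r mconst mvar p"
      let ?D = "det (pmev ?q (companion ?r mvar))"
      have D: "h ?D = det (pmev (hpoly ?r (\<lambda>a. h (mconst a)) (\<lambda>i. h (mvar i)) p) (companion ?r (\<lambda>i. h (mvar i))))"
        if h: "comm_ring_hom h" for h :: "(nat, 'k) mpol \<Rightarrow> 'b::comm_ring_1"
      proof -
        interpret h: comm_ring_hom h by (rule h)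
        have "h ?D = det (map_mat h (pmev ?q (companion ?r mvar)))" by simp
        also have "map_mat h (pmev ?q (companion ?r mvar)) = pmev (map_poly h ?q) (map_mat h (companion ?r mvar))"
          by (rule hom_pmev[OF h companion_carrier])
        finally show ?thesis by (simp only: hom_hpoly[OF h mconst_hom] hom_companion[OF h])
      qed
      have "mpol_eval \<iota> ?v ?D = 0"
      proof -
        have "poly (char_poly (companion ?r ?v)) (\<mu> ?r) = 0"
        proof -
          have "char_poly (companion ?r ?v) = roots_poly \<mu> ?r"
            by (rule char_poly_companion) (use step.hyps in \<open>auto simp: roots_poly_coeff partial_point_def\<close>)
          then show ?thesis by (simp add: roots_poly_Suc)
        qed
        moreover have "poly (hpoly ?r \<iota> ?v p) (\<mu> ?r) = 0"
        proof -
          have "poly (horner ?r ?v i) (\<mu> ?r) = partial_point n \<mu> r i" for i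
          proof -
            consider "i = 0" | "1 \<le> i" "i \<le> r" | "i = ?r" | "i > ?r" by linarith
            then show ?thesis
            proof cases
              case 2
              have "(\<Sum>l\<le>i. (if l = 0 then 1 else ?v l) * \<mu> ?r ^ (i - l)) =
                  (\<Sum>l\<le>i. Polynomial.coeff (roots_poly \<mu> ?r) (?r - l) * \<mu> ?r ^ (i - l))"
                by (rule sum.cong[OF refl]) (use 2 step.hyps in \<open>auto simp: roots_poly_coeff partial_point_def\<close>)
              then show ?thesis
                using 2 step.hyps coeff_roots_poly_Suc[OF 2(2), of \<mu>] by (simp add: poly_horner partial_point_def)
            qed (use step.hyps in \<open>auto simp: poly_horner partial_point_def\<close>)
          qed
          then show ?thesis using z by (simp add: poly_hpoly[OF \<iota>])
        qed
        ultimately have "det (pmev (hpoly ?r \<iota> ?v p) (companion ?r ?v)) = 0"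
          by (rule det_pmev_root[OF companion_carrier])
        then show ?thesis
          using D[OF mpol_eval_hom[OF \<iota>, of ?v]] by (simp add: mpol_eval_mconst[OF \<iota>] mpol_eval_mvar[OF \<iota>])
      qed
      moreover have "\<exists>c. (\<forall>i. i = 0 \<or> i > n \<longrightarrow> c i = 0) \<and> ev c ?D \<noteq> 0"
      proof -
        \<comment> \<open>The coefficients of the product of \<open>t - a\<^sub>r\<^sub>+\<^sub>1\<close> with the polynomial that has the coefficients \<open>a\<^sub>1, ..., a\<^sub>r\<close>;
          the constant term is left open, and is chosen to make the determinant nonzero.\<close>
        define c where "c i = (if i = 0 then 0 else if i \<le> r then
          a i - a ?r * (if i = 1 then 1 else a (i - 1)) else a i)" for i
        have "poly (horner ?r c i) (a ?r) = a i" for i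
        proof -
          have sum: "(\<Sum>l\<le>i. (if l = 0 then 1 else c l) * a ?r ^ (i - l)) = (if i = 0 then 1 else a i)" if "i \<le> r" for i
            using that
          proof (induction i)
            case (Suc i)
            have "(\<Sum>l\<le>i. (if l = 0 then 1 else c l) * a ?r ^ (Suc i - l)) =
                a ?r * (\<Sum>l\<le>i. (if l = 0 then 1 else c l) * a ?r ^ (i - l))"
              unfolding sum_distrib_left by (rule sum.cong[OF refl]) (simp add: Suc_diff_le mult_ac)
            then show ?case using Suc by (simp add: c_def)
          qed simp
          consider "i = 0" | "1 \<le> i" "i \<le> r" | "i = ?r" | "i > ?r" by linarith
          then show ?thesis
            by cases (use a(1) sum[of i] in \<open>auto simp: poly_horner c_def\<close>)
        qed
        then have "poly (hpoly ?r (\<lambda>a. a) c p) (a ?r) = ev a p" by (simp add: poly_hpoly[OF id_hom])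
        then have "hpoly ?r (\<lambda>a. a) c p \<noteq> 0" using a(2) by auto
        then obtain s where s: "det (pmev (hpoly ?r (\<lambda>a. a) c p) (companion ?r (c(?r := s)))) \<noteq> 0"
          using companion_nonsingular_value[of _ ?r] by blast
        have "horner ?r c = horner ?r (c(?r := s))" by (rule ext) (rule horner_cong, simp)
        then have "hpoly ?r (\<lambda>a. a) c p = hpoly ?r (\<lambda>a. a) (c(?r := s)) p" by (simp only: hpoly_def)
        then have "ev (c(?r := s)) ?D \<noteq> 0"
          using s D[OF ev_hom, of "c(?r := s)"] by (simp only: ev_mconst ev_mvar) simp
        moreover have "\<forall>i. i = 0 \<or> i > n \<longrightarrow> (c(?r := s)) i = 0"
          using a(1) step.hyps by (auto simp: c_def)
        ultimately show ?thesis by blast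
      qed
      ultimately show False using step.IH by blast
    qed
  qed
  from this[of 0] a show ?thesis by blast
qed

context generic_size
begin

text \<open>The coefficients of the characteristic polynomial are algebraically independent because they
  take arbitrary values on the slice. Hence the roots are independent, and two equal roots would be a
  relation between them.\<close>

theorem eigenvalues_of_Y:
  defines "E \<equiv> {e. eigenvalue (map_mat to_ac (frac_mat (YY :: 'k::field_char_0 gpol mat))) e}"
  shows "card E = n" "alg_independent (\<lambda>a::'k. to_ac (to_fract (mconst a))) E"
proof -
  define h where "h = (\<lambda>p::'k gpol. to_ac (to_fract p))"
  define \<iota> where "\<iota> = (\<lambda>a::'k. h (mconst a))"
  have h: "comm_ring_hom h" unfolding h_def by (rule comm_ring_hom_comp[OF to_ac_hom to_fract_hom])
  have \<iota>: "comm_ring_hom \<iota>" unfolding \<iota>_def by (rule comm_ring_hom_comp[OF h mconst_hom])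
  interpret h: comm_ring_hom h by (rule h)
  let ?Y = "map_mat h YY"
  have Y: "map_mat to_ac (frac_mat YY) = ?Y" by (rule eq_matI) (auto simp: h_def)
  have Yc: "?Y \<in> carrier_mat n n" using YY_carrier by simp
  have deg: "Polynomial.degree (char_poly ?Y) = n" and lead: "Polynomial.lead_coeff (char_poly ?Y) = 1"
    using degree_monic_char_poly[OF Yc] by auto
  obtain \<mu> where \<mu>: "char_poly ?Y = roots_poly \<mu> n"
  proof -
    have "char_poly ?Y \<noteq> 0" using lead by auto
    from alg_closed_imp_factorization[OF this, unfolded lead, unfolded deg smult_1_left]
    obtain A where A: "size A = n" "char_poly ?Y = (\<Prod>x\<in>#A. [:- x, 1:])" by (elim exE conjE)
    obtain xs where xs: "mset xs = A" using ex_mset by blast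
    have len: "length xs = n" using A(1) xs by auto
    have "char_poly ?Y = (\<Prod>x\<leftarrow>xs. [:- x, 1:])"
      unfolding A(2) xs[symmetric] mset_map[symmetric] prod_mset_prod_list ..
    also have "\<dots> = (\<Prod>i<n. [:- (xs ! i), 1:])"
      using len by (simp add: prod.list_conv_set_nth lessThan_atLeast0)
    also have "\<dots> = roots_poly (\<lambda>i. xs ! (i - 1)) n"
      unfolding roots_poly_def
      by (rule prod.reindex_bij_witness[of _ "\<lambda>i. i - 1" Suc]) auto
    finally show ?thesis by (rule that)
  qed
  have E: "E = \<mu> ` {1..n}"
    unfolding E_def Y eigenvalue_root_char_poly[OF Yc] \<mu> roots_poly_def
    by (auto simp: poly_prod)
  have base: "mpol_eval \<iota> (partial_point n \<mu> n) p \<noteq> 0"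
    if a: "\<forall>i. i = 0 \<or> i > n \<longrightarrow> a i = 0" "ev a p \<noteq> 0" for a and p :: "(nat, 'k) mpol"
  proof -
    let ?c = "\<lambda>i. if i = 0 \<or> i > n then 0 else cY i :: 'k gpol"
    have "partial_point n \<mu> n i = h (?c i)" for i
    proof -
      have "cc n ?Y i = h (cY i)" by (rule hom_cc[OF h YY_carrier])
      then show ?thesis by (simp add: partial_point_def cc_def \<mu>)
    qed
    then have "partial_point n \<mu> n = (\<lambda>i. h (?c i))" by (rule ext)
    then have "mpol_eval \<iota> (partial_point n \<mu> n) p = h (mpol_eval mconst ?c p)"
      by (simp only: \<iota>_def hom_mpol_eval[OF mconst_hom h])
    moreover have "mpol_eval mconst ?c p \<noteq> 0"
    proof
      assume z: "mpol_eval mconst ?c p = 0"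
      let ?A = "slice (companion n a)"
      interpret e: comm_ring_hom "evp ?A" by (rule evp_hom)
      have "evp ?A (?c i) = a i" for i
        using a(1) by (auto simp: evp_cY Yt_slice_companion cc_companion)
      then have "evp ?A (mpol_eval mconst ?c p) = ev a p"
        by (simp only: hom_mpol_eval[OF mconst_hom evp_hom] ev_mconst)
      then show False using a(2) unfolding z by simp
    qed
    ultimately show ?thesis by (simp add: h_def)
  qed
  have indep: "mpol_eval \<iota> (\<lambda>i. if i \<in> {1..n} then \<mu> i else 0) p \<noteq> 0"
    if "\<forall>i. i = 0 \<or> i > n \<longrightarrow> a i = 0" "ev a p \<noteq> 0" for a and p :: "(nat, 'k) mpol"
  proof -
    have "partial_point n \<mu> 0 = (\<lambda>i. if i \<in> {1..n} then \<mu> i else 0)" by (auto simp: partial_point_def)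
    then show ?thesis using roots_independent[OF \<iota> base that] by simp
  qed
  have inj: "inj_on \<mu> {1..n}"
  proof (rule inj_onI, rule ccontr)
    fix i j assume ij: "i \<in> {1..n}" "j \<in> {1..n}" "\<mu> i = \<mu> j" "i \<noteq> j"
    let ?p = "mvar i - mvar j :: (nat, 'k) mpol" and ?a = "\<lambda>l. if l = i then 1 else 0 :: 'k"
    interpret e: comm_ring_hom "ev ?a :: _ \<Rightarrow> 'k" by (rule ev_hom)
    interpret e': comm_ring_hom "mpol_eval \<iota> (\<lambda>i. if i \<in> {1..n} then \<mu> i else 0)" by (rule mpol_eval_hom[OF \<iota>])
    have "ev ?a ?p \<noteq> 0" using ij by (simp add: e.hom_minus ev_mvar)
    moreover have "\<forall>l. l = 0 \<or> l > n \<longrightarrow> ?a l = 0" using ij by auto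
    moreover have "mpol_eval \<iota> (\<lambda>i. if i \<in> {1..n} then \<mu> i else 0) ?p = 0"
      by (simp only: e'.hom_minus mpol_eval_mvar[OF \<iota>] ij(1-3) if_True diff_self)
    ultimately show False using indep[of ?a ?p] by blast
  qed
  show "card E = n" unfolding E card_image[OF inj] by simp
  show "alg_independent (\<lambda>a::'k. to_ac (to_fract (mconst a))) E"
    unfolding alg_independent_def
  proof (intro ballI impI)
    fix p assume p: "p \<in> mpol_in E" and z: "mpol_eval (\<lambda>a::'k. to_ac (to_fract (mconst a))) (\<lambda>s. s) p = 0"
    define idx where "idx = inv_into {1..n} \<mu>"
    have idx: "idx s \<in> {1..n}" "\<mu> (idx s) = s" if "s \<in> E" for s
      using that unfolding idx_def E by (rule inv_into_into, rule f_inv_into_f)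
    define q where "q = mpol_eval mconst (\<lambda>s. mvar (idx s)) p"
    have sub: "mpol_eval \<kappa> f q = mpol_eval \<kappa> (\<lambda>s. f (idx s)) p" if \<kappa>: "comm_ring_hom \<kappa>" for \<kappa> :: "'k \<Rightarrow> 'b::comm_ring_1" and f
      unfolding q_def using hom_mpol_eval[OF mconst_hom mpol_eval_hom[OF \<kappa>], of f "\<lambda>s. mvar (idx s)" p]
      by (simp add: mpol_eval_mconst[OF \<kappa>] mpol_eval_mvar[OF \<kappa>])
    have "mpol_eval \<iota> (\<lambda>i. if i \<in> {1..n} then \<mu> i else 0) q = mpol_eval \<iota> (\<lambda>s. s) p"
      unfolding sub[OF \<iota>] by (rule mpol_eval_cong[OF p \<iota>]) (use idx in auto)
    then have q0: "mpol_eval \<iota> (\<lambda>i. if i \<in> {1..n} then \<mu> i else 0) q = 0" using z by (simp add: \<iota>_def h_def)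
    show "p = 0"
    proof (rule mpol_eq_0_if_ev_0)
      fix f :: "'k gpol fract alg_closure \<Rightarrow> 'k"
      let ?a = "\<lambda>i. if i \<in> {1..n} then f (\<mu> i) else 0"
      have "ev ?a q = ev f p" unfolding sub[OF id_hom] by (rule mpol_eval_cong[OF p id_hom]) (use idx in auto)
      moreover have "ev ?a q = 0" using indep[of ?a q] q0 by auto
      ultimately show "ev f p = 0" by simp
    qed
  qed
qed

end

context generic_size
begin

lemma phi_ring_iso:
  "phi \<in> ring_iso (mpol_ring {1..n}) ((mat_alg n)\<lparr>carrier := cY_ring :: 'k::field_char_0 gpol mat set\<rparr>)"
proof -
  have "inj_on phi (mpol_in {1..n} :: (nat, 'k) mpol set)"
    by (rule inj_onI) (rule phi_inj)
  then have "bij_betw phi (mpol_in {1..n} :: (nat, 'k) mpol set) cY_ring"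
    by (simp add: bij_betw_def cY_ring_phi)
  then show ?thesis
    using phi_cY_ring by (auto simp: ring_iso_def ring_hom_def mpol_ring_def ring_mat_def phi_add phi_mult phi_one)
qed

end

theorem proposition8p3:
  fixes n m :: nat
    and Y :: "'k::field_char_0 gpol mat"
    and c :: "nat \<Rightarrow> 'k gpol"
  assumes "n \<ge> 2"
    and "m = n^2 - 1"
    and "Y = Y_mat m n"
    and "\<And>i. 1 \<le> i \<Longrightarrow> i \<le> n \<Longrightarrow> c i = Polynomial.coeff (char_poly Y) (n - i)"
  shows
    "(Y \<in> mat_invariants m (SL m) (trace_ring m n)) \<and>
     (card {e. eigenvalue (map_mat to_ac (frac_mat Y)) e} = n \<and>
      alg_independent (\<lambda>a::'k. to_ac (to_fract (mconst a)))
        {e. eigenvalue (map_mat to_ac (frac_mat Y)) e}) \<and>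
     (mat_invariants m (SL m) (trace_ring m n) =
        generate_ring (mat_alg n)
          (base_scalars n \<union> {c i \<cdot>\<^sub>m 1\<^sub>m n | i. 1 \<le> i \<and> i \<le> n - 1} \<union> {Y}) \<and>
      (\<exists>\<phi> \<in> ring_iso (mpol_ring {1..n})
          ((mat_alg n)\<lparr>carrier := mat_invariants m (SL m) (trace_ring m n)\<rparr>).
        (\<forall>a::'k. \<phi> (mconst a) = mconst a \<cdot>\<^sub>m 1\<^sub>m n) \<and>
        (\<forall>i. 1 \<le> i \<and> i \<le> n - 1 \<longrightarrow> \<phi> (mvar i) = c i \<cdot>\<^sub>m 1\<^sub>m n) \<and>
        \<phi> (mvar n) = Y)) \<and>
     (frac_invariants m (SL m) (UD m n) =
      generate_field (mat_alg n)
        (frac_mat ` base_scalars n \<union>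
         {to_fract (c i) \<cdot>\<^sub>m 1\<^sub>m n | i. 1 \<le> i \<and> i \<le> n - 1} \<union> {frac_mat Y})) \<and>
     (frac_invariants m (GL m) (UD m n) =
      generate_field (mat_alg n)
        (frac_mat ` base_scalars n \<union>
         {(to_fract (c i) / to_fract (c 1) ^ i) \<cdot>\<^sub>m 1\<^sub>m n | i. 2 \<le> i \<and> i \<le> n - 1} \<union>
         {(1 / to_fract (c 1)) \<cdot>\<^sub>m frac_mat Y}))"
proof -
  interpret generic_size n m by unfold_locales (use assms in simp_all)
  have c: "c i = cY i" if "1 \<le> i" "i \<le> n" for i
    using assms(3,4) that by (simp add: cc_def)
  have gens: "{f (c i) i | i. a \<le> i \<and> i \<le> n - 1} = {f (cY i) i | i. a \<le> i \<and> i \<le> n - 1}"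
    if "1 \<le> a" for a :: nat and f :: "'k gpol \<Rightarrow> nat \<Rightarrow> 'x"
  proof -
    have "c i = cY i" if "a \<le> i \<and> i \<le> n - 1" for i using \<open>1 \<le> a\<close> that by (intro c) auto
    then show ?thesis by metis
  qed
  have c1: "c 1 = cY 1" using c[of 1] n2 by simp
  have ring: "generate_ring (mat_alg n) (base_scalars n \<union> {c i \<cdot>\<^sub>m 1\<^sub>m n | i. 1 \<le> i \<and> i \<le> n - 1} \<union> {Y}) = cY_ring"
    unfolding gens[of 1 "\<lambda>x i. x \<cdot>\<^sub>m 1\<^sub>m n", OF order_refl] assms(3) cY_ring_def ..
  have E: "\<exists>\<phi> \<in> ring_iso (mpol_ring {1..n}) ((mat_alg n)\<lparr>carrier := mat_invariants m (SL m) (trace_ring m n)\<rparr>).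
      (\<forall>a::'k. \<phi> (mconst a) = mconst a \<cdot>\<^sub>m 1\<^sub>m n) \<and>
      (\<forall>i. 1 \<le> i \<and> i \<le> n - 1 \<longrightarrow> \<phi> (mvar i) = c i \<cdot>\<^sub>m 1\<^sub>m n) \<and> \<phi> (mvar n) = Y"
    unfolding SL_invariants
  proof (rule bexI[OF _ phi_ring_iso], intro conjI allI impI)
    fix i assume "1 \<le> i \<and> i \<le> n - 1"
    then have i: "1 \<le> i" "i \<le> n" "i \<noteq> n" using n0 by auto
    show "phi (mvar i) = c i \<cdot>\<^sub>m 1\<^sub>m n" unfolding c[OF i(1,2)] by (rule phi_simps(3)[OF i(3)])
  qed (simp_all add: phi_simps assms(3))
  show ?thesis
  proof (intro conjI)
    show "Y \<in> mat_invariants m (SL m) (trace_ring m n)"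
      unfolding SL_invariants assms(3) by (rule cY_ring_gen(3))
    show "card {e. eigenvalue (map_mat to_ac (frac_mat Y)) e} = n"
      "alg_independent (\<lambda>a::'k. to_ac (to_fract (mconst a))) {e. eigenvalue (map_mat to_ac (frac_mat Y)) e}"
      unfolding assms(3) by (rule eigenvalues_of_Y)+
    show "mat_invariants m (SL m) (trace_ring m n) = generate_ring (mat_alg n)
        (base_scalars n \<union> {c i \<cdot>\<^sub>m 1\<^sub>m n | i. 1 \<le> i \<and> i \<le> n - 1} \<union> {Y})"
      unfolding ring by (rule SL_invariants)
    show "frac_invariants m (SL m) (UD m n) = generate_field (mat_alg n)
        (frac_mat ` base_scalars n \<union> {to_fract (c i) \<cdot>\<^sub>m 1\<^sub>m n | i. 1 \<le> i \<and> i \<le> n - 1} \<union> {frac_mat Y})"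
      unfolding gens[of 1 "\<lambda>x i. to_fract x \<cdot>\<^sub>m 1\<^sub>m n", OF order_refl] assms(3) by (rule SL_invariant_field)
    show "frac_invariants m (GL m) (UD m n) = generate_field (mat_alg n) (frac_mat ` base_scalars n \<union>
        {(to_fract (c i) / to_fract (c 1) ^ i) \<cdot>\<^sub>m 1\<^sub>m n | i. 2 \<le> i \<and> i \<le> n - 1} \<union>
        {(1 / to_fract (c 1)) \<cdot>\<^sub>m frac_mat Y})"
      unfolding c1 gens[of 2 "\<lambda>x i. (to_fract x / to_fract (cY 1) ^ i) \<cdot>\<^sub>m 1\<^sub>m n", OF one_le_numeral] assms(3)
        GL_invariant_field quotient_gens_def ..
  qed (rule E)
qed

end
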